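(* Let $t>0$ and suppose that the bounded measurable function $g:[0,t]\times\mathcal X\times\mathcal X\to\mathbb R$ satisfies Condition $C[\nu,t]$. Then the following holds, where all expectations appearing are well defined and finite (those involving $X^\lambda$ for $\lambda$ sufficiently close to $0$) and the derivatives at $\lambda=0$ exist. (1) Let $v:\mathcal X\to\mathbb R$ be measurable with $v(X_t)\in L^p(\mathbb P_\nu)$ for some $p\in(1,+\infty]$. Then $$\partial_{\lambda=0}\mathbb E_\nu[v(X^\lambda_t)]=\mathbb E_\nu\big[v(X_t)\,G_t(X_{[0,t]})\big].$$ (2) Let $v:[0,t]\times\mathcal X\to\mathbb R$ be measurable with $\int_0^t\|v(s,X_s)\|_{L^p(\mathbb P_\nu)}ds<+\infty$ for some $p\in(1,+\infty]$. Then $$\partial_{\lambda=0}\mathbb E_\nu\Big[\int_0^tv(s,X^\lambda_s)\,ds\Big]=\int_0^t\mathbb E_\nu\big[v(s,X_s)\,G_s(X_{[0,s]})\big]ds.$$ (3) Let $F(\xi_{[0,t]})=\sum_{s\in(0,t]}\alpha(s,\xi_{s-},\xi_s)$ with $\alpha:[0,t]\times\mathcal X\times\mathcal X\to\mathbb R$ measurable and such that $$\sum_{s\in(0,t]}|\alpha(s,X_{s-},X_s)|\quad\text{and}\quad\int_0^t|\alpha|_r(s,X_s)\,ds$$ belong to $L^p(\mathbb P_\nu)$ for some $p\in(1,+\infty]$ (for example, $\alpha$ bounded and satisfying Condition $C[\nu,t]$). Then $$\partial_{\lambda=0}\mathbb E_\nu\big[F(X^\lambda_{[0,t]})\big]=\int_0^t\mathbb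 E_\nu\big[(\alpha g)_r(s,X_s)\big]ds+\int_0^t\mathbb E_\nu\big[\alpha_r(s,X_s)\,G_s(X_{[0,s]})\big]ds.$$
   Context: Unperturbed process. $(\mathcal X,\mathcal B)$ is a measurable space whose singletons are measurable. $r(x,dy)$ is a transition kernel: for every $x\in\mathcal X$, $r(x,\cdot)$ is a measure on $(\mathcal X,\mathcal B)$ with total mass $\hat r(x):=r(x,\mathcal X)\in(0,+\infty)$ and $r(x,\{x\})=0$; for every $B\in\mathcal B$ the map $x\mapsto r(x,B)$ is measurable. $\nu$ is a probability measure on $(\mathcal X,\mathcal B)$. The unperturbed Markov jump process $(X_s)_{s\ge0}$ has $X_0\sim\nu$; once at $x$ it waits an exponential time of parameter $\hat r(x)$ (independently from the rest) and then jumps to a point chosen with law $r(x,dy)/\hat r(x)$. Explosion time: supremum of the jump times (afterwards the process sits in a cemetery state). Standing assumption: the unperturbed process started from $\nu$ almost surely does not explode. $\mathbb P_\nu,\mathbb E_\nu$ denote probability and expectation with initial distribution $\nu$ (same symbols for the perturbed process). Perturbed process. For $\lambda\in\mathbb R$ let $r^\lambda_s(x,dy):=e^{\lambda g(s,x,y)}r(x,dy)$ and $\hat r^\lambda_s(x):=r^\lambda_s(x,\mathcal X)$. The perturbed process $X^\lambda$ (considered on $[0,t]$) has $X^\lambda_0\sim\nu$; if it arrives at $x$ at time $s$ (or starts there, $s=0$), it stays at $x$ until a random time $\tau$ with $P(\tau>u)=\exp\{-\int_s^u\hat r^\lambda_w(x)\,dw\}$, $u\ge s$; given $\tau=u$ it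 jumps at time $u$ to a point with law $r^\lambda_u(x,dy)/\hat r^\lambda_u(x)$, and so on. Under Condition $C[\nu,t]$ for $g$, $X^\lambda$ almost surely does not explode in $[0,t]$ for $\lambda$ close to $0$. Notation. For measurable $\alpha:[0,t]\times\mathcal X\times\mathcal X\to\mathbb R$, $\alpha_r(s,x):=\int_{\mathcal X}\alpha(s,x,y)\,r(x,dy)$ (when well posed); likewise $|\alpha|_r$, $(\alpha g)_r$ are the contractions of $|\alpha|$ and of the product $\alpha g$. $\alpha$ satisfies Condition $C[\nu,t]$ if for some $\theta>0$, $\mathbb E_\nu[\exp\{\theta\int_0^t|\alpha|_r(s,X_s)ds\}]<+\infty$. $D_f([0,t],\mathcal X)$ is the set of càdlàg (piecewise constant) paths $\xi_{[0,t]}=(\xi_s)_{s\in[0,t]}$ in $\mathcal X$ with finitely many jumps, and $\sum_{s\in(0,t]}\alpha(s,\xi_{s-},\xi_s)$ always means the sum over the jump times $s\in(0,t]$ with $\xi_{s-}\ne\xi_s$. For $s\in[0,t]$, $$G_s(\xi_{[0,s]}):=\sum_{u\in(0,s]}g(u,\xi_{u-},\xi_u)-\int_0^sg_r(u,\xi_u)\,du.$$ $\partial_{\lambda=0}$ denotes the derivative with respect to $\lambda$ at $\lambda=0$. *)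

theory Defs
  imports "HOL-Probability.Probability"
begin

section \<open>Transition kernels and contractions\<close>

definition transition_kernel :: "'a measure \<Rightarrow> ('a \<Rightarrow> 'a measure) \<Rightarrow> bool" where
  "transition_kernel \<X> r \<longleftrightarrow>
     (\<forall>x\<in>space \<X>. sets (r x) = sets \<X> \<and>
        0 < emeasure (r x) (space \<X>) \<and> emeasure (r x) (space \<X>) < \<infinity> \<and>
        emeasure (r x) {x} = 0) \<and>
     (\<forall>B\<in>sets \<X>. (\<lambda>x. emeasure (r x) B) \<in> borel_measurable \<X>)"

definition total_rate :: "'a measure \<Rightarrow> ('a \<Rightarrow> 'a measure) \<Rightarrow> 'a \<Rightarrow> real" where
  "total_rate \<X> r x = measure (r x) (space \<X>)"

definition tilted_kernel ::
  "('a \<Rightarrow> 'a measure) \<Rightarrow> (real \<Rightarrow> 'a \<Rightarrow> 'a \<Rightarrow> real) \<Rightarrow> real \<Rightarrow> real \<Rightarrow> 'a \<Rightarrow> 'a measure" where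
  "tilted_kernel r g l s x = density (r x) (\<lambda>y. ennreal (exp (l * g s x y)))"

definition contraction ::
  "('a \<Rightarrow> 'a measure) \<Rightarrow> (real \<Rightarrow> 'a \<Rightarrow> 'a \<Rightarrow> real) \<Rightarrow> real \<Rightarrow> 'a \<Rightarrow> real" where
  "contraction r \<alpha> s x = (\<integral>y. \<alpha> s x y \<partial>r x)"

text \<open>The contraction of \<open>\<bar>\<alpha>\<bar>\<close>, with values in \<open>[0, \<infinity>]\<close>: unlike the Bochner integral, it is not set
  to \<open>0\<close> when the integral diverges.\<close>

definition abs_contraction ::
  "('a \<Rightarrow> 'a measure) \<Rightarrow> (real \<Rightarrow> 'a \<Rightarrow> 'a \<Rightarrow> real) \<Rightarrow> real \<Rightarrow> 'a \<Rightarrow> ennreal" where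
  "abs_contraction r \<alpha> s x = (\<integral>\<^sup>+y. ennreal \<bar>\<alpha> s x y\<bar> \<partial>r x)"

definition measurable1_on :: "'a measure \<Rightarrow> real \<Rightarrow> (real \<Rightarrow> 'a \<Rightarrow> real) \<Rightarrow> bool" where
  "measurable1_on \<X> t v \<longleftrightarrow>
     (\<lambda>(s, x). v s x) \<in> borel_measurable (restrict_space borel {0..t} \<Otimes>\<^sub>M \<X>)"

definition measurable2_on :: "'a measure \<Rightarrow> real \<Rightarrow> (real \<Rightarrow> 'a \<Rightarrow> 'a \<Rightarrow> real) \<Rightarrow> bool" where
  "measurable2_on \<X> t \<alpha> \<longleftrightarrow>
     (\<lambda>(s, x, y). \<alpha> s x y) \<in> borel_measurable (restrict_space borel {0..t} \<Otimes>\<^sub>M \<X> \<Otimes>\<^sub>M \<X>)"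

definition bounded2_on :: "'a measure \<Rightarrow> real \<Rightarrow> (real \<Rightarrow> 'a \<Rightarrow> 'a \<Rightarrow> real) \<Rightarrow> bool" where
  "bounded2_on \<X> t \<alpha> \<longleftrightarrow>
     (\<exists>C. \<forall>s\<in>{0..t}. \<forall>x\<in>space \<X>. \<forall>y\<in>space \<X>. \<bar>\<alpha> s x y\<bar> \<le> C)"

section \<open>Jump processes\<close>

text \<open>A pure jump process on a probability space \<open>M\<close> is given by its jump times
  \<open>0 = T 0 < T 1 < T 2 < \<dots>\<close> and the states \<open>Y n\<close> entered at the times \<open>T n\<close>. The two
  sigma-algebras below are those generated by \<open>T 0, Y 0, \<dots>, T n, Y n\<close>, and by these variables
  together with the next jump time \<open>T (n + 1)\<close>.\<close>

definition history ::
  "'a measure \<Rightarrow> 'w measure \<Rightarrow> (nat \<Rightarrow> 'w \<Rightarrow> real) \<Rightarrow> (nat \<Rightarrow> 'w \<Rightarrow> 'a) \<Rightarrow> nat \<Rightarrow> 'w measure" where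
  "history \<X> M T Y n =
     vimage_algebra (space M) (\<lambda>\<omega>. \<lambda>i\<in>{..n}. (T i \<omega>, Y i \<omega>)) (\<Pi>\<^sub>M i\<in>{..n}. borel \<Otimes>\<^sub>M \<X>)"

definition history_and_next_time ::
  "'a measure \<Rightarrow> 'w measure \<Rightarrow> (nat \<Rightarrow> 'w \<Rightarrow> real) \<Rightarrow> (nat \<Rightarrow> 'w \<Rightarrow> 'a) \<Rightarrow> nat \<Rightarrow> 'w measure" where
  "history_and_next_time \<X> M T Y n =
     vimage_algebra (space M) (\<lambda>\<omega>. (\<lambda>i\<in>{..n}. (T i \<omega>, Y i \<omega>), T (Suc n) \<omega>))
       ((\<Pi>\<^sub>M i\<in>{..n}. borel \<Otimes>\<^sub>M \<X>) \<Otimes>\<^sub>M borel)"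

text \<open>The dynamics is prescribed for times in \<open>I\<close> (either \<open>{0..}\<close> or \<open>{0..t}\<close>); jump times outside
  \<open>I\<close> are arbitrary. A process that arrives at \<open>x\<close> at time \<open>s\<close> is still there at time \<open>u \<ge> s\<close> with
  probability \<open>S s x u\<close>, and jumps at time \<open>u\<close> into \<open>B\<close> with probability \<open>J u x B\<close>,
  conditionally on the past.

  The requirement \<open>Y (Suc n) \<omega> \<noteq> Y n \<omega>\<close> says that the times \<open>T (Suc n)\<close> are genuine jump
  times of the path. It reflects \<open>r x {x} = 0\<close>, but it has to be imposed pointwise: since
  only singletons are assumed measurable, the diagonal need not be a measurable subset of the product
  space, and then the joint law of \<open>Y n\<close> and \<open>Y (Suc n)\<close> says nothing about
  \<open>Y (Suc n) = Y n\<close>.\<close>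

definition jump_process ::
  "'a measure \<Rightarrow> 'a measure \<Rightarrow> real set \<Rightarrow> (real \<Rightarrow> 'a \<Rightarrow> real \<Rightarrow> real) \<Rightarrow> (real \<Rightarrow> 'a \<Rightarrow> 'a set \<Rightarrow> real) \<Rightarrow>
   'w measure \<Rightarrow> (nat \<Rightarrow> 'w \<Rightarrow> real) \<Rightarrow> (nat \<Rightarrow> 'w \<Rightarrow> 'a) \<Rightarrow> bool" where
  "jump_process \<X> \<nu> I S J M T Y \<longleftrightarrow>
     prob_space M \<and>
     (\<forall>n. T n \<in> borel_measurable M) \<and> (\<forall>n. Y n \<in> M \<rightarrow>\<^sub>M \<X>) \<and>
     (\<forall>\<omega>\<in>space M. T 0 \<omega> = 0 \<and>
        (\<forall>n. T n \<omega> < T (Suc n) \<omega> \<and> (T (Suc n) \<omega> \<in> I \<longrightarrow> Y (Suc n) \<omega> \<noteq> Y n \<omega>))) \<and>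
     distr M \<X> (Y 0) = \<nu> \<and>
     (\<forall>n. \<forall>u\<in>I. AE \<omega> in M. T n \<omega> \<le> u \<longrightarrow>
        real_cond_exp M (history \<X> M T Y n) (indicator {\<omega>\<in>space M. u < T (Suc n) \<omega>}) \<omega>
          = S (T n \<omega>) (Y n \<omega>) u) \<and>
     (\<forall>n. \<forall>B\<in>sets \<X>. AE \<omega> in M. T (Suc n) \<omega> \<in> I \<longrightarrow>
        real_cond_exp M (history_and_next_time \<X> M T Y n)
          (indicator {\<omega>\<in>space M. Y (Suc n) \<omega> \<in> B}) \<omega>
          = J (T (Suc n) \<omega>) (Y n \<omega>) B)"

definition markov_jump_process ::
  "'a measure \<Rightarrow> ('a \<Rightarrow> 'a measure) \<Rightarrow> 'a measure \<Rightarrow>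
   'w measure \<Rightarrow> (nat \<Rightarrow> 'w \<Rightarrow> real) \<Rightarrow> (nat \<Rightarrow> 'w \<Rightarrow> 'a) \<Rightarrow> bool" where
  "markov_jump_process \<X> r \<nu> M T Y \<longleftrightarrow>
     jump_process \<X> \<nu> {0..}
       (\<lambda>s x u. exp (- (total_rate \<X> r x * (u - s))))
       (\<lambda>u x B. measure (r x) B / total_rate \<X> r x) M T Y"

definition perturbed_jump_process ::
  "'a measure \<Rightarrow> ('a \<Rightarrow> 'a measure) \<Rightarrow> (real \<Rightarrow> 'a \<Rightarrow> 'a \<Rightarrow> real) \<Rightarrow> real \<Rightarrow> real \<Rightarrow> 'a measure \<Rightarrow>
   'w measure \<Rightarrow> (nat \<Rightarrow> 'w \<Rightarrow> real) \<Rightarrow> (nat \<Rightarrow> 'w \<Rightarrow> 'a) \<Rightarrow> bool" where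
  "perturbed_jump_process \<X> r g t l \<nu> M T Y \<longleftrightarrow>
     jump_process \<X> \<nu> {0..t}
       (\<lambda>s x u. exp (- (LINT w:{s..u}|lborel. total_rate \<X> (tilted_kernel r g l w) x)))
       (\<lambda>u x B. measure (tilted_kernel r g l u x) B / total_rate \<X> (tilted_kernel r g l u) x) M T Y"

definition explosion_time :: "(nat \<Rightarrow> 'w \<Rightarrow> real) \<Rightarrow> 'w \<Rightarrow> ereal" where
  "explosion_time T \<omega> = (SUP n. ereal (T n \<omega>))"

text \<open>From the explosion time on, the path is an arbitrary \<open>Y k\<close> with \<open>k\<close> fixed; there is no explicit
  cemetery state.\<close>

definition jump_path ::
  "(nat \<Rightarrow> 'w \<Rightarrow> real) \<Rightarrow> (nat \<Rightarrow> 'w \<Rightarrow> 'a) \<Rightarrow> 'w \<Rightarrow> real \<Rightarrow> 'a" where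
  "jump_path T Y \<omega> s = Y (THE n. T n \<omega> \<le> s \<and> s < T (Suc n) \<omega>) \<omega>"

section \<open>Path functionals\<close>

text \<open>For piecewise constant paths the left limit is the value eventually taken from the left; no
  topology on the state space is involved.\<close>

definition left_value :: "(real \<Rightarrow> 'a) \<Rightarrow> real \<Rightarrow> 'a" where
  "left_value \<xi> s = (THE x. eventually (\<lambda>u. \<xi> u = x) (at_left s))"

definition jumps_upto :: "(real \<Rightarrow> 'a) \<Rightarrow> real \<Rightarrow> real set" where
  "jumps_upto \<xi> s = {u\<in>{0<..s}. left_value \<xi> u \<noteq> \<xi> u}"

definition jump_sum :: "(real \<Rightarrow> 'a \<Rightarrow> 'a \<Rightarrow> real) \<Rightarrow> (real \<Rightarrow> 'a) \<Rightarrow> real \<Rightarrow> real" where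
  "jump_sum \<alpha> \<xi> s = (\<Sum>u\<in>jumps_upto \<xi> s. \<alpha> u (left_value \<xi> u) (\<xi> u))"

definition G_functional ::
  "('a \<Rightarrow> 'a measure) \<Rightarrow> (real \<Rightarrow> 'a \<Rightarrow> 'a \<Rightarrow> real) \<Rightarrow> real \<Rightarrow> (real \<Rightarrow> 'a) \<Rightarrow> real" where
  "G_functional r g s \<xi> = jump_sum g \<xi> s - (LINT u:{0..s}|lborel. contraction r g u (\<xi> u))"

definition abs_time_integral ::
  "('a \<Rightarrow> 'a measure) \<Rightarrow> (real \<Rightarrow> 'a \<Rightarrow> 'a \<Rightarrow> real) \<Rightarrow> real \<Rightarrow> (real \<Rightarrow> 'a) \<Rightarrow> ennreal" where
  "abs_time_integral r \<alpha> t \<xi> = (\<integral>\<^sup>+s\<in>{0..t}. abs_contraction r \<alpha> s (\<xi> s) \<partial>lborel)"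

section \<open>Integrability conditions\<close>

definition ennexp :: "ennreal \<Rightarrow> ennreal" where
  "ennexp a = (if a = \<infinity> then \<infinity> else ennreal (exp (enn2real a)))"

definition ennpowr :: "ennreal \<Rightarrow> real \<Rightarrow> ennreal" where
  "ennpowr a q = (if a = \<infinity> then \<infinity> else ennreal (enn2real a powr q))"

text \<open>The exponent \<open>p\<close> ranges over \<open>(1, \<infinity>]\<close>.\<close>

definition Lp_norm :: "'w measure \<Rightarrow> ereal \<Rightarrow> ('w \<Rightarrow> ennreal) \<Rightarrow> ennreal" where
  "Lp_norm M p f =
     (if p = \<infinity> then esssup M f
      else ennpowr (\<integral>\<^sup>+\<omega>. ennpowr (f \<omega>) (real_of_ereal p) \<partial>M) (1 / real_of_ereal p))"

definition in_Lp :: "'w measure \<Rightarrow> ereal \<Rightarrow> ('w \<Rightarrow> ennreal) \<Rightarrow> bool" where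
  "in_Lp M p f \<longleftrightarrow> f \<in> borel_measurable M \<and> Lp_norm M p f < \<infinity>"

definition condition_C ::
  "('a \<Rightarrow> 'a measure) \<Rightarrow> real \<Rightarrow> 'w measure \<Rightarrow> ('w \<Rightarrow> real \<Rightarrow> 'a) \<Rightarrow> (real \<Rightarrow> 'a \<Rightarrow> 'a \<Rightarrow> real) \<Rightarrow> bool" where
  "condition_C r t M X \<alpha> \<longleftrightarrow>
     (\<exists>\<theta>>0. (\<integral>\<^sup>+\<omega>. ennexp (ennreal \<theta> * abs_time_integral r \<alpha> t (X \<omega>)) \<partial>M) < \<infinity>)"

end

theory Submission
  imports Defs
begin

text \<open>Write \<open>D\<^sub>s = exp (\<lambda> \<Sum> g - \<integral>\<^sub>0\<^sup>s ((e\<^sup>\<lambda>\<^sup>g - 1) r) du)\<close> for the density, up to time \<open>s\<close>, of the perturbed process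
  with respect to the unperturbed one. Integrating out the last jump repeatedly gives, along the chain
  of jump times and states, \<open>E f(X\<^sup>\<lambda>\<^sub>s) = E (D\<^sub>s f(X\<^sub>s))\<close> for every fixed time \<open>s\<close>. With the density taken up to
  time \<open>s\<close> rather than \<open>t\<close>, the martingale property of \<open>G\<close> is never needed.

  Since densities have mass at most \<open>1\<close>, Condition C for \<open>g\<close> gives an exponential moment of
  \<open>W = \<Sum> |g| + \<integral>\<^sub>0\<^sup>t |g|\<^sub>r\<close>, and \<open>|D\<^sub>s - 1 - \<lambda> G\<^sub>s| \<le> C \<lambda>\<^sup>2 e\<^sup>c\<^sup>W\<close> for \<open>c > 0\<close> arbitrarily small. By Young's
  inequality this bound is integrable against a functional in \<open>L\<^sup>p\<close>, so the remainder of the first order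
  expansion is \<open>O(\<lambda>\<^sup>2)\<close>. The mean of a sum over jumps is first rewritten by the compensator formula as
  \<open>\<integral>\<^sub>0\<^sup>t E (\<alpha> e\<^sup>\<lambda>\<^sup>g)\<^sub>r(s, X\<^sup>\<lambda>\<^sub>s) ds\<close>, where \<open>\<lambda>\<close> also enters the integrand.\<close>

section \<open>Kernels and disintegration\<close>

text \<open>The process is given only through conditional probabilities, at each fixed time and for
  each fixed set, with null sets depending on both, and the state space carries no topology.
  Explicit kernels are therefore built from \<open>r\<close> and matched with these probabilities on
  rectangles; from then on the identities are between nonnegative integrals and make sense before
  integrability is known. Non-explosion of the perturbed process cannot be presupposed when the
  change of measure starts. The identity is first proved at the \<open>n\<close>-th jump, where
  explosion does no harm. On the unperturbed side alone, the weights of any bounded tilt telescope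
  to a mass of at most \<open>1\<close>. Together with Condition C this gives the exponential moment
  of \<open>W\<close>, which dominates the weights and so excludes explosion for small
  \<open>\<lambda>\<close>. Only afterwards are the slices between consecutive jumps summed to an
  identity at a fixed time.\<close>

locale rate_kernel =
  fixes \<X> :: "'a measure" and r :: "'a \<Rightarrow> 'a measure"
  assumes transition_kernel: "transition_kernel \<X> r"
begin

abbreviation rate :: "'a \<Rightarrow> real" where "rate \<equiv> total_rate \<X> r"

lemma sets_r: "x \<in> space \<X> \<Longrightarrow> sets (r x) = sets \<X>"
  using transition_kernel by (auto simp: transition_kernel_def)

lemma space_r: "x \<in> space \<X> \<Longrightarrow> space (r x) = space \<X>"
  using sets_r by (rule sets_eq_imp_space_eq)

lemma finite_measure_r: "x \<in> space \<X> \<Longrightarrow> finite_measure (r x)"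
  using transition_kernel by (intro finite_measureI) (auto simp: transition_kernel_def space_r)

lemma ennreal_rate: "x \<in> space \<X> \<Longrightarrow> ennreal (rate x) = emeasure (r x) (space \<X>)"
  using transition_kernel by (auto simp: transition_kernel_def total_rate_def measure_def)

lemma rate_pos: "x \<in> space \<X> \<Longrightarrow> 0 < rate x"
  using transition_kernel unfolding transition_kernel_def total_rate_def measure_def
  by (simp add: enn2real_positive_iff less_top)

lemma rate_measurable [measurable]: "rate \<in> borel_measurable \<X>"
  using transition_kernel unfolding transition_kernel_def total_rate_def[abs_def] measure_def
  by (intro borel_measurable_enn2real) blast

text \<open>The rates need not be bounded in \<open>x\<close>, so \<open>r\<close> itself is in
  general not a subprobability kernel. Its normalization is one, and measurability of integrals
  against \<open>r\<close> is transferred from it.\<close>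

definition jump_law :: "'a \<Rightarrow> 'a measure" where
  "jump_law x = density (r x) (\<lambda>_. ennreal (1 / rate x))"

lemma jump_law_measurable [measurable]: "jump_law \<in> measurable \<X> (subprob_algebra \<X>)"
proof (rule measurable_subprob_algebra)
  have em: "emeasure (jump_law a) A = ennreal (1 / rate a) * emeasure (r a) A"
    if "a \<in> space \<X>" "A \<in> sets \<X>" for a A
    using that unfolding jump_law_def by (subst emeasure_density_const) (auto simp: sets_r)
  fix a assume a: "a \<in> space \<X>"
  show "sets (jump_law a) = sets \<X>" using a by (simp add: jump_law_def sets_r)
  then have sp: "space (jump_law a) = space \<X>" by (rule sets_eq_imp_space_eq)
  show "subprob_space (jump_law a)"
    proof (rule subprob_spaceI)
    show "emeasure (jump_law a) (space (jump_law a)) \<le> 1"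
      using rate_pos[OF a] unfolding sp em[OF a sets.top] ennreal_rate[OF a, symmetric]
      by (simp add: ennreal_mult''[symmetric])
    show "space (jump_law a) \<noteq> {}" using a by (auto simp: sp)
  qed
next
  fix A assume A: "A \<in> sets \<X>"
  then have [measurable]: "(\<lambda>x. emeasure (r x) A) \<in> borel_measurable \<X>"
    using transition_kernel by (auto simp: transition_kernel_def)
  have "emeasure (jump_law a) A = ennreal (1 / rate a) * emeasure (r a) A"
    if "a \<in> space \<X>" for a
    using that A unfolding jump_law_def by (subst emeasure_density_const) (auto simp: sets_r)
  then show "(\<lambda>a. emeasure (jump_law a) A) \<in> borel_measurable \<X>"
    by (subst measurable_cong) auto
qed

lemma nn_integral_r:
  assumes x: "x \<in> space \<X>" and f: "f \<in> borel_measurable \<X>"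
  shows "(\<integral>\<^sup>+y. f y \<partial>r x) = ennreal (rate x) * (\<integral>\<^sup>+y. f y \<partial>jump_law x)"
proof -
  have [measurable]: "f \<in> borel_measurable (r x)"
    using f by (subst measurable_cong_sets[OF sets_r[OF x] refl])
  have "(\<integral>\<^sup>+y. f y \<partial>jump_law x) = ennreal (1 / rate x) * (\<integral>\<^sup>+y. f y \<partial>r x)"
    unfolding jump_law_def by (subst nn_integral_density) (auto simp: nn_integral_cmult)
  then show ?thesis
    using rate_pos[OF x] by (simp add: mult.assoc[symmetric] ennreal_mult[symmetric])
qed

lemma integral_r:
  fixes f :: "'a \<Rightarrow> real"
  assumes x: "x \<in> space \<X>" and f: "f \<in> borel_measurable \<X>"
  shows "(\<integral>y. f y \<partial>r x) = rate x * (\<integral>y. f y \<partial>jump_law x)"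
proof -
  have [measurable]: "f \<in> borel_measurable (r x)"
    using f by (subst measurable_cong_sets[OF sets_r[OF x] refl])
  have "(\<integral>y. f y \<partial>jump_law x) = (1 / rate x) * (\<integral>y. f y \<partial>r x)"
    unfolding jump_law_def using rate_pos[OF x] by (subst integral_density) auto
  then show ?thesis using rate_pos[OF x] by simp
qed

lemma nn_integral_r_measurable:
  assumes [measurable]: "(\<lambda>(w, y). f w y) \<in> borel_measurable (N \<Otimes>\<^sub>M \<X>)" "a \<in> measurable N \<X>"
  shows "(\<lambda>w. \<integral>\<^sup>+y. f w y \<partial>r (a w)) \<in> borel_measurable N"
proof -
  have "(\<lambda>w. ennreal (rate (a w)) * (\<integral>\<^sup>+y. f w y \<partial>jump_law (a w))) \<in> borel_measurable N"
    by (intro borel_measurable_times_ennreal nn_integral_measurable_subprob_algebra2[where N = \<X>])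
      measurable
  moreover have "f w \<in> borel_measurable \<X>" if "w \<in> space N" for w
    using measurable_Pair2[OF assms(1) that] by simp
  ultimately show ?thesis
    using measurable_space[OF assms(2)] by (subst measurable_cong) (auto intro!: nn_integral_r)
qed

text \<open>The integrand depends on the parameter as well as the measure. Pushing
  \<open>jump_law (a w)\<close> forward along \<open>Pair w\<close> moves the parameter into the
  measure, so that one fixed function is integrated against a measurable family of measures.\<close>

lemma integral_r_measurable:
  fixes f :: "'b \<Rightarrow> 'a \<Rightarrow> real"
  assumes [measurable]: "(\<lambda>(w, y). f w y) \<in> borel_measurable (N \<Otimes>\<^sub>M \<X>)" "a \<in> measurable N \<X>"
  shows "(\<lambda>w. \<integral>y. f w y \<partial>r (a w)) \<in> borel_measurable N"
proof -
  have f: "f w \<in> borel_measurable \<X>" if "w \<in> space N" for w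
    using measurable_Pair2[OF assms(1) that] by simp
  have J [measurable]: "(\<lambda>w. jump_law (a w)) \<in> measurable N (subprob_algebra \<X>)" by measurable
  have "(\<lambda>w. distr (jump_law (a w)) (N \<Otimes>\<^sub>M \<X>) (Pair w)) \<in> measurable N (subprob_algebra (N \<Otimes>\<^sub>M \<X>))"
    by (rule measurable_distr2[where M = \<X>]) measurable
  then have "(\<lambda>w. integral\<^sup>L (distr (jump_law (a w)) (N \<Otimes>\<^sub>M \<X>) (Pair w)) (\<lambda>(w, y). f w y))
      \<in> borel_measurable N"
    by (rule measurable_compose) (rule integral_measurable_subprob_algebra[OF assms(1)])
  moreover have "integral\<^sup>L (distr (jump_law (a w)) (N \<Otimes>\<^sub>M \<X>) (Pair w)) (\<lambda>(w, y). f w y)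
      = (\<integral>y. f w y \<partial>jump_law (a w))" if w: "w \<in> space N" for w
  proof -
    have [measurable_cong]: "sets (jump_law (a w)) = sets \<X>" by (rule sets_kernel[OF J w])
    show ?thesis using w by (subst integral_distr[OF _ assms(1)]) simp_all
  qed
  ultimately have "(\<lambda>w. \<integral>y. f w y \<partial>jump_law (a w)) \<in> borel_measurable N"
    by (subst measurable_cong) (auto simp: eq_commute)
  then have "(\<lambda>w. rate (a w) * (\<integral>y. f w y \<partial>jump_law (a w))) \<in> borel_measurable N"
    by (intro borel_measurable_times) measurable
  then show ?thesis
    using measurable_space[OF assms(2)] f by (subst measurable_cong) (auto intro!: integral_r)
qed

end

text \<open>Both sides integrate \<open>f\<close> against measures on the product of
  \<open>N\<close> and \<open>\<Y>\<close>: the joint law of \<open>(\<omega>, Z \<omega>)\<close>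
  on the event \<open>D\<close>, and the mixture of the \<open>K \<omega>\<close>. Rectangles form
  an intersection-stable generator, so agreement on them suffices. \<open>K\<close> is a
  subprobability kernel because its mass is the conditional probability of \<open>D\<close>.\<close>

lemma disintegration:
  fixes M N :: "'w measure" and Z :: "'w \<Rightarrow> 'b" and K :: "'w \<Rightarrow> 'b measure"
  assumes M: "finite_measure M" and N: "subalgebra M N"
    and Z [measurable]: "Z \<in> measurable M \<Y>" and K: "K \<in> measurable N (subprob_algebra \<Y>)"
    and D [measurable]: "D \<in> sets M"
    and rect: "\<And>A B. A \<in> sets N \<Longrightarrow> B \<in> sets \<Y> \<Longrightarrow>
      (\<integral>\<^sup>+\<omega>. indicator A \<omega> * indicator D \<omega> * indicator B (Z \<omega>) \<partial>M)
        = (\<integral>\<^sup>+\<omega>. indicator A \<omega> * emeasure (K \<omega>) B \<partial>M)"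
    and f: "(\<lambda>(\<omega>, y). f \<omega> y) \<in> borel_measurable (N \<Otimes>\<^sub>M \<Y>)"
  shows "(\<integral>\<^sup>+\<omega>. indicator D \<omega> * f \<omega> (Z \<omega>) \<partial>M) = (\<integral>\<^sup>+\<omega>. (\<integral>\<^sup>+y. f \<omega> y \<partial>K \<omega>) \<partial>M)"
proof (cases "space M = {}")
  case True
  then show ?thesis by (simp add: nn_integral_empty)
next
  case False
  interpret finite_measure M by fact
  let ?R = "restr_to_subalg M N" and ?P = "N \<Otimes>\<^sub>M \<Y>"
  have idM: "(\<lambda>\<omega>. \<omega>) \<in> measurable M N"
    by (rule measurable_from_subalg[OF N]) simp
  have pairM [measurable]: "(\<lambda>\<omega>. (\<omega>, Z \<omega>)) \<in> measurable M (N \<Otimes>\<^sub>M \<Y>)"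
    by (rule measurable_Pair[OF idM Z])
  have sp: "space N = space M" using N by (simp add: subalgebra_def)

  define L where "L = (\<lambda>\<omega>. distr (K \<omega>) ?P (Pair \<omega>))"
  have L: "L \<in> measurable N (subprob_algebra ?P)"
    unfolding L_def by (rule measurable_distr2[where M = \<Y>, OF _ K]) simp
  have L_R: "L \<in> measurable ?R (subprob_algebra ?P)"
    by (rule measurable_in_subalg[OF N L])
  define m1 where "m1 = distr (density M (indicator D)) ?P (\<lambda>\<omega>. (\<omega>, Z \<omega>))"
  define m2 where "m2 = ?R \<bind> L"
  have R_ne: "space ?R \<noteq> {}" using False by (simp add: space_restr_to_subalg)
  have nn_m1: "(\<integral>\<^sup>+z. h z \<partial>m1) = (\<integral>\<^sup>+\<omega>. indicator D \<omega> * h (\<omega>, Z \<omega>) \<partial>M)"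
    if [measurable]: "h \<in> borel_measurable ?P" for h
    unfolding m1_def by (subst nn_integral_distr) (auto simp: nn_integral_density)
  have nn_m2: "(\<integral>\<^sup>+z. h z \<partial>m2) = (\<integral>\<^sup>+\<omega>. (\<integral>\<^sup>+y. h (\<omega>, y) \<partial>K \<omega>) \<partial>M)"
    if h [measurable]: "h \<in> borel_measurable ?P" for h
  proof -
    have "(\<integral>\<^sup>+z. h z \<partial>m2) = (\<integral>\<^sup>+\<omega>. (\<integral>\<^sup>+z. h z \<partial>L \<omega>) \<partial>?R)"
      unfolding m2_def by (rule nn_integral_bind[OF h L_R])
    also have "\<dots> = (\<integral>\<^sup>+\<omega>. (\<integral>\<^sup>+z. h z \<partial>L \<omega>) \<partial>M)"
      by (rule nn_integral_subalgebra2[OF N])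
        (rule measurable_compose[OF L nn_integral_measurable_subprob_algebra[OF h]])
    also have "\<dots> = (\<integral>\<^sup>+\<omega>. (\<integral>\<^sup>+y. h (\<omega>, y) \<partial>K \<omega>) \<partial>M)"
    proof (rule nn_integral_cong)
      fix \<omega> assume "\<omega> \<in> space M"
      then have \<omega>: "\<omega> \<in> space N" by (simp add: sp)
      then have [measurable_cong]: "sets (K \<omega>) = sets \<Y>" by (rule sets_kernel[OF K])
      show "(\<integral>\<^sup>+z. h z \<partial>L \<omega>) = (\<integral>\<^sup>+y. h (\<omega>, y) \<partial>K \<omega>)"
        unfolding L_def using \<omega> by (subst nn_integral_distr) simp_all
    qed
    finally show ?thesis .
  qed
  have sets_m: "sets m1 = sets ?P" "sets m2 = sets ?P"
    unfolding m1_def m2_def using sets_bind_measurable[OF L_R R_ne] by auto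
  have "m1 = m2"
  proof (rule measure_eqI_generator_eq[OF Int_stable_pair_measure_generator[of N \<Y>]])
    show "{a \<times> b |a b. a \<in> sets N \<and> b \<in> sets \<Y>} \<subseteq> Pow (space N \<times> space \<Y>)"
      using sets.space_closed[of N] sets.space_closed[of \<Y>] by auto
    show "sets m1 = sigma_sets (space N \<times> space \<Y>) {a \<times> b |a b. a \<in> sets N \<and> b \<in> sets \<Y>}"
      "sets m2 = sigma_sets (space N \<times> space \<Y>) {a \<times> b |a b. a \<in> sets N \<and> b \<in> sets \<Y>}"
      by (simp_all add: sets_m sets_pair_measure)
    show "range (\<lambda>_::nat. space N \<times> space \<Y>) \<subseteq> {a \<times> b |a b. a \<in> sets N \<and> b \<in> sets \<Y>}"
      by auto
    show "(\<Union>i::nat. space N \<times> space \<Y>) = space N \<times> space \<Y>" by simp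
    have "emeasure m1 (space N \<times> space \<Y>) = emeasure M D"
      using nn_m1[of "\<lambda>_. 1"] sets_eq_imp_space_eq[OF sets_m(1)] by (simp add: space_pair_measure)
    then show "emeasure m1 (space N \<times> space \<Y>) \<noteq> \<infinity>"
      using emeasure_finite[of D] by simp
    fix X assume "X \<in> {a \<times> b |a b. a \<in> sets N \<and> b \<in> sets \<Y>}"
    then obtain A B where AB [measurable]: "A \<in> sets N" "B \<in> sets \<Y>" and X: "X = A \<times> B" by auto
    have [measurable]: "X \<in> sets ?P" unfolding X by measurable
    have "emeasure m1 X = (\<integral>\<^sup>+z. indicator X z \<partial>m1)" using sets_m by simp
    also have "\<dots> = (\<integral>\<^sup>+\<omega>. indicator D \<omega> * indicator X (\<omega>, Z \<omega>) \<partial>M)" by (rule nn_m1) measurable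
    also have "\<dots> = (\<integral>\<^sup>+\<omega>. indicator A \<omega> * indicator D \<omega> * indicator B (Z \<omega>) \<partial>M)"
      unfolding X by (intro nn_integral_cong) (auto split: split_indicator)
    also have "\<dots> = (\<integral>\<^sup>+\<omega>. indicator A \<omega> * emeasure (K \<omega>) B \<partial>M)" by (rule rect[OF AB])
    also have "\<dots> = (\<integral>\<^sup>+\<omega>. (\<integral>\<^sup>+y. indicator X (\<omega>, y) \<partial>K \<omega>) \<partial>M)"
    proof (rule nn_integral_cong)
      fix \<omega> assume "\<omega> \<in> space M"
      then have "sets (K \<omega>) = sets \<Y>" using sets_kernel[OF K] by (simp add: sp)
      moreover have "(\<lambda>y. indicator X (\<omega>, y)) = (\<lambda>y. indicator A \<omega> * (indicator B y :: ennreal))"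
        unfolding X by (auto split: split_indicator)
      ultimately show "indicator A \<omega> * emeasure (K \<omega>) B = (\<integral>\<^sup>+y. indicator X (\<omega>, y) \<partial>K \<omega>)"
        using AB(2) by (simp add: nn_integral_cmult)
    qed
    also have "\<dots> = (\<integral>\<^sup>+z. indicator X z \<partial>m2)" by (rule nn_m2[symmetric]) measurable
    also have "\<dots> = emeasure m2 X" using sets_m by simp
    finally show "emeasure m1 X = emeasure m2 X" .
  qed
  then show ?thesis using nn_m1[OF f] nn_m2[OF f] by simp
qed

section \<open>Tilted rates and survival probabilities\<close>

context rate_kernel begin

text \<open>Times range over the whole real line. Coefficients given on \<open>[0, t]\<close> are
  extended by zero in the last section, so that no restricted time space enters the
  argument.\<close>

definition bounded_tilt :: "(real \<Rightarrow> 'a \<Rightarrow> 'a \<Rightarrow> real) \<Rightarrow> bool" where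
  "bounded_tilt h \<longleftrightarrow>
     (\<lambda>(s, x, y). h s x y) \<in> borel_measurable (borel \<Otimes>\<^sub>M \<X> \<Otimes>\<^sub>M \<X>) \<and>
     (\<exists>K. \<forall>s. \<forall>x\<in>space \<X>. \<forall>y\<in>space \<X>. \<bar>h s x y\<bar> \<le> K)"

definition tilted_rate :: "(real \<Rightarrow> 'a \<Rightarrow> 'a \<Rightarrow> real) \<Rightarrow> real \<Rightarrow> 'a \<Rightarrow> real" where
  "tilted_rate h s x = (\<integral>y. exp (h s x y) \<partial>r x)"

definition surv :: "(real \<Rightarrow> 'a \<Rightarrow> 'a \<Rightarrow> real) \<Rightarrow> real \<Rightarrow> 'a \<Rightarrow> real \<Rightarrow> real" where
  "surv h s x u = exp (- (LINT w:{s..u}|lborel. tilted_rate h w x))"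

lemma bounded_tiltE:
  assumes "bounded_tilt h"
  obtains K where "\<And>s x y. x \<in> space \<X> \<Longrightarrow> y \<in> space \<X> \<Longrightarrow> \<bar>h s x y\<bar> \<le> K"
  using assms by (auto simp: bounded_tilt_def)

lemma bounded_tilt_measurable:
  assumes "bounded_tilt h"
    and "a \<in> borel_measurable N" "b \<in> measurable N \<X>" "c \<in> measurable N \<X>"
  shows "(\<lambda>w. h (a w) (b w) (c w)) \<in> borel_measurable N"
proof -
  have m: "(\<lambda>(s, x, y). h s x y) \<in> borel_measurable (borel \<Otimes>\<^sub>M \<X> \<Otimes>\<^sub>M \<X>)"
    using assms(1) by (simp add: bounded_tilt_def)
  have "(\<lambda>w. (a w, b w, c w)) \<in> measurable N (borel \<Otimes>\<^sub>M \<X> \<Otimes>\<^sub>M \<X>)"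
    by (intro measurable_Pair assms)
  from measurable_compose[OF this m] show ?thesis by simp
qed

lemma bounded_tilt_measurable_r:
  assumes "bounded_tilt h" "x \<in> space \<X>"
  shows "h s x \<in> borel_measurable (r x)" "h s x \<in> borel_measurable \<X>"
proof -
  show "h s x \<in> borel_measurable \<X>"
    by (rule bounded_tilt_measurable[OF assms(1)]) (simp_all add: assms(2))
  then show "h s x \<in> borel_measurable (r x)"
    by (subst measurable_cong_sets[OF sets_r[OF assms(2)] refl])
qed

lemma bounded_tilt_scale:
  assumes "bounded_tilt h" shows "bounded_tilt (\<lambda>s x y. l * h s x y)"
proof -
  obtain K where K: "\<And>s x y. x \<in> space \<X> \<Longrightarrow> y \<in> space \<X> \<Longrightarrow> \<bar>h s x y\<bar> \<le> K"
    by (rule bounded_tiltE[OF assms]) (rule that)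
  have "\<bar>l * h s x y\<bar> \<le> \<bar>l\<bar> * K" if "x \<in> space \<X>" "y \<in> space \<X>" for s x y
    using K[OF that] by (simp add: abs_mult mult_left_mono)
  moreover have "(\<lambda>(s, x, y). l * h s x y) \<in> borel_measurable (borel \<Otimes>\<^sub>M \<X> \<Otimes>\<^sub>M \<X>)"
    using assms unfolding bounded_tilt_def case_prod_beta
    by (intro borel_measurable_times borel_measurable_const) (erule conjunct1)
  ultimately show ?thesis unfolding bounded_tilt_def by blast
qed

lemma bounded_tilt_abs:
  assumes "bounded_tilt h" shows "bounded_tilt (\<lambda>s x y. \<bar>h s x y\<bar>)"
proof -
  obtain K where K: "\<And>s x y. x \<in> space \<X> \<Longrightarrow> y \<in> space \<X> \<Longrightarrow> \<bar>h s x y\<bar> \<le> K"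
    by (rule bounded_tiltE[OF assms]) (rule that)
  have "(\<lambda>(s, x, y). \<bar>h s x y\<bar>) \<in> borel_measurable (borel \<Otimes>\<^sub>M \<X> \<Otimes>\<^sub>M \<X>)"
    using assms unfolding bounded_tilt_def case_prod_beta
    by (intro borel_measurable_abs) (erule conjunct1)
  then show ?thesis unfolding bounded_tilt_def abs_abs using K by blast
qed

lemma integrable_r_bounded:
  assumes "x \<in> space \<X>" "f \<in> borel_measurable (r x)"
    "\<And>y. y \<in> space \<X> \<Longrightarrow> \<bar>f y\<bar> \<le> (C::real)"
  shows "integrable (r x) f"
proof -
  interpret finite_measure "r x" by (rule finite_measure_r) fact
  show ?thesis
    by (rule integrable_const_bound[of _ C]) (use assms in \<open>auto simp: space_r\<close>)
qed

lemma integrable_exp_tilt: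
  assumes h: "bounded_tilt h" and x: "x \<in> space \<X>"
  shows "integrable (r x) (\<lambda>y. exp (h s x y))"
proof -
  obtain K where K: "\<And>s x y. x \<in> space \<X> \<Longrightarrow> y \<in> space \<X> \<Longrightarrow> \<bar>h s x y\<bar> \<le> K"
    by (rule bounded_tiltE[OF h]) (rule that)
  note [measurable] = bounded_tilt_measurable_r[OF h x]
  show ?thesis
    by (rule integrable_r_bounded[where C = "exp K"]) (use K[OF x] x in \<open>auto simp: abs_le_iff\<close>)
qed

lemma nn_integral_exp_tilt:
  assumes "bounded_tilt h" "x \<in> space \<X>"
  shows "(\<integral>\<^sup>+y. ennreal (exp (h s x y)) \<partial>r x) = ennreal (tilted_rate h s x)"
  unfolding tilted_rate_def using integrable_exp_tilt[OF assms]
  by (intro nn_integral_eq_integral) auto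

lemma tilted_rate_bounds:
  assumes h: "bounded_tilt h" and x: "x \<in> space \<X>"
    and K: "\<And>s y. y \<in> space \<X> \<Longrightarrow> \<bar>h s x y\<bar> \<le> K"
  shows "tilted_rate h s x \<le> exp K * rate x" "exp (- K) * rate x \<le> tilted_rate h s x"
proof -
  interpret finite_measure "r x" by (rule finite_measure_r) fact
  have c: "integrable (r x) (\<lambda>_. c::real)" for c by simp
  have i: "(\<integral>y. c \<partial>r x) = c * rate x" for c :: real
    by (simp add: total_rate_def space_r[OF x])
  show "tilted_rate h s x \<le> exp K * rate x"
    unfolding tilted_rate_def i[symmetric]
    by (rule integral_mono[OF integrable_exp_tilt[OF h x] c])
      (use K in \<open>auto simp: space_r[OF x] abs_le_iff\<close>)
  show "exp (- K) * rate x \<le> tilted_rate h s x"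
    unfolding tilted_rate_def i[symmetric]
    by (rule integral_mono[OF c integrable_exp_tilt[OF h x]])
      (use K in \<open>simp add: space_r[OF x] abs_le_iff minus_le_iff\<close>)
qed

lemma tilted_rate_pos:
  assumes h: "bounded_tilt h" and x: "x \<in> space \<X>"
  shows "0 < tilted_rate h s x"
proof -
  obtain K where K: "\<And>s x y. x \<in> space \<X> \<Longrightarrow> y \<in> space \<X> \<Longrightarrow> \<bar>h s x y\<bar> \<le> K"
    by (rule bounded_tiltE[OF h]) (rule that)
  have "0 < exp (- K) * rate x" using rate_pos[OF x] by simp
  also have "\<dots> \<le> tilted_rate h s x" by (rule tilted_rate_bounds[OF h x K[OF x]])
  finally show ?thesis .
qed

lemma tilted_rate_zero: "tilted_rate (\<lambda>_ _ _. 0) s x = rate x" if "x \<in> space \<X>"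
  unfolding tilted_rate_def total_rate_def using that by (simp add: space_r)

lemma bounded_tilt_zero: "bounded_tilt (\<lambda>_ _ _. 0)"
  unfolding bounded_tilt_def by auto

lemma tilted_rate_measurable:
  assumes h: "bounded_tilt h"
    and [measurable]: "a \<in> borel_measurable N" "b \<in> measurable N \<X>"
  shows "(\<lambda>w. tilted_rate h (a w) (b w)) \<in> borel_measurable N"
proof -
  have [measurable]: "(\<lambda>p. h (a (fst p)) (b (fst p)) (snd p)) \<in> borel_measurable (N \<Otimes>\<^sub>M \<X>)"
    by (rule bounded_tilt_measurable[OF h]) measurable
  show ?thesis
    unfolding tilted_rate_def by (rule integral_r_measurable) (auto simp: case_prod_beta)
qed

lemma set_integral_measurable:
  fixes f :: "'b \<Rightarrow> real \<Rightarrow> real"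
  assumes [measurable]: "(\<lambda>p. f (fst p) (snd p)) \<in> borel_measurable (N \<Otimes>\<^sub>M borel)"
    "a \<in> borel_measurable N" "c \<in> borel_measurable N"
  shows "(\<lambda>w. LINT u:{a w..c w}|lborel. f w u) \<in> borel_measurable N"
proof -
  have "(\<lambda>(w, u). indicator {a w..c w} u *\<^sub>R f w u) \<in> borel_measurable (N \<Otimes>\<^sub>M lborel)"
    unfolding indicator_def atLeastAtMost_iff case_prod_beta by measurable
  then show ?thesis
    unfolding set_lebesgue_integral_def by (rule lborel.borel_measurable_lebesgue_integral)
qed

lemma surv_measurable:
  assumes h: "bounded_tilt h"
    and [measurable]: "a \<in> borel_measurable N" "b \<in> measurable N \<X>" "c \<in> borel_measurable N"
  shows "(\<lambda>w. surv h (a w) (b w) (c w)) \<in> borel_measurable N"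
proof -
  have [measurable]: "(\<lambda>w. LINT u:{a w..c w}|lborel. tilted_rate h u (b w)) \<in> borel_measurable N"
    by (rule set_integral_measurable) (auto intro!: tilted_rate_measurable[OF h])
  show ?thesis unfolding surv_def by measurable
qed

lemma set_integrable_tilted_rate:
  assumes h: "bounded_tilt h" and x: "x \<in> space \<X>"
  shows "set_integrable lborel {s..u} (\<lambda>w. tilted_rate h w x)"
proof -
  obtain K where K: "\<And>s x y. x \<in> space \<X> \<Longrightarrow> y \<in> space \<X> \<Longrightarrow> \<bar>h s x y\<bar> \<le> K"
    by (rule bounded_tiltE[OF h]) (rule that)
  have [measurable]: "(\<lambda>w. tilted_rate h w x) \<in> borel_measurable lborel"
    by (rule tilted_rate_measurable[OF h]) (use x in auto)
  have "set_integrable lborel {s..u} (\<lambda>w. exp K * rate x)"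
    by (rule borel_integrable_atLeastAtMost') auto
  then show ?thesis
    unfolding set_integrable_def
    by (rule Bochner_Integration.integrable_bound)
      (use tilted_rate_pos[OF h x] tilted_rate_bounds(1)[OF h x K[OF x]] rate_pos[OF x] in
        \<open>auto simp: indicator_def less_imp_le abs_of_pos\<close>)
qed

end

section \<open>Real analysis behind the law of a jump time\<close>

lemma set_integral_split_Icc:
  fixes f :: "real \<Rightarrow> real"
  assumes f: "set_integrable lborel {a..c} f" and "a \<le> b" "b \<le> c"
  shows "(LINT w:{a..c}|lborel. f w) = (LINT w:{a..b}|lborel. f w) + (LINT w:{b..c}|lborel. f w)"
proof -
  have i: "set_integrable lborel A f" if "A \<subseteq> {a..c}" "A \<in> sets lborel" for A
    by (rule set_integrable_subset[OF f that(2,1)])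
  have *: "(LINT w:{b<..c}|lborel. f w) = (LINT w:{b..c}|lborel. f w)"
    unfolding set_lebesgue_integral_def
    by (rule integral_discrete_difference[of "{b}"]) (auto simp: indicator_def)
  have "(LINT w:{a..b} \<union> {b<..c}|lborel. f w) = (LINT w:{a..b}|lborel. f w) + (LINT w:{b<..c}|lborel. f w)"
    by (rule set_integral_Un) (use assms in \<open>auto intro!: i\<close>)
  moreover have "{a..b} \<union> {b<..c} = {a..c}" using assms by auto
  ultimately show ?thesis using * by simp
qed

text \<open>Over \<open>n\<close> equal subintervals the increments add up to at most
  \<open>C * (b - a)\<^sup>2 / n\<close>, which tends to zero. This stands in for the vanishing of a
  derivative where none need exist.\<close>

lemma eq_of_quadratic_bound:
  fixes f :: "real \<Rightarrow> real"
  assumes C: "\<And>u v. a \<le> u \<Longrightarrow> u \<le> v \<Longrightarrow> v \<le> b \<Longrightarrow> \<bar>f v - f u\<bar> \<le> C * (v - u)\<^sup>2"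
    and "a \<le> b"
  shows "f b = f a"
proof (rule ccontr)
  assume ne: "f b \<noteq> f a"
  have b: "\<bar>f b - f a\<bar> \<le> C * (b - a)\<^sup>2 / real n" if "0 < n" for n :: nat
  proof -
    define x where "x i = a + real i * (b - a) / real n" for i
    have "\<bar>f b - f a\<bar> = \<bar>\<Sum>i<n. f (x (Suc i)) - f (x i)\<bar>"
      using that by (subst sum_lessThan_telescope) (simp add: x_def)
    also have "\<dots> \<le> (\<Sum>i<n. \<bar>f (x (Suc i)) - f (x i)\<bar>)" by (rule sum_abs)
    also have "\<dots> \<le> (\<Sum>i<n. C * ((b - a) / real n)\<^sup>2)"
    proof (rule sum_mono)
      fix i assume i: "i \<in> {..<n}"
      have d: "x (Suc i) - x i = (b - a) / real n"
        by (simp add: x_def diff_divide_distrib[symmetric] algebra_simps)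
      have 1: "a \<le> x i" using \<open>a \<le> b\<close> that by (simp add: x_def)
      have 2: "x i \<le> x (Suc i)" using d \<open>a \<le> b\<close> that by (smt (verit) divide_nonneg_nonneg of_nat_0_le_iff)
      have "real (Suc i) * (b - a) \<le> real n * (b - a)"
        using i \<open>a \<le> b\<close> by (intro mult_right_mono) auto
      then have 3: "x (Suc i) \<le> b" using that unfolding x_def by (simp add: field_simps)
      show "\<bar>f (x (Suc i)) - f (x i)\<bar> \<le> C * ((b - a) / real n)\<^sup>2"
        using C[OF 1 2 3] d by simp
    qed
    also have "\<dots> = C * (b - a)\<^sup>2 / real n" using that by (simp add: power2_eq_square)
    finally show ?thesis .
  qed
  obtain n :: nat where n: "C * (b - a)\<^sup>2 / \<bar>f b - f a\<bar> < real n" using reals_Archimedean2 by blast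
  have "0 \<le> C * (b - a)\<^sup>2" using C[of a b] \<open>a \<le> b\<close> by linarith
  then have "0 < n" using n by (smt (verit) divide_nonneg_nonneg abs_ge_zero of_nat_0_less_iff)
  then have "\<bar>f b - f a\<bar> < \<bar>f b - f a\<bar>"
    using b[of n] n ne by (simp add: field_simps)
  then show False by simp
qed

text \<open>Both are instances of \<open>1 + z \<le> exp z\<close>, at \<open>z = y - x\<close> and
  at \<open>z = x - y\<close>.\<close>

lemma exp_diff_bounds:
  fixes x y :: real assumes "x \<le> y"
  shows "exp (- y) * (y - x) \<le> exp (- x) - exp (- y)" "exp (- x) - exp (- y) \<le> exp (- x) * (y - x)"
proof -
  have "exp (- y) * (1 + (y - x)) \<le> exp (- y) * exp (y - x)"
    by (intro mult_left_mono exp_ge_add_one_self) auto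
  then show "exp (- y) * (y - x) \<le> exp (- x) - exp (- y)"
    by (simp add: exp_add[symmetric] algebra_simps)
  have "exp (- x) * (1 + (x - y)) \<le> exp (- x) * exp (x - y)"
    by (intro mult_left_mono exp_ge_add_one_self) auto
  then show "exp (- x) - exp (- y) \<le> exp (- x) * (y - x)"
    by (simp add: exp_add[symmetric] algebra_simps)
qed

context rate_kernel begin

text \<open>The total rate is only measurable in time, so \<^const>\<open>surv\<close> need not be differentiable. Instead,
  \<open>e\<^sup>-\<^sup>Q\<close> plus the integral of \<open>q e\<^sup>-\<^sup>Q\<close> varies at most quadratically on short intervals, where \<open>q\<close> is the
  total rate and \<open>Q\<close> its primitive; hence it is constant.\<close>

lemma integral_surv:
  assumes h: "bounded_tilt h" and x: "x \<in> space \<X>" and su: "s \<le> u"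
  shows "set_integrable lborel {s..u} (\<lambda>w. tilted_rate h w x * surv h s x w)"
    "(LINT w:{s..u}|lborel. tilted_rate h w x * surv h s x w) = 1 - surv h s x u"
proof -
  obtain K where K: "\<And>s x y. x \<in> space \<X> \<Longrightarrow> y \<in> space \<X> \<Longrightarrow> \<bar>h s x y\<bar> \<le> K"
    by (rule bounded_tiltE[OF h]) (rule that)
  define q where "q w = tilted_rate h w x" for w
  define R where "R = exp K * rate x"
  have q: "0 \<le> q w" "q w \<le> R" for w
    using tilted_rate_pos[OF h x] tilted_rate_bounds(1)[OF h x K[OF x]]
    by (auto simp: q_def R_def less_imp_le)
  have qi: "set_integrable lborel {a..b} q" for a b
    using set_integrable_tilted_rate[OF h x] by (simp add: q_def[abs_def])
  have qm [measurable]: "q \<in> borel_measurable borel"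
    unfolding q_def[abs_def] by (rule tilted_rate_measurable[OF h]) (use x in auto)
  define Q where "Q v = (LINT w:{s..v}|lborel. q w)" for v
  have S: "surv h s x w = exp (- Q w)" for w by (simp add: surv_def Q_def q_def)
  have [measurable]: "Q \<in> borel_measurable borel"
    unfolding Q_def[abs_def] by (rule set_integral_measurable) auto
  have Q0: "0 \<le> Q v" for v
    unfolding Q_def set_lebesgue_integral_def using q by (intro integral_nonneg_AE) auto
  have Qd: "Q v - Q w = (LINT z:{w..v}|lborel. q z)" if "s \<le> w" "w \<le> v" for w v
    using set_integral_split_Icc[OF qi that] by (simp add: Q_def)
  have Qmono: "Q w \<le> Q v" if "s \<le> w" "w \<le> v" for w v
    using Qd[OF that] q unfolding set_lebesgue_integral_def
    by (smt (verit) Bochner_Integration.integral_nonneg_AE AE_I2 indicator_pos_le scaleR_nonneg_nonneg)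
  have Qlip: "Q v - Q w \<le> R * (v - w)" if "s \<le> w" "w \<le> v" for w v
  proof -
    have "(LINT z:{w..v}|lborel. q z) \<le> (LINT z:{w..v}|lborel. R)"
      by (rule set_integral_mono[OF qi]) (use q in \<open>auto intro!: borel_integrable_atLeastAtMost'\<close>)
    then show ?thesis using Qd[OF that] that by (simp add: set_lebesgue_integral_def mult.commute)
  qed
  have fi: "set_integrable lborel {a..b} (\<lambda>w. q w * exp (- Q w))" for a b
    using qi[of a b] unfolding set_integrable_def
    by (rule Bochner_Integration.integrable_bound)
      (use q Q0 in \<open>auto simp: indicator_def abs_mult intro!: mult_left_le\<close>)
  then show "set_integrable lborel {s..u} (\<lambda>w. tilted_rate h w x * surv h s x w)"
    by (simp add: q_def[symmetric] S)
  define \<Psi> where "\<Psi> v = exp (- Q v) + (LINT w:{s..v}|lborel. q w * exp (- Q w))" for v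
  have bound: "\<bar>\<Psi> v - \<Psi> w\<bar> \<le> R\<^sup>2 * (v - w)\<^sup>2" if wv: "s \<le> w" "w \<le> v" for w v
  proof -
    define I where "I = (LINT z:{w..v}|lborel. q z * exp (- Q z))"
    have "(LINT z:{s..v}|lborel. q z * exp (- Q z)) = (LINT z:{s..w}|lborel. q z * exp (- Q z)) + I"
      unfolding I_def by (rule set_integral_split_Icc[OF fi wv])
    then have d: "\<Psi> v - \<Psi> w = I - (exp (- Q w) - exp (- Q v))" by (simp add: \<Psi>_def)
    have "I \<le> (LINT z:{w..v}|lborel. q z * exp (- Q w))"
      unfolding I_def
      by (rule set_integral_mono[OF fi]) (use qi q Qmono wv in \<open>auto intro!: mult_left_mono\<close>)
    then have up: "I \<le> (Q v - Q w) * exp (- Q w)" by (simp add: Qd wv)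
    have "(LINT z:{w..v}|lborel. q z * exp (- Q v)) \<le> I"
      unfolding I_def
      by (rule set_integral_mono[OF _ fi]) (use qi q Qmono wv in \<open>auto intro!: mult_left_mono\<close>)
    then have lo: "(Q v - Q w) * exp (- Q v) \<le> I" by (simp add: Qd wv)
    have m: "0 \<le> Q v - Q w" using Qmono[OF wv] by simp
    note e = exp_diff_bounds[OF Qmono[OF wv]]
    \<comment> \<open>The integral \<open>I\<close> and the drop of \<open>exp (- Q)\<close> both
      lie between \<open>Q v - Q w\<close> times the value of \<open>exp (- Q)\<close> at
      \<open>v\<close> and at \<open>w\<close>. They differ by at most the length of that range,
      which is a product of two increments and hence quadratic in \<open>v - w\<close>.\<close>
    have "\<bar>\<Psi> v - \<Psi> w\<bar> \<le> (Q v - Q w) * (exp (- Q w) - exp (- Q v))"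
      unfolding d using up lo e by (simp add: abs_le_iff algebra_simps)
    also have "\<dots> \<le> (Q v - Q w) * (exp (- Q w) * (Q v - Q w))"
      using e m by (intro mult_left_mono) auto
    also have "\<dots> \<le> (Q v - Q w) * (1 * (Q v - Q w))"
      using m Q0 by (intro mult_left_mono mult_right_mono) auto
    also have "\<dots> \<le> (R * (v - w))\<^sup>2"
      using m Qlip[OF wv] by (simp add: power2_eq_square[symmetric] power_mono)
    finally show ?thesis by (simp add: power_mult_distrib)
  qed
  have "\<Psi> u = \<Psi> s" by (rule eq_of_quadratic_bound[of _ _ _ "R\<^sup>2", OF _ su]) (rule bound)
  moreover have "Q s = 0" "(LINT w:{s..s}|lborel. q w * exp (- Q w)) = 0"
    using set_integral_split_Icc[OF qi, of s s s] set_integral_split_Icc[OF fi, of s s s]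
    by (simp_all add: Q_def)
  ultimately show "(LINT w:{s..u}|lborel. tilted_rate h w x * surv h s x w) = 1 - surv h s x u"
    by (simp add: \<Psi>_def q_def[symmetric] S)
qed

lemma surv_pos: "0 < surv h s x u"
  by (simp add: surv_def)

lemma surv_le_1:
  assumes "bounded_tilt h" "x \<in> space \<X>"
  shows "surv h s x u \<le> 1"
proof -
  have "0 \<le> (LINT w:{s..u}|lborel. tilted_rate h w x)"
    unfolding set_lebesgue_integral_def using tilted_rate_pos[OF assms]
    by (intro integral_nonneg_AE AE_I2 scaleR_nonneg_nonneg) (auto simp: less_imp_le)
  then show ?thesis by (simp add: surv_def)
qed

lemma nn_integral_surv:
  assumes h: "bounded_tilt h" and x: "x \<in> space \<X>" and su: "s \<le> u"
  shows "(\<integral>\<^sup>+w\<in>{s..u}. ennreal (tilted_rate h w x * surv h s x w) \<partial>lborel) = ennreal (1 - surv h s x u)"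
proof -
  have "(\<integral>\<^sup>+w\<in>{s..u}. ennreal (tilted_rate h w x * surv h s x w) \<partial>lborel)
      = (\<integral>\<^sup>+w. ennreal (indicator {s..u} w *\<^sub>R (tilted_rate h w x * surv h s x w)) \<partial>lborel)"
    by (intro nn_integral_cong) (auto split: split_indicator)
  also have "\<dots> = ennreal (LINT w:{s..u}|lborel. tilted_rate h w x * surv h s x w)"
    unfolding set_lebesgue_integral_def
  proof (rule nn_integral_eq_integral)
    show "AE w in lborel. 0 \<le> indicator {s..u} w *\<^sub>R (tilted_rate h w x * surv h s x w)"
      using tilted_rate_pos[OF h x] surv_pos
      by (intro AE_I2 scaleR_nonneg_nonneg mult_nonneg_nonneg) (auto simp: less_imp_le)
  qed (use integral_surv(1)[OF h x su] in \<open>simp add: set_integrable_def\<close>)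
  finally show ?thesis by (simp add: integral_surv(2)[OF assms])
qed

end

section \<open>One step of a jump process\<close>

text \<open>\<open>real_cond_exp\<close> is a difference of two extended nonnegative conditional
  expectations. For an indicator the first is at most \<open>1\<close> and the second is
  \<open>0\<close> almost everywhere, so nothing is lost on the way to real numbers. The nonnegative
  form admits weights \<open>a\<close> of infinite integral.\<close>

lemma (in prob_space) nn_integral_cond_indicator:
  assumes F: "subalgebra M F" and A [measurable]: "A \<in> sets M" and a: "a \<in> borel_measurable F"
  shows "(\<integral>\<^sup>+\<omega>. a \<omega> * indicator A \<omega> \<partial>M)
    = (\<integral>\<^sup>+\<omega>. a \<omega> * ennreal (real_cond_exp M F (indicator A) \<omega>) \<partial>M)"
proof -
  interpret sigma_finite_subalgebra M F
    using finite_measure_subalgebra_is_sigma_finite[of M F] F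
    by (simp add: finite_measure_subalgebra_def finite_measure_subalgebra_axioms_def finite_measure_axioms)
  have "AE \<omega> in M. nn_cond_exp M F (\<lambda>\<omega>. ennreal (indicator A \<omega>)) \<omega> \<le> nn_cond_exp M F (\<lambda>_. 1) \<omega>"
    by (rule nn_cond_exp_mono) (auto simp: indicator_def)
  moreover have "AE \<omega> in M. 1 = nn_cond_exp M F (\<lambda>_. 1) \<omega>"
    by (rule nn_cond_exp_F_meas) auto
  moreover have "AE \<omega> in M. 0 = nn_cond_exp M F (\<lambda>_. 0) \<omega>"
    by (rule nn_cond_exp_F_meas) auto
  moreover have "(\<lambda>\<omega>. ennreal (- indicator A \<omega>)) = (\<lambda>_. 0)"
    by (auto simp: indicator_def ennreal_neg)
  moreover have "x = ennreal (enn2real x)" if "x \<le> 1" for x :: ennreal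
    using that by (cases x) (auto simp: top_unique)
  ultimately have ae: "AE \<omega> in M. nn_cond_exp M F (\<lambda>\<omega>. ennreal (indicator A \<omega>)) \<omega>
      = ennreal (real_cond_exp M F (indicator A) \<omega>)"
    unfolding real_cond_exp_def by auto
  have "(\<integral>\<^sup>+\<omega>. a \<omega> * indicator A \<omega> \<partial>M) = (\<integral>\<^sup>+\<omega>. a \<omega> * ennreal (indicator A \<omega>) \<partial>M)"
    by (simp add: ennreal_indicator)
  also have "\<dots> = (\<integral>\<^sup>+\<omega>. a \<omega> * nn_cond_exp M F (\<lambda>\<omega>. ennreal (indicator A \<omega>)) \<omega> \<partial>M)"
    by (rule nn_cond_exp_intg[symmetric, OF a]) measurable
  also have "\<dots> = (\<integral>\<^sup>+\<omega>. a \<omega> * ennreal (real_cond_exp M F (indicator A) \<omega>) \<partial>M)"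
    by (rule nn_integral_cong_AE) (use ae in auto)
  finally show ?thesis .
qed

text \<open>The process jumps with rates \<open>e\<^sup>h r\<close>: the unperturbed process is the case \<open>h = 0\<close>, the perturbed one
  the case \<open>h = \<lambda> g\<close>.\<close>

locale tilted_process = rate_kernel \<X> r for \<X> :: "'a measure" and r +
  fixes \<nu> :: "'a measure" and h :: "real \<Rightarrow> 'a \<Rightarrow> 'a \<Rightarrow> real" and t :: real
    and M :: "'w measure" and T :: "nat \<Rightarrow> 'w \<Rightarrow> real" and Y :: "nat \<Rightarrow> 'w \<Rightarrow> 'a"
  assumes h: "bounded_tilt h"
    and jump: "jump_process \<X> \<nu> {0..t} (surv h)
      (\<lambda>u x B. (\<integral>y. exp (h u x y) * indicator B y \<partial>r x) / tilted_rate h u x) M T Y"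
begin

sublocale prob_space M
  using jump by (simp add: jump_process_def)

lemma T_measurable [measurable]: "T n \<in> borel_measurable M"
  and Y_measurable [measurable]: "Y n \<in> measurable M \<X>"
  using jump by (simp_all add: jump_process_def)

lemma T_0: "\<omega> \<in> space M \<Longrightarrow> T 0 \<omega> = 0"
  and T_less_Suc: "\<omega> \<in> space M \<Longrightarrow> T n \<omega> < T (Suc n) \<omega>"
  and Y_Suc_neq: "\<omega> \<in> space M \<Longrightarrow> 0 \<le> T (Suc n) \<omega> \<Longrightarrow> T (Suc n) \<omega> \<le> t \<Longrightarrow> Y (Suc n) \<omega> \<noteq> Y n \<omega>"
  and distr_Y_0: "distr M \<X> (Y 0) = \<nu>"
  using jump by (simp_all add: jump_process_def)

lemma T_strict_mono: "\<omega> \<in> space M \<Longrightarrow> strict_mono (\<lambda>n. T n \<omega>)"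
  using T_less_Suc by (simp add: strict_mono_Suc_iff)

lemma T_mono: "\<omega> \<in> space M \<Longrightarrow> m \<le> n \<Longrightarrow> T m \<omega> \<le> T n \<omega>"
  using strict_mono_less_eq[OF T_strict_mono] by simp

lemma T_nonneg: "\<omega> \<in> space M \<Longrightarrow> 0 \<le> T n \<omega>"
  using T_mono[of \<omega> 0 n] T_0 by simp

lemma Y_space: "\<omega> \<in> space M \<Longrightarrow> Y n \<omega> \<in> space \<X>"
  using Y_measurable by (rule measurable_space)

section \<open>The sigma-algebras of the past and the conditional laws of the next jump\<close>

abbreviation "H \<equiv> history \<X> M T Y"
abbreviation "H_next \<equiv> history_and_next_time \<X> M T Y"

lemma space_H [simp]: "space (H n) = space M" "space (H_next n) = space M"
  by (simp_all add: history_def history_and_next_time_def)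

lemma history_map_space: "(\<lambda>\<omega>. \<lambda>i\<in>{..n}. (T i \<omega>, Y i \<omega>)) \<in> space M \<rightarrow> space (\<Pi>\<^sub>M i\<in>{..n}. borel \<Otimes>\<^sub>M \<X>)"
  using Y_space by (auto simp: space_PiM space_pair_measure)

lemma TY_H_measurable:
  assumes "i \<le> n"
  shows "T i \<in> borel_measurable (H n)" "Y i \<in> measurable (H n) \<X>"
proof -
  have 1: "(\<lambda>\<omega>. \<lambda>i\<in>{..n}. (T i \<omega>, Y i \<omega>)) \<in> measurable (H n) (\<Pi>\<^sub>M i\<in>{..n}. borel \<Otimes>\<^sub>M \<X>)"
    unfolding history_def by (rule measurable_vimage_algebra1[OF history_map_space])
  have 2: "(\<lambda>f. f i) \<in> measurable (\<Pi>\<^sub>M i\<in>{..n}. borel \<Otimes>\<^sub>M \<X>) (borel \<Otimes>\<^sub>M \<X>)"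
    using assms by (intro measurable_component_singleton) auto
  have 3: "(\<lambda>\<omega>. (T i \<omega>, Y i \<omega>)) \<in> measurable (H n) (borel \<Otimes>\<^sub>M \<X>)"
    using measurable_compose[OF 1 2] assms by simp
  show "T i \<in> borel_measurable (H n)" using measurable_compose[OF 3 measurable_fst] by simp
  show "Y i \<in> measurable (H n) \<X>" using measurable_compose[OF 3 measurable_snd] by simp
qed

lemma TY_H_next_measurable:
  shows "i \<le> n \<Longrightarrow> T i \<in> borel_measurable (H_next n)" "i \<le> n \<Longrightarrow> Y i \<in> measurable (H_next n) \<X>"
    "T (Suc n) \<in> borel_measurable (H_next n)"
proof -
  have 1: "(\<lambda>\<omega>. (\<lambda>i\<in>{..n}. (T i \<omega>, Y i \<omega>), T (Suc n) \<omega>))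
      \<in> measurable (H_next n) ((\<Pi>\<^sub>M i\<in>{..n}. borel \<Otimes>\<^sub>M \<X>) \<Otimes>\<^sub>M borel)"
    unfolding history_and_next_time_def
    by (rule measurable_vimage_algebra1) (use history_map_space in \<open>auto simp: space_pair_measure\<close>)
  show "T (Suc n) \<in> borel_measurable (H_next n)" using measurable_compose[OF 1 measurable_snd] by simp
  assume i: "i \<le> n"
  have 2: "(\<lambda>f. f i) \<in> measurable (\<Pi>\<^sub>M i\<in>{..n}. borel \<Otimes>\<^sub>M \<X>) (borel \<Otimes>\<^sub>M \<X>)"
    using i by (intro measurable_component_singleton) auto
  have 3: "(\<lambda>\<omega>. (T i \<omega>, Y i \<omega>)) \<in> measurable (H_next n) (borel \<Otimes>\<^sub>M \<X>)"
    using measurable_compose[OF measurable_compose[OF 1 measurable_fst] 2] i by simp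
  show "T i \<in> borel_measurable (H_next n)" using measurable_compose[OF 3 measurable_fst] by simp
  show "Y i \<in> measurable (H_next n) \<X>" using measurable_compose[OF 3 measurable_snd] by simp
qed

lemma sets_H_subset:
  assumes "space N = space M" "\<And>i. i \<le> n \<Longrightarrow> T i \<in> borel_measurable N" "\<And>i. i \<le> n \<Longrightarrow> Y i \<in> measurable N \<X>"
  shows "sets (H n) \<subseteq> sets N"
  unfolding history_def
  by (rule sets_image_in_sets[OF assms(1)])
    (intro measurable_restrict measurable_Pair assms, auto)

lemma sets_H_next_subset:
  assumes "space N = space M" "\<And>i. i \<le> n \<Longrightarrow> T i \<in> borel_measurable N" "\<And>i. i \<le> n \<Longrightarrow> Y i \<in> measurable N \<X>"
    "T (Suc n) \<in> borel_measurable N"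
  shows "sets (H_next n) \<subseteq> sets N"
  unfolding history_and_next_time_def
  by (rule sets_image_in_sets[OF assms(1)])
    (intro measurable_restrict measurable_Pair assms, auto)

lemma subalgebra_H: "subalgebra M (H n)" and subalgebra_H_next: "subalgebra M (H_next n)"
  using sets_H_subset[of M n] sets_H_next_subset[of M n] by (auto simp: subalgebra_def)

lemma H_H_next_measurable:
  assumes "a \<in> measurable (H n) B" shows "a \<in> measurable (H_next n) B"
proof -
  have "subalgebra (H_next n) (H n)"
    using sets_H_subset[of "H_next n" n] TY_H_next_measurable(1,2)[of _ n] by (auto simp: subalgebra_def)
  then show ?thesis using assms by (rule measurable_from_subalg)
qed

lemma H_measurable_M: "a \<in> measurable (H n) B \<Longrightarrow> a \<in> measurable M B"
  by (rule measurable_from_subalg[OF subalgebra_H])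

text \<open>The prescribed waiting probability at a fixed time, tested against a weight depending on
  the past. It is prescribed only on the event \<open>T n \<le> u\<close>, which belongs to
  \<open>H n\<close> and can therefore be absorbed into the weight.\<close>

lemma survival:
  assumes a: "a \<in> borel_measurable (H n)" and u: "0 \<le> u" "u \<le> t"
  shows "(\<integral>\<^sup>+\<omega>. a \<omega> * indicator {\<omega>\<in>space M. T n \<omega> \<le> u \<and> u < T (Suc n) \<omega>} \<omega> \<partial>M)
    = (\<integral>\<^sup>+\<omega>. a \<omega> * indicator {\<omega>\<in>space M. T n \<omega> \<le> u} \<omega> * ennreal (surv h (T n \<omega>) (Y n \<omega>) u) \<partial>M)"
proof -
  have [measurable]: "T n \<in> borel_measurable (H n)" by (rule TY_H_measurable) simp
  note a [measurable]
  define A where "A = {\<omega>\<in>space M. u < T (Suc n) \<omega>}"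
  have A [measurable]: "A \<in> sets M" unfolding A_def by measurable
  have ae: "AE \<omega> in M. T n \<omega> \<le> u \<longrightarrow> real_cond_exp M (H n) (indicator A) \<omega> = surv h (T n \<omega>) (Y n \<omega>) u"
    using jump u unfolding jump_process_def A_def by auto
  have "{\<omega>\<in>space M. T n \<omega> \<le> u} = {\<omega>\<in>space (H n). T n \<omega> \<le> u}" by simp
  also have "\<dots> \<in> sets (H n)" by measurable
  finally have B: "{\<omega>\<in>space M. T n \<omega> \<le> u} \<in> sets (H n)" .
  have "(\<integral>\<^sup>+\<omega>. a \<omega> * indicator {\<omega>\<in>space M. T n \<omega> \<le> u \<and> u < T (Suc n) \<omega>} \<omega> \<partial>M)
    = (\<integral>\<^sup>+\<omega>. (a \<omega> * indicator {\<omega>\<in>space M. T n \<omega> \<le> u} \<omega>) * indicator A \<omega> \<partial>M)"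
    by (intro nn_integral_cong) (auto simp: A_def indicator_def)
  also have "\<dots> = (\<integral>\<^sup>+\<omega>. (a \<omega> * indicator {\<omega>\<in>space M. T n \<omega> \<le> u} \<omega>) * ennreal (real_cond_exp M (H n) (indicator A) \<omega>) \<partial>M)"
    by (rule nn_integral_cond_indicator[OF subalgebra_H A])
      (intro borel_measurable_times_ennreal a borel_measurable_indicator B)
  also have "\<dots> = (\<integral>\<^sup>+\<omega>. a \<omega> * indicator {\<omega>\<in>space M. T n \<omega> \<le> u} \<omega> * ennreal (surv h (T n \<omega>) (Y n \<omega>) u) \<partial>M)"
    by (rule nn_integral_cong_AE) (use ae in \<open>auto simp: indicator_def elim!: eventually_mono\<close>)
  finally show ?thesis .
qed

text \<open>This is the law of the next state given the past and the next jump time. The prescribed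
  probabilities hold outside a null set that depends on \<open>B\<close>; since \<open>K\<close> is
  written down from \<open>r\<close>, \<open>disintegration\<close> asks for the identity with one
  \<open>B\<close> at a time.\<close>

lemma mark_step:
  assumes f: "(\<lambda>(\<omega>, y). f \<omega> y) \<in> borel_measurable (H_next n \<Otimes>\<^sub>M \<X>)"
  shows "(\<integral>\<^sup>+\<omega>. indicator {\<omega>\<in>space M. T (Suc n) \<omega> \<le> t} \<omega> * f \<omega> (Y (Suc n) \<omega>) \<partial>M)
    = (\<integral>\<^sup>+\<omega>. indicator {\<omega>\<in>space M. T (Suc n) \<omega> \<le> t} \<omega> *
        (\<integral>\<^sup>+y. ennreal (exp (h (T (Suc n) \<omega>) (Y n \<omega>) y) / tilted_rate h (T (Suc n) \<omega>) (Y n \<omega>)) * f \<omega> y \<partial>r (Y n \<omega>)) \<partial>M)"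
proof -
  define D where "D = {\<omega>\<in>space M. T (Suc n) \<omega> \<le> t}"
  have TS: "T (Suc n) \<in> borel_measurable (H_next n)" and Yn: "Y n \<in> measurable (H_next n) \<X>"
    by (rule TY_H_next_measurable, simp?)+
  note TS [measurable] Yn [measurable]
  have "{\<omega>\<in>space (H_next n). T (Suc n) \<omega> \<le> t} \<in> sets (H_next n)" by measurable
  then have D: "D \<in> sets (H_next n)" by (simp add: D_def)
  have DM: "D \<in> sets M" using D subalgebra_H_next by (auto simp: subalgebra_def)
  \<comment> \<open>After time \<open>t\<close> the dynamics is not prescribed. The indicator makes
    \<open>K\<close> the zero measure there.\<close>
  define d where "d \<omega> y = indicator D \<omega> * (exp (h (T (Suc n) \<omega>) (Y n \<omega>) y) / tilted_rate h (T (Suc n) \<omega>) (Y n \<omega>))"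
    for \<omega> y
  have d_meas: "(\<lambda>p. d (fst p) (snd p)) \<in> borel_measurable (H_next n \<Otimes>\<^sub>M \<X>)"
  proof -
    have 1: "(\<lambda>p. h (T (Suc n) (fst p)) (Y n (fst p)) (snd p)) \<in> borel_measurable (H_next n \<Otimes>\<^sub>M \<X>)"
      by (rule bounded_tilt_measurable[OF h]) measurable
    have 2: "(\<lambda>p. tilted_rate h (T (Suc n) (fst p)) (Y n (fst p))) \<in> borel_measurable (H_next n \<Otimes>\<^sub>M \<X>)"
      by (rule tilted_rate_measurable[OF h]) measurable
    have 3: "(\<lambda>p. indicator D (fst p) :: real) \<in> borel_measurable (H_next n \<Otimes>\<^sub>M \<X>)"
      by (rule measurable_compose[OF measurable_fst borel_measurable_indicator[OF D]])
    show ?thesis unfolding d_def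
      by (intro borel_measurable_times borel_measurable_divide borel_measurable_exp 3 2
          measurable_compose[OF 1 borel_measurable_exp])
  qed
  have d_r: "d \<omega> \<in> borel_measurable (r (Y n \<omega>))" if "\<omega> \<in> space M" for \<omega>
    using measurable_Pair2[OF d_meas, of \<omega>] that
    by (subst measurable_cong_sets[OF sets_r[OF Y_space[OF that]] refl]) simp

  define K where "K \<omega> = density (r (Y n \<omega>)) (\<lambda>y. ennreal (d \<omega> y))" for \<omega>
  have sets_K: "sets (K \<omega>) = sets \<X>" if "\<omega> \<in> space M" for \<omega>
    using sets_r[OF Y_space[OF that]] by (simp add: K_def)
  have em_K: "emeasure (K \<omega>) B = (\<integral>\<^sup>+y. ennreal (d \<omega> y) * indicator B y \<partial>r (Y n \<omega>))"
    if "\<omega> \<in> space M" "B \<in> sets \<X>" for \<omega> B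
    unfolding K_def using d_r[OF that(1)] that sets_r[OF Y_space[OF that(1)]]
    by (subst emeasure_density) auto
  have J: "(\<integral>\<^sup>+y. ennreal (d \<omega> y) * indicator B y \<partial>r (Y n \<omega>)) = indicator D \<omega> *
      ennreal ((\<integral>y. exp (h (T (Suc n) \<omega>) (Y n \<omega>) y) * indicator B y \<partial>r (Y n \<omega>)) / tilted_rate h (T (Suc n) \<omega>) (Y n \<omega>))"
    if w: "\<omega> \<in> space M" and B: "B \<in> sets \<X>" for \<omega> B
  proof -
    let ?x = "Y n \<omega>" let ?u = "T (Suc n) \<omega>"
    have x: "?x \<in> space \<X>" by (rule Y_space[OF w])
    have [measurable]: "B \<in> sets (r ?x)" using B by (simp add: sets_r[OF x])
    note [measurable] = bounded_tilt_measurable_r(1)[OF h x]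
    have i: "integrable (r ?x) (\<lambda>y. exp (h ?u ?x y) * indicator B y)"
      using integrable_real_mult_indicator[OF \<open>B \<in> sets (r ?x)\<close> integrable_exp_tilt[OF h x, of ?u]]
      by (simp add: mult.commute)
    have "(\<integral>\<^sup>+y. ennreal (d \<omega> y) * indicator B y \<partial>r ?x)
      = (\<integral>\<^sup>+y. indicator D \<omega> * ennreal (1 / tilted_rate h ?u ?x) * ennreal (exp (h ?u ?x y) * indicator B y) \<partial>r ?x)"
      using tilted_rate_pos[OF h x, of ?u]
      by (intro nn_integral_cong) (auto simp: d_def indicator_def ennreal_mult[symmetric] split: if_splits)
    also have "\<dots> = indicator D \<omega> * ennreal (1 / tilted_rate h ?u ?x) * ennreal (\<integral>y. exp (h ?u ?x y) * indicator B y \<partial>r ?x)"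
      using i by (subst nn_integral_cmult) (auto simp: nn_integral_eq_integral)
    also have "\<dots> = indicator D \<omega> * ennreal ((\<integral>y. exp (h ?u ?x y) * indicator B y \<partial>r ?x) / tilted_rate h ?u ?x)"
      using tilted_rate_pos[OF h x, of ?u]
      by (simp add: mult.assoc ennreal_mult[symmetric] integral_nonneg_AE)
    finally show ?thesis .
  qed
  have K: "K \<in> measurable (H_next n) (subprob_algebra \<X>)"
  proof (rule measurable_subprob_algebra)
    fix \<omega> assume "\<omega> \<in> space (H_next n)"
    then have w: "\<omega> \<in> space M" by simp
    have sp: "space (K \<omega>) = space \<X>" by (rule sets_eq_imp_space_eq[OF sets_K[OF w]])
    let ?x = "Y n \<omega>"
    have x: "?x \<in> space \<X>" by (rule Y_space[OF w])
    have "(\<integral>y. exp (h (T (Suc n) \<omega>) ?x y) * indicator (space \<X>) y \<partial>r ?x) = tilted_rate h (T (Suc n) \<omega>) ?x"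
      unfolding tilted_rate_def by (intro Bochner_Integration.integral_cong) (auto simp: space_r[OF x])
    then have "emeasure (K \<omega>) (space (K \<omega>)) \<le> 1"
      using em_K[OF w sets.top] J[OF w sets.top] tilted_rate_pos[OF h x, of "T (Suc n) \<omega>"]
      by (simp add: sp split: split_indicator)
    then show "subprob_space (K \<omega>)"
      using x by (intro subprob_spaceI) (auto simp: sp)
    show "sets (K \<omega>) = sets \<X>" by (rule sets_K[OF w])
  next
    fix B assume B [measurable]: "B \<in> sets \<X>"
    have "(\<lambda>\<omega>. \<integral>\<^sup>+y. ennreal (d \<omega> y) * indicator B y \<partial>r (Y n \<omega>)) \<in> borel_measurable (H_next n)"
      by (rule nn_integral_r_measurable[OF _ Yn])
        (unfold case_prod_beta, intro borel_measurable_times_ennreal measurable_compose[OF d_meas measurable_ennreal]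
          measurable_compose[OF measurable_snd borel_measurable_indicator[OF B]])
    then show "(\<lambda>\<omega>. emeasure (K \<omega>) B) \<in> borel_measurable (H_next n)"
      by (subst measurable_cong) (auto simp: em_K B)
  qed
  have "(\<integral>\<^sup>+\<omega>. indicator D \<omega> * f \<omega> (Y (Suc n) \<omega>) \<partial>M) = (\<integral>\<^sup>+\<omega>. (\<integral>\<^sup>+y. f \<omega> y \<partial>K \<omega>) \<partial>M)"
  proof (rule disintegration[OF finite_measure_axioms subalgebra_H_next Y_measurable K DM _ f])
    fix A B assume A: "A \<in> sets (H_next n)" and B [measurable]: "B \<in> sets \<X>"
    define C where "C = {\<omega>\<in>space M. Y (Suc n) \<omega> \<in> B}"
    have C [measurable]: "C \<in> sets M" unfolding C_def by measurable
    have ae: "AE \<omega> in M. T (Suc n) \<omega> \<in> {0..t} \<longrightarrow> real_cond_exp M (H_next n) (indicator C) \<omega>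
        = (\<integral>y. exp (h (T (Suc n) \<omega>) (Y n \<omega>) y) * indicator B y \<partial>r (Y n \<omega>)) / tilted_rate h (T (Suc n) \<omega>) (Y n \<omega>)"
      using jump B unfolding jump_process_def C_def by auto
    have "(\<integral>\<^sup>+\<omega>. indicator A \<omega> * indicator D \<omega> * indicator B (Y (Suc n) \<omega>) \<partial>M)
      = (\<integral>\<^sup>+\<omega>. (indicator A \<omega> * indicator D \<omega>) * indicator C \<omega> \<partial>M)"
      by (intro nn_integral_cong) (auto simp: C_def indicator_def)
    also have "\<dots> = (\<integral>\<^sup>+\<omega>. (indicator A \<omega> * indicator D \<omega>) * ennreal (real_cond_exp M (H_next n) (indicator C) \<omega>) \<partial>M)"
      by (rule nn_integral_cond_indicator[OF subalgebra_H_next C])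
        (intro borel_measurable_times_ennreal borel_measurable_indicator A D)
    also have "\<dots> = (\<integral>\<^sup>+\<omega>. indicator A \<omega> * emeasure (K \<omega>) B \<partial>M)"
    proof (rule nn_integral_cong_AE)
      show "AE \<omega> in M. indicator A \<omega> * indicator D \<omega> * ennreal (real_cond_exp M (H_next n) (indicator C) \<omega>)
          = indicator A \<omega> * emeasure (K \<omega>) B"
        using ae AE_space
      proof eventually_elim
        case (elim \<omega>)
        then show ?case
          using T_nonneg[of \<omega> "Suc n"]
          by (cases "\<omega> \<in> D") (auto simp: em_K[OF _ B] J[OF _ B] D_def)
      qed
    qed
    finally show "(\<integral>\<^sup>+\<omega>. indicator A \<omega> * indicator D \<omega> * indicator B (Y (Suc n) \<omega>) \<partial>M)
      = (\<integral>\<^sup>+\<omega>. indicator A \<omega> * emeasure (K \<omega>) B \<partial>M)" .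
  qed
  also have "\<dots> = (\<integral>\<^sup>+\<omega>. indicator D \<omega> *
        (\<integral>\<^sup>+y. ennreal (exp (h (T (Suc n) \<omega>) (Y n \<omega>) y) / tilted_rate h (T (Suc n) \<omega>) (Y n \<omega>)) * f \<omega> y \<partial>r (Y n \<omega>)) \<partial>M)"
  proof (rule nn_integral_cong)
    fix \<omega> assume w: "\<omega> \<in> space M"
    have fm: "f \<omega> \<in> borel_measurable (r (Y n \<omega>))"
      using measurable_Pair2[OF f, of \<omega>] w
      by (subst measurable_cong_sets[OF sets_r[OF Y_space[OF w]] refl]) simp
    have "(\<integral>\<^sup>+y. f \<omega> y \<partial>K \<omega>) = (\<integral>\<^sup>+y. ennreal (d \<omega> y) * f \<omega> y \<partial>r (Y n \<omega>))"
      unfolding K_def by (rule nn_integral_density[OF measurable_compose[OF d_r[OF w] measurable_ennreal] fm])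
    then show "(\<integral>\<^sup>+y. f \<omega> y \<partial>K \<omega>) = indicator D \<omega> *
        (\<integral>\<^sup>+y. ennreal (exp (h (T (Suc n) \<omega>) (Y n \<omega>) y) / tilted_rate h (T (Suc n) \<omega>) (Y n \<omega>)) * f \<omega> y \<partial>r (Y n \<omega>))"
      by (cases "\<omega> \<in> D") (simp_all add: d_def)
  qed
  finally show ?thesis by (simp add: D_def)
qed

text \<open>This is the law of the next jump time given the past. The data prescribe its tail
  \<open>surv\<close>, and by \<open>nn_integral_surv\<close> the complement \<open>1 - surv\<close>
  is the distribution function of the density \<open>tilted_rate\<close> times \<open>surv\<close>.
  So it is enough to compare half-lines.\<close>

lemma time_step:
  assumes f: "(\<lambda>(\<omega>, u). f \<omega> u) \<in> borel_measurable (H n \<Otimes>\<^sub>M borel)"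
  shows "(\<integral>\<^sup>+\<omega>. indicator {\<omega>\<in>space M. T (Suc n) \<omega> \<le> t} \<omega> * f \<omega> (T (Suc n) \<omega>) \<partial>M)
    = (\<integral>\<^sup>+\<omega>. (\<integral>\<^sup>+u\<in>{T n \<omega>..t}. ennreal (tilted_rate h u (Y n \<omega>) * surv h (T n \<omega>) (Y n \<omega>) u) * f \<omega> u \<partial>lborel) \<partial>M)"
proof -
  define D where "D = {\<omega>\<in>space M. T (Suc n) \<omega> \<le> t}"
  have D [measurable]: "D \<in> sets M" unfolding D_def by measurable
  have Tn: "T n \<in> borel_measurable (H n)" and Yn: "Y n \<in> measurable (H n) \<X>"
    by (rule TY_H_measurable, simp)+
  note Tn [measurable] Yn [measurable]
  define d where "d \<omega> u = indicator {T n \<omega>..t} u * (tilted_rate h u (Y n \<omega>) * surv h (T n \<omega>) (Y n \<omega>) u)" for \<omega> u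
  have d_meas: "(\<lambda>p. d (fst p) (snd p)) \<in> borel_measurable (H n \<Otimes>\<^sub>M borel)"
  proof -
    have [measurable]: "(\<lambda>p. tilted_rate h (snd p) (Y n (fst p))) \<in> borel_measurable (H n \<Otimes>\<^sub>M borel)"
      by (rule tilted_rate_measurable[OF h]) measurable
    have [measurable]: "(\<lambda>p. surv h (T n (fst p)) (Y n (fst p)) (snd p)) \<in> borel_measurable (H n \<Otimes>\<^sub>M borel)"
      by (rule surv_measurable[OF h]) measurable
    show ?thesis unfolding d_def indicator_def atLeastAtMost_iff by measurable
  qed
  have d_1: "d \<omega> \<in> borel_measurable borel" if "\<omega> \<in> space M" for \<omega>
    using measurable_Pair2[OF d_meas, of \<omega>] that by simp
  define K where "K \<omega> = density lborel (\<lambda>u. ennreal (d \<omega> u))" for \<omega>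
  have em_K: "emeasure (K \<omega>) B = (\<integral>\<^sup>+u. ennreal (d \<omega> u) * indicator B u \<partial>lborel)"
    if "\<omega> \<in> space M" "B \<in> sets borel" for \<omega> B
    unfolding K_def using d_1[OF that(1)] that by (subst emeasure_density) auto
  have em_K_atMost: "emeasure (K \<omega>) {..u} = indicator {\<omega>\<in>space M. T n \<omega> \<le> min u t} \<omega>
      * ennreal (1 - surv h (T n \<omega>) (Y n \<omega>) (min u t))" if w: "\<omega> \<in> space M" for \<omega> u
  proof -
    have "emeasure (K \<omega>) {..u} = (\<integral>\<^sup>+w\<in>{T n \<omega>..min u t}. ennreal (tilted_rate h w (Y n \<omega>) * surv h (T n \<omega>) (Y n \<omega>) w) \<partial>lborel)"
      unfolding em_K[OF w atMost_borel] by (intro nn_integral_cong) (auto simp: d_def indicator_def)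
    also have "\<dots> = indicator {\<omega>\<in>space M. T n \<omega> \<le> min u t} \<omega> * ennreal (1 - surv h (T n \<omega>) (Y n \<omega>) (min u t))"
    proof (cases "T n \<omega> \<le> min u t")
      case True
      then show ?thesis using w by (simp add: nn_integral_surv[OF h Y_space[OF w]])
    next
      case False
      then have *: "{T n \<omega>..min u t} = {}" by auto
      show ?thesis unfolding * using False by simp
    qed
    finally show ?thesis .
  qed
  have em_K_UNIV: "emeasure (K \<omega>) UNIV \<le> 1" if w: "\<omega> \<in> space M" for \<omega>
  proof -
    have "emeasure (K \<omega>) UNIV = emeasure (K \<omega>) {..t}"
      unfolding em_K[OF w atMost_borel] em_K[OF w sets.top[of borel, unfolded space_borel]]
      by (intro nn_integral_cong) (auto simp: d_def indicator_def)
    also have "\<dots> \<le> 1"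
      unfolding em_K_atMost[OF w] using surv_pos[of h "T n \<omega>" "Y n \<omega>" "min t t"]
      by (auto simp: indicator_def less_imp_le)
    finally show ?thesis .
  qed
  have K: "K \<in> measurable (H n) (subprob_algebra borel)"
  proof (rule measurable_subprob_algebra)
    fix \<omega> assume "\<omega> \<in> space (H n)"
    then have w: "\<omega> \<in> space M" by simp
    show "subprob_space (K \<omega>)"
      using em_K_UNIV[OF w] by (intro subprob_spaceI) (auto simp: K_def)
    show "sets (K \<omega>) = sets borel" by (simp add: K_def)
  next
    fix B :: "real set" assume B [measurable]: "B \<in> sets borel"
    have "(\<lambda>(\<omega>, u). ennreal (d \<omega> u) * indicator B u) \<in> borel_measurable (H n \<Otimes>\<^sub>M lborel)"
      unfolding case_prod_beta
      by (intro borel_measurable_times_ennreal measurable_compose[OF _ measurable_ennreal]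
          measurable_compose[OF measurable_snd borel_measurable_indicator])
        (use d_meas in \<open>simp_all cong: measurable_cong_sets\<close>)
    then have "(\<lambda>\<omega>. \<integral>\<^sup>+u. ennreal (d \<omega> u) * indicator B u \<partial>lborel) \<in> borel_measurable (H n)"
      by (rule lborel.borel_measurable_nn_integral)
    then show "(\<lambda>\<omega>. emeasure (K \<omega>) B) \<in> borel_measurable (H n)"
      by (subst measurable_cong) (auto simp: em_K B)
  qed
  have "(\<integral>\<^sup>+\<omega>. indicator D \<omega> * f \<omega> (T (Suc n) \<omega>) \<partial>M) = (\<integral>\<^sup>+\<omega>. (\<integral>\<^sup>+u. f \<omega> u \<partial>K \<omega>) \<partial>M)"
  proof (rule disintegration[OF finite_measure_axioms subalgebra_H T_measurable K D _ f])
    fix A and B :: "real set" assume A: "A \<in> sets (H n)" and B: "B \<in> sets borel"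
    have AM [measurable]: "A \<in> sets M" using A subalgebra_H by (auto simp: subalgebra_def)
    \<comment> \<open>For a fixed event \<open>A\<close> of the past, both sides of the rectangle
      identity are measures in \<open>B\<close>. They are named \<open>m1\<close> and
      \<open>m2\<close> and compared on half-lines, which generate the Borel sets.\<close>
    let ?R = "density (restr_to_subalg M (H n)) (indicator A)"
    have R: "space ?R \<noteq> {}" using not_empty by (simp add: space_restr_to_subalg)
    have sets_R: "sets ?R = sets (H n)" by (simp add: sets_restr_to_subalg[OF subalgebra_H])
    have K_R: "K \<in> measurable ?R (subprob_algebra borel)"
      using K by (subst measurable_cong_sets[OF sets_R refl])
    define m1 where "m1 = distr (density M (\<lambda>\<omega>. indicator A \<omega> * indicator D \<omega>)) borel (T (Suc n))"
    define m2 where "m2 = ?R \<bind> K"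
    have m1: "emeasure m1 C = (\<integral>\<^sup>+\<omega>. indicator A \<omega> * indicator D \<omega> * indicator C (T (Suc n) \<omega>) \<partial>M)"
      if [measurable]: "C \<in> sets borel" for C
    proof -
      have "emeasure m1 C = (\<integral>\<^sup>+z. indicator C z \<partial>m1)" by (simp add: m1_def)
      also have "\<dots> = (\<integral>\<^sup>+\<omega>. indicator A \<omega> * indicator D \<omega> * indicator C (T (Suc n) \<omega>) \<partial>M)"
        unfolding m1_def by (subst nn_integral_distr) (auto simp: nn_integral_density)
      finally show ?thesis .
    qed
    have m2: "emeasure m2 C = (\<integral>\<^sup>+\<omega>. indicator A \<omega> * emeasure (K \<omega>) C \<partial>M)"
      if C: "C \<in> sets borel" for C
    proof -
      have KC: "(\<lambda>\<omega>. emeasure (K \<omega>) C) \<in> borel_measurable (H n)"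
        by (rule measurable_emeasure_kernel[OF K C])
      have "emeasure m2 C = (\<integral>\<^sup>+\<omega>. emeasure (K \<omega>) C \<partial>?R)"
        unfolding m2_def by (rule emeasure_bind[OF R K_R C])
      also have "\<dots> = (\<integral>\<^sup>+\<omega>. indicator A \<omega> * emeasure (K \<omega>) C \<partial>restr_to_subalg M (H n))"
        by (rule nn_integral_density)
          (intro measurable_in_subalg[OF subalgebra_H] borel_measurable_indicator A KC)+
      also have "\<dots> = (\<integral>\<^sup>+\<omega>. indicator A \<omega> * emeasure (K \<omega>) C \<partial>M)"
        by (rule nn_integral_subalgebra2[OF subalgebra_H])
          (intro borel_measurable_times_ennreal borel_measurable_indicator A KC)
      finally show ?thesis .
    qed
    have atMost: "emeasure m1 {..u} = emeasure m2 {..u}" for u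
    proof (cases "0 \<le> min u t")
      case False
      have neg: "\<not> (T k \<omega> \<le> u \<and> T k \<omega> \<le> t)" if "\<omega> \<in> space M" for k \<omega>
        using False T_nonneg[OF that, of k] by linarith
      have "emeasure m1 {..u} = 0"
        unfolding m1[OF atMost_borel]
        by (subst nn_integral_cong[of M _ "\<lambda>_. 0"])
          (use neg[of _ "Suc n"] in \<open>auto simp: indicator_def D_def\<close>)
      moreover have "emeasure m2 {..u} = 0"
        unfolding m2[OF atMost_borel]
        by (subst nn_integral_cong[of M _ "\<lambda>_. 0"])
          (use neg[of _ n] in \<open>auto simp: em_K_atMost indicator_def\<close>)
      ultimately show ?thesis by simp
    next
      case True
      \<comment> \<open>The event \<open>T (Suc n) \<le> t\<close> is part of both measures, so a
        half-line up to \<open>u\<close> is seen only up to \<open>u'\<close>.\<close>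
      define u' where "u' = min u t"
      let ?B = "{\<omega>\<in>space M. T n \<omega> \<le> u'}"
      let ?S = "\<lambda>\<omega>. surv h (T n \<omega>) (Y n \<omega>) u'"
      have u': "0 \<le> u'" "u' \<le> t" using True by (auto simp: u'_def)
      have Sm: "?S \<in> borel_measurable (H n)" by (rule surv_measurable[OF h]) auto

      note [measurable] = H_measurable_M[OF Sm]
      \<comment> \<open>Once \<open>T n \<le> u'\<close>, the next jump has either occurred by
        \<open>u'\<close> or is still awaited. \<open>survival\<close> evaluates the waiting part;
        being finite, it can be cancelled, which leaves the equality of \<open>m1\<close> and
        \<open>m2\<close>.\<close>
      have split: "(\<integral>\<^sup>+\<omega>. indicator A \<omega> * indicator ?B \<omega> \<partial>M) = emeasure m1 {..u}
          + (\<integral>\<^sup>+\<omega>. indicator A \<omega> * indicator {\<omega>\<in>space M. T n \<omega> \<le> u' \<and> u' < T (Suc n) \<omega>} \<omega> \<partial>M)"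
        unfolding m1[OF atMost_borel]
        by (subst nn_integral_add[symmetric], measurable, intro nn_integral_cong)
          (use T_less_Suc[of _ n] in \<open>fastforce simp: indicator_def D_def u'_def\<close>)
      have surv: "(\<integral>\<^sup>+\<omega>. indicator A \<omega> * indicator {\<omega>\<in>space M. T n \<omega> \<le> u' \<and> u' < T (Suc n) \<omega>} \<omega> \<partial>M)
          = (\<integral>\<^sup>+\<omega>. indicator A \<omega> * indicator ?B \<omega> * ennreal (?S \<omega>) \<partial>M)"
        by (rule survival[OF borel_measurable_indicator[OF A] u'])
      have "(\<integral>\<^sup>+\<omega>. indicator A \<omega> * indicator ?B \<omega> \<partial>M) = (\<integral>\<^sup>+\<omega>. indicator A \<omega> * emeasure (K \<omega>) {..u}
          + indicator A \<omega> * indicator ?B \<omega> * ennreal (?S \<omega>) \<partial>M)"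
      proof (rule nn_integral_cong)
        fix \<omega> assume w: "\<omega> \<in> space M"
        have "ennreal (1 - ?S \<omega>) + ennreal (?S \<omega>) = 1"
          using surv_pos[of h "T n \<omega>" "Y n \<omega>" u'] surv_le_1[OF h Y_space[OF w], of "T n \<omega>" n u']
          by (subst ennreal_plus[symmetric]) (auto simp: less_imp_le)
        then show "indicator A \<omega> * indicator ?B \<omega> = indicator A \<omega> * emeasure (K \<omega>) {..u}
          + indicator A \<omega> * indicator ?B \<omega> * ennreal (?S \<omega>)"
          unfolding em_K_atMost[OF w] u'_def[symmetric] by (auto split: split_indicator)
      qed
      also have "\<dots> = emeasure m2 {..u} + (\<integral>\<^sup>+\<omega>. indicator A \<omega> * indicator ?B \<omega> * ennreal (?S \<omega>) \<partial>M)"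
        unfolding m2[OF atMost_borel]
        by (rule nn_integral_add)
          (use H_measurable_M[OF measurable_emeasure_kernel[OF K atMost_borel]] in measurable)
      finally have eq: "emeasure m1 {..u} + (\<integral>\<^sup>+\<omega>. indicator A \<omega> * indicator ?B \<omega> * ennreal (?S \<omega>) \<partial>M)
        = emeasure m2 {..u} + (\<integral>\<^sup>+\<omega>. indicator A \<omega> * indicator ?B \<omega> * ennreal (?S \<omega>) \<partial>M)"
        unfolding split surv .
      have "(\<integral>\<^sup>+\<omega>. indicator A \<omega> * indicator ?B \<omega> * ennreal (?S \<omega>) \<partial>M) \<le> (\<integral>\<^sup>+\<omega>. 1 \<partial>M)"
        by (intro nn_integral_mono) (auto simp: indicator_def surv_le_1[OF h Y_space])
      then have "(\<integral>\<^sup>+\<omega>. indicator A \<omega> * indicator ?B \<omega> * ennreal (?S \<omega>) \<partial>M) \<noteq> \<infinity>"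
        by (auto simp: emeasure_space_1 top_unique)
      then show ?thesis using eq by (simp add: ennreal_add_left_cancel add.commute)
    qed
    have sets_m: "sets m1 = sets borel" "sets m2 = sets borel"
      unfolding m1_def m2_def using sets_bind_measurable[OF K_R R] by auto
    have "m1 = m2"
    proof (rule measure_eqI_generator_eq[where \<Omega> = UNIV and E = "range atMost" and A = "\<lambda>n. {..real n}"])
      show "Int_stable (range (atMost :: real \<Rightarrow> real set))"
        unfolding Int_stable_def by auto
      show "sets m1 = sigma_sets UNIV (range atMost)" "sets m2 = sigma_sets UNIV (range atMost)"
        unfolding sets_m by (simp_all add: borel_eq_atMost)
      show "(\<Union>i. {..real i}) = UNIV" by (auto intro: real_arch_simple)
      have "emeasure m1 {..real i} \<le> (\<integral>\<^sup>+\<omega>. 1 \<partial>M)" for i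
        unfolding m1[OF atMost_borel] by (intro nn_integral_mono) (auto simp: indicator_def)
      then have "emeasure m1 {..real i} \<le> 1" for i by (simp add: emeasure_space_1)
      then show "emeasure m1 {..real i} \<noteq> \<infinity>" for i
        by (metis ennreal_one_neq_top infinity_ennreal_def top.extremum_unique)
    qed (auto simp: atMost)
    then show "(\<integral>\<^sup>+\<omega>. indicator A \<omega> * indicator D \<omega> * indicator B (T (Suc n) \<omega>) \<partial>M)
      = (\<integral>\<^sup>+\<omega>. indicator A \<omega> * emeasure (K \<omega>) B \<partial>M)"
      using m1[OF B] m2[OF B] by simp
  qed
  also have "\<dots> = (\<integral>\<^sup>+\<omega>. (\<integral>\<^sup>+u\<in>{T n \<omega>..t}. ennreal (tilted_rate h u (Y n \<omega>) * surv h (T n \<omega>) (Y n \<omega>) u) * f \<omega> u \<partial>lborel) \<partial>M)"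
  proof (rule nn_integral_cong)
    fix \<omega> assume w: "\<omega> \<in> space M"
    have fm: "f \<omega> \<in> borel_measurable lborel"
      using measurable_Pair2[OF f, of \<omega>] w by simp
    have "(\<integral>\<^sup>+u. f \<omega> u \<partial>K \<omega>) = (\<integral>\<^sup>+u. ennreal (d \<omega> u) * f \<omega> u \<partial>lborel)"
      unfolding K_def by (rule nn_integral_density[OF _ fm]) (use d_1[OF w] in simp)
    also have "\<dots> = (\<integral>\<^sup>+u\<in>{T n \<omega>..t}. ennreal (tilted_rate h u (Y n \<omega>) * surv h (T n \<omega>) (Y n \<omega>) u) * f \<omega> u \<partial>lborel)"
      by (intro nn_integral_cong) (auto simp: d_def indicator_def)
    finally show "(\<integral>\<^sup>+u. f \<omega> u \<partial>K \<omega>) = \<dots>" .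
  qed
  finally show ?thesis by (simp add: D_def)
qed

text \<open>The law of the state and that of the time are composed. The normalization by
  \<open>tilted_rate\<close> in the former cancels the factor \<open>tilted_rate\<close> in the
  density of the latter.\<close>

lemma kernel_step:
  assumes f: "(\<lambda>(\<omega>, u, y). f \<omega> u y) \<in> borel_measurable (H n \<Otimes>\<^sub>M borel \<Otimes>\<^sub>M \<X>)"
  shows "(\<integral>\<^sup>+\<omega>. indicator {\<omega>\<in>space M. T (Suc n) \<omega> \<le> t} \<omega> * f \<omega> (T (Suc n) \<omega>) (Y (Suc n) \<omega>) \<partial>M)
    = (\<integral>\<^sup>+\<omega>. (\<integral>\<^sup>+u\<in>{T n \<omega>..t}. ennreal (surv h (T n \<omega>) (Y n \<omega>) u) *
        (\<integral>\<^sup>+y. ennreal (exp (h u (Y n \<omega>) y)) * f \<omega> u y \<partial>r (Y n \<omega>)) \<partial>lborel) \<partial>M)"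
proof -
  have TS: "T (Suc n) \<in> borel_measurable (H_next n)"
    by (rule TY_H_next_measurable)
  have Yn: "Y n \<in> measurable (H n) \<X>"
    by (rule TY_H_measurable) simp
  note Yn [measurable]
  have id: "(\<lambda>\<omega>. \<omega>) \<in> measurable (H_next n) (H n)"
    by (rule H_H_next_measurable) simp
  have "(\<lambda>p. (fst p, T (Suc n) (fst p), snd p)) \<in> measurable (H_next n \<Otimes>\<^sub>M \<X>) (H n \<Otimes>\<^sub>M borel \<Otimes>\<^sub>M \<X>)"
    by (intro measurable_Pair measurable_snd measurable_compose[OF measurable_fst id]
        measurable_compose[OF measurable_fst TS])
  from measurable_compose[OF this f]
  have f1: "(\<lambda>(\<omega>, y). f \<omega> (T (Suc n) \<omega>) y) \<in> borel_measurable (H_next n \<Otimes>\<^sub>M \<X>)"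
    by (simp add: case_prod_beta)
  let ?q = "\<lambda>u x y. ennreal (exp (h u x y) / tilted_rate h u x)"
  let ?f2 = "\<lambda>\<omega> u. \<integral>\<^sup>+y. ?q u (Y n \<omega>) y * f \<omega> u y \<partial>r (Y n \<omega>)"
  have f2: "(\<lambda>(\<omega>, u). ?f2 \<omega> u) \<in> borel_measurable (H n \<Otimes>\<^sub>M borel)"
    unfolding case_prod_beta
  proof (rule nn_integral_r_measurable)
    have 1: "(\<lambda>p. h (snd (fst p)) (Y n (fst (fst p))) (snd p)) \<in> borel_measurable ((H n \<Otimes>\<^sub>M borel) \<Otimes>\<^sub>M \<X>)"
      by (rule bounded_tilt_measurable[OF h]) measurable
    have 2: "(\<lambda>p. tilted_rate h (snd (fst p)) (Y n (fst (fst p)))) \<in> borel_measurable ((H n \<Otimes>\<^sub>M borel) \<Otimes>\<^sub>M \<X>)"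
      by (rule tilted_rate_measurable[OF h]) measurable
    have "(\<lambda>p. (fst (fst p), snd (fst p), snd p)) \<in> measurable ((H n \<Otimes>\<^sub>M borel) \<Otimes>\<^sub>M \<X>) (H n \<Otimes>\<^sub>M borel \<Otimes>\<^sub>M \<X>)"
      by measurable
    from measurable_compose[OF this f]
    have 3: "(\<lambda>p. f (fst (fst p)) (snd (fst p)) (snd p)) \<in> borel_measurable ((H n \<Otimes>\<^sub>M borel) \<Otimes>\<^sub>M \<X>)"
      by simp
    show "(\<lambda>(w, y). ?q (snd w) (Y n (fst w)) y * f (fst w) (snd w) y) \<in> borel_measurable ((H n \<Otimes>\<^sub>M borel) \<Otimes>\<^sub>M \<X>)"
      unfolding case_prod_beta
      by (intro borel_measurable_times_ennreal 3 measurable_compose[OF _ measurable_ennreal]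
          borel_measurable_divide measurable_compose[OF 1 borel_measurable_exp] 2)
    show "(\<lambda>w. Y n (fst w)) \<in> measurable (H n \<Otimes>\<^sub>M borel) \<X>" by measurable
  qed
  have "(\<integral>\<^sup>+\<omega>. indicator {\<omega>\<in>space M. T (Suc n) \<omega> \<le> t} \<omega> * f \<omega> (T (Suc n) \<omega>) (Y (Suc n) \<omega>) \<partial>M)
    = (\<integral>\<^sup>+\<omega>. indicator {\<omega>\<in>space M. T (Suc n) \<omega> \<le> t} \<omega> * ?f2 \<omega> (T (Suc n) \<omega>) \<partial>M)"
    by (rule mark_step[OF f1])
  also have "\<dots> = (\<integral>\<^sup>+\<omega>. (\<integral>\<^sup>+u\<in>{T n \<omega>..t}. ennreal (tilted_rate h u (Y n \<omega>) * surv h (T n \<omega>) (Y n \<omega>) u) * ?f2 \<omega> u \<partial>lborel) \<partial>M)"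
    by (rule time_step[OF f2])
  also have "\<dots> = (\<integral>\<^sup>+\<omega>. (\<integral>\<^sup>+u\<in>{T n \<omega>..t}. ennreal (surv h (T n \<omega>) (Y n \<omega>) u) *
        (\<integral>\<^sup>+y. ennreal (exp (h u (Y n \<omega>) y)) * f \<omega> u y \<partial>r (Y n \<omega>)) \<partial>lborel) \<partial>M)"
  proof (rule nn_integral_cong, rule nn_integral_cong, rule arg_cong2[where f = "(*)", OF _ refl])
    fix \<omega> u assume w: "\<omega> \<in> space M"
    let ?x = "Y n \<omega>" let ?R = "tilted_rate h u ?x"
    have x: "?x \<in> space \<X>" by (rule Y_space[OF w])
    have R: "0 < ?R" by (rule tilted_rate_pos[OF h x])

    have "(\<lambda>p. f \<omega> (fst p) (snd p)) \<in> borel_measurable (borel \<Otimes>\<^sub>M \<X>)"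
      using measurable_Pair2[OF f, of \<omega>] w by (simp add: case_prod_beta)
    from measurable_Pair2[OF this, of u] have "f \<omega> u \<in> borel_measurable \<X>" by simp
    then have "f \<omega> u \<in> borel_measurable (r ?x)"
      by (subst measurable_cong_sets[OF sets_r[OF x] refl])
    then have m: "(\<lambda>y. ennreal (exp (h u ?x y)) * f \<omega> u y) \<in> borel_measurable (r ?x)"
      using bounded_tilt_measurable_r(1)[OF h x, of u]
      by (intro borel_measurable_times_ennreal measurable_compose[OF _ measurable_ennreal]
          measurable_compose[OF _ borel_measurable_exp])
    have "?f2 \<omega> u = (\<integral>\<^sup>+y. ennreal (1 / ?R) * (ennreal (exp (h u ?x y)) * f \<omega> u y) \<partial>r ?x)"
      using R by (intro nn_integral_cong) (simp add: mult.assoc[symmetric] ennreal_mult[symmetric])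
    also have "\<dots> = ennreal (1 / ?R) * (\<integral>\<^sup>+y. ennreal (exp (h u ?x y)) * f \<omega> u y \<partial>r ?x)"
      by (rule nn_integral_cmult[OF m])
    finally show "ennreal (?R * surv h (T n \<omega>) ?x u) * ?f2 \<omega> u = ennreal (surv h (T n \<omega>) ?x u) *
        (\<integral>\<^sup>+y. ennreal (exp (h u ?x y)) * f \<omega> u y \<partial>r ?x)"
      using R surv_pos[of h "T n \<omega>" ?x u]
      by (simp add: mult.assoc[symmetric] ennreal_mult[symmetric] less_imp_le)
  qed
  finally show ?thesis .
qed

end

section \<open>Likelihood ratios along the jump chain\<close>

context rate_kernel begin

text \<open>This is the integral of \<open>exp h - 1\<close> against \<open>r x\<close>, the drift
  in the exponent of the likelihood ratio.\<close>

definition excess_rate :: "(real \<Rightarrow> 'a \<Rightarrow> 'a \<Rightarrow> real) \<Rightarrow> real \<Rightarrow> 'a \<Rightarrow> real" where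
  "excess_rate h s x = tilted_rate h s x - rate x"

lemma excess_rate_measurable:
  assumes h: "bounded_tilt h"
    and [measurable]: "a \<in> borel_measurable N" "b \<in> measurable N \<X>"
  shows "(\<lambda>w. excess_rate h (a w) (b w)) \<in> borel_measurable N"
proof -
  note [measurable] = tilted_rate_measurable[OF assms]
  show ?thesis unfolding excess_rate_def by measurable
qed

lemma set_integral_excess_rate_measurable:
  assumes h: "bounded_tilt h"
    and [measurable]: "a \<in> borel_measurable N" "c \<in> borel_measurable N" "b \<in> measurable N \<X>"
  shows "(\<lambda>w. LINT u:{a w..c w}|lborel. excess_rate h u (b w)) \<in> borel_measurable N"
  by (rule set_integral_measurable) (auto intro!: excess_rate_measurable[OF h])

lemma set_integrable_excess_rate:
  assumes h: "bounded_tilt h" and x: "x \<in> space \<X>"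
  shows "set_integrable lborel {s..u} (\<lambda>w. excess_rate h w x)"
  unfolding excess_rate_def
  by (intro set_integral_diff set_integrable_tilted_rate[OF h x] borel_integrable_atLeastAtMost') auto

text \<open>The exponential factor is the likelihood ratio of waiting from \<open>s\<close> to
  \<open>u\<close> without a jump.\<close>

lemma surv_excess:
  assumes h: "bounded_tilt h" and x: "x \<in> space \<X>"
  shows "surv (\<lambda>_ _ _. 0) s x u * exp (- (LINT w:{s..u}|lborel. excess_rate h w x)) = surv h s x u"
proof -
  have "(LINT w:{s..u}|lborel. excess_rate h w x)
      = (LINT w:{s..u}|lborel. tilted_rate h w x) - (LINT w:{s..u}|lborel. tilted_rate (\<lambda>_ _ _. 0) w x)"
    using set_integral_diff(2)[OF set_integrable_tilted_rate[OF h x, of s u]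
        set_integrable_tilted_rate[OF bounded_tilt_zero x, of s u]]
    by (simp add: excess_rate_def tilted_rate_zero[OF x])
  then show ?thesis by (simp add: surv_def exp_add[symmetric])
qed

text \<open>The transition operator of the chain of jump times and states under the tilt, killed
  when the next jump falls after \<open>t\<close>: the mean of \<open>F\<close> at the next jump,
  started from an arrival in \<open>x\<close> at time \<open>s\<close>.\<close>

definition step_op :: "(real \<Rightarrow> 'a \<Rightarrow> 'a \<Rightarrow> real) \<Rightarrow> real \<Rightarrow> (real \<Rightarrow> 'a \<Rightarrow> ennreal) \<Rightarrow> real \<Rightarrow> 'a \<Rightarrow> ennreal" where
  "step_op h t F s x = (\<integral>\<^sup>+u\<in>{s..t}. ennreal (surv h s x u) *
     (\<integral>\<^sup>+y. ennreal (exp (h u x y)) * F u y \<partial>r x) \<partial>lborel)"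

lemma exp_tilt_integral_measurable:
  assumes h: "bounded_tilt h" and F: "(\<lambda>(u, x). F u x) \<in> borel_measurable (borel \<Otimes>\<^sub>M \<X>)"
    and a: "a \<in> borel_measurable N" and b: "b \<in> measurable N \<X>"
  shows "(\<lambda>w. \<integral>\<^sup>+y. ennreal (exp (h (a w) (b w) y)) * F (a w) y \<partial>r (b w)) \<in> borel_measurable N"
proof (rule nn_integral_r_measurable[OF _ b])
  note a [measurable] b [measurable]
  have 1: "(\<lambda>p. h (a (fst p)) (b (fst p)) (snd p)) \<in> borel_measurable (N \<Otimes>\<^sub>M \<X>)"
    by (rule bounded_tilt_measurable[OF h]) measurable
  have "(\<lambda>p. (a (fst p), snd p)) \<in> measurable (N \<Otimes>\<^sub>M \<X>) (borel \<Otimes>\<^sub>M \<X>)" by measurable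
  from measurable_compose[OF this F]
  have 2: "(\<lambda>p. F (a (fst p)) (snd p)) \<in> borel_measurable (N \<Otimes>\<^sub>M \<X>)" by simp
  show "(\<lambda>(w, y). ennreal (exp (h (a w) (b w) y)) * F (a w) y) \<in> borel_measurable (N \<Otimes>\<^sub>M \<X>)"
    unfolding case_prod_beta
    by (intro borel_measurable_times_ennreal measurable_compose[OF _ measurable_ennreal]
        measurable_compose[OF 1 borel_measurable_exp] 2)
qed

text \<open>This keeps the iterates of the operator in the class of functions over which the
  induction in \<open>girsanov_chain\<close> ranges.\<close>

lemma step_op_measurable:
  assumes h: "bounded_tilt h" and F: "(\<lambda>(u, x). F u x) \<in> borel_measurable (borel \<Otimes>\<^sub>M \<X>)"
  shows "(\<lambda>(s, x). step_op h t F s x) \<in> borel_measurable (borel \<Otimes>\<^sub>M \<X>)"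
proof -
  let ?N = "(borel \<Otimes>\<^sub>M \<X>) \<Otimes>\<^sub>M borel :: ((real \<times> 'a) \<times> real) measure"
  have 1: "(\<lambda>p. \<integral>\<^sup>+y. ennreal (exp (h (snd p) (snd (fst p)) y)) * F (snd p) y \<partial>r (snd (fst p)))
      \<in> borel_measurable ?N"
    by (rule exp_tilt_integral_measurable[OF h F]) measurable
  have 2: "(\<lambda>p. surv h (fst (fst p)) (snd (fst p)) (snd p)) \<in> borel_measurable ?N"
    by (rule surv_measurable[OF h]) measurable
  have 3: "(\<lambda>p. indicator {fst (fst p)..t} (snd p) :: ennreal) \<in> borel_measurable ?N"
    unfolding indicator_def atLeastAtMost_iff by measurable
  have m: "(\<lambda>(p, u). ennreal (surv h (fst p) (snd p) u) *
     (\<integral>\<^sup>+y. ennreal (exp (h u (snd p) y)) * F u y \<partial>r (snd p)) * indicator {fst p..t} u)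
      \<in> borel_measurable ((borel \<Otimes>\<^sub>M \<X>) \<Otimes>\<^sub>M lborel)"
    unfolding case_prod_beta measurable_cong_sets[OF sets_pair_measure_cong[OF refl sets_lborel] refl]
    by (intro borel_measurable_times_ennreal 1 3 measurable_compose[OF 2 measurable_ennreal])
  from lborel.borel_measurable_nn_integral[OF m] show ?thesis
    unfolding step_op_def case_prod_beta .
qed

lemma step_op_empty: "t < s \<Longrightarrow> step_op h t F s x = 0"
  by (simp add: step_op_def)

text \<open>The defect from mass one is the probability of no further jump up to \<open>t\<close>.
  It drives the telescoping in \<open>sum_weights_le_1\<close>.\<close>

lemma step_op_1:
  assumes h: "bounded_tilt h" and x: "x \<in> space \<X>" and s: "s \<le> t"
  shows "step_op h t (\<lambda>_ _. 1) s x = ennreal (1 - surv h s x t)"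
proof -
  have "step_op h t (\<lambda>_ _. 1) s x = (\<integral>\<^sup>+u\<in>{s..t}. ennreal (tilted_rate h u x * surv h s x u) \<partial>lborel)"
    unfolding step_op_def using tilted_rate_pos[OF h x] surv_pos
    by (intro nn_integral_cong) (auto simp: nn_integral_exp_tilt[OF h x] ennreal_mult[symmetric] less_imp_le mult.commute)
  then show ?thesis using nn_integral_surv[OF assms] by simp
qed

end

context tilted_process begin

lemma process_step:
  assumes F: "(\<lambda>(u, x). F u x) \<in> borel_measurable (borel \<Otimes>\<^sub>M \<X>)"
  shows "(\<integral>\<^sup>+\<omega>. indicator {\<omega>\<in>space M. T (Suc n) \<omega> \<le> t} \<omega> * F (T (Suc n) \<omega>) (Y (Suc n) \<omega>) \<partial>M)
    = (\<integral>\<^sup>+\<omega>. indicator {\<omega>\<in>space M. T n \<omega> \<le> t} \<omega> * step_op h t F (T n \<omega>) (Y n \<omega>) \<partial>M)"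
proof -
  have "(\<lambda>p. (fst (snd p), snd (snd p))) \<in> measurable (H n \<Otimes>\<^sub>M borel \<Otimes>\<^sub>M \<X>) (borel \<Otimes>\<^sub>M \<X>)" by measurable
  from measurable_compose[OF this F]
  have "(\<lambda>(\<omega>, u, y). F u y) \<in> borel_measurable (H n \<Otimes>\<^sub>M borel \<Otimes>\<^sub>M \<X>)" by (simp add: case_prod_beta)
  note kernel_step[OF this]
  also have "(\<integral>\<^sup>+\<omega>. (\<integral>\<^sup>+u\<in>{T n \<omega>..t}. ennreal (surv h (T n \<omega>) (Y n \<omega>) u) *
        (\<integral>\<^sup>+y. ennreal (exp (h u (Y n \<omega>) y)) * F u y \<partial>r (Y n \<omega>)) \<partial>lborel) \<partial>M)
    = (\<integral>\<^sup>+\<omega>. indicator {\<omega>\<in>space M. T n \<omega> \<le> t} \<omega> * step_op h t F (T n \<omega>) (Y n \<omega>) \<partial>M)"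
    unfolding step_op_def[symmetric]
    by (intro nn_integral_cong) (auto simp: step_op_empty split: split_indicator)
  finally show ?thesis .
qed

end

section \<open>Likelihood weights of the unperturbed chain\<close>

locale base_process = tilted_process \<X> r \<nu> "\<lambda>_ _ _. 0" t M T Y
  for \<X> :: "'a measure" and r \<nu> t and M :: "'w measure" and T Y +
  assumes t_nonneg: "0 \<le> t" and finite_jumps: "AE \<omega> in M. \<exists>n. t < T n \<omega>"
begin

text \<open>This is the logarithm of the likelihood ratio of the first \<open>n\<close> jumps. It
  stops at the random time \<open>T n\<close> instead of a fixed time, which makes it a function of
  the history \<open>H n\<close>.\<close>

definition log_weight :: "(real \<Rightarrow> 'a \<Rightarrow> 'a \<Rightarrow> real) \<Rightarrow> nat \<Rightarrow> 'w \<Rightarrow> real" where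
  "log_weight h n \<omega> = (\<Sum>i<n. h (T (Suc i) \<omega>) (Y i \<omega>) (Y (Suc i) \<omega>)
     - (LINT w:{T i \<omega>..T (Suc i) \<omega>}|lborel. excess_rate h w (Y i \<omega>)))"

lemma log_weight_Suc: "log_weight h (Suc n) \<omega> = log_weight h n \<omega> + (h (T (Suc n) \<omega>) (Y n \<omega>) (Y (Suc n) \<omega>)
     - (LINT w:{T n \<omega>..T (Suc n) \<omega>}|lborel. excess_rate h w (Y n \<omega>)))"
  by (simp add: log_weight_def)

lemma log_weight_measurable:
  assumes h: "bounded_tilt h"
  shows "log_weight h n \<in> borel_measurable (H n)"
  unfolding log_weight_def
  by (intro borel_measurable_sum borel_measurable_diff bounded_tilt_measurable[OF h]
      set_integral_excess_rate_measurable[OF h] TY_H_measurable) auto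

text \<open>Integrating out the last jump under the unperturbed law turns its factor of the weight
  into the operator of the tilt: by \<open>surv_excess\<close> the waiting part becomes
  \<open>surv h\<close>, and the jump itself contributes \<open>exp h\<close>. The result is the
  recursion that \<open>process_step\<close> gives for the tilted process.\<close>

lemma weight_step:
  assumes h: "bounded_tilt h" and F: "(\<lambda>(u, x). F u x) \<in> borel_measurable (borel \<Otimes>\<^sub>M \<X>)"
  shows "(\<integral>\<^sup>+\<omega>. ennreal (exp (log_weight h (Suc n) \<omega>)) *
      (indicator {\<omega>\<in>space M. T (Suc n) \<omega> \<le> t} \<omega> * F (T (Suc n) \<omega>) (Y (Suc n) \<omega>)) \<partial>M)
    = (\<integral>\<^sup>+\<omega>. ennreal (exp (log_weight h n \<omega>)) *
      (indicator {\<omega>\<in>space M. T n \<omega> \<le> t} \<omega> * step_op h t F (T n \<omega>) (Y n \<omega>)) \<partial>M)"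
proof -
  define R where "R s x u = (LINT w:{s..u}|lborel. excess_rate h w x)" for s x u
  define f where "f \<omega> u y = ennreal (exp (log_weight h n \<omega>) * exp (h u (Y n \<omega>) y - R (T n \<omega>) (Y n \<omega>) u)) * F u y"
    for \<omega> u y
  have Tn: "T n \<in> borel_measurable (H n)" and Yn: "Y n \<in> measurable (H n) \<X>"
    by (rule TY_H_measurable, simp)+
  note Tn [measurable] Yn [measurable]
  have f: "(\<lambda>(\<omega>, u, y). f \<omega> u y) \<in> borel_measurable (H n \<Otimes>\<^sub>M borel \<Otimes>\<^sub>M \<X>)"
  proof -
    let ?N = "H n \<Otimes>\<^sub>M borel \<Otimes>\<^sub>M \<X>"
    have 1: "(\<lambda>p. log_weight h n (fst p)) \<in> borel_measurable ?N"
      by (rule measurable_compose[OF measurable_fst log_weight_measurable[OF h]])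
    have 2: "(\<lambda>p. h (fst (snd p)) (Y n (fst p)) (snd (snd p))) \<in> borel_measurable ?N"
      by (rule bounded_tilt_measurable[OF h]) measurable
    have 3: "(\<lambda>p. R (T n (fst p)) (Y n (fst p)) (fst (snd p))) \<in> borel_measurable ?N"
      unfolding R_def by (rule set_integral_excess_rate_measurable[OF h]) measurable
    have "(\<lambda>p. (fst (snd p), snd (snd p))) \<in> measurable ?N (borel \<Otimes>\<^sub>M \<X>)" by measurable
    from measurable_compose[OF this F]
    have 4: "(\<lambda>p. F (fst (snd p)) (snd (snd p))) \<in> borel_measurable ?N" unfolding case_prod_beta by simp
    show ?thesis
      unfolding f_def case_prod_beta
      by (intro borel_measurable_times_ennreal measurable_compose[OF _ measurable_ennreal] borel_measurable_times
          measurable_compose[OF 1 borel_measurable_exp] measurable_compose[OF _ borel_measurable_exp]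
          borel_measurable_diff 2 3 4)
  qed
  have "(\<integral>\<^sup>+\<omega>. ennreal (exp (log_weight h (Suc n) \<omega>)) *
      (indicator {\<omega>\<in>space M. T (Suc n) \<omega> \<le> t} \<omega> * F (T (Suc n) \<omega>) (Y (Suc n) \<omega>)) \<partial>M)
    = (\<integral>\<^sup>+\<omega>. indicator {\<omega>\<in>space M. T (Suc n) \<omega> \<le> t} \<omega> * f \<omega> (T (Suc n) \<omega>) (Y (Suc n) \<omega>) \<partial>M)"
    by (intro nn_integral_cong) (simp add: f_def log_weight_Suc R_def exp_add mult_ac)
  also have "\<dots> = (\<integral>\<^sup>+\<omega>. (\<integral>\<^sup>+u\<in>{T n \<omega>..t}. ennreal (surv (\<lambda>_ _ _. 0) (T n \<omega>) (Y n \<omega>) u) *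
        (\<integral>\<^sup>+y. ennreal (exp 0) * f \<omega> u y \<partial>r (Y n \<omega>)) \<partial>lborel) \<partial>M)"
    by (rule kernel_step[OF f])
  also have "\<dots> = (\<integral>\<^sup>+\<omega>. ennreal (exp (log_weight h n \<omega>)) *
      (indicator {\<omega>\<in>space M. T n \<omega> \<le> t} \<omega> * step_op h t F (T n \<omega>) (Y n \<omega>)) \<partial>M)"
  proof (rule nn_integral_cong)
    fix \<omega> assume w: "\<omega> \<in> space M"
    let ?x = "Y n \<omega>" let ?s = "T n \<omega>" let ?L = "exp (log_weight h n \<omega>)"
    have x: "?x \<in> space \<X>" by (rule Y_space[OF w])
    have G: "(\<lambda>u. \<integral>\<^sup>+y. ennreal (exp (h u ?x y)) * F u y \<partial>r ?x) \<in> borel_measurable borel"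
      by (rule exp_tilt_integral_measurable[OF h F]) (use x in auto)
    have S: "(\<lambda>u. surv h ?s ?x u) \<in> borel_measurable borel"
      by (rule surv_measurable[OF h]) (use x in auto)
    have "ennreal (surv (\<lambda>_ _ _. 0) ?s ?x u) * (\<integral>\<^sup>+y. ennreal (exp 0) * f \<omega> u y \<partial>r ?x)
        = ennreal ?L * (ennreal (surv h ?s ?x u) * (\<integral>\<^sup>+y. ennreal (exp (h u ?x y)) * F u y \<partial>r ?x))" for u
    proof -
      have "(\<lambda>y. F u y) \<in> borel_measurable \<X>" using measurable_Pair2[OF F, of u] by simp
      then have "(\<lambda>y. F u y) \<in> borel_measurable (r ?x)"
        by (subst measurable_cong_sets[OF sets_r[OF x] refl])
      then have m: "(\<lambda>y. ennreal (exp (h u ?x y)) * F u y) \<in> borel_measurable (r ?x)"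
        using bounded_tilt_measurable_r(1)[OF h x, of u]
        by (intro borel_measurable_times_ennreal measurable_compose[OF _ measurable_ennreal]
            measurable_compose[OF _ borel_measurable_exp])
      have "(\<integral>\<^sup>+y. ennreal (exp 0) * f \<omega> u y \<partial>r ?x)
          = (\<integral>\<^sup>+y. ennreal (?L * exp (- R ?s ?x u)) * (ennreal (exp (h u ?x y)) * F u y) \<partial>r ?x)"
        by (intro nn_integral_cong)
          (simp add: f_def exp_diff exp_minus divide_inverse ennreal_mult'' mult_ac)
      also have "\<dots> = ennreal (?L * exp (- R ?s ?x u)) * (\<integral>\<^sup>+y. ennreal (exp (h u ?x y)) * F u y \<partial>r ?x)"
        by (rule nn_integral_cmult[OF m])
      finally show ?thesis
        unfolding surv_excess[OF h x, of ?s u, symmetric] R_def[symmetric]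
        by (simp add: ennreal_mult'' surv_pos[THEN less_imp_le] mult_ac)
    qed
    then have "(\<integral>\<^sup>+u\<in>{?s..t}. ennreal (surv (\<lambda>_ _ _. 0) ?s ?x u) *
        (\<integral>\<^sup>+y. ennreal (exp 0) * f \<omega> u y \<partial>r ?x) \<partial>lborel)
      = (\<integral>\<^sup>+u. ennreal ?L * ((ennreal (surv h ?s ?x u) * (\<integral>\<^sup>+y. ennreal (exp (h u ?x y)) * F u y \<partial>r ?x))
          * indicator {?s..t} u) \<partial>lborel)"
      by (simp add: mult.assoc)
    also have "\<dots> = ennreal ?L * step_op h t F ?s ?x"
      unfolding step_op_def
    proof (rule nn_integral_cmult)
      show "(\<lambda>u. ennreal (surv h ?s ?x u) * (\<integral>\<^sup>+y. ennreal (exp (h u ?x y)) * F u y \<partial>r ?x) * indicator {?s..t} u)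
          \<in> borel_measurable lborel"
        unfolding measurable_lborel1 using S G
        by (intro borel_measurable_times_ennreal measurable_compose[OF S measurable_ennreal] borel_measurable_indicator) auto
    qed
    finally show "(\<integral>\<^sup>+u\<in>{?s..t}. ennreal (surv (\<lambda>_ _ _. 0) ?s ?x u) *
        (\<integral>\<^sup>+y. ennreal (exp 0) * f \<omega> u y \<partial>r ?x) \<partial>lborel)
      = ennreal ?L * (indicator {\<omega>\<in>space M. T n \<omega> \<le> t} \<omega> * step_op h t F ?s ?x)"
      using w by (cases "T n \<omega> \<le> t") (auto simp: step_op_empty)
  qed
  finally show ?thesis .
qed

text \<open>Both sides satisfy the same recursion, in which \<open>n\<close> decreases and
  \<open>F\<close> is replaced by \<open>step_op h t F\<close>; at \<open>n = 0\<close> both start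
  from the law \<open>\<nu>\<close>. The function \<open>F\<close> must stay arbitrary in the
  induction. The identity holds whether or not the tilted process explodes.\<close>

lemma girsanov_chain:
  assumes P': "tilted_process \<X> r \<nu> h t M' T' Y'" and F: "(\<lambda>(u, x). F u x) \<in> borel_measurable (borel \<Otimes>\<^sub>M \<X>)"
  shows "(\<integral>\<^sup>+\<omega>. indicator {\<omega>\<in>space M'. T' n \<omega> \<le> t} \<omega> * F (T' n \<omega>) (Y' n \<omega>) \<partial>M')
    = (\<integral>\<^sup>+\<omega>. ennreal (exp (log_weight h n \<omega>)) *
      (indicator {\<omega>\<in>space M. T n \<omega> \<le> t} \<omega> * F (T n \<omega>) (Y n \<omega>)) \<partial>M)"
  using F
proof (induction n arbitrary: F)
  case (0 F)
  interpret P': tilted_process \<X> r \<nu> h t M' T' Y' by (rule P')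
  have F0: "F 0 \<in> borel_measurable \<X>" using measurable_Pair2[OF 0, of 0] by simp
  have "(\<integral>\<^sup>+\<omega>. indicator {\<omega>\<in>space M'. T' 0 \<omega> \<le> t} \<omega> * F (T' 0 \<omega>) (Y' 0 \<omega>) \<partial>M') = (\<integral>\<^sup>+\<omega>. F 0 (Y' 0 \<omega>) \<partial>M')"
    by (intro nn_integral_cong) (auto simp: P'.T_0 t_nonneg)
  also have "\<dots> = (\<integral>\<^sup>+x. F 0 x \<partial>distr M' \<X> (Y' 0))"
    by (rule nn_integral_distr[symmetric, OF P'.Y_measurable]) (use F0 in simp)
  also have "\<dots> = (\<integral>\<^sup>+x. F 0 x \<partial>distr M \<X> (Y 0))"
    by (simp add: distr_Y_0 P'.distr_Y_0)
  also have "\<dots> = (\<integral>\<^sup>+\<omega>. F 0 (Y 0 \<omega>) \<partial>M)"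
    by (rule nn_integral_distr[OF Y_measurable]) (use F0 in simp)
  also have "\<dots> = (\<integral>\<^sup>+\<omega>. ennreal (exp (log_weight h 0 \<omega>)) *
      (indicator {\<omega>\<in>space M. T 0 \<omega> \<le> t} \<omega> * F (T 0 \<omega>) (Y 0 \<omega>)) \<partial>M)"
    by (intro nn_integral_cong) (auto simp: T_0 t_nonneg log_weight_def)
  finally show ?case .
next
  case (Suc n F)
  interpret P': tilted_process \<X> r \<nu> h t M' T' Y' by (rule P')
  show ?case
    unfolding P'.process_step[OF Suc.prems] weight_step[OF P'.h Suc.prems]
    by (rule Suc.IH[OF step_op_measurable[OF P'.h Suc.prems]])
qed

text \<open>The survival factor of the tilt is the unperturbed one times the likelihood ratio of the
  unfinished waiting interval \<open>[T n, s]\<close>. \<open>survival\<close> then converts the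
  unperturbed factor back into the event that no jump has followed by time \<open>s\<close>.\<close>

lemma weight_slice:
  assumes h: "bounded_tilt h" and f: "f \<in> borel_measurable \<X>" and s: "0 \<le> s" "s \<le> t"
  shows "(\<integral>\<^sup>+\<omega>. ennreal (exp (log_weight h n \<omega>)) *
      (indicator {\<omega>\<in>space M. T n \<omega> \<le> s} \<omega> * (ennreal (surv h (T n \<omega>) (Y n \<omega>) s) * f (Y n \<omega>))) \<partial>M)
    = (\<integral>\<^sup>+\<omega>. ennreal (exp (log_weight h n \<omega> - (LINT w:{T n \<omega>..s}|lborel. excess_rate h w (Y n \<omega>)))) * f (Y n \<omega>)
        * indicator {\<omega>\<in>space M. T n \<omega> \<le> s \<and> s < T (Suc n) \<omega>} \<omega> \<partial>M)"
proof -
  have Tn: "T n \<in> borel_measurable (H n)" and Yn: "Y n \<in> measurable (H n) \<X>"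
    by (rule TY_H_measurable, simp)+
  define R where "R \<omega> = (LINT w:{T n \<omega>..s}|lborel. excess_rate h w (Y n \<omega>))" for \<omega>
  have R: "R \<in> borel_measurable (H n)"
    unfolding R_def[abs_def] by (rule set_integral_excess_rate_measurable[OF h Tn _ Yn]) simp
  have a: "(\<lambda>\<omega>. ennreal (exp (log_weight h n \<omega> - R \<omega>)) * f (Y n \<omega>)) \<in> borel_measurable (H n)"
    by (intro borel_measurable_times_ennreal measurable_compose[OF _ measurable_ennreal]
        measurable_compose[OF _ borel_measurable_exp] borel_measurable_diff log_weight_measurable[OF h] R
        measurable_compose[OF Yn f])
  show ?thesis
    unfolding R_def[symmetric] survival[OF a s]
  proof (rule nn_integral_cong)
    fix \<omega> assume w: "\<omega> \<in> space M"
    have "exp (log_weight h n \<omega>) * surv h (T n \<omega>) (Y n \<omega>) s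
        = exp (log_weight h n \<omega> - R \<omega>) * surv (\<lambda>_ _ _. 0) (T n \<omega>) (Y n \<omega>) s"
      by (simp add: surv_excess[OF h Y_space[OF w], symmetric] R_def exp_diff exp_minus divide_inverse)
    then have "ennreal (exp (log_weight h n \<omega>)) * ennreal (surv h (T n \<omega>) (Y n \<omega>) s)
        = ennreal (exp (log_weight h n \<omega> - R \<omega>)) * ennreal (surv (\<lambda>_ _ _. 0) (T n \<omega>) (Y n \<omega>) s)"
      using surv_pos by (simp add: ennreal_mult[symmetric] less_imp_le)
    note eq = this
    show "ennreal (exp (log_weight h n \<omega>)) *
        (indicator {\<omega>\<in>space M. T n \<omega> \<le> s} \<omega> * (ennreal (surv h (T n \<omega>) (Y n \<omega>) s) * f (Y n \<omega>)))
      = ennreal (exp (log_weight h n \<omega> - R \<omega>)) * f (Y n \<omega>) * indicator {\<omega>\<in>space M. T n \<omega> \<le> s} \<omega>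
          * ennreal (surv (\<lambda>_ _ _. 0) (T n \<omega>) (Y n \<omega>) s)"
      unfolding mult.left_commute[of _ "indicator _ _"] mult.assoc[symmetric] mult.commute[of "indicator _ _"] eq
      by (simp add: mult_ac)
  qed
qed

text \<open>A fixed time is reduced to the chain. \<open>survival\<close> removes the jump
  \<open>Suc n\<close> from the event, and what remains is a function of \<open>T' n\<close> and
  \<open>Y' n\<close>, to which \<open>girsanov_chain\<close> applies.\<close>

lemma girsanov_slice:
  assumes P': "tilted_process \<X> r \<nu> h t M' T' Y'" and f: "f \<in> borel_measurable \<X>" and s: "0 \<le> s" "s \<le> t"
  shows "(\<integral>\<^sup>+\<omega>. f (Y' n \<omega>) * indicator {\<omega>\<in>space M'. T' n \<omega> \<le> s \<and> s < T' (Suc n) \<omega>} \<omega> \<partial>M')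
    = (\<integral>\<^sup>+\<omega>. ennreal (exp (log_weight h n \<omega> - (LINT w:{T n \<omega>..s}|lborel. excess_rate h w (Y n \<omega>)))) * f (Y n \<omega>)
        * indicator {\<omega>\<in>space M. T n \<omega> \<le> s \<and> s < T (Suc n) \<omega>} \<omega> \<partial>M)"
proof -
  interpret P': tilted_process \<X> r \<nu> h t M' T' Y' by (rule P')
  have a: "(\<lambda>\<omega>. f (Y' n \<omega>)) \<in> borel_measurable (P'.H n)"
    by (rule measurable_compose[OF P'.TY_H_measurable(2) f]) simp
  define F where "F u x = indicator {..s} u * (ennreal (surv h u x s) * f x)" for u x
  have "(\<lambda>p. surv h (fst p) (snd p) s) \<in> borel_measurable (borel \<Otimes>\<^sub>M \<X>)"
    by (rule surv_measurable[OF P'.h]) measurable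
  then have F: "(\<lambda>(u, x). F u x) \<in> borel_measurable (borel \<Otimes>\<^sub>M \<X>)"
    unfolding F_def case_prod_beta
    by (intro borel_measurable_times_ennreal measurable_compose[OF _ measurable_ennreal]
        measurable_compose[OF measurable_snd f] measurable_compose[OF measurable_fst borel_measurable_indicator]) auto
  have "(\<integral>\<^sup>+\<omega>. f (Y' n \<omega>) * indicator {\<omega>\<in>space M'. T' n \<omega> \<le> s \<and> s < T' (Suc n) \<omega>} \<omega> \<partial>M')
    = (\<integral>\<^sup>+\<omega>. indicator {\<omega>\<in>space M'. T' n \<omega> \<le> t} \<omega> * F (T' n \<omega>) (Y' n \<omega>) \<partial>M')"
    unfolding P'.survival[OF a s] using s
    by (intro nn_integral_cong) (auto simp: F_def mult_ac split: split_indicator)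
  also have "\<dots> = (\<integral>\<^sup>+\<omega>. ennreal (exp (log_weight h n \<omega>)) *
      (indicator {\<omega>\<in>space M. T n \<omega> \<le> s} \<omega> * (ennreal (surv h (T n \<omega>) (Y n \<omega>) s) * f (Y n \<omega>))) \<partial>M)"
    unfolding girsanov_chain[OF P' F] using s
    by (intro nn_integral_cong) (auto simp: F_def split: split_indicator)
  also note weight_slice[OF P'.h f s]
  finally show ?thesis .
qed

text \<open>Let \<open>a n\<close> be the weight of at least \<open>n\<close> jumps up to
  \<open>t\<close> and \<open>b n\<close> that of exactly \<open>n\<close>. Then
  \<open>a n = b n + a (Suc n)\<close> and \<open>a 0 = 1\<close>, which bounds the partial sums of
  \<open>b\<close>. The mass that may be missing is the limit of \<open>a n\<close>; it corresponds
  to an explosion under the tilt, which is not excluded at this stage.\<close>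

lemma sum_weights_le_1:
  assumes h: "bounded_tilt h"
  shows "(\<Sum>n. \<integral>\<^sup>+\<omega>. ennreal (exp (log_weight h n \<omega> - (LINT w:{T n \<omega>..t}|lborel. excess_rate h w (Y n \<omega>))))
        * indicator {\<omega>\<in>space M. T n \<omega> \<le> t \<and> t < T (Suc n) \<omega>} \<omega> \<partial>M) \<le> 1"
proof -
  define a where "a n = (\<integral>\<^sup>+\<omega>. ennreal (exp (log_weight h n \<omega>)) * indicator {\<omega>\<in>space M. T n \<omega> \<le> t} \<omega> \<partial>M)" for n
  define b where "b n = (\<integral>\<^sup>+\<omega>. ennreal (exp (log_weight h n \<omega> - (LINT w:{T n \<omega>..t}|lborel. excess_rate h w (Y n \<omega>))))
        * indicator {\<omega>\<in>space M. T n \<omega> \<le> t \<and> t < T (Suc n) \<omega>} \<omega> \<partial>M)" for n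
  have b: "b n = (\<integral>\<^sup>+\<omega>. ennreal (exp (log_weight h n \<omega>)) *
      (indicator {\<omega>\<in>space M. T n \<omega> \<le> t} \<omega> * ennreal (surv h (T n \<omega>) (Y n \<omega>) t)) \<partial>M)" for n
    unfolding b_def using weight_slice[OF h, of "\<lambda>_. 1" t n] t_nonneg by simp
  have [measurable]: "log_weight h n \<in> borel_measurable M" for n
    by (rule H_measurable_M[OF log_weight_measurable[OF h]])
  have [measurable]: "(\<lambda>\<omega>. surv h (T n \<omega>) (Y n \<omega>) t) \<in> borel_measurable M" for n
    by (rule surv_measurable[OF h]) measurable
  have ab: "a n = b n + a (Suc n)" for n
  proof -
    have "a (Suc n) = (\<integral>\<^sup>+\<omega>. ennreal (exp (log_weight h n \<omega>)) *
      (indicator {\<omega>\<in>space M. T n \<omega> \<le> t} \<omega> * step_op h t (\<lambda>_ _. 1) (T n \<omega>) (Y n \<omega>)) \<partial>M)"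
      unfolding a_def using weight_step[OF h, of "\<lambda>_ _. 1" n] by simp
    also have "\<dots> = (\<integral>\<^sup>+\<omega>. ennreal (exp (log_weight h n \<omega>)) *
      (indicator {\<omega>\<in>space M. T n \<omega> \<le> t} \<omega> * ennreal (1 - surv h (T n \<omega>) (Y n \<omega>) t)) \<partial>M)"
      by (intro nn_integral_cong) (auto simp: step_op_1[OF h Y_space] split: split_indicator)
    finally have "b n + a (Suc n) = (\<integral>\<^sup>+\<omega>. ennreal (exp (log_weight h n \<omega>)) *
      (indicator {\<omega>\<in>space M. T n \<omega> \<le> t} \<omega> * ennreal (surv h (T n \<omega>) (Y n \<omega>) t)) +
      ennreal (exp (log_weight h n \<omega>)) *
      (indicator {\<omega>\<in>space M. T n \<omega> \<le> t} \<omega> * ennreal (1 - surv h (T n \<omega>) (Y n \<omega>) t)) \<partial>M)"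
      unfolding b by (subst nn_integral_add) auto
    also have "\<dots> = a n"
      unfolding a_def
    proof (rule nn_integral_cong)
      fix \<omega> assume w: "\<omega> \<in> space M"
      have "ennreal (surv h (T n \<omega>) (Y n \<omega>) t) + ennreal (1 - surv h (T n \<omega>) (Y n \<omega>) t) = 1"
        using surv_pos[of h "T n \<omega>" "Y n \<omega>" t] surv_le_1[OF h Y_space[OF w], of "T n \<omega>" n t]
        by (subst ennreal_plus[symmetric]) (auto simp: less_imp_le)
      then show "ennreal (exp (log_weight h n \<omega>)) *
      (indicator {\<omega>\<in>space M. T n \<omega> \<le> t} \<omega> * ennreal (surv h (T n \<omega>) (Y n \<omega>) t)) +
      ennreal (exp (log_weight h n \<omega>)) *
      (indicator {\<omega>\<in>space M. T n \<omega> \<le> t} \<omega> * ennreal (1 - surv h (T n \<omega>) (Y n \<omega>) t))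
      = ennreal (exp (log_weight h n \<omega>)) * indicator {\<omega>\<in>space M. T n \<omega> \<le> t} \<omega>"
        by (auto simp: distrib_left[symmetric] split: split_indicator)
    qed
    finally show ?thesis by simp
  qed
  have "a 0 = (\<integral>\<^sup>+\<omega>. 1 \<partial>M)"
    unfolding a_def by (intro nn_integral_cong) (auto simp: T_0 t_nonneg log_weight_def)
  then have a0: "a 0 = 1" by (simp add: emeasure_space_1)
  have "(\<Sum>n<N. b n) + a N = 1" for N
  proof (induction N)
    case (Suc N)
    then show ?case unfolding ab[of N] by (simp add: add.assoc)
  qed (simp add: a0)
  then have "(\<Sum>n<N. b n) \<le> 1" for N
    by (metis add.right_neutral add_left_mono zero_le)
  then show ?thesis
    unfolding b_def[symmetric] by (intro suminf_le_const summableI) auto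
qed

end

section \<open>Paths and the change of measure\<close>

lemma measurable3_compose:
  assumes \<alpha>: "(\<lambda>(s, x, y). \<alpha> s x y) \<in> measurable (A \<Otimes>\<^sub>M B \<Otimes>\<^sub>M C) L"
    and "a \<in> measurable N A" "b \<in> measurable N B" "c \<in> measurable N C"
  shows "(\<lambda>w. \<alpha> (a w) (b w) (c w)) \<in> measurable N L"
proof -
  have "(\<lambda>w. (a w, b w, c w)) \<in> measurable N (A \<Otimes>\<^sub>M B \<Otimes>\<^sub>M C)"
    by (intro measurable_Pair assms)
  from measurable_compose[OF this \<alpha>] show ?thesis by simp
qed

context tilted_process begin

abbreviation X :: "'w \<Rightarrow> real \<Rightarrow> 'a" where "X \<equiv> jump_path T Y"

section \<open>Paths as functions of time: jump counts, left limits, sums and integrals\<close>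

definition jump_index :: "real \<Rightarrow> 'w \<Rightarrow> nat" where
  "jump_index s \<omega> = (THE n. T n \<omega> \<le> s \<and> s < T (Suc n) \<omega>)"

lemma X_eq: "X \<omega> s = Y (jump_index s \<omega>) \<omega>"
  by (simp add: jump_path_def jump_index_def)

lemma slice_unique:
  assumes w: "\<omega> \<in> space M" and "T m \<omega> \<le> s" "s < T (Suc m) \<omega>" "T n \<omega> \<le> s" "s < T (Suc n) \<omega>"
  shows "m = n"
proof -
  have "T m \<omega> < T (Suc n) \<omega>" "T n \<omega> < T (Suc m) \<omega>" using assms by auto
  then show ?thesis using strict_mono_less[OF T_strict_mono[OF w]] by auto
qed

lemma jump_index_eq: "\<omega> \<in> space M \<Longrightarrow> T n \<omega> \<le> s \<Longrightarrow> s < T (Suc n) \<omega> \<Longrightarrow> jump_index s \<omega> = n"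
  unfolding jump_index_def by (rule the_equality) (auto intro: slice_unique)

lemma X_slice: "\<omega> \<in> space M \<Longrightarrow> T n \<omega> \<le> s \<Longrightarrow> s < T (Suc n) \<omega> \<Longrightarrow> X \<omega> s = Y n \<omega>"
  by (simp add: X_eq jump_index_eq)

lemma X_space: "\<omega> \<in> space M \<Longrightarrow> X \<omega> s \<in> space \<X>"
  by (simp add: X_eq Y_space)

lemma slice_exists:
  assumes w: "\<omega> \<in> space M" and s: "0 \<le> s" "s < T m \<omega>"
  shows "\<exists>n<m. T n \<omega> \<le> s \<and> s < T (Suc n) \<omega>"
proof -
  define k where "k = (LEAST k. s < T k \<omega>)"
  have k: "s < T k \<omega>" unfolding k_def using s(2) by (rule LeastI)
  have km: "k \<le> m" unfolding k_def using s(2) by (rule Least_le)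
  have "k \<noteq> 0" using k s T_0[OF w] by (cases k) auto
  then obtain n where n: "k = Suc n" by (cases k) auto
  then have "\<not> s < T n \<omega>" unfolding k_def by (metis k_def lessI not_less_Least)
  then have "n < m \<and> T n \<omega> \<le> s \<and> s < T (Suc n) \<omega>" using k n km by auto
  then show ?thesis by blast
qed

lemma jump_index_measurable:
  "(\<lambda>p. jump_index (fst p) (snd p)) \<in> measurable (borel \<Otimes>\<^sub>M M) (count_space UNIV)"
proof -
  let ?P = "\<lambda>n p. T n (snd p) \<le> fst p \<and> fst p < T (Suc n) (snd p)"
  have [measurable]: "Measurable.pred (borel \<Otimes>\<^sub>M M) (?P n)" for n by measurable
  \<comment> \<open>If no slice contains the time, the definite description takes the constant value
    \<open>THE n. False\<close>. Spelling it out covers the exploded paths as well.\<close>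
  have "(\<lambda>p. if \<exists>n. ?P n p then LEAST n. ?P n p else (THE n. False)) \<in> measurable (borel \<Otimes>\<^sub>M M) (count_space UNIV)"
    by measurable
  moreover have "jump_index (fst p) (snd p) = (if \<exists>n. ?P n p then LEAST n. ?P n p else (THE n. False))"
    if "p \<in> space (borel \<Otimes>\<^sub>M M)" for p
  proof (cases "\<exists>n. ?P n p")
    case True
    then have "?P (LEAST n. ?P n p) p" by (rule LeastI_ex)
    then show ?thesis using True that jump_index_eq[of "snd p" "LEAST n. ?P n p" "fst p"]
      by (auto simp: space_pair_measure)
  next
    case False
    then show ?thesis unfolding jump_index_def by (auto intro!: arg_cong[where f = The])
  qed
  ultimately show ?thesis by (subst measurable_cong)
qed

lemma X_measurable_pair: "(\<lambda>p. X (snd p) (fst p)) \<in> measurable (borel \<Otimes>\<^sub>M M) \<X>"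
  unfolding X_eq
  by (rule measurable_compose_countable[where f = "\<lambda>n p. Y n (snd p)" and g = "\<lambda>p. jump_index (fst p) (snd p)",
        OF _ jump_index_measurable]) measurable

lemma X_compose_measurable:
  assumes "a \<in> borel_measurable N" "b \<in> measurable N M"
  shows "(\<lambda>w. X (b w) (a w)) \<in> measurable N \<X>"
  using measurable_compose[OF measurable_Pair[OF assms] X_measurable_pair] by simp

lemma X_measurable: "(\<lambda>\<omega>. X \<omega> s) \<in> measurable M \<X>"
  by (rule X_compose_measurable) auto

text \<open>The sum over the jumps up to time \<open>s\<close>; the value \<open>0\<close> in the case of explosion agrees
  with \<^const>\<open>jump_sum\<close>, where it is a sum over an infinite set.\<close>

definition jsum :: "(real \<Rightarrow> 'a \<Rightarrow> 'a \<Rightarrow> real) \<Rightarrow> real \<Rightarrow> 'w \<Rightarrow> real" where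
  "jsum \<alpha> s \<omega> = (if \<exists>n. s < T n \<omega>
     then \<Sum>i<jump_index s \<omega>. \<alpha> (T (Suc i) \<omega>) (Y i \<omega>) (Y (Suc i) \<omega>) else 0)"

lemma jsum_slice: "\<omega> \<in> space M \<Longrightarrow> T n \<omega> \<le> s \<Longrightarrow> s < T (Suc n) \<omega> \<Longrightarrow>
    jsum \<alpha> s \<omega> = (\<Sum>i<n. \<alpha> (T (Suc i) \<omega>) (Y i \<omega>) (Y (Suc i) \<omega>))"
  by (auto simp: jsum_def jump_index_eq)

lemma jsum_measurable:
  assumes \<alpha>: "(\<lambda>(s, x, y). \<alpha> s x y) \<in> borel_measurable (borel \<Otimes>\<^sub>M \<X> \<Otimes>\<^sub>M \<X>)"
    and [measurable]: "a \<in> borel_measurable N" "b \<in> measurable N M"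
  shows "(\<lambda>w. jsum \<alpha> (a w) (b w)) \<in> borel_measurable N"
proof -
  have 1: "(\<lambda>w. \<alpha> (T (Suc i) (b w)) (Y i (b w)) (Y (Suc i) (b w))) \<in> borel_measurable N" for i
    by (rule measurable3_compose[OF \<alpha>]) measurable
  have "(\<lambda>w. (a w, b w)) \<in> measurable N (borel \<Otimes>\<^sub>M M)" by measurable
  from measurable_compose[OF this jump_index_measurable]
  have 2: "(\<lambda>w. jump_index (a w) (b w)) \<in> measurable N (count_space UNIV)" by simp
  have 3: "(\<lambda>w. \<Sum>i<jump_index (a w) (b w). \<alpha> (T (Suc i) (b w)) (Y i (b w)) (Y (Suc i) (b w))) \<in> borel_measurable N"
    by (rule measurable_compose_countable[where f = "\<lambda>n w. \<Sum>i<n. \<alpha> (T (Suc i) (b w)) (Y i (b w)) (Y (Suc i) (b w))", OF _ 2])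
      (rule borel_measurable_sum[OF 1])
  have [measurable]: "Measurable.pred N (\<lambda>w. \<exists>n. a w < T n (b w))" by measurable
  show ?thesis unfolding jsum_def by (intro measurable_If 3) auto
qed

text \<open>The interval for \<open>u\<close> is closed on the right: at
  \<open>u = T (Suc k) \<omega>\<close> this is the state that is being left.\<close>

lemma left_value_X:
  assumes w: "\<omega> \<in> space M" and u: "T k \<omega> < u" "u \<le> T (Suc k) \<omega>"
  shows "left_value (X \<omega>) u = Y k \<omega>"
proof -
  have "eventually (\<lambda>v. v \<in> {T k \<omega><..<u}) (at_left u)"
    by (rule eventually_at_left_real[OF u(1)])
  then have ev: "eventually (\<lambda>v. X \<omega> v = Y k \<omega>) (at_left u)"
    by (rule eventually_mono) (use u w X_slice[OF w, of k] in auto)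
  show ?thesis unfolding left_value_def
  proof (rule the_equality)
    show "eventually (\<lambda>v. X \<omega> v = Y k \<omega>) (at_left u)" by (rule ev)
    fix x assume "eventually (\<lambda>v. X \<omega> v = x) (at_left u)"
    with ev have "eventually (\<lambda>v. x = Y k \<omega>) (at_left u)" by eventually_elim simp
    then show "x = Y k \<omega>" by simp
  qed
qed

text \<open>Each \<open>T (Suc i)\<close> is visible as a discontinuity because consecutive states
  differ pointwise by \<open>Y_Suc_neq\<close>. That is guaranteed up to time \<open>t\<close> only,
  hence the bound on \<open>s\<close>.\<close>

lemma jumps_upto_slice:
  assumes w: "\<omega> \<in> space M" and s: "s \<le> t" "T n \<omega> \<le> s" "s < T (Suc n) \<omega>"
  shows "jumps_upto (X \<omega>) s = (\<lambda>i. T (Suc i) \<omega>) ` {..<n}"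
proof (intro equalityI subsetI)
  fix u assume "u \<in> jumps_upto (X \<omega>) s"
  then have u: "0 < u" "u \<le> s" "left_value (X \<omega>) u \<noteq> X \<omega> u" by (auto simp: jumps_upto_def)
  then obtain k where k: "T k \<omega> \<le> u" "u < T (Suc k) \<omega>"
    using slice_exists[OF w, of u "Suc n"] s by auto
  have "\<not> T k \<omega> < u"
    using left_value_X[OF w _ less_imp_le[OF k(2)]] X_slice[OF w k] u(3) by metis
  then have uk: "u = T k \<omega>" using k by linarith
  then obtain i where i: "k = Suc i" using u T_0[OF w] by (cases k) auto
  have "T k \<omega> < T (Suc n) \<omega>" using uk u s by simp
  then have "k \<le> n" using strict_mono_less[OF T_strict_mono[OF w]] by auto
  then show "u \<in> (\<lambda>i. T (Suc i) \<omega>) ` {..<n}" using uk i by auto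
next
  fix u assume "u \<in> (\<lambda>i. T (Suc i) \<omega>) ` {..<n}"
  then obtain i where i: "i < n" and u: "u = T (Suc i) \<omega>" by auto
  have le: "u \<le> s" using T_mono[OF w, of "Suc i" n] i s u by simp
  have "0 < u" unfolding u using T_nonneg[OF w, of i] T_less_Suc[OF w, of i] by simp
  moreover have "left_value (X \<omega>) u = Y i \<omega>"
    using left_value_X[OF w, of i u] T_less_Suc[OF w, of i] u by simp
  moreover have "X \<omega> u = Y (Suc i) \<omega>"
    using X_slice[OF w, of "Suc i" u] T_less_Suc[OF w, of "Suc i"] u by simp
  moreover have "Y (Suc i) \<omega> \<noteq> Y i \<omega>"
    using Y_Suc_neq[OF w, of i] T_nonneg[OF w, of "Suc i"] le u s by simp
  ultimately show "u \<in> jumps_upto (X \<omega>) s" using le by (auto simp: jumps_upto_def)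
qed

lemma jump_sum_slice:
  assumes w: "\<omega> \<in> space M" and s: "s \<le> t" "T n \<omega> \<le> s" "s < T (Suc n) \<omega>"
  shows "jump_sum \<alpha> (X \<omega>) s = (\<Sum>i<n. \<alpha> (T (Suc i) \<omega>) (Y i \<omega>) (Y (Suc i) \<omega>))"
proof -
  have "inj_on (\<lambda>i. T (Suc i) \<omega>) {..<n}"
    using strict_mono_eq[OF T_strict_mono[OF w]] by (auto simp: inj_on_def)
  then have "jump_sum \<alpha> (X \<omega>) s = (\<Sum>i<n. \<alpha> (T (Suc i) \<omega>) (left_value (X \<omega>) (T (Suc i) \<omega>)) (X \<omega> (T (Suc i) \<omega>)))"
    unfolding jump_sum_def jumps_upto_slice[OF assms] by (subst sum.reindex) auto
  also have "\<dots> = (\<Sum>i<n. \<alpha> (T (Suc i) \<omega>) (Y i \<omega>) (Y (Suc i) \<omega>))"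
    using left_value_X[OF w T_less_Suc[OF w] order_refl] X_slice[OF w order_refl T_less_Suc[OF w]] by simp
  finally show ?thesis .
qed

lemma jump_sum_eq_jsum:
  assumes w: "\<omega> \<in> space M" and s: "0 \<le> s" "s \<le> t"
  shows "jump_sum \<alpha> (X \<omega>) s = jsum \<alpha> s \<omega>"
proof (cases "\<exists>n. s < T n \<omega>")
  case True
  then obtain m where "s < T m \<omega>" by auto
  then obtain n where n: "T n \<omega> \<le> s" "s < T (Suc n) \<omega>" using slice_exists[OF w s(1), of m] by auto
  show ?thesis using jump_sum_slice[OF w s(2) n] jsum_slice[OF w n] by simp
next
  case False
  then have le: "T n \<omega> \<le> s" for n by (auto simp: not_less)
  have "range (\<lambda>i. T (Suc i) \<omega>) \<subseteq> jumps_upto (X \<omega>) s"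
  proof clarify
    fix i
    have "0 < T (Suc i) \<omega>" using T_nonneg[OF w, of i] T_less_Suc[OF w, of i] by simp
    moreover have "left_value (X \<omega>) (T (Suc i) \<omega>) = Y i \<omega>"
      using left_value_X[OF w, of i] T_less_Suc[OF w, of i] by simp
    moreover have "X \<omega> (T (Suc i) \<omega>) = Y (Suc i) \<omega>"
      using X_slice[OF w, of "Suc i"] T_less_Suc[OF w, of "Suc i"] by simp
    moreover have "Y (Suc i) \<omega> \<noteq> Y i \<omega>"
      using Y_Suc_neq[OF w, of i] T_nonneg[OF w, of "Suc i"] le[of "Suc i"] s by simp
    ultimately show "T (Suc i) \<omega> \<in> jumps_upto (X \<omega>) s" using le[of "Suc i"] by (auto simp: jumps_upto_def)
  qed
  moreover have "infinite (range (\<lambda>i. T (Suc i) \<omega>))"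
    using strict_mono_eq[OF T_strict_mono[OF w]] by (intro range_inj_infinite) (auto simp: inj_def)
  ultimately have "infinite (jumps_upto (X \<omega>) s)" using finite_subset by blast
  then show ?thesis using False by (simp add: jump_sum_def jsum_def)
qed

text \<open>On \<open>[T n, s]\<close> the path equals \<open>Y n\<close>, except possibly at the
  end point \<open>s = T (Suc n)\<close>, which is a null set.\<close>

lemma path_integral_piece:
  fixes \<phi> :: "real \<Rightarrow> 'a \<Rightarrow> real"
  assumes w: "\<omega> \<in> space M" and \<phi>: "\<And>a b x. x \<in> space \<X> \<Longrightarrow> set_integrable lborel {a..b} (\<lambda>u. \<phi> u x)"
    and s: "s \<le> T (Suc n) \<omega>"
  shows "set_integrable lborel {T n \<omega>..s} (\<lambda>u. \<phi> u (X \<omega> u)) \<and>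
    (LINT u:{T n \<omega>..s}|lborel. \<phi> u (X \<omega> u)) = (LINT u:{T n \<omega>..s}|lborel. \<phi> u (Y n \<omega>))"
proof
  have eq: "indicator {T n \<omega>..s} u *\<^sub>R \<phi> u (X \<omega> u) = indicator {T n \<omega>..s} u *\<^sub>R \<phi> u (Y n \<omega>)" if "u \<notin> {s}" for u
    using that s X_slice[OF w, of n u] by (auto simp: indicator_def)
  have "integrable lborel (\<lambda>u. indicator {T n \<omega>..s} u *\<^sub>R \<phi> u (Y n \<omega>))"
    using \<phi>[OF Y_space[OF w]] by (simp add: set_integrable_def)
  then show "set_integrable lborel {T n \<omega>..s} (\<lambda>u. \<phi> u (X \<omega> u))"
    unfolding set_integrable_def
    by (subst integrable_discrete_difference[where X = "{s}" and g = "\<lambda>u. indicator {T n \<omega>..s} u *\<^sub>R \<phi> u (Y n \<omega>)"])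
      (use eq in auto)
  show "(LINT u:{T n \<omega>..s}|lborel. \<phi> u (X \<omega> u)) = (LINT u:{T n \<omega>..s}|lborel. \<phi> u (Y n \<omega>))"
    unfolding set_lebesgue_integral_def
    by (rule integral_discrete_difference[where X = "{s}"]) (use eq in auto)
qed

lemma path_integral_slice:
  fixes \<phi> :: "real \<Rightarrow> 'a \<Rightarrow> real"
  assumes w: "\<omega> \<in> space M" and \<phi>: "\<And>a b x. x \<in> space \<X> \<Longrightarrow> set_integrable lborel {a..b} (\<lambda>u. \<phi> u x)"
    and s: "T n \<omega> \<le> s" "s \<le> T (Suc n) \<omega>"
  shows "set_integrable lborel {0..s} (\<lambda>u. \<phi> u (X \<omega> u)) \<and> (LINT u:{0..s}|lborel. \<phi> u (X \<omega> u))
    = (\<Sum>i<n. LINT u:{T i \<omega>..T (Suc i) \<omega>}|lborel. \<phi> u (Y i \<omega>)) + (LINT u:{T n \<omega>..s}|lborel. \<phi> u (Y n \<omega>))"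
  using s
proof (induction n arbitrary: s)
  case *: (0 s)
  show ?case using path_integral_piece[where \<phi> = \<phi> and n = 0 and s = s, OF w \<phi>] * T_0[OF w] by simp
next
  case (Suc n s)
  note sl = path_integral_piece[where \<phi> = \<phi>, OF w \<phi> Suc.prems(2)]
  let ?T = "T (Suc n) \<omega>"
  have IH: "set_integrable lborel {0..?T} (\<lambda>u. \<phi> u (X \<omega> u))"
    "(LINT u:{0..?T}|lborel. \<phi> u (X \<omega> u))
    = (\<Sum>i<n. LINT u:{T i \<omega>..T (Suc i) \<omega>}|lborel. \<phi> u (Y i \<omega>)) + (LINT u:{T n \<omega>..?T}|lborel. \<phi> u (Y n \<omega>))"
    using Suc.IH[of ?T] T_less_Suc[OF w, of n] by auto
  have un: "{0..s} = {0..?T} \<union> {?T..s}" using Suc.prems T_nonneg[OF w, of "Suc n"] by auto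
  have i: "set_integrable lborel {0..s} (\<lambda>u. \<phi> u (X \<omega> u))"
    unfolding un using IH(1) sl by (intro set_integrable_Un) auto
  show ?case
    using i set_integral_split_Icc[OF i T_nonneg[OF w] Suc.prems(1)] IH(2) sl by simp
qed

text \<open>Without explosion the number of jumps up to \<open>s\<close> has exactly one finite
  value, so the slices partition the space up to a null set.\<close>

lemma nn_integral_slices:
  assumes fin: "AE \<omega> in M. \<exists>n. t < T n \<omega>" and s: "0 \<le> s" "s \<le> t" and [measurable]: "f \<in> borel_measurable M"
  shows "(\<integral>\<^sup>+\<omega>. f \<omega> \<partial>M) = (\<Sum>n. \<integral>\<^sup>+\<omega>. f \<omega> * indicator {\<omega>\<in>space M. T n \<omega> \<le> s \<and> s < T (Suc n) \<omega>} \<omega> \<partial>M)"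
proof -
  have "(\<integral>\<^sup>+\<omega>. f \<omega> \<partial>M) = (\<integral>\<^sup>+\<omega>. (\<Sum>n. f \<omega> * indicator {\<omega>\<in>space M. T n \<omega> \<le> s \<and> s < T (Suc n) \<omega>} \<omega>) \<partial>M)"
  proof (rule nn_integral_cong_AE, use fin AE_space in eventually_elim)
    case (elim \<omega>)
    then obtain m where "s < T m \<omega>" using s by (auto intro: le_less_trans)
    from slice_exists[OF elim(2) s(1) this] obtain N where N: "T N \<omega> \<le> s" "s < T (Suc N) \<omega>" by blast
    have "(\<lambda>n. f \<omega> * indicator {\<omega>\<in>space M. T n \<omega> \<le> s \<and> s < T (Suc n) \<omega>} \<omega>) = (\<lambda>n. if n = N then f \<omega> else 0)"
    proof (rule ext)
      fix n
      have "(T n \<omega> \<le> s \<and> s < T (Suc n) \<omega>) \<longleftrightarrow> n = N"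
        using slice_unique[OF elim(2) _ _ N] N by blast
      then show "f \<omega> * indicator {\<omega>\<in>space M. T n \<omega> \<le> s \<and> s < T (Suc n) \<omega>} \<omega> = (if n = N then f \<omega> else 0)"
        using elim(2) by (simp add: indicator_def)
    qed
    then show ?case using sums_single[of N "\<lambda>_. f \<omega>"] by (simp add: sums_iff)
  qed
  also have "\<dots> = (\<Sum>n. \<integral>\<^sup>+\<omega>. f \<omega> * indicator {\<omega>\<in>space M. T n \<omega> \<le> s \<and> s < T (Suc n) \<omega>} \<omega> \<partial>M)"
    by (rule nn_integral_suminf) measurable
  finally show ?thesis .
qed

lemma ennreal_jsum:
  assumes w: "\<omega> \<in> space M" and fin: "\<exists>n. t < T n \<omega>" and t: "0 \<le> t"
    and \<alpha>: "\<And>s x y. 0 \<le> \<alpha> s x y"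
  shows "ennreal (jsum \<alpha> t \<omega>)
    = (\<Sum>n. indicator {\<omega>\<in>space M. T (Suc n) \<omega> \<le> t} \<omega> * ennreal (\<alpha> (T (Suc n) \<omega>) (Y n \<omega>) (Y (Suc n) \<omega>)))"
proof -
  obtain m where "t < T m \<omega>" using fin by auto
  from slice_exists[OF w t this] obtain N where N: "T N \<omega> \<le> t" "t < T (Suc N) \<omega>" by blast
  have iff: "T (Suc n) \<omega> \<le> t \<longleftrightarrow> n < N" for n
    using T_mono[OF w, of "Suc n" N] T_mono[OF w, of "Suc N" "Suc n"] N by (cases "n < N") auto
  have "(\<Sum>n. indicator {\<omega>\<in>space M. T (Suc n) \<omega> \<le> t} \<omega> * ennreal (\<alpha> (T (Suc n) \<omega>) (Y n \<omega>) (Y (Suc n) \<omega>)))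
    = (\<Sum>n<N. indicator {\<omega>\<in>space M. T (Suc n) \<omega> \<le> t} \<omega> * ennreal (\<alpha> (T (Suc n) \<omega>) (Y n \<omega>) (Y (Suc n) \<omega>)))"
    by (rule suminf_finite) (auto simp: iff)
  also have "\<dots> = (\<Sum>n<N. ennreal (\<alpha> (T (Suc n) \<omega>) (Y n \<omega>) (Y (Suc n) \<omega>)))"
    by (rule sum.cong) (auto simp: iff w)
  also have "\<dots> = ennreal (jsum \<alpha> t \<omega>)"
    unfolding jsum_slice[OF w N] using \<alpha> by (rule sum_ennreal)
  finally show ?thesis ..
qed

text \<open>\<open>kernel_step\<close> gives the mean of the term for the jump \<open>Suc n\<close>,
  and Tonelli exchanges time and \<open>\<omega>\<close>. Read backwards, \<open>survival\<close>
  turns the factor \<open>surv\<close> into the event that exactly \<open>n\<close> jumps have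
  occurred by time \<open>u\<close>; summing over \<open>n\<close> removes this event. Nonnegativity
  lets infinite values pass through.\<close>

lemma compensator:
  assumes t: "0 \<le> t" and fin: "AE \<omega> in M. \<exists>n. t < T n \<omega>"
    and \<alpha>: "(\<lambda>(s, x, y). \<alpha> s x y) \<in> borel_measurable (borel \<Otimes>\<^sub>M \<X> \<Otimes>\<^sub>M \<X>)"
    and \<alpha>_nn: "\<And>s x y. 0 \<le> (\<alpha> s x y :: real)"
  shows "(\<integral>\<^sup>+\<omega>. ennreal (jsum \<alpha> t \<omega>) \<partial>M)
    = (\<integral>\<^sup>+u\<in>{0..t}. (\<integral>\<^sup>+\<omega>. (\<integral>\<^sup>+y. ennreal (exp (h u (X \<omega> u) y) * \<alpha> u (X \<omega> u) y) \<partial>r (X \<omega> u)) \<partial>M) \<partial>lborel)"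
proof -
  define c where "c u x = (\<integral>\<^sup>+y. ennreal (exp (h u x y) * \<alpha> u x y) \<partial>r x)" for u x
  have c: "(\<lambda>w. c (a w) (b w)) \<in> borel_measurable N"
    if [measurable]: "a \<in> borel_measurable N" "b \<in> measurable N \<X>" for a b and N :: "'z measure"
    unfolding c_def
  proof (rule nn_integral_r_measurable)
    have 1: "(\<lambda>p. h (a (fst p)) (b (fst p)) (snd p)) \<in> borel_measurable (N \<Otimes>\<^sub>M \<X>)"
      by (rule bounded_tilt_measurable[OF h]) measurable
    have 2: "(\<lambda>p. \<alpha> (a (fst p)) (b (fst p)) (snd p)) \<in> borel_measurable (N \<Otimes>\<^sub>M \<X>)"
      by (rule measurable3_compose[OF \<alpha>]) measurable
    show "(\<lambda>(w, y). ennreal (exp (h (a w) (b w) y) * \<alpha> (a w) (b w) y)) \<in> borel_measurable (N \<Otimes>\<^sub>M \<X>)"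
      unfolding case_prod_beta
      by (intro measurable_compose[OF _ measurable_ennreal] borel_measurable_times 2
          measurable_compose[OF 1 borel_measurable_exp])
  qed fact
  let ?A = "\<lambda>n u. {\<omega>\<in>space M. T n \<omega> \<le> u \<and> u < T (Suc n) \<omega>}"
  have step: "(\<integral>\<^sup>+\<omega>. indicator {\<omega>\<in>space M. T (Suc n) \<omega> \<le> t} \<omega> * ennreal (\<alpha> (T (Suc n) \<omega>) (Y n \<omega>) (Y (Suc n) \<omega>)) \<partial>M)
    = (\<integral>\<^sup>+u\<in>{0..t}. (\<integral>\<^sup>+\<omega>. c u (X \<omega> u) * indicator (?A n u) \<omega> \<partial>M) \<partial>lborel)" for n
  proof -
    have Yn: "Y n \<in> measurable (H n) \<X>" by (rule TY_H_measurable) simp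
    have "(\<lambda>p. \<alpha> (fst (snd p)) (Y n (fst p)) (snd (snd p))) \<in> borel_measurable (H n \<Otimes>\<^sub>M borel \<Otimes>\<^sub>M \<X>)"
      by (rule measurable3_compose[OF \<alpha>]) (use Yn in measurable)
    then have m: "(\<lambda>(\<omega>, u, y). ennreal (\<alpha> u (Y n \<omega>) y)) \<in> borel_measurable (H n \<Otimes>\<^sub>M borel \<Otimes>\<^sub>M \<X>)"
      unfolding case_prod_beta by (rule measurable_compose[OF _ measurable_ennreal])
    have sv: "(\<lambda>p. surv h (T n (fst p)) (Y n (fst p)) (snd p)) \<in> borel_measurable (M \<Otimes>\<^sub>M lborel)"
      by (rule surv_measurable[OF h]) measurable
    have cY: "(\<lambda>p. c (snd p) (Y n (fst p))) \<in> borel_measurable (M \<Otimes>\<^sub>M lborel)"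
      by (rule c) measurable
    have ind: "(\<lambda>p. indicator {T n (fst p)..t} (snd p) :: ennreal) \<in> borel_measurable (M \<Otimes>\<^sub>M lborel)"
      unfolding indicator_def atLeastAtMost_iff by measurable
    have fub: "(\<lambda>(\<omega>, u). ennreal (surv h (T n \<omega>) (Y n \<omega>) u) * c u (Y n \<omega>) * indicator {T n \<omega>..t} u)
        \<in> borel_measurable (M \<Otimes>\<^sub>M lborel)"
      unfolding case_prod_beta
      by (intro borel_measurable_times_ennreal measurable_compose[OF sv measurable_ennreal] cY ind)
    interpret pair_sigma_finite M lborel ..
    have "(\<integral>\<^sup>+\<omega>. indicator {\<omega>\<in>space M. T (Suc n) \<omega> \<le> t} \<omega> * ennreal (\<alpha> (T (Suc n) \<omega>) (Y n \<omega>) (Y (Suc n) \<omega>)) \<partial>M)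
      = (\<integral>\<^sup>+\<omega>. (\<integral>\<^sup>+u\<in>{T n \<omega>..t}. ennreal (surv h (T n \<omega>) (Y n \<omega>) u) * c u (Y n \<omega>) \<partial>lborel) \<partial>M)"
      unfolding kernel_step[OF m] c_def by (simp add: ennreal_mult')
    also have "\<dots> = (\<integral>\<^sup>+u. (\<integral>\<^sup>+\<omega>. ennreal (surv h (T n \<omega>) (Y n \<omega>) u) * c u (Y n \<omega>) * indicator {T n \<omega>..t} u \<partial>M) \<partial>lborel)"
      by (rule Fubini'[symmetric, OF fub])
    also have "\<dots> = (\<integral>\<^sup>+u\<in>{0..t}. (\<integral>\<^sup>+\<omega>. c u (X \<omega> u) * indicator (?A n u) \<omega> \<partial>M) \<partial>lborel)"
    proof (rule nn_integral_cong)
      fix u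
      show "(\<integral>\<^sup>+\<omega>. ennreal (surv h (T n \<omega>) (Y n \<omega>) u) * c u (Y n \<omega>) * indicator {T n \<omega>..t} u \<partial>M)
        = (\<integral>\<^sup>+\<omega>. c u (X \<omega> u) * indicator (?A n u) \<omega> \<partial>M) * indicator {0..t} u"
      proof (cases "u \<in> {0..t}")
        case True
        have cH: "(\<lambda>\<omega>. c u (Y n \<omega>)) \<in> borel_measurable (H n)" by (rule c[OF _ Yn]) simp
        have "(\<integral>\<^sup>+\<omega>. ennreal (surv h (T n \<omega>) (Y n \<omega>) u) * c u (Y n \<omega>) * indicator {T n \<omega>..t} u \<partial>M)
          = (\<integral>\<^sup>+\<omega>. c u (Y n \<omega>) * indicator {\<omega>\<in>space M. T n \<omega> \<le> u} \<omega> * ennreal (surv h (T n \<omega>) (Y n \<omega>) u) \<partial>M)"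
          using True by (intro nn_integral_cong) (auto simp: mult_ac split: split_indicator)
        also have "\<dots> = (\<integral>\<^sup>+\<omega>. c u (Y n \<omega>) * indicator (?A n u) \<omega> \<partial>M)"
          using True by (intro survival[symmetric, OF cH]) auto
        also have "\<dots> = (\<integral>\<^sup>+\<omega>. c u (X \<omega> u) * indicator (?A n u) \<omega> \<partial>M)"
          by (intro nn_integral_cong) (auto simp: X_slice split: split_indicator)
        finally show ?thesis using True by simp
      next
        case False
        then have "indicator {T n \<omega>..t} u = (0::ennreal)" if "\<omega> \<in> space M" for \<omega>
          using T_nonneg[OF that, of n] by (auto simp: indicator_def)
        then show ?thesis using False by (simp cong: nn_integral_cong)
      qed
    qed
    finally show ?thesis .
  qed
  have cX: "(\<lambda>\<omega>. c u (X \<omega> u)) \<in> borel_measurable M" for u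
    by (rule c[OF _ X_measurable]) simp
  have mu: "(\<lambda>u. (\<integral>\<^sup>+\<omega>. c u (X \<omega> u) * indicator (?A n u) \<omega> \<partial>M) * indicator {0..t} u) \<in> borel_measurable lborel" for n
  proof -
    have 1: "(\<lambda>p. c (fst p) (X (snd p) (fst p))) \<in> borel_measurable (lborel \<Otimes>\<^sub>M M)"
      by (rule c[OF _ X_compose_measurable]) measurable
    have 2: "(\<lambda>p. indicator (?A n (fst p)) (snd p) :: ennreal) \<in> borel_measurable (lborel \<Otimes>\<^sub>M M)"
      unfolding indicator_def mem_Collect_eq by measurable
    have "(\<lambda>(u, \<omega>). c u (X \<omega> u) * indicator (?A n u) \<omega>) \<in> borel_measurable (lborel \<Otimes>\<^sub>M M)"
      unfolding case_prod_beta by (intro borel_measurable_times_ennreal 1 2)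
    then show ?thesis
      by (intro borel_measurable_times_ennreal borel_measurable_nn_integral) auto
  qed
  have "(\<integral>\<^sup>+\<omega>. ennreal (jsum \<alpha> t \<omega>) \<partial>M)
    = (\<integral>\<^sup>+\<omega>. (\<Sum>n. indicator {\<omega>\<in>space M. T (Suc n) \<omega> \<le> t} \<omega> * ennreal (\<alpha> (T (Suc n) \<omega>) (Y n \<omega>) (Y (Suc n) \<omega>))) \<partial>M)"
    by (rule nn_integral_cong_AE) (use fin AE_space in eventually_elim, intro ennreal_jsum t \<alpha>_nn)
  also have "\<dots> = (\<Sum>n. \<integral>\<^sup>+\<omega>. indicator {\<omega>\<in>space M. T (Suc n) \<omega> \<le> t} \<omega> * ennreal (\<alpha> (T (Suc n) \<omega>) (Y n \<omega>) (Y (Suc n) \<omega>)) \<partial>M)"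
  proof (rule nn_integral_suminf)
    fix n
    have "(\<lambda>\<omega>. \<alpha> (T (Suc n) \<omega>) (Y n \<omega>) (Y (Suc n) \<omega>)) \<in> borel_measurable M"
      by (rule measurable3_compose[OF \<alpha>]) measurable
    then show "(\<lambda>\<omega>. indicator {\<omega>\<in>space M. T (Suc n) \<omega> \<le> t} \<omega> * ennreal (\<alpha> (T (Suc n) \<omega>) (Y n \<omega>) (Y (Suc n) \<omega>))) \<in> borel_measurable M"
      by (intro borel_measurable_times_ennreal measurable_compose[OF _ measurable_ennreal] borel_measurable_indicator) measurable
  qed
  also have "\<dots> = (\<Sum>n. \<integral>\<^sup>+u\<in>{0..t}. (\<integral>\<^sup>+\<omega>. c u (X \<omega> u) * indicator (?A n u) \<omega> \<partial>M) \<partial>lborel)"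
    by (simp add: step)
  also have "\<dots> = (\<integral>\<^sup>+u. (\<Sum>n. (\<integral>\<^sup>+\<omega>. c u (X \<omega> u) * indicator (?A n u) \<omega> \<partial>M) * indicator {0..t} u) \<partial>lborel)"
    by (rule nn_integral_suminf[symmetric]) (rule mu)
  also have "\<dots> = (\<integral>\<^sup>+u\<in>{0..t}. (\<integral>\<^sup>+\<omega>. c u (X \<omega> u) \<partial>M) \<partial>lborel)"
    by (intro nn_integral_cong) (auto simp: nn_integral_slices[OF fin _ _ cX] split: split_indicator)
  finally show ?thesis by (simp add: c_def)
qed

end

section \<open>The density of the tilted law at a fixed time\<close>

context base_process begin

definition path_density :: "(real \<Rightarrow> 'a \<Rightarrow> 'a \<Rightarrow> real) \<Rightarrow> real \<Rightarrow> 'w \<Rightarrow> real" where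
  "path_density h s \<omega> = exp (jsum h s \<omega> - (LINT u:{0..s}|lborel. excess_rate h u (X \<omega> u)))"

lemma path_density_slice:
  assumes h: "bounded_tilt h" and w: "\<omega> \<in> space M" and s: "T n \<omega> \<le> s" "s < T (Suc n) \<omega>"
  shows "path_density h s \<omega> = exp (log_weight h n \<omega> - (LINT w:{T n \<omega>..s}|lborel. excess_rate h w (Y n \<omega>)))"
  using path_integral_slice[where \<phi> = "excess_rate h", OF w set_integrable_excess_rate[OF h], where n = n and s = s] s
  by (simp add: path_density_def jsum_slice[OF w s] log_weight_def sum_subtractf)

lemma time_integral_measurable:
  fixes \<phi> :: "real \<Rightarrow> 'a \<Rightarrow> real"
  assumes \<phi>: "(\<lambda>(u, x). \<phi> u x) \<in> borel_measurable (borel \<Otimes>\<^sub>M \<X>)"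
    and [measurable]: "a \<in> borel_measurable N" "b \<in> measurable N M"
  shows "(\<lambda>w. LINT u:{0..a w}|lborel. \<phi> u (X (b w) u)) \<in> borel_measurable N"
proof (rule set_integral_measurable)
  have "(\<lambda>p. (snd p, X (b (fst p)) (snd p))) \<in> measurable (N \<Otimes>\<^sub>M borel) (borel \<Otimes>\<^sub>M \<X>)"
    by (intro measurable_Pair X_compose_measurable) measurable
  from measurable_compose[OF this \<phi>]
  show "(\<lambda>p. \<phi> (snd p) (X (b (fst p)) (snd p))) \<in> borel_measurable (N \<Otimes>\<^sub>M borel)" by simp
qed auto

lemma path_density_measurable:
  assumes h: "bounded_tilt h" and a: "a \<in> borel_measurable N" and b: "b \<in> measurable N M"
  shows "(\<lambda>w. path_density h (a w) (b w)) \<in> borel_measurable N"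
proof -
  have "(\<lambda>p. excess_rate h (fst p) (snd p)) \<in> borel_measurable (borel \<Otimes>\<^sub>M \<X>)"
    by (rule excess_rate_measurable[OF h]) measurable
  then have 1: "(\<lambda>(u, x). excess_rate h u x) \<in> borel_measurable (borel \<Otimes>\<^sub>M \<X>)" by (simp add: case_prod_beta)
  have 2: "(\<lambda>(s, x, y). h s x y) \<in> borel_measurable (borel \<Otimes>\<^sub>M \<X> \<Otimes>\<^sub>M \<X>)" using h by (simp add: bounded_tilt_def)
  show ?thesis
    unfolding path_density_def
    by (intro measurable_compose[OF _ borel_measurable_exp] borel_measurable_diff
        jsum_measurable[OF 2 a b] time_integral_measurable[OF 1 a b])
qed

text \<open>The slice identities are summed over the number of jumps up to \<open>s\<close>.
  Non-explosion enters on both sides, since otherwise the slices could miss mass.\<close>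

lemma girsanov:
  assumes P': "tilted_process \<X> r \<nu> h t M' T' Y'" and fin: "AE \<omega> in M'. \<exists>n. t < T' n \<omega>"
    and f: "f \<in> borel_measurable \<X>" and s: "0 \<le> s" "s \<le> t"
  shows "(\<integral>\<^sup>+\<omega>. f (jump_path T' Y' \<omega> s) \<partial>M') = (\<integral>\<^sup>+\<omega>. ennreal (path_density h s \<omega>) * f (X \<omega> s) \<partial>M)"
proof -
  interpret P': tilted_process \<X> r \<nu> h t M' T' Y' by (rule P')
  have 1: "(\<lambda>\<omega>. f (P'.X \<omega> s)) \<in> borel_measurable M'"
    by (rule measurable_compose[OF P'.X_measurable f])
  have 2: "(\<lambda>\<omega>. ennreal (path_density h s \<omega>) * f (X \<omega> s)) \<in> borel_measurable M"
    by (intro borel_measurable_times_ennreal measurable_compose[OF _ measurable_ennreal]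
        path_density_measurable[OF P'.h] measurable_compose[OF X_measurable f]) auto
  have "(\<integral>\<^sup>+\<omega>. f (P'.X \<omega> s) * indicator {\<omega>\<in>space M'. T' n \<omega> \<le> s \<and> s < T' (Suc n) \<omega>} \<omega> \<partial>M')
    = (\<integral>\<^sup>+\<omega>. ennreal (path_density h s \<omega>) * f (X \<omega> s) * indicator {\<omega>\<in>space M. T n \<omega> \<le> s \<and> s < T (Suc n) \<omega>} \<omega> \<partial>M)"
    for n
  proof -
    have "(\<integral>\<^sup>+\<omega>. f (P'.X \<omega> s) * indicator {\<omega>\<in>space M'. T' n \<omega> \<le> s \<and> s < T' (Suc n) \<omega>} \<omega> \<partial>M')
      = (\<integral>\<^sup>+\<omega>. f (Y' n \<omega>) * indicator {\<omega>\<in>space M'. T' n \<omega> \<le> s \<and> s < T' (Suc n) \<omega>} \<omega> \<partial>M')"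
      by (intro nn_integral_cong) (auto simp: P'.X_slice split: split_indicator)
    also note girsanov_slice[OF P' f s]
    also have "(\<integral>\<^sup>+\<omega>. ennreal (exp (log_weight h n \<omega> - (LINT w:{T n \<omega>..s}|lborel. excess_rate h w (Y n \<omega>)))) * f (Y n \<omega>)
        * indicator {\<omega>\<in>space M. T n \<omega> \<le> s \<and> s < T (Suc n) \<omega>} \<omega> \<partial>M)
      = (\<integral>\<^sup>+\<omega>. ennreal (path_density h s \<omega>) * f (X \<omega> s) * indicator {\<omega>\<in>space M. T n \<omega> \<le> s \<and> s < T (Suc n) \<omega>} \<omega> \<partial>M)"
      by (intro nn_integral_cong) (auto simp: X_slice path_density_slice[OF P'.h] split: split_indicator)
    finally show ?thesis .
  qed
  then show ?thesis
    unfolding P'.nn_integral_slices[OF fin s 1] nn_integral_slices[OF finite_jumps s 2] by simp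
qed

text \<open>This concerns the unperturbed law only, so it applies to a tilt such as
  \<open>2 * \<kappa> * \<bar>g\<bar>\<close>, for which no process is given.\<close>

lemma path_density_mass_le_1:
  assumes h: "bounded_tilt h"
  shows "(\<integral>\<^sup>+\<omega>. ennreal (path_density h t \<omega>) \<partial>M) \<le> 1"
proof -
  have 1: "(\<lambda>\<omega>. ennreal (path_density h t \<omega>)) \<in> borel_measurable M"
    by (intro measurable_compose[OF _ measurable_ennreal] path_density_measurable[OF h]) auto
  have "(\<integral>\<^sup>+\<omega>. ennreal (path_density h t \<omega>) * indicator {\<omega>\<in>space M. T n \<omega> \<le> t \<and> t < T (Suc n) \<omega>} \<omega> \<partial>M)
    = (\<integral>\<^sup>+\<omega>. ennreal (exp (log_weight h n \<omega> - (LINT w:{T n \<omega>..t}|lborel. excess_rate h w (Y n \<omega>))))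
        * indicator {\<omega>\<in>space M. T n \<omega> \<le> t \<and> t < T (Suc n) \<omega>} \<omega> \<partial>M)" for n
    by (intro nn_integral_cong) (auto simp: path_density_slice[OF h] split: split_indicator)
  then show ?thesis
    unfolding nn_integral_slices[OF finite_jumps t_nonneg order_refl 1]
    using sum_weights_le_1[OF h] by simp
qed

end

section \<open>Exponential moments and bounds on the log-density\<close>

text \<open>The inequality \<open>1 + z \<le> exp z\<close> at \<open>z = y\<close> and
  \<open>z = - y\<close> gives \<open>y \<le> exp y - 1 \<le> y * exp y\<close>. Subtracting
  \<open>y\<close> on the right leaves \<open>y * (exp y - 1)\<close>, so the second bound is the
  first one times \<open>\<bar>y\<bar>\<close>.\<close>

lemma exp_remainder_bounds:
  fixes y :: real
  shows "\<bar>exp y - 1\<bar> \<le> \<bar>y\<bar> * exp \<bar>y\<bar>" "\<bar>exp y - 1 - y\<bar> \<le> y\<^sup>2 * exp \<bar>y\<bar>"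
proof -
  have lo: "1 + y \<le> exp y" by (rule exp_ge_add_one_self)
  have "exp y * (1 + (- y)) \<le> exp y * exp (- y)"
    by (intro mult_left_mono exp_ge_add_one_self) auto
  then have up: "exp y - 1 \<le> y * exp y" by (simp add: exp_minus field_simps)
  show 1: "\<bar>exp y - 1\<bar> \<le> \<bar>y\<bar> * exp \<bar>y\<bar>"
  proof (cases "0 \<le> y")
    case True
    then show ?thesis using up by simp
  next
    case False
    then have "- y * 1 \<le> - y * exp (- y)" by (intro mult_left_mono) auto
    then have "- y \<le> \<bar>y\<bar> * exp \<bar>y\<bar>" using False by simp
    moreover have "\<bar>exp y - 1\<bar> = 1 - exp y" using False by simp
    ultimately show ?thesis using lo by linarith
  qed
  have "\<bar>exp y - 1 - y\<bar> = exp y - 1 - y" using lo by linarith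
  also have "\<dots> \<le> y * (exp y - 1)" using up by (simp add: algebra_simps)
  also have "\<dots> \<le> \<bar>y\<bar> * \<bar>exp y - 1\<bar>" by (metis abs_ge_self abs_mult)
  also have "\<dots> \<le> \<bar>y\<bar> * (\<bar>y\<bar> * exp \<bar>y\<bar>)" by (rule mult_left_mono[OF 1]) simp
  finally show "\<bar>exp y - 1 - y\<bar> \<le> y\<^sup>2 * exp \<bar>y\<bar>" by (simp add: power2_eq_square mult.assoc[symmetric])
qed

text \<open>One factor \<open>\<bar>z\<bar>\<close> is kept, because it becomes
  \<open>\<bar>g\<bar>\<close> and is integrated against \<open>r\<close>; a second one is bounded
  by \<open>K\<close>. The constant with \<open>1 + K\<close> serves both estimates.\<close>

lemma exp_scaled_bounds:
  fixes z l K :: real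
  assumes z: "\<bar>z\<bar> \<le> K" and l: "\<bar>l\<bar> \<le> 1"
  shows "\<bar>exp (l * z) - 1\<bar> \<le> \<bar>l\<bar> * ((1 + K) * exp K) * \<bar>z\<bar>"
    "\<bar>exp (l * z) - 1 - l * z\<bar> \<le> l\<^sup>2 * ((1 + K) * exp K) * \<bar>z\<bar>"
proof -
  have lz: "\<bar>l * z\<bar> \<le> K" using mult_mono[OF l z] by (simp add: abs_mult)
  have K: "0 \<le> K" using z by simp
  have e: "exp \<bar>l * z\<bar> \<le> exp K" using lz by simp
  have "\<bar>exp (l * z) - 1\<bar> \<le> \<bar>l * z\<bar> * exp \<bar>l * z\<bar>" by (rule exp_remainder_bounds)
  also have "\<dots> \<le> \<bar>l * z\<bar> * ((1 + K) * exp K)"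
    using e K by (intro mult_left_mono) (auto intro: order_trans[OF e] simp: algebra_simps)
  finally show "\<bar>exp (l * z) - 1\<bar> \<le> \<bar>l\<bar> * ((1 + K) * exp K) * \<bar>z\<bar>" by (simp add: abs_mult mult_ac)
  have "\<bar>exp (l * z) - 1 - l * z\<bar> \<le> (l * z)\<^sup>2 * exp \<bar>l * z\<bar>" by (rule exp_remainder_bounds)
  also have "\<dots> \<le> (l * z)\<^sup>2 * exp K" using e by (intro mult_left_mono) auto
  also have "\<dots> = l\<^sup>2 * exp K * (\<bar>z\<bar> * \<bar>z\<bar>)" by (simp add: power_mult_distrib power2_eq_square)
  also have "\<dots> \<le> l\<^sup>2 * exp K * ((1 + K) * \<bar>z\<bar>)"
    using z K by (intro mult_left_mono mult_right_mono) auto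
  finally show "\<bar>exp (l * z) - 1 - l * z\<bar> \<le> l\<^sup>2 * ((1 + K) * exp K) * \<bar>z\<bar>" by (simp add: mult_ac)
qed

context rate_kernel begin

lemma integrable_tilt:
  assumes h: "bounded_tilt h" and x: "x \<in> space \<X>"
  shows "integrable (r x) (h s x)"
proof -
  obtain K where K: "\<And>s x y. x \<in> space \<X> \<Longrightarrow> y \<in> space \<X> \<Longrightarrow> \<bar>h s x y\<bar> \<le> K"
    by (rule bounded_tiltE[OF h]) (rule that)
  show ?thesis by (rule integrable_r_bounded[OF x bounded_tilt_measurable_r(1)[OF h x] K[OF x]])
qed

lemma contraction_measurable:
  assumes \<alpha>: "(\<lambda>(s, x, y). \<alpha> s x y) \<in> borel_measurable (borel \<Otimes>\<^sub>M \<X> \<Otimes>\<^sub>M \<X>)"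
    and [measurable]: "a \<in> borel_measurable N" "b \<in> measurable N \<X>"
  shows "(\<lambda>w. contraction r \<alpha> (a w) (b w)) \<in> borel_measurable N"
  unfolding contraction_def
proof (rule integral_r_measurable)
  show "(\<lambda>(w, y). \<alpha> (a w) (b w) y) \<in> borel_measurable (N \<Otimes>\<^sub>M \<X>)"
    unfolding case_prod_beta by (rule measurable3_compose[OF \<alpha>]) measurable
qed fact

lemma bounded_tilt_measurable3:
  "bounded_tilt h \<Longrightarrow> (\<lambda>(s, x, y). h s x y) \<in> borel_measurable (borel \<Otimes>\<^sub>M \<X> \<Otimes>\<^sub>M \<X>)"
  by (simp add: bounded_tilt_def)

lemma set_integrable_contraction:
  assumes h: "bounded_tilt h" and x: "x \<in> space \<X>"
  shows "set_integrable lborel {a..b} (\<lambda>u. contraction r h u x)"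
proof -
  obtain K where K: "\<And>s x y. x \<in> space \<X> \<Longrightarrow> y \<in> space \<X> \<Longrightarrow> \<bar>h s x y\<bar> \<le> K"
    by (rule bounded_tiltE[OF h]) (rule that)
  have m: "(\<lambda>u. contraction r h u x) \<in> borel_measurable borel"
    by (rule contraction_measurable[OF bounded_tilt_measurable3[OF h]]) (use x in auto)
  have b: "\<bar>contraction r h u x\<bar> \<le> \<bar>K\<bar> * rate x" for u
  proof -
    interpret finite_measure "r x" by (rule finite_measure_r[OF x])
    have "\<bar>contraction r h u x\<bar> \<le> (\<integral>y. \<bar>h u x y\<bar> \<partial>r x)"
      unfolding contraction_def by (rule integral_abs_bound)
    also have "\<dots> \<le> (\<integral>y. \<bar>K\<bar> \<partial>r x)"
      using integrable_tilt[OF h x, of u] K[OF x]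
      by (intro integral_mono) (auto simp: space_r[OF x] intro: order_trans[OF _ abs_ge_self])
    also have "\<dots> = \<bar>K\<bar> * rate x" by (simp add: total_rate_def space_r[OF x])
    finally show ?thesis .
  qed
  have "set_integrable lborel {a..b} (\<lambda>_. \<bar>K\<bar> * rate x)"
    by (rule borel_integrable_atLeastAtMost') auto
  then show ?thesis
    unfolding set_integrable_def
    by (rule Bochner_Integration.integrable_bound)
      (use b rate_pos[OF x] m in \<open>auto simp: indicator_def abs_mult\<close>)
qed

text \<open>The pointwise bounds are integrated against \<open>r x\<close>. The estimate is thus in
  terms of the contraction of \<open>\<bar>g\<bar>\<close>, which Condition C controls, and not of
  the total rate, which may be unbounded.\<close>

lemma excess_rate_bounds:
  assumes g: "bounded_tilt g" and x: "x \<in> space \<X>" and K: "\<And>y. y \<in> space \<X> \<Longrightarrow> \<bar>g s x y\<bar> \<le> K"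
    and l: "\<bar>l\<bar> \<le> 1"
  defines "c \<equiv> contraction r (\<lambda>s x y. \<bar>g s x y\<bar>) s x"
  shows "\<bar>excess_rate (\<lambda>s x y. l * g s x y) s x\<bar> \<le> \<bar>l\<bar> * ((1 + K) * exp K) * c"
    "\<bar>excess_rate (\<lambda>s x y. l * g s x y) s x - l * contraction r g s x\<bar> \<le> l\<^sup>2 * ((1 + K) * exp K) * c"
proof -
  interpret finite_measure "r x" by (rule finite_measure_r[OF x])
  note ie = integrable_exp_tilt[OF bounded_tilt_scale[OF g] x, of l s]
  note ig = integrable_tilt[OF g x, of s]
  note ia = integrable_tilt[OF bounded_tilt_abs[OF g] x, of s]
  have one: "rate x = (\<integral>y. 1 \<partial>r x)" by (simp add: total_rate_def space_r[OF x])
  have e1: "excess_rate (\<lambda>s x y. l * g s x y) s x = (\<integral>y. exp (l * g s x y) - 1 \<partial>r x)"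
    unfolding excess_rate_def tilted_rate_def one using ie by simp
  have e2: "excess_rate (\<lambda>s x y. l * g s x y) s x - l * contraction r g s x = (\<integral>y. exp (l * g s x y) - 1 - l * g s x y \<partial>r x)"
    unfolding e1 contraction_def using ie ig by simp
  have "\<bar>excess_rate (\<lambda>s x y. l * g s x y) s x\<bar> \<le> (\<integral>y. \<bar>exp (l * g s x y) - 1\<bar> \<partial>r x)"
    unfolding e1 by (rule integral_abs_bound)
  also have "\<dots> \<le> (\<integral>y. \<bar>l\<bar> * ((1 + K) * exp K) * \<bar>g s x y\<bar> \<partial>r x)"
    using ie ia K exp_scaled_bounds(1)[OF _ l] by (intro integral_mono) (auto simp: space_r[OF x])
  finally show "\<bar>excess_rate (\<lambda>s x y. l * g s x y) s x\<bar> \<le> \<bar>l\<bar> * ((1 + K) * exp K) * c"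
    by (simp add: c_def contraction_def)
  have "\<bar>excess_rate (\<lambda>s x y. l * g s x y) s x - l * contraction r g s x\<bar> \<le> (\<integral>y. \<bar>exp (l * g s x y) - 1 - l * g s x y\<bar> \<partial>r x)"
    unfolding e2 by (rule integral_abs_bound)
  also have "\<dots> \<le> (\<integral>y. l\<^sup>2 * ((1 + K) * exp K) * \<bar>g s x y\<bar> \<partial>r x)"
    using ie ig ia K exp_scaled_bounds(2)[OF _ l] by (intro integral_mono) (auto simp: space_r[OF x])
  finally show "\<bar>excess_rate (\<lambda>s x y. l * g s x y) s x - l * contraction r g s x\<bar> \<le> l\<^sup>2 * ((1 + K) * exp K) * c"
    by (simp add: c_def contraction_def)
qed

lemma contraction_abs_nonneg: "0 \<le> contraction r (\<lambda>s x y. \<bar>g s x y\<bar>) s x"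
  by (simp add: contraction_def)

end

context tilted_process begin

text \<open>A path that has not exploded visits finitely many states, so local integrability in time
  at each single state is enough.\<close>

lemma path_integrable:
  fixes \<phi> :: "real \<Rightarrow> 'a \<Rightarrow> real"
  assumes w: "\<omega> \<in> space M" and \<phi>: "\<And>a b x. x \<in> space \<X> \<Longrightarrow> set_integrable lborel {a..b} (\<lambda>u. \<phi> u x)"
    and s: "0 \<le> s" "s < T m \<omega>"
  shows "set_integrable lborel {0..s} (\<lambda>u. \<phi> u (X \<omega> u))"
proof -
  from slice_exists[OF w s] obtain n where n: "T n \<omega> \<le> s" "s < T (Suc n) \<omega>" by blast
  show ?thesis
    using path_integral_slice[where \<phi> = \<phi>, OF w \<phi> n(1) less_imp_le[OF n(2)]] by blast
qed

lemma jsum_bounds: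
  assumes w: "\<omega> \<in> space M" and s: "0 \<le> s" "s \<le> t'" "t' < T m \<omega>"
  shows "\<bar>jsum \<alpha> s \<omega>\<bar> \<le> jsum (\<lambda>s x y. \<bar>\<alpha> s x y\<bar>) s \<omega>"
    "jsum (\<lambda>s x y. \<bar>\<alpha> s x y\<bar>) s \<omega> \<le> jsum (\<lambda>s x y. \<bar>\<alpha> s x y\<bar>) t' \<omega>"
proof -
  have "s < T m \<omega>" "0 \<le> t'" using s by auto
  from slice_exists[OF w s(1) this(1)] obtain n where n: "T n \<omega> \<le> s" "s < T (Suc n) \<omega>" by blast
  from slice_exists[OF w \<open>0 \<le> t'\<close> s(3)] obtain N where N: "T N \<omega> \<le> t'" "t' < T (Suc N) \<omega>" by blast
  show "\<bar>jsum \<alpha> s \<omega>\<bar> \<le> jsum (\<lambda>s x y. \<bar>\<alpha> s x y\<bar>) s \<omega>"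
    unfolding jsum_slice[OF w n] by (rule sum_abs)
  have "T n \<omega> < T (Suc N) \<omega>" using n N s by simp
  then have "n \<le> N" using strict_mono_less[OF T_strict_mono[OF w]] by auto
  then show "jsum (\<lambda>s x y. \<bar>\<alpha> s x y\<bar>) s \<omega> \<le> jsum (\<lambda>s x y. \<bar>\<alpha> s x y\<bar>) t' \<omega>"
    unfolding jsum_slice[OF w n] jsum_slice[OF w N] by (intro sum_mono2) auto
qed

lemma jsum_scale: "jsum (\<lambda>s x y. l * \<alpha> s x y) s \<omega> = l * jsum \<alpha> s \<omega>"
  by (simp add: jsum_def sum_distrib_left)

lemma jsum_abs_nonneg: "0 \<le> jsum (\<lambda>s x y. \<bar>\<alpha> s x y\<bar>) s \<omega>"
  by (simp add: jsum_def sum_nonneg)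

end

text \<open>The exponential moment is Condition C for a bounded \<open>g\<close> in real-valued
  form; \<open>condition_C_exp_moment\<close> makes the translation.\<close>

locale perturbed_base = base_process \<X> r \<nu> t M T Y
  for \<X> :: "'a measure" and r \<nu> t and M :: "'w measure" and T Y +
  fixes g :: "real \<Rightarrow> 'a \<Rightarrow> 'a \<Rightarrow> real" and K \<theta> :: real
  assumes g: "bounded_tilt g"
    and K: "\<And>s x y. x \<in> space \<X> \<Longrightarrow> y \<in> space \<X> \<Longrightarrow> \<bar>g s x y\<bar> \<le> K" and K_nonneg: "0 \<le> K"
    and \<theta>: "0 < \<theta>" and exp_moment: "(\<integral>\<^sup>+\<omega>. ennreal (exp (\<theta> *
      (LINT u:{0..t}|lborel. contraction r (\<lambda>s x y. \<bar>g s x y\<bar>) u (X \<omega> u)))) \<partial>M) < \<infinity>"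
begin

abbreviation gl :: "real \<Rightarrow> real \<Rightarrow> 'a \<Rightarrow> 'a \<Rightarrow> real" where
  "gl l \<equiv> (\<lambda>s x y. l * g s x y)"

definition A :: "'w \<Rightarrow> real" where
  "A \<omega> = (LINT u:{0..t}|lborel. contraction r (\<lambda>s x y. \<bar>g s x y\<bar>) u (X \<omega> u))"

definition W :: "'w \<Rightarrow> real" where
  "W \<omega> = jsum (\<lambda>s x y. \<bar>g s x y\<bar>) t \<omega> + A \<omega>"

text \<open>The constant of \<open>exp_scaled_bounds\<close>, for the bound \<open>K\<close> of
  \<open>g\<close>.\<close>

definition C0 :: real where "C0 = (1 + K) * exp K"

text \<open>This is \<open>G_functional\<close> with \<open>jsum\<close> in place of
  \<open>jump_sum\<close>, a form whose joint measurability in time and \<open>\<omega>\<close> is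
  at hand. \<open>G_functional_eq\<close> identifies the two for the final statement.\<close>

definition G :: "real \<Rightarrow> 'w \<Rightarrow> real" where
  "G s \<omega> = jsum g s \<omega> - (LINT u:{0..s}|lborel. contraction r g u (X \<omega> u))"

lemma C0_ge_1: "1 \<le> C0"
proof -
  have "1 * 1 \<le> (1 + K) * exp K" using K_nonneg by (intro mult_mono) auto
  then show ?thesis by (simp add: C0_def)
qed

lemma gl: "bounded_tilt (gl l)"
  by (rule bounded_tilt_scale[OF g])

lemma contraction_case_measurable:
  "bounded_tilt h \<Longrightarrow> (\<lambda>(u, x). contraction r h u x) \<in> borel_measurable (borel \<Otimes>\<^sub>M \<X>)"
  unfolding case_prod_beta by (rule contraction_measurable[OF bounded_tilt_measurable3]) auto

lemma A_measurable: "A \<in> borel_measurable M"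
  unfolding A_def[abs_def]
  by (rule time_integral_measurable[OF contraction_case_measurable[OF bounded_tilt_abs[OF g]]]) auto

lemma W_measurable: "W \<in> borel_measurable M"
  unfolding W_def[abs_def]
  by (intro borel_measurable_add A_measurable
      jsum_measurable[OF bounded_tilt_measurable3[OF bounded_tilt_abs[OF g]]]) auto

lemma G_measurable:
  assumes "a \<in> borel_measurable N" "b \<in> measurable N M"
  shows "(\<lambda>w. G (a w) (b w)) \<in> borel_measurable N"
  unfolding G_def
  by (intro borel_measurable_diff time_integral_measurable[OF contraction_case_measurable[OF g]]
      jsum_measurable[OF bounded_tilt_measurable3[OF g]] assms)

lemma A_nonneg: "0 \<le> A \<omega>"
  unfolding A_def set_lebesgue_integral_def
  by (intro integral_nonneg_AE AE_I2 scaleR_nonneg_nonneg contraction_abs_nonneg) auto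

lemma W_nonneg: "0 \<le> W \<omega>"
  unfolding W_def by (intro add_nonneg_nonneg jsum_abs_nonneg A_nonneg)

text \<open>One variable \<open>W\<close>, taken at the final time \<open>t\<close>, serves all
  \<open>s\<close>, since the sums and integrals of \<open>\<bar>g\<bar>\<close> grow with
  \<open>s\<close>. The jump part of the log-density is exactly linear in \<open>l\<close>, so the
  quadratic error stems from the drift alone.\<close>

lemma log_density_bounds:
  assumes w: "\<omega> \<in> space M" and m: "t < T m \<omega>" and s: "0 \<le> s" "s \<le> t" and l: "\<bar>l\<bar> \<le> 1"
  shows "\<bar>jsum (gl l) s \<omega> - (LINT u:{0..s}|lborel. excess_rate (gl l) u (X \<omega> u))\<bar> \<le> \<bar>l\<bar> * C0 * W \<omega>"
    "\<bar>jsum (gl l) s \<omega> - (LINT u:{0..s}|lborel. excess_rate (gl l) u (X \<omega> u)) - l * G s \<omega>\<bar> \<le> l\<^sup>2 * C0 * W \<omega>"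
    "\<bar>G s \<omega>\<bar> \<le> W \<omega>"
proof -
  let ?c = "\<lambda>u. contraction r (\<lambda>s x y. \<bar>g s x y\<bar>) u (X \<omega> u)"
  have sm: "s < T m \<omega>" using s m by simp
  note i_ex = path_integrable[where \<phi> = "excess_rate (gl l)", OF w set_integrable_excess_rate[OF gl] s(1) sm]
  note i_g = path_integrable[where \<phi> = "contraction r g", OF w set_integrable_contraction[OF g] s(1) sm]
  note i_a = path_integrable[where \<phi> = "contraction r (\<lambda>s x y. \<bar>g s x y\<bar>)", OF w set_integrable_contraction[OF bounded_tilt_abs[OF g]] s(1) sm]
  note i_at = path_integrable[where \<phi> = "contraction r (\<lambda>s x y. \<bar>g s x y\<bar>)", OF w set_integrable_contraction[OF bounded_tilt_abs[OF g]] t_nonneg m]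
  define As where "As = (LINT u:{0..s}|lborel. ?c u)"
  have As: "As \<le> A \<omega>"
    unfolding As_def A_def set_lebesgue_integral_def
    using i_a i_at s by (intro integral_mono) (auto simp: set_integrable_def indicator_def contraction_abs_nonneg)

  define J where "J = jsum (\<lambda>s x y. \<bar>g s x y\<bar>) t \<omega>"
  have J: "\<bar>jsum g s \<omega>\<bar> \<le> J"
    using jsum_bounds[OF w s m, of g] by (simp add: J_def)
  have bound: "\<bar>LINT u:{0..s}|lborel. f u\<bar> \<le> c * As"
    if f: "set_integrable lborel {0..s} f" and b: "\<And>u. \<bar>f u\<bar> \<le> c * ?c u" for f c
  proof -
    have "\<bar>LINT u:{0..s}|lborel. f u\<bar> \<le> (LINT u|lborel. \<bar>indicator {0..s} u *\<^sub>R f u\<bar>)"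
      unfolding set_lebesgue_integral_def by (rule integral_abs_bound)
    also have "\<dots> \<le> (LINT u|lborel. c * (indicator {0..s} u *\<^sub>R ?c u))"
      using f i_a b by (intro integral_mono) (auto simp: set_integrable_def indicator_def)
    also have "\<dots> = c * As" by (simp add: As_def set_lebesgue_integral_def)
    finally show ?thesis .
  qed
  have X: "X \<omega> u \<in> space \<X>" for u by (rule X_space[OF w])
  note eb = excess_rate_bounds[OF g X K[OF X] l, folded C0_def]
  have b1: "\<bar>LINT u:{0..s}|lborel. excess_rate (gl l) u (X \<omega> u)\<bar> \<le> \<bar>l\<bar> * C0 * As"
    by (rule bound[OF i_ex eb(1)])
  have "\<bar>LINT u:{0..s}|lborel. excess_rate (gl l) u (X \<omega> u) - l * contraction r g u (X \<omega> u)\<bar> \<le> l\<^sup>2 * C0 * As"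
    by (rule bound[OF set_integral_diff(1)[OF i_ex set_integrable_mult_right[OF i_g]] eb(2)])
  moreover have "(LINT u:{0..s}|lborel. excess_rate (gl l) u (X \<omega> u) - l * contraction r g u (X \<omega> u))
      = (LINT u:{0..s}|lborel. excess_rate (gl l) u (X \<omega> u)) - l * (LINT u:{0..s}|lborel. contraction r g u (X \<omega> u))"
    using set_integral_diff(2)[OF i_ex set_integrable_mult_right[OF i_g, of l]] by simp
  ultimately have b2: "\<bar>(LINT u:{0..s}|lborel. excess_rate (gl l) u (X \<omega> u)) - l * (LINT u:{0..s}|lborel. contraction r g u (X \<omega> u))\<bar> \<le> l\<^sup>2 * C0 * As"
    by simp
  have "\<bar>contraction r g u (X \<omega> u)\<bar> \<le> 1 * ?c u" for u
    unfolding contraction_def by (simp add: integral_abs_bound)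
  from bound[OF i_g this] have b3: "\<bar>LINT u:{0..s}|lborel. contraction r g u (X \<omega> u)\<bar> \<le> As" by simp
  have W: "W \<omega> = J + A \<omega>" by (simp add: W_def J_def)
  have J0: "0 \<le> J" using J by linarith
  have "\<bar>l * jsum g s \<omega>\<bar> \<le> \<bar>l\<bar> * 1 * J" using J by (simp add: abs_mult mult_left_mono)
  also have "\<dots> \<le> \<bar>l\<bar> * C0 * J" using C0_ge_1 J0 by (intro mult_right_mono mult_left_mono) auto
  finally have j: "\<bar>l * jsum g s \<omega>\<bar> \<le> \<bar>l\<bar> * C0 * J" .
  have m1: "\<bar>l\<bar> * C0 * As \<le> \<bar>l\<bar> * C0 * A \<omega>" using As C0_ge_1 by (intro mult_left_mono) auto
  have m2: "l\<^sup>2 * C0 * As \<le> l\<^sup>2 * C0 * W \<omega>" using As C0_ge_1 J0 W by (intro mult_left_mono) auto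
  show "\<bar>jsum (gl l) s \<omega> - (LINT u:{0..s}|lborel. excess_rate (gl l) u (X \<omega> u))\<bar> \<le> \<bar>l\<bar> * C0 * W \<omega>"
    using j b1 m1 unfolding W jsum_scale by (simp add: distrib_left abs_le_iff)
  show "\<bar>jsum (gl l) s \<omega> - (LINT u:{0..s}|lborel. excess_rate (gl l) u (X \<omega> u)) - l * G s \<omega>\<bar> \<le> l\<^sup>2 * C0 * W \<omega>"
    using b2 m2 unfolding jsum_scale G_def by (simp add: right_diff_distrib abs_le_iff)
  show "\<bar>G s \<omega>\<bar> \<le> W \<omega>" using J b3 As unfolding G_def W by linarith
qed

text \<open>\<open>exp (\<kappa> W)\<close> is the geometric mean of the density of the tilt \<open>2 \<kappa> |g|\<close>, of mass at most \<open>1\<close>, and of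
  \<open>exp (R + 2 \<kappa> A)\<close> with \<open>R\<close> at most a multiple of \<open>\<kappa> A\<close>.\<close>

lemma exp_moment_W: "\<exists>c>0. (\<integral>\<^sup>+\<omega>. ennreal (exp (c * W \<omega>)) \<partial>M) < \<infinity>"
proof -
  \<comment> \<open>The bound \<open>1 / 2\<close> allows \<open>excess_rate_bounds\<close> to be
    used at \<open>l = 2 * \<kappa>\<close>. The other one makes the leftover exponent
    \<open>2 * \<kappa> * (1 + C0) * A \<omega>\<close> at most
    \<open>\<theta> * A \<omega>\<close>.\<close>
  define \<kappa> where "\<kappa> = min (1 / 2) (\<theta> / (2 * (1 + C0)))"
  have \<kappa>: "0 < \<kappa>" "2 * \<kappa> \<le> 1" "2 * \<kappa> * (1 + C0) \<le> \<theta>"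
  proof -
    show "0 < \<kappa>" "2 * \<kappa> \<le> 1" using \<theta> C0_ge_1 by (auto simp: \<kappa>_def)
    have "\<kappa> * (2 * (1 + C0)) \<le> \<theta> / (2 * (1 + C0)) * (2 * (1 + C0))"
      using C0_ge_1 by (intro mult_right_mono) (auto simp: \<kappa>_def)
    then show "2 * \<kappa> * (1 + C0) \<le> \<theta>" using C0_ge_1 by (simp add: mult_ac)
  qed
  let ?h = "\<lambda>s x y. 2 * \<kappa> * \<bar>g s x y\<bar>"
  note ga = bounded_tilt_abs[OF g]
  have h: "bounded_tilt ?h" by (rule bounded_tilt_scale[OF ga])
  have "AE \<omega> in M. exp (\<kappa> * W \<omega>) \<le> path_density ?h t \<omega> + exp (\<theta> * A \<omega>)"
    using finite_jumps AE_space
  proof eventually_elim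
    case (elim \<omega>)
    then obtain m where m: "t < T m \<omega>" by auto
    have w: "\<omega> \<in> space M" by fact
    note X = X_space[OF w]
    define R where "R = (LINT u:{0..t}|lborel. excess_rate ?h u (X \<omega> u))"
    define J where "J = jsum (\<lambda>s x y. \<bar>g s x y\<bar>) t \<omega>"
    note i_at = path_integrable[where \<phi> = "contraction r (\<lambda>s x y. \<bar>g s x y\<bar>)", OF w set_integrable_contraction[OF ga] t_nonneg m]
    note i_ex = path_integrable[where \<phi> = "excess_rate ?h", OF w set_integrable_excess_rate[OF h] t_nonneg m]
    have "R \<le> (LINT u:{0..t}|lborel. 2 * \<kappa> * C0 * contraction r (\<lambda>s x y. \<bar>g s x y\<bar>) u (X \<omega> u))"
      unfolding R_def
    proof (rule set_integral_mono[OF i_ex set_integrable_mult_right[OF i_at]])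
      fix u
      show "excess_rate ?h u (X \<omega> u) \<le> 2 * \<kappa> * C0 * contraction r (\<lambda>s x y. \<bar>g s x y\<bar>) u (X \<omega> u)"
        using excess_rate_bounds(1)[OF ga X, where s = u and K = K and l = "2 * \<kappa>"] K[OF X] \<kappa>
        by (simp add: C0_def abs_le_iff)
    qed
    then have R: "R \<le> 2 * \<kappa> * C0 * A \<omega>" by (simp add: A_def)
    have D: "path_density ?h t \<omega> = exp (2 * \<kappa> * J - R)"
      by (simp add: path_density_def jsum_scale J_def R_def)
    have "R + 2 * \<kappa> * A \<omega> \<le> (2 * \<kappa> * (1 + C0)) * A \<omega>" using R by (simp add: algebra_simps)
    also have "\<dots> \<le> \<theta> * A \<omega>" using \<kappa> A_nonneg by (intro mult_right_mono) auto
    finally have RA: "R + 2 * \<kappa> * A \<omega> \<le> \<theta> * A \<omega>" .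
    have W: "\<kappa> * W \<omega> = ((2 * \<kappa> * J - R) + (R + 2 * \<kappa> * A \<omega>)) / 2" by (simp add: W_def J_def algebra_simps)
    show ?case
    proof (cases "2 * \<kappa> * J - R \<le> \<theta> * A \<omega>")
      case True
      then have "exp (\<kappa> * W \<omega>) \<le> exp (\<theta> * A \<omega>)" using W RA by simp
      then show ?thesis unfolding D using exp_gt_zero[of "2 * \<kappa> * J - R"] by linarith
    next
      case False
      then have "exp (\<kappa> * W \<omega>) \<le> exp (2 * \<kappa> * J - R)" using W RA by simp
      then show ?thesis unfolding D using exp_gt_zero[of "\<theta> * A \<omega>"] by linarith
    qed
  qed
  then have "AE \<omega> in M. ennreal (exp (\<kappa> * W \<omega>)) \<le> ennreal (path_density ?h t \<omega>) + ennreal (exp (\<theta> * A \<omega>))"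
  proof eventually_elim
    case (elim \<omega>)
    have "ennreal (exp (\<kappa> * W \<omega>)) \<le> ennreal (path_density ?h t \<omega> + exp (\<theta> * A \<omega>))"
      by (rule ennreal_leI[OF elim])
    also have "\<dots> = ennreal (path_density ?h t \<omega>) + ennreal (exp (\<theta> * A \<omega>))"
      by (rule ennreal_plus) (auto simp: path_density_def)
    finally show ?case .
  qed
  then have "(\<integral>\<^sup>+\<omega>. ennreal (exp (\<kappa> * W \<omega>)) \<partial>M) \<le> (\<integral>\<^sup>+\<omega>. ennreal (path_density ?h t \<omega>) + ennreal (exp (\<theta> * A \<omega>)) \<partial>M)"
    by (rule nn_integral_mono_AE)
  also have "\<dots> = (\<integral>\<^sup>+\<omega>. ennreal (path_density ?h t \<omega>) \<partial>M) + (\<integral>\<^sup>+\<omega>. ennreal (exp (\<theta> * A \<omega>)) \<partial>M)"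
  proof (rule nn_integral_add)
    show "(\<lambda>\<omega>. ennreal (path_density ?h t \<omega>)) \<in> borel_measurable M"
      by (intro measurable_compose[OF _ measurable_ennreal] path_density_measurable[OF h]) auto
    show "(\<lambda>\<omega>. ennreal (exp (\<theta> * A \<omega>))) \<in> borel_measurable M"
      using A_measurable by measurable
  qed
  also have "\<dots> \<le> 1 + (\<integral>\<^sup>+\<omega>. ennreal (exp (\<theta> * A \<omega>)) \<partial>M)"
    by (intro add_right_mono path_density_mass_le_1[OF h])
  also have "\<dots> < \<infinity>" using exp_moment by (simp add: A_def less_top)
  finally show ?thesis using \<kappa>(1) by blast
qed

text \<open>Explosion up to time \<open>t\<close> lies in the event \<open>T' n \<le> t\<close> for
  every \<open>n\<close>. By \<open>girsanov_chain\<close> the probability of that event is an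
  integral under the unperturbed law, whose integrand vanishes for large \<open>n\<close> on almost
  every path and is dominated by \<open>exp (c * W \<omega>)\<close>.\<close>

lemma perturbed_finite_jumps:
  assumes P': "tilted_process \<X> r \<nu> (gl l) t M' T' Y'" and l: "\<bar>l\<bar> \<le> 1" "\<bar>l\<bar> * C0 \<le> c"
    and c: "(\<integral>\<^sup>+\<omega>. ennreal (exp (c * W \<omega>)) \<partial>M) < \<infinity>"
  shows "AE \<omega> in M'. \<exists>n. t < T' n \<omega>"
proof -
  interpret P': tilted_process \<X> r \<nu> "gl l" t M' T' Y' by (rule P')
  define a where "a n \<omega> = ennreal (exp (log_weight (gl l) n \<omega>)) * indicator {\<omega>\<in>space M. T n \<omega> \<le> t} \<omega>" for n \<omega>
  have [measurable]: "log_weight (gl l) n \<in> borel_measurable M" for n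
    by (rule H_measurable_M[OF log_weight_measurable[OF gl]])
  have em: "emeasure M' {\<omega>\<in>space M'. T' n \<omega> \<le> t} = (\<integral>\<^sup>+\<omega>. a n \<omega> \<partial>M)" for n
    using girsanov_chain[OF P', of "\<lambda>_ _. 1" n] by (simp add: a_def)
  have "(\<lambda>n. \<integral>\<^sup>+\<omega>. a n \<omega> \<partial>M) \<longlonglongrightarrow> (\<integral>\<^sup>+\<omega>. 0 \<partial>M)"
  proof (rule nn_integral_dominated_convergence)
    show "a n \<in> borel_measurable M" for n unfolding a_def[abs_def] by measurable
    show "(\<lambda>\<omega>. ennreal (exp (c * W \<omega>))) \<in> borel_measurable M" using W_measurable by measurable
    show "(\<integral>\<^sup>+\<omega>. ennreal (exp (c * W \<omega>)) \<partial>M) < \<infinity>" by (rule c)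
    show "AE \<omega> in M. (\<lambda>n. a n \<omega>) \<longlonglongrightarrow> 0"
      using finite_jumps AE_space
    proof eventually_elim
      case (elim \<omega>)
      then obtain m where m: "t < T m \<omega>" by auto
      have "a n \<omega> = 0" if "m \<le> n" for n
        using T_mono[OF elim(2) that] m by (simp add: a_def)
      then show ?case by (intro tendsto_eventually eventually_sequentiallyI[of m])
    qed
    show "AE \<omega> in M. a n \<omega> \<le> ennreal (exp (c * W \<omega>))" for n
      using finite_jumps AE_space
    proof eventually_elim
      case (elim \<omega>)
      then obtain m where m: "t < T m \<omega>" by auto
      have w: "\<omega> \<in> space M" by fact
      show ?case
      proof (cases "T n \<omega> \<le> t")
        case True
        \<comment> \<open>At the time \<open>T n\<close> itself the unfinished waiting interval is a
          single point. The chain weight is therefore the path density at that time, to which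
          \<open>log_density_bounds\<close> applies.\<close>
        have z: "(LINT u:{s}|lborel. f u) = 0" for s and f :: "real \<Rightarrow> real"
          unfolding set_lebesgue_integral_def
          by (rule integral_eq_zero_AE) (rule AE_mp[OF AE_lborel_singleton[of s]], auto simp: indicator_def)
        have "exp (log_weight (gl l) n \<omega>) = path_density (gl l) (T n \<omega>) \<omega>"
          using path_density_slice[OF gl w order_refl T_less_Suc[OF w]] by (simp add: z)
        also have "\<dots> \<le> exp (\<bar>l\<bar> * C0 * W \<omega>)"
          using log_density_bounds(1)[OF w m T_nonneg[OF w] True l(1)] by (simp add: path_density_def abs_le_iff)
        also have "\<dots> \<le> exp (c * W \<omega>)" using l(2) W_nonneg by (simp add: mult_right_mono)
        finally show ?thesis using w True by (simp add: a_def)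
      qed (simp add: a_def)
    qed
  qed (auto simp: a_def)
  then have lim: "(\<lambda>n. emeasure M' {\<omega>\<in>space M'. T' n \<omega> \<le> t}) \<longlonglongrightarrow> 0" by (simp add: em)
  have "emeasure M' {\<omega>\<in>space M'. \<forall>n. T' n \<omega> \<le> t} \<le> 0"
    by (rule LIMSEQ_le_const[OF lim]) (auto intro!: exI[of _ 0] emeasure_mono)
  then have "AE \<omega> in M'. \<not> (\<forall>n. T' n \<omega> \<le> t)"
    by (subst AE_iff_measurable[OF _ refl]) auto
  then show ?thesis by eventually_elim (auto simp: not_le)
qed

end

section \<open>Linear response of time-marginal functionals\<close>

lemma has_real_derivative_of_quadratic_remainder:
  fixes f :: "real \<Rightarrow> real"
  assumes \<epsilon>: "0 < \<epsilon>" and f: "\<And>l. \<bar>l\<bar> \<le> \<epsilon> \<Longrightarrow> \<bar>f l - f0 - l * d\<bar> \<le> C * l\<^sup>2"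
  shows "(f has_real_derivative d) (at 0)"
proof -
  have f0: "f 0 = f0" using f[of 0] \<epsilon> by simp
  have "((\<lambda>l. (f l - f 0) / l) \<longlongrightarrow> d) (at 0)"
  proof (rule Lim_transform_bound[where g = "\<lambda>l. C * l", THEN LIM_zero_cancel])
    have "eventually (\<lambda>l::real. \<bar>l\<bar> < \<epsilon> \<and> l \<noteq> 0) (at 0)"
      using \<epsilon> by (auto simp: eventually_at intro!: exI[of _ \<epsilon>])
    then show "\<forall>\<^sub>F l in at 0. norm ((f l - f 0) / l - d) \<le> norm (C * l)"
    proof eventually_elim
      case (elim l)
      then have "f l - f0 - l * d = l * ((f l - f 0) / l - d)"
        by (simp add: f0 field_simps)
      then have "\<bar>l\<bar> * \<bar>(f l - f 0) / l - d\<bar> = \<bar>f l - f0 - l * d\<bar>"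
        by (simp add: abs_mult)
      also have "\<dots> \<le> C * l\<^sup>2" using f elim by auto
      also have "\<dots> \<le> \<bar>l\<bar> * (\<bar>C\<bar> * \<bar>l\<bar>)"
        by (simp add: power2_eq_square mult.left_commute[of "\<bar>l\<bar>"]) (simp add: mult_right_mono)
      finally have "\<bar>(f l - f 0) / l - d\<bar> \<le> \<bar>C\<bar> * \<bar>l\<bar>" using elim by simp
      then show ?case by (simp add: abs_mult)
    qed
    show "((\<lambda>l. C * l) \<longlongrightarrow> 0) (at 0)" by (auto intro!: tendsto_eq_intros)
  qed
  then show ?thesis by (simp add: DERIV_def)
qed

lemma exp_dominates:
  fixes c w :: real assumes c: "0 < c" and w: "0 \<le> w"
  shows "w \<le> 1 / c * exp (c * w)" "w\<^sup>2 \<le> 2 / c\<^sup>2 * exp (c * w)"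
proof -
  have e: "1 + c * w + (c * w)\<^sup>2 / 2 \<le> exp (c * w)"
    using exp_lower_Taylor_quadratic[of "c * w"] c w by simp
  have "c * w \<le> exp (c * w)" using e c w by (smt (verit) divide_nonneg_nonneg zero_le_power2)
  then show "w \<le> 1 / c * exp (c * w)" using c by (simp add: field_simps)
  have "(c * w)\<^sup>2 / 2 \<le> exp (c * w)" using e c w by (smt (verit) mult_nonneg_nonneg)
  then show "w\<^sup>2 \<le> 2 / c\<^sup>2 * exp (c * w)" using c by (simp add: field_simps power_mult_distrib)
qed

context perturbed_base begin

text \<open>The exponent \<open>c\<close> is split in halves. The condition on \<open>l\<close>
  bounds the log-density by \<open>c / 2 * W \<omega>\<close>, and the factor
  \<open>(W \<omega>)\<^sup>2\<close> of the remainder is absorbed by the other half. This produces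
  the constant \<open>8 * C0\<^sup>2 / c\<^sup>2\<close>, since
  \<open>2 / (c / 2)\<^sup>2 = 8 / c\<^sup>2\<close>.\<close>

lemma density_bounds:
  assumes w: "\<omega> \<in> space M" and m: "t < T m \<omega>" and s: "0 \<le> s" "s \<le> t"
    and c: "0 < c" and l: "\<bar>l\<bar> \<le> 1" "\<bar>l\<bar> * C0 \<le> c / 2"
  shows "path_density (gl l) s \<omega> \<le> exp (c * W \<omega>)"
    "\<bar>path_density (gl l) s \<omega> - 1 - l * G s \<omega>\<bar> \<le> l\<^sup>2 * (8 * C0\<^sup>2 / c\<^sup>2 + C0 / c) * exp (c * W \<omega>)"
    "\<bar>G s \<omega>\<bar> \<le> 1 / c * exp (c * W \<omega>)"
proof -
  define h where "h = jsum (gl l) s \<omega> - (LINT u:{0..s}|lborel. excess_rate (gl l) u (X \<omega> u))"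
  have D: "path_density (gl l) s \<omega> = exp h" by (simp add: path_density_def h_def)
  note b = log_density_bounds[OF w m s l(1), folded h_def]
  have W: "0 \<le> W \<omega>" by (rule W_nonneg)
  have "\<bar>l\<bar> * C0 * W \<omega> \<le> c / 2 * W \<omega>" using l W by (intro mult_right_mono) auto
  then have hc: "\<bar>h\<bar> \<le> c / 2 * W \<omega>" using b(1) by linarith
  have eh: "exp \<bar>h\<bar> \<le> exp (c / 2 * W \<omega>)" using hc by simp
  have ee: "exp (c / 2 * W \<omega>) * exp (c / 2 * W \<omega>) = exp (c * W \<omega>)" by (simp add: exp_add[symmetric])
  have "0 \<le> c * W \<omega>" using c W by simp
  then have "exp h \<le> exp (c * W \<omega>)" using hc by simp
  then show "path_density (gl l) s \<omega> \<le> exp (c * W \<omega>)" by (simp add: D)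
  show "\<bar>G s \<omega>\<bar> \<le> 1 / c * exp (c * W \<omega>)" using b(3) exp_dominates(1)[OF c W] by linarith
  have "\<bar>exp h - 1 - h\<bar> \<le> h\<^sup>2 * exp \<bar>h\<bar>" by (rule exp_remainder_bounds)
  also have "\<dots> \<le> (\<bar>l\<bar> * C0 * W \<omega>)\<^sup>2 * exp (c / 2 * W \<omega>)"
    using b(1) eh by (intro mult_mono) (auto simp: abs_le_square_iff[symmetric])
  also have "\<dots> = l\<^sup>2 * C0\<^sup>2 * ((W \<omega>)\<^sup>2 * exp (c / 2 * W \<omega>))" by (simp add: power_mult_distrib)
  also have "\<dots> \<le> l\<^sup>2 * C0\<^sup>2 * ((2 / (c / 2)\<^sup>2 * exp (c / 2 * W \<omega>)) * exp (c / 2 * W \<omega>))"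
    using exp_dominates(2)[of "c / 2", OF _ W] c by (intro mult_left_mono mult_right_mono) auto
  also have "\<dots> = l\<^sup>2 * (8 * C0\<^sup>2 / c\<^sup>2) * exp (c * W \<omega>)"
    by (simp add: ee[symmetric] power_divide)
  finally have 1: "\<bar>exp h - 1 - h\<bar> \<le> l\<^sup>2 * (8 * C0\<^sup>2 / c\<^sup>2) * exp (c * W \<omega>)" .
  have "\<bar>h - l * G s \<omega>\<bar> \<le> l\<^sup>2 * C0 * W \<omega>" by (rule b(2))
  also have "\<dots> \<le> l\<^sup>2 * C0 * (1 / c * exp (c * W \<omega>))"
    using exp_dominates(1)[OF c W] C0_ge_1 by (intro mult_left_mono) auto
  finally have 2: "\<bar>h - l * G s \<omega>\<bar> \<le> l\<^sup>2 * (C0 / c) * exp (c * W \<omega>)" by simp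
  have "\<bar>exp h - 1 - l * G s \<omega>\<bar> \<le> \<bar>exp h - 1 - h\<bar> + \<bar>h - l * G s \<omega>\<bar>" by linarith
  then show "\<bar>path_density (gl l) s \<omega> - 1 - l * G s \<omega>\<bar> \<le> l\<^sup>2 * (8 * C0\<^sup>2 / c\<^sup>2 + C0 / c) * exp (c * W \<omega>)"
    using 1 2 unfolding D by (simp add: distrib_left distrib_right)
qed

text \<open>The measure \<open>\<mu>\<close> on times is the point mass at \<open>t\<close> in part (1) and Lebesgue measure on \<open>[0, t]\<close> in
  parts (2) and (3).\<close>

lemma response:
  fixes \<mu> :: "real measure" and \<psi> :: "real \<Rightarrow> real \<Rightarrow> 'a \<Rightarrow> real" and \<psi>' B :: "real \<Rightarrow> 'a \<Rightarrow> real"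
  assumes \<mu>: "sigma_finite_measure \<mu>" "sets \<mu> = sets borel" "AE s in \<mu>. 0 \<le> s \<and> s \<le> t"
    and \<psi>: "\<And>l. (\<lambda>(s, x). \<psi> l s x) \<in> borel_measurable (borel \<Otimes>\<^sub>M \<X>)"
    and \<psi>': "(\<lambda>(s, x). \<psi>' s x) \<in> borel_measurable (borel \<Otimes>\<^sub>M \<X>)"
    and B: "(\<lambda>(s, x). B s x) \<in> borel_measurable (borel \<Otimes>\<^sub>M \<X>)"
    and bounds: "\<And>s x. x \<in> space \<X> \<Longrightarrow> \<bar>\<psi> 0 s x\<bar> \<le> B s x" "\<And>s x. x \<in> space \<X> \<Longrightarrow> \<bar>\<psi>' s x\<bar> \<le> C * B s x"
      "\<And>l s x. \<bar>l\<bar> \<le> 1 \<Longrightarrow> x \<in> space \<X> \<Longrightarrow> \<bar>\<psi> l s x - \<psi> 0 s x - l * \<psi>' s x\<bar> \<le> C * l\<^sup>2 * B s x"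
    and C: "0 \<le> C" and c: "0 < c"
    and fin: "(\<integral>\<^sup>+s. (\<integral>\<^sup>+\<omega>. ennreal (B s (X \<omega> s)) * ennreal (exp (c * W \<omega>)) \<partial>M) \<partial>\<mu>) < \<infinity>"
  defines "p \<equiv> \<mu> \<Otimes>\<^sub>M M"
  shows "\<And>l. \<bar>l\<bar> \<le> 1 \<Longrightarrow> \<bar>l\<bar> * C0 \<le> c / 2 \<Longrightarrow>
      integrable p (\<lambda>(s, \<omega>). path_density (gl l) s \<omega> * \<psi> l s (X \<omega> s))"
    "integrable p (\<lambda>(s, \<omega>). \<psi>' s (X \<omega> s))" "integrable p (\<lambda>(s, \<omega>). \<psi> 0 s (X \<omega> s) * G s \<omega>)"
    "((\<lambda>l. \<integral>(s, \<omega>). path_density (gl l) s \<omega> * \<psi> l s (X \<omega> s) \<partial>p) has_real_derivative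
      (\<integral>(s, \<omega>). \<psi>' s (X \<omega> s) \<partial>p) + (\<integral>(s, \<omega>). \<psi> 0 s (X \<omega> s) * G s \<omega> \<partial>p)) (at 0)"
proof -
  interpret \<mu>: sigma_finite_measure \<mu> by fact
  interpret pr: pair_sigma_finite \<mu> M ..
  note [measurable_cong] = \<mu>(2)
  have fst_m: "fst \<in> borel_measurable p" and snd_m: "snd \<in> measurable p M"
    unfolding p_def by measurable
  note Xm = X_compose_measurable[OF fst_m snd_m]
  have comp: "(\<lambda>z. f (fst z) (X (snd z) (fst z))) \<in> borel_measurable p"
    if "(\<lambda>(s, x). f s x) \<in> borel_measurable (borel \<Otimes>\<^sub>M \<X>)" for f :: "real \<Rightarrow> 'a \<Rightarrow> real"
    using measurable_compose[OF measurable_Pair[OF fst_m Xm] that] by simp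
  note \<psi>_m = comp[OF \<psi>] note \<psi>'_m = comp[OF \<psi>'] note B_m = comp[OF B]
  have D_m: "(\<lambda>z. path_density (gl l) (fst z) (snd z)) \<in> borel_measurable p" for l
    by (rule path_density_measurable[OF gl fst_m snd_m])
  have G_m: "(\<lambda>z. G (fst z) (snd z)) \<in> borel_measurable p"
    by (rule G_measurable[OF fst_m snd_m])
  have W_m: "(\<lambda>z. W (snd z)) \<in> borel_measurable p"
    by (rule measurable_compose[OF snd_m W_measurable])
  define E where "E z = B (fst z) (X (snd z) (fst z)) * exp (c * W (snd z))" for z
  have E_m: "E \<in> borel_measurable p"
    unfolding E_def[abs_def]
    by (intro borel_measurable_times B_m measurable_compose[OF _ borel_measurable_exp] borel_measurable_const W_m)
  \<comment> \<open>Almost every pair consists of a time in \<open>[0, t]\<close> and a path that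
    has not exploded by \<open>t\<close>. On such pairs the bounds that follow are
    pointwise.\<close>
  define good where "good z \<longleftrightarrow> 0 \<le> fst z \<and> fst z \<le> t \<and> (\<exists>m. t < T m (snd z)) \<and> snd z \<in> space M" for z
  have "AE z in p. 0 \<le> fst z \<and> fst z \<le> t \<and> (\<exists>m. t < T m (snd z))"
    unfolding p_def
  proof (rule pr.AE_pair_measure)
    show "{z \<in> space (\<mu> \<Otimes>\<^sub>M M). 0 \<le> fst z \<and> fst z \<le> t \<and> (\<exists>m. t < T m (snd z))} \<in> sets (\<mu> \<Otimes>\<^sub>M M)"
      using fst_m snd_m unfolding p_def by measurable
    show "AE s in \<mu>. AE \<omega> in M. 0 \<le> fst (s, \<omega>) \<and> fst (s, \<omega>) \<le> t \<and> (\<exists>m. t < T m (snd (s, \<omega>)))"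
      using \<mu>(3) finite_jumps by (auto elim!: eventually_mono)
  qed
  then have good: "AE z in p. good z"
    using AE_space by eventually_elim (auto simp: good_def p_def space_pair_measure)
  have B_nn: "0 \<le> B s x" if "x \<in> space \<X>" for s x
    using bounds(1)[OF that] by (meson abs_ge_zero order_trans)
  have E_nn: "0 \<le> E z" if "good z" for z
    using that B_nn[OF X_space] by (auto simp: E_def good_def)
  have "(\<integral>\<^sup>+z. ennreal (E z) \<partial>p) = (\<integral>\<^sup>+s. \<integral>\<^sup>+\<omega>. ennreal (E (s, \<omega>)) \<partial>M \<partial>\<mu>)"
    unfolding p_def
    using E_m by (intro nn_integral_fst[where f = "\<lambda>z. ennreal (E z)", symmetric]) (simp add: p_def)
  also have "\<dots> = (\<integral>\<^sup>+s. (\<integral>\<^sup>+\<omega>. ennreal (B s (X \<omega> s)) * ennreal (exp (c * W \<omega>)) \<partial>M) \<partial>\<mu>)"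
    by (simp add: E_def ennreal_mult'')
  finally have E_fin: "(\<integral>\<^sup>+z. ennreal (E z) \<partial>p) < \<infinity>" using fin by simp
  have E_int: "integrable p E"
    by (rule integrableI_nonneg[OF E_m _ E_fin]) (use good E_nn in \<open>auto elim: eventually_mono\<close>)
  have dominated: "integrable p f" if "f \<in> borel_measurable p" "\<And>z. good z \<Longrightarrow> \<bar>f z\<bar> \<le> k * E z" for f k
  proof (rule Bochner_Integration.integrable_bound)
    show "integrable p (\<lambda>z. k * E z)" using E_int by simp
    show "AE z in p. norm (f z) \<le> norm (k * E z)"
      using good by eventually_elim (use that(2) in \<open>force intro: order_trans[OF _ abs_ge_self]\<close>)
  qed fact
  have goodD: "snd z \<in> space M" "\<exists>m. t < T m (snd z)" "0 \<le> fst z" "fst z \<le> t" if "good z" for z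
    using that by (auto simp: good_def)
  define k where "k = 8 * C0\<^sup>2 / c\<^sup>2 + C0 / c"
  have k: "0 \<le> k" using c C0_ge_1 by (simp add: k_def)
  have e1: "1 \<le> exp (c * W \<omega>)" for \<omega> using c W_nonneg[of \<omega>] by simp
  show int1: "integrable p (\<lambda>(s, \<omega>). path_density (gl l) s \<omega> * \<psi> l s (X \<omega> s))"
    if l: "\<bar>l\<bar> \<le> 1" "\<bar>l\<bar> * C0 \<le> c / 2" for l
    unfolding case_prod_beta
  proof (rule dominated[of _ "1 + 2 * C"])
    fix z assume z: "good z"
    let ?s = "fst z" let ?w = "snd z" let ?x = "X ?w ?s" let ?D = "path_density (gl l) ?s ?w"
    from goodD(2)[OF z] obtain m where m: "t < T m ?w" by blast
    have x: "?x \<in> space \<X>" by (rule X_space[OF goodD(1)[OF z]])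
    note d = density_bounds[OF goodD(1)[OF z] m goodD(3,4)[OF z] c l]
    have l2: "l\<^sup>2 \<le> 1" using l by (simp add: abs_square_le_1)
    have "\<bar>\<psi> l ?s ?x\<bar> \<le> \<bar>\<psi> l ?s ?x - \<psi> 0 ?s ?x - l * \<psi>' ?s ?x\<bar> + \<bar>\<psi> 0 ?s ?x\<bar> + \<bar>l * \<psi>' ?s ?x\<bar>" by linarith
    also have "\<dots> \<le> C * l\<^sup>2 * B ?s ?x + B ?s ?x + 1 * (C * B ?s ?x)"
      unfolding abs_mult using bounds(1)[OF x] bounds(3)[OF l(1) x] mult_mono[OF l(1) bounds(2)[OF x]]
      by (intro add_mono) auto
    also have "\<dots> \<le> (1 + 2 * C) * B ?s ?x"
      using mult_right_mono[OF mult_left_mono[OF l2 C] B_nn[OF x], of ?s] by (simp add: algebra_simps)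
    finally have p: "\<bar>\<psi> l ?s ?x\<bar> \<le> (1 + 2 * C) * B ?s ?x" .
    have "\<bar>?D * \<psi> l ?s ?x\<bar> \<le> exp (c * W ?w) * ((1 + 2 * C) * B ?s ?x)"
      unfolding abs_mult using d(1) p by (intro mult_mono) (auto simp: path_density_def)
    then show "\<bar>?D * \<psi> l ?s ?x\<bar> \<le> (1 + 2 * C) * E z" by (simp add: E_def mult_ac)
  qed (intro borel_measurable_times D_m \<psi>_m)
  have b2: "\<bar>\<psi>' (fst z) (X (snd z) (fst z))\<bar> \<le> C * E z" if z: "good z" for z
  proof -
    have x: "X (snd z) (fst z) \<in> space \<X>" by (rule X_space[OF goodD(1)[OF z]])
    have "\<bar>\<psi>' (fst z) (X (snd z) (fst z))\<bar> \<le> C * B (fst z) (X (snd z) (fst z)) * 1" using bounds(2)[OF x] by simp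
    also have "\<dots> \<le> C * B (fst z) (X (snd z) (fst z)) * exp (c * W (snd z))"
      using e1 C B_nn[OF x] by (intro mult_left_mono) auto
    finally show ?thesis by (simp add: E_def mult_ac)
  qed
  show int2: "integrable p (\<lambda>(s, \<omega>). \<psi>' s (X \<omega> s))"
    unfolding case_prod_beta by (rule dominated[OF \<psi>'_m b2])
  have G_b: "\<bar>G (fst z) (snd z)\<bar> \<le> 1 / c * exp (c * W (snd z))" if z: "good z" for z
  proof -
    from goodD(2)[OF z] obtain m where m: "t < T m (snd z)" by blast
    show ?thesis by (rule density_bounds(3)[OF goodD(1)[OF z] m goodD(3,4)[OF z] c, of 0]) (use c in auto)
  qed
  show int3: "integrable p (\<lambda>(s, \<omega>). \<psi> 0 s (X \<omega> s) * G s \<omega>)"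
    unfolding case_prod_beta
  proof (rule dominated[of _ "1 / c"])
    fix z assume z: "good z"
    have x: "X (snd z) (fst z) \<in> space \<X>" by (rule X_space[OF goodD(1)[OF z]])
    have "\<bar>\<psi> 0 (fst z) (X (snd z) (fst z)) * G (fst z) (snd z)\<bar>
        \<le> B (fst z) (X (snd z) (fst z)) * (1 / c * exp (c * W (snd z)))"
      unfolding abs_mult using bounds(1)[OF x] G_b[OF z] by (intro mult_mono) (auto intro: B_nn[OF x])
    then show "\<bar>\<psi> 0 (fst z) (X (snd z) (fst z)) * G (fst z) (snd z)\<bar> \<le> 1 / c * E z"
      by (simp add: E_def mult_ac)
  qed (intro borel_measurable_times \<psi>_m G_m)
  have int0: "integrable p (\<lambda>(s, \<omega>). \<psi> 0 s (X \<omega> s))"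
    unfolding case_prod_beta
  proof (rule dominated[of _ 1])
    fix z assume z: "good z"
    have x: "X (snd z) (fst z) \<in> space \<X>" by (rule X_space[OF goodD(1)[OF z]])
    have "B (fst z) (X (snd z) (fst z)) * 1 \<le> B (fst z) (X (snd z) (fst z)) * exp (c * W (snd z))"
      using e1 B_nn[OF x] by (intro mult_left_mono) auto
    then show "\<bar>\<psi> 0 (fst z) (X (snd z) (fst z))\<bar> \<le> 1 * E z"
      using bounds(1)[OF x, of "fst z"] by (simp add: E_def)
  qed (rule \<psi>_m)
  define k2 where "k2 = C + (1 + C) * k + C / c"
  define F where "F l = (\<integral>(s, \<omega>). path_density (gl l) s \<omega> * \<psi> l s (X \<omega> s) \<partial>p)" for l
  define F0 where "F0 = (\<integral>(s, \<omega>). \<psi> 0 s (X \<omega> s) \<partial>p)"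
  define d where "d = (\<integral>(s, \<omega>). \<psi>' s (X \<omega> s) \<partial>p) + (\<integral>(s, \<omega>). \<psi> 0 s (X \<omega> s) * G s \<omega> \<partial>p)"
  have quad: "\<bar>F l - F0 - l * d\<bar> \<le> (k2 * (\<integral>z. E z \<partial>p)) * l\<^sup>2" if l: "\<bar>l\<bar> \<le> 1" "\<bar>l\<bar> * C0 \<le> c / 2" for l
  proof -
    let ?f = "\<lambda>(s, \<omega>). path_density (gl l) s \<omega> * \<psi> l s (X \<omega> s) - \<psi> 0 s (X \<omega> s)
      - l * (\<psi>' s (X \<omega> s) + \<psi> 0 s (X \<omega> s) * G s \<omega>)"
    note ints = int1[OF l, unfolded case_prod_beta] int0[unfolded case_prod_beta]
      int2[unfolded case_prod_beta] int3[unfolded case_prod_beta]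
    note i12 = Bochner_Integration.integrable_diff[OF ints(1,2)]
    note i34 = integrable_mult_right[OF Bochner_Integration.integrable_add[OF ints(3,4)], of l]
    have fi: "integrable p ?f"
      unfolding case_prod_beta by (rule Bochner_Integration.integrable_diff[OF i12 i34])
    have eq: "F l - F0 - l * d = (\<integral>z. ?f z \<partial>p)"
      unfolding F_def F0_def d_def case_prod_beta
      by (simp only: Bochner_Integration.integral_diff[OF i12 i34] Bochner_Integration.integral_diff[OF ints(1,2)]
          integral_mult_right_zero Bochner_Integration.integral_add[OF ints(3,4)])
    have "\<bar>F l - F0 - l * d\<bar> \<le> (\<integral>z. \<bar>?f z\<bar> \<partial>p)"
      unfolding eq by (rule integral_abs_bound)
    also have "\<dots> \<le> (\<integral>z. l\<^sup>2 * k2 * E z \<partial>p)"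
    proof (rule integral_mono_AE)
      show "integrable p (\<lambda>z. \<bar>?f z\<bar>)" using fi by (rule integrable_abs)
      show "integrable p (\<lambda>z. l\<^sup>2 * k2 * E z)" using E_int by simp
      show "AE z in p. \<bar>?f z\<bar> \<le> l\<^sup>2 * k2 * E z"
        using good
      proof eventually_elim
        case (elim z)
        let ?s = "fst z" let ?w = "snd z" let ?x = "X ?w ?s" let ?D = "path_density (gl l) ?s ?w"
        let ?e = "exp (c * W ?w)" let ?b = "B ?s ?x"
        from goodD(2)[OF elim] obtain m where m: "t < T m ?w" by blast
        have x: "?x \<in> space \<X>" by (rule X_space[OF goodD(1)[OF elim]])
        note dd = density_bounds[OF goodD(1)[OF elim] m goodD(3,4)[OF elim] c l, folded k_def]
        have b: "0 \<le> ?b" by (rule B_nn[OF x])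
        \<comment> \<open>The remainder of the product splits into three quadratic terms: the
          remainder of \<open>\<psi>\<close> times the density, the affine part of
          \<open>\<psi>\<close> times the remainder of the density, and the cross term of the two
          first order terms. They account for the three summands of \<open>k2\<close>.\<close>
        have "\<bar>(\<psi> l ?s ?x - \<psi> 0 ?s ?x - l * \<psi>' ?s ?x) * ?D\<bar> \<le> (C * l\<^sup>2 * ?b) * ?e"
          unfolding abs_mult using bounds(3)[OF l(1) x] dd(1) b C
          by (intro mult_mono) (auto simp: path_density_def)
        moreover have "\<bar>(\<psi> 0 ?s ?x + l * \<psi>' ?s ?x) * (?D - 1 - l * G ?s ?w)\<bar> \<le> ((1 + C) * ?b) * (l\<^sup>2 * k * ?e)"
          unfolding abs_mult
        proof (rule mult_mono[OF _ dd(2)])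
          have "\<bar>\<psi> 0 ?s ?x + l * \<psi>' ?s ?x\<bar> \<le> \<bar>\<psi> 0 ?s ?x\<bar> + \<bar>l\<bar> * \<bar>\<psi>' ?s ?x\<bar>"
            by (metis abs_mult abs_triangle_ineq)
          also have "\<dots> \<le> ?b + 1 * (C * ?b)"
            using bounds(1)[OF x] mult_mono[OF l(1) bounds(2)[OF x]] by (intro add_mono) auto
          finally show "\<bar>\<psi> 0 ?s ?x + l * \<psi>' ?s ?x\<bar> \<le> (1 + C) * ?b" by (simp add: algebra_simps)
        qed (use b C in auto)
        moreover have "\<bar>l\<^sup>2 * (\<psi>' ?s ?x * G ?s ?w)\<bar> \<le> l\<^sup>2 * ((C * ?b) * (1 / c * ?e))"
          unfolding abs_mult using bounds(2)[OF x] dd(3) b C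
          by (simp only: abs_power2) (intro mult_left_mono mult_mono, auto)
        moreover have "?f z = (\<psi> l ?s ?x - \<psi> 0 ?s ?x - l * \<psi>' ?s ?x) * ?D
            + (\<psi> 0 ?s ?x + l * \<psi>' ?s ?x) * (?D - 1 - l * G ?s ?w) + l\<^sup>2 * (\<psi>' ?s ?x * G ?s ?w)"
          by (simp add: case_prod_beta algebra_simps power2_eq_square)
        ultimately have "\<bar>?f z\<bar> \<le> (C * l\<^sup>2 * ?b) * ?e + ((1 + C) * ?b) * (l\<^sup>2 * k * ?e) + l\<^sup>2 * ((C * ?b) * (1 / c * ?e))"
          by linarith
        also have "\<dots> = l\<^sup>2 * k2 * E z" by (simp add: E_def k2_def algebra_simps)
        finally show ?case .
      qed
    qed
    also have "\<dots> = (k2 * (\<integral>z. E z \<partial>p)) * l\<^sup>2" by simp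
    finally show ?thesis .
  qed
  have "0 < min 1 (c / (2 * C0))" using c C0_ge_1 by simp
  then have "(F has_real_derivative d) (at 0)"
  proof (rule has_real_derivative_of_quadratic_remainder)
    fix l assume l: "\<bar>l\<bar> \<le> min 1 (c / (2 * C0))"
    then have "\<bar>l\<bar> * C0 \<le> c / (2 * C0) * C0" using C0_ge_1 by (intro mult_right_mono) auto
    then show "\<bar>F l - F0 - l * d\<bar> \<le> (k2 * (\<integral>z. E z \<partial>p)) * l\<^sup>2"
      using l C0_ge_1 by (intro quad) auto
  qed
  then show "((\<lambda>l. \<integral>(s, \<omega>). path_density (gl l) s \<omega> * \<psi> l s (X \<omega> s) \<partial>p) has_real_derivative
      (\<integral>(s, \<omega>). \<psi>' s (X \<omega> s) \<partial>p) + (\<integral>(s, \<omega>). \<psi> 0 s (X \<omega> s) * G s \<omega> \<partial>p)) (at 0)"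
    unfolding F_def[abs_def] d_def .
qed

end

section \<open>Terminal functionals\<close>

lemma ennpowr_measurable [measurable]: "(\<lambda>a. ennpowr a q) \<in> borel_measurable borel"
  unfolding ennpowr_def[abs_def] by measurable

text \<open>A form of the Hoelder inequality. For the conjugate exponent \<open>q\<close>, the
  choice \<open>c = a / q\<close> makes the \<open>q\<close>-th power of \<open>exp (c * W)\<close>
  equal to \<open>exp (a * W)\<close>; for \<open>p = \<infinity>\<close> it is
  \<open>c = a\<close>. Young's inequality is applied after division by the norm and its factors
  \<open>1 / p'\<close> and \<open>1 / q\<close> are dropped, hence the constant
  \<open>1 + E\<close>. The constants do not depend on \<open>f\<close>, so the bound can be
  integrated over time.\<close>

lemma Lp_norm_exp_bound:
  fixes W :: "'w \<Rightarrow> real" and p :: ereal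
  assumes p: "1 < p" and W [measurable]: "W \<in> borel_measurable M"
    and a: "0 < a" and fin: "(\<integral>\<^sup>+\<omega>. ennreal (exp (a * W \<omega>)) \<partial>M) < \<infinity>"
  shows "\<exists>c>0. \<exists>C>0. \<forall>f\<in>borel_measurable M.
    (\<integral>\<^sup>+\<omega>. f \<omega> * ennreal (exp (c * W \<omega>)) \<partial>M) \<le> Lp_norm M p f * ennreal C"
proof -
  define E where "E = enn2real (\<integral>\<^sup>+\<omega>. ennreal (exp (a * W \<omega>)) \<partial>M)"
  have E: "(\<integral>\<^sup>+\<omega>. ennreal (exp (a * W \<omega>)) \<partial>M) = ennreal E" "0 \<le> E"
    using fin by (auto simp: E_def)
  consider "p = \<infinity>" | p' where "p = ereal p'" "1 < p'"
    using p by (cases p) auto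
  then show ?thesis
  proof cases
    case 1
    have "(\<integral>\<^sup>+\<omega>. f \<omega> * ennreal (exp (a * W \<omega>)) \<partial>M) \<le> Lp_norm M p f * ennreal (1 + E)"
      if [measurable]: "f \<in> borel_measurable M" for f
    proof -
      have "(\<integral>\<^sup>+\<omega>. f \<omega> * ennreal (exp (a * W \<omega>)) \<partial>M) \<le> (\<integral>\<^sup>+\<omega>. esssup M f * ennreal (exp (a * W \<omega>)) \<partial>M)"
        by (rule nn_integral_mono_AE) (use esssup_AE[of f M] in \<open>eventually_elim, auto intro: mult_right_mono\<close>)
      also have "\<dots> = esssup M f * ennreal E" by (subst nn_integral_cmult) (auto simp: E)
      also have "\<dots> \<le> esssup M f * ennreal (1 + E)" by (intro mult_left_mono ennreal_leI) auto
      finally show ?thesis by (simp add: Lp_norm_def 1)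
    qed
    then show ?thesis
      using a E(2) by (intro exI[of _ a] conjI exI[of _ "1 + E"] ballI) (simp_all del: ennreal_plus)
  next
    case (2 p')
    define q where "q = p' / (p' - 1)"
    have q: "1 < q" "1 / p' + 1 / q = 1" using 2 by (auto simp: q_def field_simps)
    define c where "c = a / q"
    have "(\<integral>\<^sup>+\<omega>. f \<omega> * ennreal (exp (c * W \<omega>)) \<partial>M) \<le> Lp_norm M p f * ennreal (1 + E)"
      if [measurable]: "f \<in> borel_measurable M" for f
    proof -
      define I where "I = (\<integral>\<^sup>+\<omega>. ennpowr (f \<omega>) p' \<partial>M)"
      have N: "Lp_norm M p f = ennpowr I (1 / p')" using 2 by (simp add: Lp_norm_def I_def)
      show ?thesis
      proof (cases "I = \<infinity>")
        case True
        \<comment> \<open>The constant is positive, so the right-hand side is infinite here even if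
          \<open>E\<close> vanishes.\<close>
        then show ?thesis using E(2) by (simp add: N ennpowr_def ennreal_top_mult)
      next
        case False
        have "AE \<omega> in M. ennpowr (f \<omega>) p' \<noteq> \<infinity>"
          by (rule nn_integral_noteq_infinite) (use False in \<open>auto simp: I_def\<close>)
        then have f_fin: "AE \<omega> in M. f \<omega> = ennreal (enn2real (f \<omega>))"
          by eventually_elim (auto simp: ennpowr_def less_top split: if_splits)
        define n where "n = enn2real I powr (1 / p')"
        have Nn: "Lp_norm M p f = ennreal n" using False by (simp add: N ennpowr_def n_def)
        have Ir: "I = ennreal (enn2real I)" using False by (simp add: less_top)
        show ?thesis
        proof (cases "enn2real I = 0")
          \<comment> \<open>With norm zero there is no scaling by \<open>n\<close>, but
            \<open>f\<close> vanishes almost everywhere.\<close>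
          case True
          then have "I = 0" using Ir by simp
          then have "AE \<omega> in M. ennpowr (f \<omega>) p' = 0"
            unfolding I_def by (subst (asm) nn_integral_0_iff_AE) auto
          then have "AE \<omega> in M. f \<omega> * ennreal (exp (c * W \<omega>)) = 0"
            using f_fin by eventually_elim (metis ennpowr_def ennreal_0 ennreal_eq_0_iff ennreal_zero_neq_top enn2real_nonneg
                infinity_ennreal_def le_less mult_zero_left not_le powr_gt_zero)
          then have "(\<integral>\<^sup>+\<omega>. f \<omega> * ennreal (exp (c * W \<omega>)) \<partial>M) = 0"
            by (subst nn_integral_0_iff_AE) auto
          then show ?thesis by simp
        next
          case nz: False
          have Ip: "0 < enn2real I" using nz by (simp add: less_le)
          have n: "0 < n" using Ip by (simp add: n_def)
          have np: "n powr p' = enn2real I" using Ip 2 by (simp add: n_def powr_powr)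
          have "AE \<omega> in M. f \<omega> * ennreal (exp (c * W \<omega>))
              \<le> ennreal n * (ennreal (1 / enn2real I) * ennpowr (f \<omega>) p' + ennreal (exp (a * W \<omega>)))"
            using f_fin
          proof eventually_elim
            case (elim \<omega>)
            have spread: "ennreal (n * (A * B + E)) = ennreal n * (ennreal A * ennreal B + ennreal E)"
              if "0 \<le> n" "0 \<le> A" "0 \<le> B" "0 \<le> E" for n A B E :: real
              using that by (simp add: ennreal_mult')
            have div_le: "x / y \<le> x" if "0 \<le> x" "1 < y" for x y :: real
              using that mult_left_mono[of 1 y x] by (simp add: divide_le_eq)
            define F where "F = enn2real (f \<omega>)"
            have F: "0 \<le> F" "f \<omega> = ennreal F" using elim by (auto simp: F_def)
            have "(F / n) * exp (c * W \<omega>) \<le> (F / n) powr p' / p' + exp (c * W \<omega>) powr q / q"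
              by (rule Youngs_inequality) (use 2 q F n in auto)
            also have "\<dots> \<le> (F / n) powr p' + exp (c * W \<omega>) powr q"
              using 2 q by (intro add_mono div_le) auto
            also have "(F / n) powr p' = 1 / enn2real I * F powr p'"
              using F n by (simp add: powr_divide np)
            also have "exp (c * W \<omega>) powr q = exp (a * W \<omega>)"
              using q by (simp add: powr_def c_def)
            finally have "F * exp (c * W \<omega>) \<le> n * (1 / enn2real I * F powr p' + exp (a * W \<omega>))"
              using n by (simp add: field_simps)
            then have "ennreal (F * exp (c * W \<omega>)) \<le> ennreal (n * (1 / enn2real I * F powr p' + exp (a * W \<omega>)))"
              by (rule ennreal_leI)
            also have "\<dots> = ennreal n * (ennreal (1 / enn2real I) * ennreal (F powr p') + ennreal (exp (a * W \<omega>)))"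
              by (rule spread) (use n Ip in auto)
            also have "ennreal (F powr p') = ennpowr (f \<omega>) p'" using F by (simp add: ennpowr_def)
            finally show ?case using F by (simp add: ennreal_mult)
          qed
          then have "(\<integral>\<^sup>+\<omega>. f \<omega> * ennreal (exp (c * W \<omega>)) \<partial>M)
            \<le> (\<integral>\<^sup>+\<omega>. ennreal n * (ennreal (1 / enn2real I) * ennpowr (f \<omega>) p' + ennreal (exp (a * W \<omega>))) \<partial>M)"
            by (rule nn_integral_mono_AE)
          also have "\<dots> = ennreal n * (ennreal (1 / enn2real I) * I + ennreal E)"
            by (simp add: nn_integral_cmult nn_integral_add I_def E(1))
          also have "ennreal (1 / enn2real I) * I = 1"
            by (subst Ir) (use Ip in \<open>simp add: ennreal_mult[symmetric] del: ennreal_enn2real\<close>)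
          also have "1 + ennreal E = ennreal (1 + E)" using E(2) by simp
          finally show ?thesis by (simp add: Nn)
        qed
      qed
    qed
    moreover have "0 < c" using a q by (simp add: c_def)
    ultimately show ?thesis
      using E(2) by (intro exI[of _ c] conjI exI[of _ "1 + E"] ballI) (simp_all del: ennreal_plus)
  qed
qed

context base_process begin

text \<open>The identity for nonnegative functions says that two image measures on
  \<open>\<X>\<close> coincide. Integrability and the integral of a signed \<open>v\<close> can then
  be read off from either of them.\<close>

lemma girsanov_integral:
  fixes v :: "'a \<Rightarrow> real"
  assumes P': "tilted_process \<X> r \<nu> h t M' T' Y'" and fin: "AE \<omega> in M'. \<exists>n. t < T' n \<omega>"
    and v: "v \<in> borel_measurable \<X>" and s: "0 \<le> s" "s \<le> t"
  shows "integrable M' (\<lambda>\<omega>. v (jump_path T' Y' \<omega> s)) \<longleftrightarrow> integrable M (\<lambda>\<omega>. path_density h s \<omega> * v (X \<omega> s))"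
    "(\<integral>\<omega>. v (jump_path T' Y' \<omega> s) \<partial>M') = (\<integral>\<omega>. path_density h s \<omega> * v (X \<omega> s) \<partial>M)"
proof -
  interpret P': tilted_process \<X> r \<nu> h t M' T' Y' by (rule P')
  note X1 = P'.X_measurable[of s]
  have D: "path_density h s \<in> borel_measurable M" by (rule path_density_measurable[OF P'.h]) auto
  let ?Q = "density M (\<lambda>\<omega>. ennreal (path_density h s \<omega>))"
  have X2: "(\<lambda>\<omega>. X \<omega> s) \<in> measurable ?Q \<X>" using X_measurable[of s] by simp
  have eq: "distr M' \<X> (\<lambda>\<omega>. P'.X \<omega> s) = distr ?Q \<X> (\<lambda>\<omega>. X \<omega> s)"
  proof (rule measure_eqI)
    fix A assume "A \<in> sets (distr M' \<X> (\<lambda>\<omega>. P'.X \<omega> s))"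
    then have A: "A \<in> sets \<X>" by simp
    have i: "indicator A \<in> borel_measurable \<X>" using A by (rule borel_measurable_indicator)
    have "emeasure (distr M' \<X> (\<lambda>\<omega>. P'.X \<omega> s)) A = (\<integral>\<^sup>+x. indicator A x \<partial>distr M' \<X> (\<lambda>\<omega>. P'.X \<omega> s))"
      using A by simp
    also have "\<dots> = (\<integral>\<^sup>+\<omega>. indicator A (P'.X \<omega> s) \<partial>M')"
      by (rule nn_integral_distr[OF X1]) (use i in simp)
    also have "\<dots> = (\<integral>\<^sup>+\<omega>. ennreal (path_density h s \<omega>) * indicator A (X \<omega> s) \<partial>M)"
      by (rule girsanov[OF P' fin i s])
    also have "\<dots> = (\<integral>\<^sup>+\<omega>. indicator A (X \<omega> s) \<partial>?Q)"
      by (rule nn_integral_density[symmetric])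
        (intro measurable_compose[OF D measurable_ennreal] measurable_compose[OF X_measurable i])+
    also have "\<dots> = (\<integral>\<^sup>+x. indicator A x \<partial>distr ?Q \<X> (\<lambda>\<omega>. X \<omega> s))"
      by (rule nn_integral_distr[symmetric, OF X2]) (use i in simp)
    also have "\<dots> = emeasure (distr ?Q \<X> (\<lambda>\<omega>. X \<omega> s)) A" using A by simp
    finally show "emeasure (distr M' \<X> (\<lambda>\<omega>. P'.X \<omega> s)) A = emeasure (distr ?Q \<X> (\<lambda>\<omega>. X \<omega> s)) A" .
  qed simp
  have vX: "(\<lambda>\<omega>. v (X \<omega> s)) \<in> borel_measurable M" by (rule measurable_compose[OF X_measurable v])
  have D_nn: "AE \<omega> in M. 0 \<le> path_density h s \<omega>" by (simp add: path_density_def)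
  show "integrable M' (\<lambda>\<omega>. v (P'.X \<omega> s)) \<longleftrightarrow> integrable M (\<lambda>\<omega>. path_density h s \<omega> * v (X \<omega> s))"
    unfolding integrable_distr_eq[OF X1 v, symmetric] eq integrable_distr_eq[OF X2 v]
    by (subst integrable_density[OF vX D D_nn]) simp
  show "(\<integral>\<omega>. v (P'.X \<omega> s) \<partial>M') = (\<integral>\<omega>. path_density h s \<omega> * v (X \<omega> s) \<partial>M)"
    unfolding integral_distr[OF X1 v, symmetric] eq integral_distr[OF X2 v]
    by (subst integral_density[OF vX D D_nn]) simp
qed

end

text \<open>Lebesgue measure on \<open>[0, t]\<close>, kept as a measure on all Borel sets of the
  line. Its product with \<open>M\<close> then has the measurable functions of
  \<open>borel \<Otimes>\<^sub>M M\<close>.\<close>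

definition interval_measure :: "real \<Rightarrow> real measure" where
  "interval_measure t = density lborel (\<lambda>s. ennreal (indicator {0..t} s))"

lemma sets_interval_measure [simp, measurable_cong]: "sets (interval_measure t) = sets borel"
  by (simp add: interval_measure_def)

lemma space_interval_measure [simp]: "space (interval_measure t) = UNIV"
  by (simp add: interval_measure_def)

lemma finite_interval_measure: "finite_measure (interval_measure t)"
proof (rule finite_measureI)
  have "emeasure (interval_measure t) UNIV = (\<integral>\<^sup>+s. indicator {0..t} s \<partial>lborel)"
    by (simp add: interval_measure_def emeasure_density ennreal_indicator)
  also have "\<dots> < \<infinity>" by (simp add: emeasure_lborel_Icc_eq)
  finally show "emeasure (interval_measure t) (space (interval_measure t)) \<noteq> \<infinity>" by simp
qed

lemma nn_integral_interval_measure: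
  "f \<in> borel_measurable borel \<Longrightarrow> (\<integral>\<^sup>+s. f s \<partial>interval_measure t) = (\<integral>\<^sup>+s\<in>{0..t}. f s \<partial>lborel)"
  unfolding interval_measure_def
  by (subst nn_integral_density) (auto simp: ennreal_indicator mult.commute)

lemma integrable_interval_measure:
  "f \<in> borel_measurable borel \<Longrightarrow> integrable (interval_measure t) (f :: real \<Rightarrow> real) \<longleftrightarrow> set_integrable lborel {0..t} f"
  unfolding interval_measure_def set_integrable_def
  by (subst integrable_density) auto

lemma integral_interval_measure:
  "f \<in> borel_measurable borel \<Longrightarrow> (\<integral>s. f s \<partial>interval_measure t) = (LINT s:{0..t}|lborel. (f s :: real))"
  unfolding interval_measure_def set_lebesgue_integral_def
  by (subst integral_density) auto

lemma AE_interval_measure: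
  "(AE s in interval_measure t. Q s) \<longleftrightarrow> (AE s in lborel. s \<in> {0..t} \<longrightarrow> Q s)"
proof -
  have iff: "0 < ennreal (indicator {0..t} s) \<longleftrightarrow> s \<in> {0..t}" for s :: real
    by (auto simp: indicator_def)
  have m: "(\<lambda>s. ennreal (indicator {0..t} s)) \<in> borel_measurable lborel" by measurable
  show ?thesis unfolding interval_measure_def AE_density[OF m] iff ..
qed

locale perturbed_family = perturbed_base \<X> r \<nu> t M T Y g K \<theta>
  for \<X> :: "'a measure" and r \<nu> t and M :: "'w measure" and T Y g K \<theta> +
  fixes P' :: "real \<Rightarrow> 'v measure" and T' :: "real \<Rightarrow> nat \<Rightarrow> 'v \<Rightarrow> real" and Y' :: "real \<Rightarrow> nat \<Rightarrow> 'v \<Rightarrow> 'a"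
  assumes P': "\<And>l. tilted_process \<X> r \<nu> (gl l) t (P' l) (T' l) (Y' l)"
begin

abbreviation X' :: "real \<Rightarrow> 'v \<Rightarrow> real \<Rightarrow> 'a" where "X' l \<equiv> jump_path (T' l) (Y' l)"

lemma eventually_small:
  assumes c: "0 < c"
  shows "\<forall>\<^sub>F l in nhds 0. \<bar>l\<bar> \<le> 1 \<and> \<bar>l\<bar> * C0 \<le> c \<and> (AE \<omega> in P' l. \<exists>n. t < T' l n \<omega>)"
proof -
  obtain a where a: "0 < a" "(\<integral>\<^sup>+\<omega>. ennreal (exp (a * W \<omega>)) \<partial>M) < \<infinity>" using exp_moment_W by blast
  \<comment> \<open>There are three demands on \<open>l\<close>: the bound \<open>1\<close> for the
    expansions, \<open>a\<close> for non-explosion of the perturbed process, and \<open>c\<close>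
    for the use made of the lemma.\<close>
  define \<epsilon> where "\<epsilon> = min 1 (min a c / C0)"
  have C0: "0 < C0" using C0_ge_1 by simp
  have \<epsilon>: "0 < \<epsilon>" using a c C0 by (simp add: \<epsilon>_def)
  have "\<forall>\<^sub>F l in nhds 0. \<bar>l\<bar> < \<epsilon>" using \<epsilon> by (auto simp: eventually_nhds_metric intro!: exI[of _ \<epsilon>])
  then show ?thesis
  proof eventually_elim
    case (elim l)
    then have l: "\<bar>l\<bar> \<le> 1" "\<bar>l\<bar> \<le> min a c / C0" by (auto simp: \<epsilon>_def)
    then have "\<bar>l\<bar> * C0 \<le> min a c" using C0 by (simp add: field_simps)
    then show ?case using l(1) perturbed_finite_jumps[OF P' l(1) _ a(2)] by auto
  qed
qed

lemma terminal_response: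
  assumes v: "v \<in> borel_measurable \<X>" and p: "1 < p" and Lp: "in_Lp M p (\<lambda>\<omega>. ennreal \<bar>v (X \<omega> t)\<bar>)"
  shows "\<forall>\<^sub>F l in nhds 0. integrable (P' l) (\<lambda>\<omega>. v (X' l \<omega> t))"
    "integrable M (\<lambda>\<omega>. v (X \<omega> t) * G t \<omega>)"
    "((\<lambda>l. \<integral>\<omega>. v (X' l \<omega> t) \<partial>P' l) has_real_derivative (\<integral>\<omega>. v (X \<omega> t) * G t \<omega> \<partial>M)) (at 0)"
proof -
  obtain a where a: "0 < a" "(\<integral>\<^sup>+\<omega>. ennreal (exp (a * W \<omega>)) \<partial>M) < \<infinity>" using exp_moment_W by blast
  from Lp_norm_exp_bound[OF p W_measurable a] obtain c C where c: "0 < c" and C: "0 < C"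
    "\<And>f. f \<in> borel_measurable M \<Longrightarrow> (\<integral>\<^sup>+\<omega>. f \<omega> * ennreal (exp (c * W \<omega>)) \<partial>M) \<le> Lp_norm M p f * ennreal C"
    by blast
  let ?\<mu> = "return borel t" let ?p = "?\<mu> \<Otimes>\<^sub>M M"
  interpret \<mu>: prob_space ?\<mu> by (rule prob_space_return) simp
  interpret pr: pair_sigma_finite ?\<mu> M ..
  have vX: "(\<lambda>z. v (X (snd z) (fst z))) \<in> borel_measurable (borel \<Otimes>\<^sub>M M)"
    by (rule measurable_compose[OF X_measurable_pair v])
  have vc: "(\<lambda>(s, x). v x) \<in> borel_measurable (borel \<Otimes>\<^sub>M \<X>)"
    unfolding case_prod_beta by (rule measurable_compose[OF measurable_snd v])
  have vac: "(\<lambda>(s, x). \<bar>v x\<bar>) \<in> borel_measurable (borel \<Otimes>\<^sub>M \<X>)"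
    unfolding case_prod_beta by (intro borel_measurable_abs measurable_compose[OF measurable_snd v])
  have J: "(\<lambda>s. \<integral>\<^sup>+\<omega>. ennreal \<bar>v (X \<omega> s)\<bar> * ennreal (exp (c * W \<omega>)) \<partial>M) \<in> borel_measurable borel"
  proof -
    have "(\<lambda>(s, \<omega>). ennreal \<bar>v (X \<omega> s)\<bar> * ennreal (exp (c * W \<omega>))) \<in> borel_measurable (borel \<Otimes>\<^sub>M M)"
      unfolding case_prod_beta
      by (intro borel_measurable_times_ennreal measurable_compose[OF _ measurable_ennreal] borel_measurable_abs vX
          measurable_compose[OF _ borel_measurable_exp] borel_measurable_times borel_measurable_const
          measurable_compose[OF measurable_snd W_measurable])
    then show ?thesis by (rule borel_measurable_nn_integral)
  qed
  have fin: "(\<integral>\<^sup>+s. (\<integral>\<^sup>+\<omega>. ennreal \<bar>v (X \<omega> s)\<bar> * ennreal (exp (c * W \<omega>)) \<partial>M) \<partial>?\<mu>) < \<infinity>"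
  proof -
    have "(\<integral>\<^sup>+s. (\<integral>\<^sup>+\<omega>. ennreal \<bar>v (X \<omega> s)\<bar> * ennreal (exp (c * W \<omega>)) \<partial>M) \<partial>?\<mu>)
      = (\<integral>\<^sup>+\<omega>. ennreal \<bar>v (X \<omega> t)\<bar> * ennreal (exp (c * W \<omega>)) \<partial>M)"
      by (rule nn_integral_return[OF _ J]) simp
    also have "\<dots> \<le> Lp_norm M p (\<lambda>\<omega>. ennreal \<bar>v (X \<omega> t)\<bar>) * ennreal C"
      by (rule C(2)) (use Lp in \<open>simp add: in_Lp_def\<close>)
    also have "\<dots> < \<infinity>" using Lp by (simp add: in_Lp_def ennreal_mult_less_top)
    finally show ?thesis .
  qed
  have \<mu>_AE: "AE s in ?\<mu>. 0 \<le> s \<and> s \<le> t"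
    by (subst AE_return) (auto simp: t_nonneg)
  \<comment> \<open>The observable does not depend on \<open>l\<close>, so \<open>response\<close>
    is used with derivative \<open>0\<close> and constant \<open>0\<close>. Only the density
    contributes.\<close>
  have R: "\<And>l. \<bar>l\<bar> \<le> 1 \<Longrightarrow> \<bar>l\<bar> * C0 \<le> c / 2 \<Longrightarrow> integrable ?p (\<lambda>(s, \<omega>). path_density (gl l) s \<omega> * v (X \<omega> s))"
    "integrable ?p (\<lambda>(s, \<omega>). v (X \<omega> s) * G s \<omega>)"
    "((\<lambda>l. \<integral>(s, \<omega>). path_density (gl l) s \<omega> * v (X \<omega> s) \<partial>?p) has_real_derivative
      (\<integral>(s, \<omega>). 0 \<partial>?p) + (\<integral>(s, \<omega>). v (X \<omega> s) * G s \<omega> \<partial>?p)) (at 0)"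
    by (rule response[where \<mu> = ?\<mu> and \<psi> = "\<lambda>_ _. v" and \<psi>' = "\<lambda>_ _. 0" and B = "\<lambda>_ x. \<bar>v x\<bar>" and C = 0,
      OF \<mu>.sigma_finite_measure_axioms _ \<mu>_AE vc _ vac _ _ _ _ c fin]; simp)+
  have at: "integrable M (\<lambda>\<omega>. f t \<omega>) \<and> (\<integral>(s, \<omega>). f s \<omega> \<partial>?p) = (\<integral>\<omega>. f t \<omega> \<partial>M)"
    if f: "integrable ?p (\<lambda>(s, \<omega>). f s \<omega>)" for f :: "real \<Rightarrow> 'w \<Rightarrow> real"
  proof
    have fm: "(\<lambda>(s, \<omega>). f s \<omega>) \<in> borel_measurable (borel \<Otimes>\<^sub>M M)"
      using borel_measurable_integrable[OF f] by (simp cong: measurable_cong_sets)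
    \<comment> \<open>An almost sure statement under the point mass is turned into a statement at
      \<open>t\<close> for a measurable predicate.\<close>
    have i: "Measurable.pred borel (\<lambda>s. integrable M (f s))"
      by (rule borel_measurable_lebesgue_integrable[OF fm])
    show "integrable M (\<lambda>\<omega>. f t \<omega>)"
      using pr.AE_integrable_fst[OF f] AE_return[OF _ i, of t] by simp
    have "(\<lambda>s. \<integral>\<omega>. f s \<omega> \<partial>M) \<in> borel_measurable borel"
      by (rule borel_measurable_lebesgue_integral[OF fm])
    then show "(\<integral>(s, \<omega>). f s \<omega> \<partial>?p) = (\<integral>\<omega>. f t \<omega> \<partial>M)"
      using integral_return[of t borel "\<lambda>s. \<integral>\<omega>. f s \<omega> \<partial>M"] pr.integral_fst[OF f] by simp
  qed
  show "integrable M (\<lambda>\<omega>. v (X \<omega> t) * G t \<omega>)" using at[OF R(2)] by simp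
  have c2: "0 < c / 2" using c by simp
  have small: "\<forall>\<^sub>F l in nhds 0. integrable (P' l) (\<lambda>\<omega>. v (X' l \<omega> t)) \<and>
      (\<integral>\<omega>. v (X' l \<omega> t) \<partial>P' l) = (\<integral>(s, \<omega>). path_density (gl l) s \<omega> * v (X \<omega> s) \<partial>?p)"
    using eventually_small[OF c2]
  proof eventually_elim
    case (elim l)
    then have l: "\<bar>l\<bar> \<le> 1" "\<bar>l\<bar> * C0 \<le> c / 2" and f: "AE \<omega> in P' l. \<exists>n. t < T' l n \<omega>" by auto
    note gi = girsanov_integral[OF P' f v t_nonneg order_refl]
    show ?case using at[OF R(1)] gi elim by simp
  qed
  then show "\<forall>\<^sub>F l in nhds 0. integrable (P' l) (\<lambda>\<omega>. v (X' l \<omega> t))" by eventually_elim simp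
  have zero: "(\<integral>(s, \<omega>). (0::real) \<partial>?p) = 0" unfolding case_prod_beta by simp
  have "((\<lambda>l. \<integral>(s, \<omega>). path_density (gl l) s \<omega> * v (X \<omega> s) \<partial>?p) has_real_derivative (\<integral>\<omega>. v (X \<omega> t) * G t \<omega> \<partial>M)) (at 0)"
    using R(3) at[OF R(2)] zero by simp
  then show "((\<lambda>l. \<integral>\<omega>. v (X' l \<omega> t) \<partial>P' l) has_real_derivative (\<integral>\<omega>. v (X \<omega> t) * G t \<omega> \<partial>M)) (at 0)"
    by (rule DERIV_cong_ev[THEN iffD2, rotated -1]) (use small in \<open>auto elim: eventually_mono\<close>)
qed

end

section \<open>Running functionals\<close>

lemma (in prob_space) fubini_interval:
  fixes f :: "real \<Rightarrow> 'a \<Rightarrow> real"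
  assumes f: "integrable (interval_measure t \<Otimes>\<^sub>M M) (\<lambda>(s, \<omega>). f s \<omega>)"
  shows "AE s in lborel. s \<in> {0..t} \<longrightarrow> integrable M (f s)"
    "set_integrable lborel {0..t} (\<lambda>s. \<integral>\<omega>. f s \<omega> \<partial>M)"
    "(\<integral>(s, \<omega>). f s \<omega> \<partial>(interval_measure t \<Otimes>\<^sub>M M)) = (LINT s:{0..t}|lborel. \<integral>\<omega>. f s \<omega> \<partial>M)"
    "AE \<omega> in M. set_integrable lborel {0..t} (\<lambda>s. f s \<omega>)"
    "integrable M (\<lambda>\<omega>. LINT s:{0..t}|lborel. f s \<omega>)"
    "(\<integral>(s, \<omega>). f s \<omega> \<partial>(interval_measure t \<Otimes>\<^sub>M M)) = (\<integral>\<omega>. (LINT s:{0..t}|lborel. f s \<omega>) \<partial>M)"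
proof -
  interpret \<mu>: finite_measure "interval_measure t" by (rule finite_interval_measure)
  interpret pr: pair_sigma_finite "interval_measure t" M ..
  have fm: "(\<lambda>(s, \<omega>). f s \<omega>) \<in> borel_measurable (borel \<Otimes>\<^sub>M M)"
    using borel_measurable_integrable[OF f] by (simp cong: measurable_cong_sets)
  have m1: "(\<lambda>s. \<integral>\<omega>. f s \<omega> \<partial>M) \<in> borel_measurable borel"
    by (rule borel_measurable_lebesgue_integral[OF fm])
  have m2: "(\<lambda>s. f s \<omega>) \<in> borel_measurable borel" if "\<omega> \<in> space M" for \<omega>
    using measurable_Pair1[OF fm that] by simp
  show "AE s in lborel. s \<in> {0..t} \<longrightarrow> integrable M (f s)"
    using pr.AE_integrable_fst[OF f] by (simp add: AE_interval_measure)
  show "set_integrable lborel {0..t} (\<lambda>s. \<integral>\<omega>. f s \<omega> \<partial>M)"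
    using pr.integrable_fst[OF f] by (simp add: integrable_interval_measure[OF m1])
  show "(\<integral>(s, \<omega>). f s \<omega> \<partial>(interval_measure t \<Otimes>\<^sub>M M)) = (LINT s:{0..t}|lborel. \<integral>\<omega>. f s \<omega> \<partial>M)"
    using pr.integral_fst[OF f] by (simp add: integral_interval_measure[OF m1])
  show "AE \<omega> in M. set_integrable lborel {0..t} (\<lambda>s. f s \<omega>)"
    using pr.AE_integrable_snd[OF f] AE_space
    by eventually_elim (simp add: integrable_interval_measure[OF m2])
  have eq: "(\<integral>s. f s \<omega> \<partial>interval_measure t) = (LINT s:{0..t}|lborel. f s \<omega>)" if "\<omega> \<in> space M" for \<omega>
    by (rule integral_interval_measure[OF m2[OF that]])
  show "integrable M (\<lambda>\<omega>. LINT s:{0..t}|lborel. f s \<omega>)"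
    using pr.integrable_snd[OF f] eq by (simp cong: Bochner_Integration.integrable_cong)
  show "(\<integral>(s, \<omega>). f s \<omega> \<partial>(interval_measure t \<Otimes>\<^sub>M M)) = (\<integral>\<omega>. (LINT s:{0..t}|lborel. f s \<omega>) \<partial>M)"
    using pr.integral_snd[OF f] eq by (simp cong: Bochner_Integration.integral_cong)
qed

context perturbed_family begin

abbreviation "p_t \<equiv> interval_measure t \<Otimes>\<^sub>M M"

text \<open>The change of measure acts at each time separately. Applied to absolute values, with
  Tonelli, it gives integrability on the product; Fubini then yields the signed identity.\<close>

lemma perturbed_integral:
  fixes \<psi> :: "real \<Rightarrow> 'a \<Rightarrow> real"
  assumes fin: "AE \<omega> in P' l. \<exists>n. t < T' l n \<omega>"
    and \<psi>: "(\<lambda>(s, x). \<psi> s x) \<in> borel_measurable (borel \<Otimes>\<^sub>M \<X>)"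
    and int: "integrable p_t (\<lambda>(s, \<omega>). path_density (gl l) s \<omega> * \<psi> s (X \<omega> s))"
  shows "integrable (interval_measure t \<Otimes>\<^sub>M P' l) (\<lambda>(s, \<omega>). \<psi> s (X' l \<omega> s))"
    "(\<integral>(s, \<omega>). \<psi> s (X' l \<omega> s) \<partial>(interval_measure t \<Otimes>\<^sub>M P' l))
      = (\<integral>(s, \<omega>). path_density (gl l) s \<omega> * \<psi> s (X \<omega> s) \<partial>p_t)"
proof -
  interpret P': tilted_process \<X> r \<nu> "gl l" t "P' l" "T' l" "Y' l" by (rule P')
  interpret \<mu>: finite_measure "interval_measure t" by (rule finite_interval_measure)
  interpret pr: pair_sigma_finite "interval_measure t" M ..
  interpret pr': pair_sigma_finite "interval_measure t" "P' l" ..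
  have \<psi>s: "\<psi> s \<in> borel_measurable \<X>" for s using measurable_Pair2[OF \<psi>, of s] by simp
  have "(\<lambda>z. (fst z, X' l (snd z) (fst z))) \<in> measurable (borel \<Otimes>\<^sub>M P' l) (borel \<Otimes>\<^sub>M \<X>)"
    by (intro measurable_Pair measurable_fst P'.X_measurable_pair)
  from measurable_compose[OF this \<psi>]
  have m': "(\<lambda>z. \<psi> (fst z) (X' l (snd z) (fst z))) \<in> borel_measurable (interval_measure t \<Otimes>\<^sub>M P' l)"
    by (simp cong: measurable_cong_sets)
  have m: "(\<lambda>z. path_density (gl l) (fst z) (snd z) * \<psi> (fst z) (X (snd z) (fst z))) \<in> borel_measurable p_t"
    using borel_measurable_integrable[OF int] by (simp add: case_prod_beta)
  have "(\<integral>\<^sup>+z. ennreal (norm (\<psi> (fst z) (X' l (snd z) (fst z)))) \<partial>(interval_measure t \<Otimes>\<^sub>M P' l))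
    = (\<integral>\<^sup>+s. \<integral>\<^sup>+\<omega>. ennreal \<bar>\<psi> s (X' l \<omega> s)\<bar> \<partial>P' l \<partial>interval_measure t)"
    by (subst P'.nn_integral_fst[symmetric]) (use m' in auto)
  also have "\<dots> = (\<integral>\<^sup>+s. \<integral>\<^sup>+\<omega>. ennreal \<bar>path_density (gl l) s \<omega> * \<psi> s (X \<omega> s)\<bar> \<partial>M \<partial>interval_measure t)"
  proof (rule nn_integral_cong_AE)
    show "AE s in interval_measure t. (\<integral>\<^sup>+\<omega>. ennreal \<bar>\<psi> s (X' l \<omega> s)\<bar> \<partial>P' l)
      = (\<integral>\<^sup>+\<omega>. ennreal \<bar>path_density (gl l) s \<omega> * \<psi> s (X \<omega> s)\<bar> \<partial>M)"
      unfolding AE_interval_measure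
    proof (intro AE_I2 impI)
      fix s assume s: "s \<in> {0..t}"
      have "(\<lambda>x. ennreal \<bar>\<psi> s x\<bar>) \<in> borel_measurable \<X>"
        by (intro measurable_compose[OF _ measurable_ennreal] borel_measurable_abs \<psi>s)
      from girsanov[OF P' fin this, of s] s
      show "(\<integral>\<^sup>+\<omega>. ennreal \<bar>\<psi> s (X' l \<omega> s)\<bar> \<partial>P' l) = (\<integral>\<^sup>+\<omega>. ennreal \<bar>path_density (gl l) s \<omega> * \<psi> s (X \<omega> s)\<bar> \<partial>M)"
        by (simp add: abs_mult ennreal_mult' path_density_def)
    qed
  qed
  also have "\<dots> = (\<integral>\<^sup>+z. ennreal (norm (path_density (gl l) (fst z) (snd z) * \<psi> (fst z) (X (snd z) (fst z)))) \<partial>p_t)"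
    by (subst nn_integral_fst[symmetric]) (use m in auto)
  also have "\<dots> < \<infinity>" using int by (simp add: integrable_iff_bounded case_prod_beta)
  finally show int': "integrable (interval_measure t \<Otimes>\<^sub>M P' l) (\<lambda>(s, \<omega>). \<psi> s (X' l \<omega> s))"
    using m' by (simp add: integrable_iff_bounded case_prod_beta)
  show "(\<integral>(s, \<omega>). \<psi> s (X' l \<omega> s) \<partial>(interval_measure t \<Otimes>\<^sub>M P' l))
      = (\<integral>(s, \<omega>). path_density (gl l) s \<omega> * \<psi> s (X \<omega> s) \<partial>p_t)"
    unfolding P'.fubini_interval(3)[OF int'] fubini_interval(3)[OF int]
    using girsanov_integral(2)[OF P' fin \<psi>s]
    by (intro set_lebesgue_integral_cong) auto
qed

lemma running_response:
  assumes v: "(\<lambda>(s, x). v s x) \<in> borel_measurable (borel \<Otimes>\<^sub>M \<X>)" and p: "1 < p"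
    and Lp: "(\<integral>\<^sup>+s\<in>{0..t}. Lp_norm M p (\<lambda>\<omega>. ennreal \<bar>v s (X \<omega> s)\<bar>) \<partial>lborel) < \<infinity>"
  shows "\<forall>\<^sub>F l in nhds 0. (AE \<omega> in P' l. set_integrable lborel {0..t} (\<lambda>s. v s (X' l \<omega> s))) \<and>
      integrable (P' l) (\<lambda>\<omega>. LINT s:{0..t}|lborel. v s (X' l \<omega> s))"
    "AE s in lborel. s \<in> {0..t} \<longrightarrow> integrable M (\<lambda>\<omega>. v s (X \<omega> s) * G s \<omega>)"
    "set_integrable lborel {0..t} (\<lambda>s. \<integral>\<omega>. v s (X \<omega> s) * G s \<omega> \<partial>M)"
    "((\<lambda>l. \<integral>\<omega>. (LINT s:{0..t}|lborel. v s (X' l \<omega> s)) \<partial>P' l)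
      has_real_derivative (LINT s:{0..t}|lborel. \<integral>\<omega>. v s (X \<omega> s) * G s \<omega> \<partial>M)) (at 0)"
proof -
  obtain a where a: "0 < a" "(\<integral>\<^sup>+\<omega>. ennreal (exp (a * W \<omega>)) \<partial>M) < \<infinity>" using exp_moment_W by blast
  from Lp_norm_exp_bound[OF p W_measurable a] obtain c C where c: "0 < c" and C: "0 < C"
    "\<And>f. f \<in> borel_measurable M \<Longrightarrow> (\<integral>\<^sup>+\<omega>. f \<omega> * ennreal (exp (c * W \<omega>)) \<partial>M) \<le> Lp_norm M p f * ennreal C"
    by blast
  interpret \<mu>: finite_measure "interval_measure t" by (rule finite_interval_measure)
  define J where "J s = (\<integral>\<^sup>+\<omega>. ennreal \<bar>v s (X \<omega> s)\<bar> * ennreal (exp (c * W \<omega>)) \<partial>M)" for s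
  have "(\<lambda>z. (fst z, X (snd z) (fst z))) \<in> measurable (borel \<Otimes>\<^sub>M M) (borel \<Otimes>\<^sub>M \<X>)"
    by (intro measurable_Pair measurable_fst X_measurable_pair)
  from measurable_compose[OF this v]
  have vX: "(\<lambda>z. v (fst z) (X (snd z) (fst z))) \<in> borel_measurable (borel \<Otimes>\<^sub>M M)" by simp
  have vXs: "(\<lambda>\<omega>. v s (X \<omega> s)) \<in> borel_measurable M" for s
    using measurable_Pair2[OF vX, of s] by simp
  have J: "J \<in> borel_measurable borel"
  proof -
    have "(\<lambda>(s, \<omega>). ennreal \<bar>v s (X \<omega> s)\<bar> * ennreal (exp (c * W \<omega>))) \<in> borel_measurable (borel \<Otimes>\<^sub>M M)"
      unfolding case_prod_beta
      by (intro borel_measurable_times_ennreal measurable_compose[OF _ measurable_ennreal] borel_measurable_abs vX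
          measurable_compose[OF _ borel_measurable_exp] borel_measurable_times borel_measurable_const
          measurable_compose[OF measurable_snd W_measurable])
    then show ?thesis unfolding J_def[abs_def] by (rule borel_measurable_nn_integral)
  qed
  have va: "(\<lambda>(s, x). \<bar>v s x\<bar>) \<in> borel_measurable (borel \<Otimes>\<^sub>M \<X>)"
    using borel_measurable_abs[OF v] by (simp add: case_prod_beta)
  have fin: "(\<integral>\<^sup>+s. J s \<partial>interval_measure t) < \<infinity>"
  proof -
    \<comment> \<open>Measurability of the norm as a function of \<open>s\<close> has not been
      established. The constant is therefore divided out on the side of \<open>J\<close>, where it
      may pass through the integral, and the comparison with the norm uses monotonicity
      alone.\<close>
    have "ennreal (1 / C) * (\<integral>\<^sup>+s\<in>{0..t}. J s \<partial>lborel) = (\<integral>\<^sup>+s. ennreal (1 / C) * (J s * indicator {0..t} s) \<partial>lborel)"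
      using J by (subst nn_integral_cmult) auto
    also have "\<dots> \<le> (\<integral>\<^sup>+s\<in>{0..t}. Lp_norm M p (\<lambda>\<omega>. ennreal \<bar>v s (X \<omega> s)\<bar>) \<partial>lborel)"
    proof (rule nn_integral_mono)
      fix s
      have "J s \<le> Lp_norm M p (\<lambda>\<omega>. ennreal \<bar>v s (X \<omega> s)\<bar>) * ennreal C"
        unfolding J_def
        by (intro C(2) measurable_compose[OF _ measurable_ennreal] borel_measurable_abs vXs)
      then have "ennreal (1 / C) * J s \<le> ennreal (1 / C) * (Lp_norm M p (\<lambda>\<omega>. ennreal \<bar>v s (X \<omega> s)\<bar>) * ennreal C)"
        by (rule mult_left_mono) simp
      also have "\<dots> = Lp_norm M p (\<lambda>\<omega>. ennreal \<bar>v s (X \<omega> s)\<bar>) * ennreal (1 / C * C)"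
        using C(1) by (subst ennreal_mult) (auto simp: mult_ac)
      also have "\<dots> = Lp_norm M p (\<lambda>\<omega>. ennreal \<bar>v s (X \<omega> s)\<bar>)" using C(1) by simp
      finally show "ennreal (1 / C) * (J s * indicator {0..t} s)
          \<le> Lp_norm M p (\<lambda>\<omega>. ennreal \<bar>v s (X \<omega> s)\<bar>) * indicator {0..t} s"
        by (simp add: mult.assoc[symmetric] mult_right_mono)
    qed
    finally have "ennreal (1 / C) * (\<integral>\<^sup>+s\<in>{0..t}. J s \<partial>lborel) < \<infinity>" using Lp by (rule le_less_trans)
    then have "(\<integral>\<^sup>+s\<in>{0..t}. J s \<partial>lborel) < \<infinity>"
      using C(1) by (auto simp: ennreal_mult_less_top)
    then show ?thesis by (simp add: nn_integral_interval_measure[OF J])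
  qed
  have \<mu>_AE: "AE s in interval_measure t. 0 \<le> s \<and> s \<le> t"
    by (simp add: AE_interval_measure)
  have R: "\<And>l. \<bar>l\<bar> \<le> 1 \<Longrightarrow> \<bar>l\<bar> * C0 \<le> c / 2 \<Longrightarrow> integrable p_t (\<lambda>(s, \<omega>). path_density (gl l) s \<omega> * v s (X \<omega> s))"
    "integrable p_t (\<lambda>(s, \<omega>). v s (X \<omega> s) * G s \<omega>)"
    "((\<lambda>l. \<integral>(s, \<omega>). path_density (gl l) s \<omega> * v s (X \<omega> s) \<partial>p_t) has_real_derivative
      (\<integral>(s, \<omega>). 0 \<partial>p_t) + (\<integral>(s, \<omega>). v s (X \<omega> s) * G s \<omega> \<partial>p_t)) (at 0)"
    by (rule response[where \<mu> = "interval_measure t" and \<psi> = "\<lambda>_. v" and \<psi>' = "\<lambda>_ _. 0" and B = "\<lambda>s x. \<bar>v s x\<bar>" and C = 0,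
      OF \<mu>.sigma_finite_measure_axioms _ \<mu>_AE v _ va _ _ _ _ c fin[unfolded J_def]]; simp)+
  have c2: "0 < c / 2" using c by simp
  have small: "\<forall>\<^sub>F l in nhds 0. ((AE \<omega> in P' l. set_integrable lborel {0..t} (\<lambda>s. v s (X' l \<omega> s))) \<and>
      integrable (P' l) (\<lambda>\<omega>. LINT s:{0..t}|lborel. v s (X' l \<omega> s))) \<and>
      (\<integral>\<omega>. (LINT s:{0..t}|lborel. v s (X' l \<omega> s)) \<partial>P' l) = (\<integral>(s, \<omega>). path_density (gl l) s \<omega> * v s (X \<omega> s) \<partial>p_t)"
    using eventually_small[OF c2]
  proof eventually_elim
    case (elim l)
    then have l: "\<bar>l\<bar> \<le> 1" "\<bar>l\<bar> * C0 \<le> c / 2" and f: "AE \<omega> in P' l. \<exists>n. t < T' l n \<omega>" by auto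
    interpret P': tilted_process \<X> r \<nu> "gl l" t "P' l" "T' l" "Y' l" by (rule P')
    note pi = perturbed_integral[OF f v R(1)[OF l]]
    show ?case using P'.fubini_interval[OF pi(1)] pi(2) by simp
  qed
  then show "\<forall>\<^sub>F l in nhds 0. (AE \<omega> in P' l. set_integrable lborel {0..t} (\<lambda>s. v s (X' l \<omega> s))) \<and>
      integrable (P' l) (\<lambda>\<omega>. LINT s:{0..t}|lborel. v s (X' l \<omega> s))"
    by eventually_elim blast
  show "AE s in lborel. s \<in> {0..t} \<longrightarrow> integrable M (\<lambda>\<omega>. v s (X \<omega> s) * G s \<omega>)"
    "set_integrable lborel {0..t} (\<lambda>s. \<integral>\<omega>. v s (X \<omega> s) * G s \<omega> \<partial>M)"
    by (rule fubini_interval[OF R(2)])+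
  have zero: "(\<integral>(s, \<omega>). (0::real) \<partial>p_t) = 0" unfolding case_prod_beta by simp
  have "((\<lambda>l. \<integral>(s, \<omega>). path_density (gl l) s \<omega> * v s (X \<omega> s) \<partial>p_t) has_real_derivative
      (LINT s:{0..t}|lborel. \<integral>\<omega>. v s (X \<omega> s) * G s \<omega> \<partial>M)) (at 0)"
    using R(3) fubini_interval(3)[OF R(2)] zero by simp
  then show "((\<lambda>l. \<integral>\<omega>. (LINT s:{0..t}|lborel. v s (X' l \<omega> s)) \<partial>P' l)
      has_real_derivative (LINT s:{0..t}|lborel. \<integral>\<omega>. v s (X \<omega> s) * G s \<omega> \<partial>M)) (at 0)"
    by (rule DERIV_cong_ev[THEN iffD2, rotated -1]) (use small in \<open>auto elim: eventually_mono\<close>)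
qed

end

section \<open>Contractions of jump functionals\<close>

abbreviation (in rate_kernel) measurable_coeff :: "(real \<Rightarrow> 'a \<Rightarrow> 'a \<Rightarrow> real) \<Rightarrow> bool" where
  "measurable_coeff \<alpha> \<equiv> (\<lambda>(s, x, y). \<alpha> s x y) \<in> borel_measurable (borel \<Otimes>\<^sub>M \<X> \<Otimes>\<^sub>M \<X>)"

context rate_kernel begin

lemma measurable_coeff_r:
  assumes \<alpha>: "measurable_coeff \<alpha>" and x: "x \<in> space \<X>"
  shows "\<alpha> s x \<in> borel_measurable (r x)"
proof -
  have "(\<lambda>y. \<alpha> s x y) \<in> borel_measurable \<X>"
    by (rule measurable3_compose[OF \<alpha>]) (use x in auto)
  then show ?thesis by (subst measurable_cong_sets[OF sets_r[OF x] refl])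
qed

lemma measurable_coeff_map2:
  assumes "measurable_coeff \<alpha>" "measurable_coeff \<beta>"
    and F: "(\<lambda>(a, b). F a b) \<in> borel_measurable (borel \<Otimes>\<^sub>M borel)"
  shows "measurable_coeff (\<lambda>s x y. F (\<alpha> s x y) (\<beta> s x y))"
  using measurable_compose[OF measurable_Pair[OF assms(1,2)] F] by (simp add: case_prod_beta)

lemma abs_contraction_measurable:
  assumes \<alpha>: "measurable_coeff \<alpha>" and [measurable]: "a \<in> borel_measurable N" "b \<in> measurable N \<X>"
  shows "(\<lambda>w. abs_contraction r \<alpha> (a w) (b w)) \<in> borel_measurable N"
  unfolding abs_contraction_def
proof (rule nn_integral_r_measurable)
  show "(\<lambda>(w, y). ennreal \<bar>\<alpha> (a w) (b w) y\<bar>) \<in> borel_measurable (N \<Otimes>\<^sub>M \<X>)"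
    unfolding case_prod_beta
    by (intro measurable_compose[OF _ measurable_ennreal] borel_measurable_abs measurable3_compose[OF \<alpha>]) measurable
qed fact

lemma integrable_iff_abs_contraction:
  assumes \<alpha>: "measurable_coeff \<alpha>" and x: "x \<in> space \<X>"
  shows "integrable (r x) (\<alpha> s x) \<longleftrightarrow> abs_contraction r \<alpha> s x < \<infinity>"
  using measurable_coeff_r[OF \<alpha> x] by (simp add: integrable_iff_bounded abs_contraction_def)

lemma abs_contraction_tilt:
  assumes h: "bounded_tilt h" and x: "x \<in> space \<X>"
  shows "abs_contraction r h s x = ennreal (contraction r (\<lambda>s x y. \<bar>h s x y\<bar>) s x)"
  unfolding abs_contraction_def contraction_def
  using integrable_tilt[OF bounded_tilt_abs[OF h] x] by (intro nn_integral_eq_integral) auto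

end

section \<open>Condition C and moments of absolute contractions\<close>

context base_process begin

lemma abs_time_integral_measurable:
  assumes \<alpha>: "measurable_coeff \<alpha>"
  shows "(\<lambda>\<omega>. abs_time_integral r \<alpha> t (X \<omega>)) \<in> borel_measurable M"
proof -
  have 1: "(\<lambda>z. abs_contraction r \<alpha> (snd z) (X (fst z) (snd z))) \<in> borel_measurable (M \<Otimes>\<^sub>M lborel)"
    by (rule abs_contraction_measurable[OF \<alpha> _ X_compose_measurable]) measurable
  have "(\<lambda>(\<omega>, s). abs_contraction r \<alpha> s (X \<omega> s) * indicator {0..t} s) \<in> borel_measurable (M \<Otimes>\<^sub>M lborel)"
    unfolding case_prod_beta
    by (intro borel_measurable_times_ennreal 1 measurable_compose[OF measurable_snd borel_measurable_indicator]) auto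
  then show ?thesis unfolding abs_time_integral_def by (rule lborel.borel_measurable_nn_integral)
qed

text \<open>The extended time integral is finite along a path that has not exploded: finitely many
  states are visited, each has a finite rate, and the coefficient is bounded.\<close>

lemma abs_time_integral_tilt:
  assumes h: "bounded_tilt h"
  shows "AE \<omega> in M. abs_time_integral r h t (X \<omega>)
    = ennreal (LINT u:{0..t}|lborel. contraction r (\<lambda>s x y. \<bar>h s x y\<bar>) u (X \<omega> u))"
  using finite_jumps AE_space
proof eventually_elim
  case (elim \<omega>)
  then obtain m where m: "t < T m \<omega>" by auto
  have w: "\<omega> \<in> space M" by fact
  note i = path_integrable[where \<phi> = "contraction r (\<lambda>s x y. \<bar>h s x y\<bar>)", OF w
      set_integrable_contraction[OF bounded_tilt_abs[OF h]] t_nonneg m]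
  have "abs_time_integral r h t (X \<omega>)
      = (\<integral>\<^sup>+u. ennreal (indicator {0..t} u *\<^sub>R contraction r (\<lambda>s x y. \<bar>h s x y\<bar>) u (X \<omega> u)) \<partial>lborel)"
    unfolding abs_time_integral_def
    by (intro nn_integral_cong) (simp add: abs_contraction_tilt[OF h X_space[OF w]] split: split_indicator)
  also have "\<dots> = ennreal (LINT u:{0..t}|lborel. contraction r (\<lambda>s x y. \<bar>h s x y\<bar>) u (X \<omega> u))"
    unfolding set_lebesgue_integral_def
    using i contraction_abs_nonneg by (intro nn_integral_eq_integral) (auto simp: set_integrable_def)
  finally show ?case .
qed

lemma condition_C_exp_moment:
  assumes h: "bounded_tilt h" and C: "condition_C r t M X h"
  shows "\<exists>\<theta>>0. (\<integral>\<^sup>+\<omega>. ennreal (exp (\<theta> *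
      (LINT u:{0..t}|lborel. contraction r (\<lambda>s x y. \<bar>h s x y\<bar>) u (X \<omega> u)))) \<partial>M) < \<infinity>"
proof -
  from C obtain \<theta> where \<theta>: "0 < \<theta>" "(\<integral>\<^sup>+\<omega>. ennexp (ennreal \<theta> * abs_time_integral r h t (X \<omega>)) \<partial>M) < \<infinity>"
    by (auto simp: condition_C_def)
  have "AE \<omega> in M. ennreal (exp (\<theta> * (LINT u:{0..t}|lborel. contraction r (\<lambda>s x y. \<bar>h s x y\<bar>) u (X \<omega> u))))
      = ennexp (ennreal \<theta> * abs_time_integral r h t (X \<omega>))"
    using abs_time_integral_tilt[OF h]
  proof eventually_elim
    case (elim \<omega>)
    have "0 \<le> (LINT u:{0..t}|lborel. contraction r (\<lambda>s x y. \<bar>h s x y\<bar>) u (X \<omega> u))"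
      unfolding set_lebesgue_integral_def
      by (intro integral_nonneg_AE AE_I2 scaleR_nonneg_nonneg contraction_abs_nonneg) auto
    then show ?case unfolding elim ennexp_def using \<theta>(1) by (simp add: ennreal_mult[symmetric])
  qed
  from nn_integral_cong_AE[OF this] \<theta> show ?thesis by (intro exI[of _ \<theta>]) simp
qed

end

context perturbed_base begin

text \<open>An exponential moment of \<open>W\<close> dominates its second moment. This serves the
  example of a bounded \<open>\<alpha>\<close> under Condition C, with \<open>\<alpha>\<close> in
  the role of \<open>g\<close>, and is the reason for the exponent \<open>2\<close>.\<close>

lemma in_L2_of_le_W:
  assumes f [measurable]: "f \<in> borel_measurable M" and le: "AE \<omega> in M. f \<omega> \<le> ennreal (W \<omega>)"
  shows "in_Lp M 2 f"
proof -
  obtain c where c: "0 < c" "(\<integral>\<^sup>+\<omega>. ennreal (exp (c * W \<omega>)) \<partial>M) < \<infinity>" using exp_moment_W by blast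
  have [measurable]: "W \<in> borel_measurable M" by (rule W_measurable)
  have "(\<integral>\<^sup>+\<omega>. ennpowr (f \<omega>) 2 \<partial>M) \<le> (\<integral>\<^sup>+\<omega>. ennreal (2 / c\<^sup>2) * ennreal (exp (c * W \<omega>)) \<partial>M)"
  proof (rule nn_integral_mono_AE, use le in eventually_elim)
    case (elim \<omega>)
    then have fin: "f \<omega> \<noteq> \<top>" by (auto simp: top_unique)
    have "enn2real (f \<omega>) \<le> W \<omega>" using elim W_nonneg[of \<omega>] by (simp add: enn2real_leI)
    then have "(enn2real (f \<omega>))\<^sup>2 \<le> (W \<omega>)\<^sup>2" by (intro power_mono) auto
    also have "\<dots> \<le> 2 / c\<^sup>2 * exp (c * W \<omega>)" by (rule exp_dominates(2)[OF c(1) W_nonneg])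
    finally have "ennreal (enn2real (f \<omega>) powr 2) \<le> ennreal (2 / c\<^sup>2 * exp (c * W \<omega>))"
      by (intro ennreal_leI) simp
    also have "\<dots> = ennreal (2 / c\<^sup>2) * ennreal (exp (c * W \<omega>))" by (rule ennreal_mult) auto
    finally show ?case unfolding ennpowr_def using fin by (simp only: if_False infinity_ennreal_def)
  qed
  also have "\<dots> = ennreal (2 / c\<^sup>2) * (\<integral>\<^sup>+\<omega>. ennreal (exp (c * W \<omega>)) \<partial>M)" by (rule nn_integral_cmult) measurable
  also have "\<dots> < \<infinity>" using c(2) by (simp add: ennreal_mult_less_top)
  finally have "(\<integral>\<^sup>+\<omega>. ennpowr (f \<omega>) 2 \<partial>M) < \<infinity>" .
  moreover have "real_of_ereal 2 = 2" "(2::ereal) \<noteq> \<infinity>" using numeral_eq_ereal[of "Num.Bit0 Num.One"] by auto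
  ultimately show ?thesis by (auto simp: in_Lp_def Lp_norm_def ennpowr_def)
qed

lemma in_L2:
  "in_Lp M 2 (\<lambda>\<omega>. ennreal (jsum (\<lambda>s x y. \<bar>g s x y\<bar>) t \<omega>))"
  "in_Lp M 2 (\<lambda>\<omega>. abs_time_integral r g t (X \<omega>))"
proof -
  show "in_Lp M 2 (\<lambda>\<omega>. ennreal (jsum (\<lambda>s x y. \<bar>g s x y\<bar>) t \<omega>))"
  proof (rule in_L2_of_le_W)
    show "(\<lambda>\<omega>. ennreal (jsum (\<lambda>s x y. \<bar>g s x y\<bar>) t \<omega>)) \<in> borel_measurable M"
      by (intro measurable_compose[OF _ measurable_ennreal]
          jsum_measurable[OF bounded_tilt_measurable3[OF bounded_tilt_abs[OF g]]]) auto
  qed (auto simp: W_def A_nonneg intro!: AE_I2 ennreal_leI)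
  show "in_Lp M 2 (\<lambda>\<omega>. abs_time_integral r g t (X \<omega>))"
  proof (rule in_L2_of_le_W)
    show "(\<lambda>\<omega>. abs_time_integral r g t (X \<omega>)) \<in> borel_measurable M"
      by (rule abs_time_integral_measurable[OF bounded_tilt_measurable3[OF g]])
    show "AE \<omega> in M. abs_time_integral r g t (X \<omega>) \<le> ennreal (W \<omega>)"
      using abs_time_integral_tilt[OF g]
      by eventually_elim (auto simp: W_def A_def jsum_abs_nonneg intro!: ennreal_leI)
  qed
qed

definition tilted_contraction :: "(real \<Rightarrow> 'a \<Rightarrow> 'a \<Rightarrow> real) \<Rightarrow> real \<Rightarrow> real \<Rightarrow> 'a \<Rightarrow> real" where
  "tilted_contraction \<alpha> l = contraction r (\<lambda>s x y. exp (l * g s x y) * \<alpha> s x y)"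

definition product_contraction :: "(real \<Rightarrow> 'a \<Rightarrow> 'a \<Rightarrow> real) \<Rightarrow> real \<Rightarrow> 'a \<Rightarrow> real" where
  "product_contraction \<alpha> = contraction r (\<lambda>s x y. \<alpha> s x y * g s x y)"

lemma tilted_contraction_0: "tilted_contraction \<alpha> 0 = contraction r \<alpha>"
  by (simp add: tilted_contraction_def)

lemma tilted_product_coeff:
  assumes "measurable_coeff \<alpha>" shows "measurable_coeff (\<lambda>s x y. exp (l * g s x y) * \<alpha> s x y)"
  by (rule measurable_coeff_map2[OF bounded_tilt_measurable3[OF g] assms, where F = "\<lambda>a b. exp (l * a) * b"]) measurable

lemma product_coeff:
  assumes "measurable_coeff \<alpha>" shows "measurable_coeff (\<lambda>s x y. \<alpha> s x y * g s x y)"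
  by (rule measurable_coeff_map2[OF assms bounded_tilt_measurable3[OF g], where F = "\<lambda>a b. a * b"]) measurable

lemma exp_g_bounds:
  assumes "x \<in> space \<X>" "y \<in> space \<X>"
  shows "exp (l * g s x y) \<le> exp (\<bar>l\<bar> * K)" "1 \<le> exp (\<bar>l\<bar> * K) * exp (l * g s x y)"
proof -
  have "\<bar>l * g s x y\<bar> \<le> \<bar>l\<bar> * K" using K[OF assms, of s] by (simp add: abs_mult mult_left_mono)
  then show "exp (l * g s x y) \<le> exp (\<bar>l\<bar> * K)" "1 \<le> exp (\<bar>l\<bar> * K) * exp (l * g s x y)"
    by (auto simp: exp_add[symmetric] abs_le_iff)
qed

lemma tilted_contraction_finite:
  assumes \<alpha>: "measurable_coeff \<alpha>" and x: "x \<in> space \<X>" and fin: "abs_contraction r \<alpha> s x < \<infinity>"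
  shows "integrable (r x) (\<lambda>y. exp (l * g s x y) * \<alpha> s x y)" "integrable (r x) (\<lambda>y. \<alpha> s x y * g s x y)"
proof -
  have ia: "integrable (r x) (\<alpha> s x)" using fin integrable_iff_abs_contraction[OF \<alpha> x] by simp
  show "integrable (r x) (\<lambda>y. exp (l * g s x y) * \<alpha> s x y)"
  proof (rule Bochner_Integration.integrable_bound)
    show "integrable (r x) (\<lambda>y. exp (\<bar>l\<bar> * K) * \<alpha> s x y)" using ia by simp
    show "(\<lambda>y. exp (l * g s x y) * \<alpha> s x y) \<in> borel_measurable (r x)"
      by (rule measurable_coeff_r[OF tilted_product_coeff[OF \<alpha>] x])
    show "AE y in r x. norm (exp (l * g s x y) * \<alpha> s x y) \<le> norm (exp (\<bar>l\<bar> * K) * \<alpha> s x y)"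
      using exp_g_bounds(1)[OF x] by (intro AE_I2) (auto simp: space_r[OF x] abs_mult intro!: mult_right_mono)
  qed
  show "integrable (r x) (\<lambda>y. \<alpha> s x y * g s x y)"
  proof (rule Bochner_Integration.integrable_bound)
    show "integrable (r x) (\<lambda>y. \<alpha> s x y * K)" using ia by simp
    show "(\<lambda>y. \<alpha> s x y * g s x y) \<in> borel_measurable (r x)"
      by (rule measurable_coeff_r[OF product_coeff[OF \<alpha>] x])
    show "AE y in r x. norm (\<alpha> s x y * g s x y) \<le> norm (\<alpha> s x y * K)"
      using K[OF x] K_nonneg by (intro AE_I2) (auto simp: space_r[OF x] abs_mult intro!: mult_left_mono)
  qed
qed

text \<open>Where \<open>\<alpha>\<close> is not integrable, the Bochner integral is \<open>0\<close> for every \<open>l\<close>, so that the bounds in \<open>l\<close>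
  below persist. The product \<open>\<alpha> g\<close> may still be integrable there.\<close>

lemma tilted_contraction_infinite:
  assumes \<alpha>: "measurable_coeff \<alpha>" and x: "x \<in> space \<X>" and inf: "abs_contraction r \<alpha> s x = \<infinity>"
  shows "tilted_contraction \<alpha> l s x = 0"
proof -
  have "\<not> integrable (r x) (\<lambda>y. exp (l * g s x y) * \<alpha> s x y)"
  proof
    assume i: "integrable (r x) (\<lambda>y. exp (l * g s x y) * \<alpha> s x y)"
    have "integrable (r x) (\<alpha> s x)"
    proof (rule Bochner_Integration.integrable_bound)
      show "integrable (r x) (\<lambda>y. exp (\<bar>l\<bar> * K) * (exp (l * g s x y) * \<alpha> s x y))" using i by simp
      show "\<alpha> s x \<in> borel_measurable (r x)" by (rule measurable_coeff_r[OF \<alpha> x])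
      show "AE y in r x. norm (\<alpha> s x y) \<le> norm (exp (\<bar>l\<bar> * K) * (exp (l * g s x y) * \<alpha> s x y))"
      proof (rule AE_I2)
        fix y assume "y \<in> space (r x)"
        then have "1 * \<bar>\<alpha> s x y\<bar> \<le> (exp (\<bar>l\<bar> * K) * exp (l * g s x y)) * \<bar>\<alpha> s x y\<bar>"
          using exp_g_bounds(2)[OF x] by (intro mult_right_mono) (auto simp: space_r[OF x])
        then show "norm (\<alpha> s x y) \<le> norm (exp (\<bar>l\<bar> * K) * (exp (l * g s x y) * \<alpha> s x y))"
          by (simp add: abs_mult mult.assoc)
      qed
    qed
    then show False using inf integrable_iff_abs_contraction[OF \<alpha> x] by simp
  qed
  then show ?thesis by (simp add: tilted_contraction_def contraction_def not_integrable_integral_eq)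
qed

text \<open>Here \<open>\<alpha>\<close> carries the integrability. The factor
  \<open>\<bar>g\<bar>\<close> that \<open>exp_scaled_bounds\<close> retains is therefore replaced
  by \<open>K\<close> as well.\<close>

lemma tilted_contraction_bounds:
  assumes \<alpha>: "measurable_coeff \<alpha>" and x: "x \<in> space \<X>" and fin: "abs_contraction r \<alpha> s x < \<infinity>"
  defines "b \<equiv> enn2real (abs_contraction r \<alpha> s x)"
  shows "\<bar>contraction r \<alpha> s x\<bar> \<le> b" "\<bar>product_contraction \<alpha> s x\<bar> \<le> K * b"
    "\<bar>l\<bar> \<le> 1 \<Longrightarrow> \<bar>tilted_contraction \<alpha> l s x - contraction r \<alpha> s x - l * product_contraction \<alpha> s x\<bar> \<le> C0 * K * l\<^sup>2 * b"
proof -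
  have ia: "integrable (r x) (\<alpha> s x)" using fin integrable_iff_abs_contraction[OF \<alpha> x] by simp
  have b: "b = (\<integral>y. \<bar>\<alpha> s x y\<bar> \<partial>r x)"
    unfolding b_def abs_contraction_def using ia measurable_coeff_r[OF \<alpha> x, of s]
    by (intro integral_eq_nn_integral[symmetric]) auto
  note i1 = tilted_contraction_finite(1)[OF \<alpha> x fin, of l] and i2 = tilted_contraction_finite(2)[OF \<alpha> x fin]
  show "\<bar>contraction r \<alpha> s x\<bar> \<le> b" unfolding b contraction_def by (rule integral_abs_bound)
  have "\<bar>product_contraction \<alpha> s x\<bar> \<le> (\<integral>y. \<bar>\<alpha> s x y * g s x y\<bar> \<partial>r x)"
    unfolding product_contraction_def contraction_def by (rule integral_abs_bound)
  also have "\<dots> \<le> (\<integral>y. K * \<bar>\<alpha> s x y\<bar> \<partial>r x)"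
  proof (rule integral_mono)
    fix y assume "y \<in> space (r x)"
    then show "\<bar>\<alpha> s x y * g s x y\<bar> \<le> K * \<bar>\<alpha> s x y\<bar>"
      using mult_left_mono[OF K[OF x, of y s], of "\<bar>\<alpha> s x y\<bar>"] by (simp add: abs_mult space_r[OF x] mult.commute)
  qed (use i2 ia in auto)
  finally show "\<bar>product_contraction \<alpha> s x\<bar> \<le> K * b" by (simp add: b)
  assume l: "\<bar>l\<bar> \<le> 1"
  have "tilted_contraction \<alpha> l s x - contraction r \<alpha> s x - l * product_contraction \<alpha> s x
      = (\<integral>y. (exp (l * g s x y) * \<alpha> s x y - \<alpha> s x y) - l * (\<alpha> s x y * g s x y) \<partial>r x)"
    unfolding tilted_contraction_def product_contraction_def contraction_def
    by (simp only: Bochner_Integration.integral_diff[OF Bochner_Integration.integrable_diff[OF i1 ia] integrable_mult_right[OF i2]]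
        Bochner_Integration.integral_diff[OF i1 ia] integral_mult_right_zero)
  then have "\<bar>tilted_contraction \<alpha> l s x - contraction r \<alpha> s x - l * product_contraction \<alpha> s x\<bar>
      \<le> (\<integral>y. \<bar>(exp (l * g s x y) * \<alpha> s x y - \<alpha> s x y) - l * (\<alpha> s x y * g s x y)\<bar> \<partial>r x)"
    by (simp only: integral_abs_bound)
  also have "\<dots> \<le> (\<integral>y. C0 * K * l\<^sup>2 * \<bar>\<alpha> s x y\<bar> \<partial>r x)"
  proof (rule integral_mono)
    show "integrable (r x) (\<lambda>y. \<bar>(exp (l * g s x y) * \<alpha> s x y - \<alpha> s x y) - l * (\<alpha> s x y * g s x y)\<bar>)"
      by (intro integrable_abs Bochner_Integration.integrable_diff i1 ia integrable_mult_right[OF i2])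
    show "integrable (r x) (\<lambda>y. C0 * K * l\<^sup>2 * \<bar>\<alpha> s x y\<bar>)" using ia by simp
    fix y assume "y \<in> space (r x)"
    then have gK: "\<bar>g s x y\<bar> \<le> K" using K[OF x] by (simp add: space_r[OF x])
    have "(exp (l * g s x y) * \<alpha> s x y - \<alpha> s x y) - l * (\<alpha> s x y * g s x y)
        = (exp (l * g s x y) - 1 - l * g s x y) * \<alpha> s x y" by (simp add: algebra_simps)
    then have "\<bar>(exp (l * g s x y) * \<alpha> s x y - \<alpha> s x y) - l * (\<alpha> s x y * g s x y)\<bar>
        = \<bar>exp (l * g s x y) - 1 - l * g s x y\<bar> * \<bar>\<alpha> s x y\<bar>" by (simp only: abs_mult)
    also have "\<dots> \<le> (l\<^sup>2 * C0 * \<bar>g s x y\<bar>) * \<bar>\<alpha> s x y\<bar>"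
      using exp_scaled_bounds(2)[OF gK l] by (intro mult_right_mono) (auto simp: C0_def)
    also have "\<dots> \<le> (l\<^sup>2 * C0 * K) * \<bar>\<alpha> s x y\<bar>"
      using gK C0_ge_1 by (intro mult_right_mono mult_left_mono) auto
    finally show "\<bar>(exp (l * g s x y) * \<alpha> s x y - \<alpha> s x y) - l * (\<alpha> s x y * g s x y)\<bar> \<le> C0 * K * l\<^sup>2 * \<bar>\<alpha> s x y\<bar>"
      by (simp add: mult_ac)
  qed
  finally show "\<bar>tilted_contraction \<alpha> l s x - contraction r \<alpha> s x - l * product_contraction \<alpha> s x\<bar> \<le> C0 * K * l\<^sup>2 * b"
    by (simp add: b)
qed

end

context perturbed_family begin

text \<open>The weight \<open>exp (c * W \<omega>)\<close> dominates densities and remainders, so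
  this is the finiteness that \<open>response\<close> asks for when the contraction of
  \<open>\<bar>\<alpha>\<bar>\<close> is the bound. It is inherited by coefficients of smaller
  modulus, in particular by positive and negative parts.\<close>

definition exp_integrable_coeff :: "(real \<Rightarrow> 'a \<Rightarrow> 'a \<Rightarrow> real) \<Rightarrow> real \<Rightarrow> bool" where
  "exp_integrable_coeff \<alpha> c \<longleftrightarrow> measurable_coeff \<alpha> \<and> 0 < c \<and>
    (\<integral>\<^sup>+s. (\<integral>\<^sup>+\<omega>. abs_contraction r \<alpha> s (X \<omega> s) * ennreal (exp (c * W \<omega>)) \<partial>M) \<partial>interval_measure t) < \<infinity>"

lemma pair_compose_X:
  "(\<lambda>(s, x). f s x) \<in> measurable (borel \<Otimes>\<^sub>M \<X>) L \<Longrightarrow> (\<lambda>z. f (fst z) (X (snd z) (fst z))) \<in> measurable p_t L"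
  using measurable_compose[OF measurable_Pair[OF measurable_fst X_measurable_pair], of "\<lambda>(s, x). f s x" L]
  by (simp cong: measurable_cong_sets)

lemma abs_contraction_AE_finite:
  assumes \<alpha>: "exp_integrable_coeff \<alpha> c"
  shows "AE z in p_t. abs_contraction r \<alpha> (fst z) (X (snd z) (fst z)) < \<infinity>"
proof -
  have m: "measurable_coeff \<alpha>" using \<alpha> by (simp add: exp_integrable_coeff_def)
  have 1: "(\<lambda>z. abs_contraction r \<alpha> (fst z) (X (snd z) (fst z))) \<in> borel_measurable p_t"
    by (rule pair_compose_X) (unfold case_prod_beta, rule abs_contraction_measurable[OF m], measurable)
  have 2: "(\<lambda>z. abs_contraction r \<alpha> (fst z) (X (snd z) (fst z)) * ennreal (exp (c * W (snd z)))) \<in> borel_measurable p_t"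
    using 1 W_measurable by measurable
  have "(\<integral>\<^sup>+z. abs_contraction r \<alpha> (fst z) (X (snd z) (fst z)) * ennreal (exp (c * W (snd z))) \<partial>p_t) \<noteq> \<infinity>"
    using \<alpha> by (subst nn_integral_fst[symmetric, OF 2]) (auto simp: exp_integrable_coeff_def)
  from nn_integral_noteq_infinite[OF 2 this] show ?thesis
    by eventually_elim (auto simp: less_top[symmetric] ennreal_top_mult)
qed

lemma coeff_response:
  assumes \<alpha>: "exp_integrable_coeff \<alpha> c"
  shows "\<And>l. \<bar>l\<bar> \<le> 1 \<Longrightarrow> \<bar>l\<bar> * C0 \<le> c / 2 \<Longrightarrow>
      integrable p_t (\<lambda>(s, \<omega>). path_density (gl l) s \<omega> * tilted_contraction \<alpha> l s (X \<omega> s))"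
    "integrable p_t (\<lambda>(s, \<omega>). product_contraction \<alpha> s (X \<omega> s))"
    "integrable p_t (\<lambda>(s, \<omega>). contraction r \<alpha> s (X \<omega> s) * G s \<omega>)"
    "((\<lambda>l. \<integral>(s, \<omega>). path_density (gl l) s \<omega> * tilted_contraction \<alpha> l s (X \<omega> s) \<partial>p_t) has_real_derivative
      (\<integral>(s, \<omega>). product_contraction \<alpha> s (X \<omega> s) \<partial>p_t) + (\<integral>(s, \<omega>). contraction r \<alpha> s (X \<omega> s) * G s \<omega> \<partial>p_t)) (at 0)"
proof -
  interpret \<mu>: finite_measure "interval_measure t" by (rule finite_interval_measure)
  have m: "measurable_coeff \<alpha>" and c: "0 < c" using \<alpha> by (simp_all add: exp_integrable_coeff_def)
  \<comment> \<open>Where \<open>\<alpha>\<close> is not integrable,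
    \<open>tilted_contraction\<close> and \<open>B\<close> are both \<open>0\<close>, while
    \<open>product_contraction\<close> may be different from \<open>0\<close>. Setting the
    derivative to \<open>0\<close> there makes the bounds of \<open>response\<close> true at every
    point and changes it only on a null set.\<close>
  define \<psi>' where "\<psi>' s x = (if abs_contraction r \<alpha> s x = \<infinity> then 0 else product_contraction \<alpha> s x)" for s x
  define B where "B s x = enn2real (abs_contraction r \<alpha> s x)" for s x
  have ac: "(\<lambda>z. abs_contraction r \<alpha> (fst z) (snd z)) \<in> borel_measurable (borel \<Otimes>\<^sub>M \<X>)"
    by (rule abs_contraction_measurable[OF m]) measurable
  have pc: "(\<lambda>z. product_contraction \<alpha> (fst z) (snd z)) \<in> borel_measurable (borel \<Otimes>\<^sub>M \<X>)"
    unfolding product_contraction_def by (rule contraction_measurable[OF product_coeff[OF m]]) measurable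
  have tc: "(\<lambda>(s, x). tilted_contraction \<alpha> l s x) \<in> borel_measurable (borel \<Otimes>\<^sub>M \<X>)" for l
    unfolding tilted_contraction_def case_prod_beta
    by (rule contraction_measurable[OF tilted_product_coeff[OF m]]) measurable
  have \<psi>'_m: "(\<lambda>(s, x). \<psi>' s x) \<in> borel_measurable (borel \<Otimes>\<^sub>M \<X>)"
    unfolding \<psi>'_def case_prod_beta using ac pc by measurable
  have B_m: "(\<lambda>(s, x). B s x) \<in> borel_measurable (borel \<Otimes>\<^sub>M \<X>)"
    unfolding B_def case_prod_beta using ac by measurable
  define C where "C = C0 * K + K"
  have C: "0 \<le> C" "K \<le> C" "C0 * K \<le> C" using K_nonneg C0_ge_1 by (auto simp: C_def)
  have fin: "(\<integral>\<^sup>+s. (\<integral>\<^sup>+\<omega>. ennreal (B s (X \<omega> s)) * ennreal (exp (c * W \<omega>)) \<partial>M) \<partial>interval_measure t) < \<infinity>"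
  proof (rule le_less_trans)
    show "(\<integral>\<^sup>+s. (\<integral>\<^sup>+\<omega>. ennreal (B s (X \<omega> s)) * ennreal (exp (c * W \<omega>)) \<partial>M) \<partial>interval_measure t)
      \<le> (\<integral>\<^sup>+s. (\<integral>\<^sup>+\<omega>. abs_contraction r \<alpha> s (X \<omega> s) * ennreal (exp (c * W \<omega>)) \<partial>M) \<partial>interval_measure t)"
      unfolding B_def by (intro nn_integral_mono mult_right_mono) (auto simp: ennreal_enn2real_if)
  qed (use \<alpha> in \<open>simp add: exp_integrable_coeff_def\<close>)
  have B_nn: "0 \<le> B s x" for s x by (simp add: B_def)
  have b1: "\<bar>tilted_contraction \<alpha> 0 s x\<bar> \<le> B s x"
    and b2: "\<bar>\<psi>' s x\<bar> \<le> C * B s x"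
    and b3: "\<And>l. \<bar>l\<bar> \<le> 1 \<Longrightarrow> \<bar>tilted_contraction \<alpha> l s x - tilted_contraction \<alpha> 0 s x - l * \<psi>' s x\<bar> \<le> C * l\<^sup>2 * B s x"
    if x: "x \<in> space \<X>" for s x
  proof -
    consider "abs_contraction r \<alpha> s x = \<infinity>" | "abs_contraction r \<alpha> s x < \<infinity>"
      by (cases "abs_contraction r \<alpha> s x = \<infinity>") (auto simp: less_top)
    then have "\<bar>tilted_contraction \<alpha> 0 s x\<bar> \<le> B s x \<and> \<bar>\<psi>' s x\<bar> \<le> C * B s x \<and>
      (\<forall>l. \<bar>l\<bar> \<le> 1 \<longrightarrow> \<bar>tilted_contraction \<alpha> l s x - tilted_contraction \<alpha> 0 s x - l * \<psi>' s x\<bar> \<le> C * l\<^sup>2 * B s x)"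
    proof cases
      case 1
      then show ?thesis using tilted_contraction_infinite[OF m x 1] by (simp add: \<psi>'_def B_def)
    next
      case 2
      note tb = tilted_contraction_bounds[OF m x 2, folded B_def]
      have ps: "\<psi>' s x = product_contraction \<alpha> s x" using 2 by (auto simp: \<psi>'_def)
      have "K * B s x \<le> C * B s x" using C B_nn by (intro mult_right_mono) auto
      moreover have "C0 * K * l\<^sup>2 * B s x \<le> C * l\<^sup>2 * B s x" for l
        using C B_nn by (intro mult_right_mono) auto
      ultimately show ?thesis
        using tb order_trans[OF tb(2)] order_trans[OF tb(3)] by (auto simp: ps tilted_contraction_0)
    qed
    then show "\<bar>tilted_contraction \<alpha> 0 s x\<bar> \<le> B s x" "\<bar>\<psi>' s x\<bar> \<le> C * B s x"
      "\<And>l. \<bar>l\<bar> \<le> 1 \<Longrightarrow> \<bar>tilted_contraction \<alpha> l s x - tilted_contraction \<alpha> 0 s x - l * \<psi>' s x\<bar> \<le> C * l\<^sup>2 * B s x"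
      by auto
  qed
  have \<mu>_AE: "AE s in interval_measure t. 0 \<le> s \<and> s \<le> t"
    by (simp add: AE_interval_measure)
  have R: "\<And>l. \<bar>l\<bar> \<le> 1 \<Longrightarrow> \<bar>l\<bar> * C0 \<le> c / 2 \<Longrightarrow>
      integrable p_t (\<lambda>(s, \<omega>). path_density (gl l) s \<omega> * tilted_contraction \<alpha> l s (X \<omega> s))"
    "integrable p_t (\<lambda>(s, \<omega>). \<psi>' s (X \<omega> s))" "integrable p_t (\<lambda>(s, \<omega>). tilted_contraction \<alpha> 0 s (X \<omega> s) * G s \<omega>)"
    "((\<lambda>l. \<integral>(s, \<omega>). path_density (gl l) s \<omega> * tilted_contraction \<alpha> l s (X \<omega> s) \<partial>p_t) has_real_derivative
      (\<integral>(s, \<omega>). \<psi>' s (X \<omega> s) \<partial>p_t) + (\<integral>(s, \<omega>). tilted_contraction \<alpha> 0 s (X \<omega> s) * G s \<omega> \<partial>p_t)) (at 0)"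
    by (rule response[where \<mu> = "interval_measure t" and \<psi> = "tilted_contraction \<alpha>" and \<psi>' = \<psi>' and B = B and C = C,
      OF \<mu>.sigma_finite_measure_axioms sets_interval_measure \<mu>_AE tc \<psi>'_m B_m _ _ _ C(1) c fin];
      blast intro: b1 b2 b3)+
  show "integrable p_t (\<lambda>(s, \<omega>). path_density (gl l) s \<omega> * tilted_contraction \<alpha> l s (X \<omega> s))"
    if "\<bar>l\<bar> \<le> 1" "\<bar>l\<bar> * C0 \<le> c / 2" for l
    by (rule R(1)[OF that])
  have ae: "AE z in p_t. (case z of (s, \<omega>) \<Rightarrow> \<psi>' s (X \<omega> s)) = (case z of (s, \<omega>) \<Rightarrow> product_contraction \<alpha> s (X \<omega> s))"
    using abs_contraction_AE_finite[OF \<alpha>] by eventually_elim (auto simp: \<psi>'_def case_prod_beta)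
  have m1: "(\<lambda>(s, \<omega>). product_contraction \<alpha> s (X \<omega> s)) \<in> borel_measurable p_t"
    using pair_compose_X[of "product_contraction \<alpha>" borel] pc by (simp add: case_prod_beta)
  have m2: "(\<lambda>(s, \<omega>). \<psi>' s (X \<omega> s)) \<in> borel_measurable p_t"
    using borel_measurable_integrable[OF R(2)] .
  show "integrable p_t (\<lambda>(s, \<omega>). product_contraction \<alpha> s (X \<omega> s))"
    using R(2) integrable_cong_AE[OF m2 m1 ae] by simp
  show "integrable p_t (\<lambda>(s, \<omega>). contraction r \<alpha> s (X \<omega> s) * G s \<omega>)"
    using R(3) by (simp add: tilted_contraction_0)
  show "((\<lambda>l. \<integral>(s, \<omega>). path_density (gl l) s \<omega> * tilted_contraction \<alpha> l s (X \<omega> s) \<partial>p_t) has_real_derivative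
      (\<integral>(s, \<omega>). product_contraction \<alpha> s (X \<omega> s) \<partial>p_t) + (\<integral>(s, \<omega>). contraction r \<alpha> s (X \<omega> s) * G s \<omega> \<partial>p_t)) (at 0)"
    using R(4) integral_cong_AE[OF m2 m1 ae] by (simp add: tilted_contraction_0)
qed

end

section \<open>Jump functionals\<close>

text \<open>This includes paths with infinitely many jumps, where all three sums are
  \<open>0\<close> by convention.\<close>

lemma jump_sum_diff: "jump_sum (\<lambda>s x y. \<alpha> s x y - \<beta> s x y) \<xi> s = jump_sum \<alpha> \<xi> s - jump_sum \<beta> \<xi> s"
  by (simp add: jump_sum_def sum_subtractf)

context perturbed_family begin

text \<open>The compensator formula replaces the sum over jumps by a time integral whose integrand
  at time \<open>u\<close> depends on the position at \<open>u\<close> alone. Hence the change of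
  measure at fixed times is enough for a functional of the whole path.\<close>

lemma jump_mean_nonneg:
  assumes \<alpha>: "exp_integrable_coeff \<alpha> c" and nn: "\<And>s x y. 0 \<le> \<alpha> s x y"
    and l: "\<bar>l\<bar> \<le> 1" "\<bar>l\<bar> * C0 \<le> c / 2" and fin: "AE \<omega> in P' l. \<exists>n. t < T' l n \<omega>"
  shows "integrable (P' l) (\<lambda>\<omega>. jump_sum \<alpha> (X' l \<omega>) t)"
    "(\<integral>\<omega>. jump_sum \<alpha> (X' l \<omega>) t \<partial>P' l)
      = (\<integral>(s, \<omega>). path_density (gl l) s \<omega> * tilted_contraction \<alpha> l s (X \<omega> s) \<partial>p_t)"
proof -
  interpret P': tilted_process \<X> r \<nu> "gl l" t "P' l" "T' l" "Y' l" by (rule P')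
  interpret \<mu>: finite_measure "interval_measure t" by (rule finite_interval_measure)
  have m: "measurable_coeff \<alpha>" using \<alpha> by (simp add: exp_integrable_coeff_def)
  have mt: "measurable_coeff (\<lambda>s x y. exp (l * g s x y) * \<alpha> s x y)" by (rule tilted_product_coeff[OF m])
  define c' where "c' s x = (\<integral>\<^sup>+y. ennreal (exp (l * g s x y) * \<alpha> s x y) \<partial>r x)" for s x
  have c'_abs: "c' = abs_contraction r (\<lambda>s x y. exp (l * g s x y) * \<alpha> s x y)"
    using nn by (intro ext) (simp add: c'_def abs_contraction_def abs_mult)
  have c'_m: "(\<lambda>(s, x). c' s x) \<in> borel_measurable (borel \<Otimes>\<^sub>M \<X>)"
    unfolding c'_abs case_prod_beta by (rule abs_contraction_measurable[OF mt]) measurable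
  have D_m: "(\<lambda>z. path_density (gl l) (fst z) (snd z)) \<in> borel_measurable (borel \<Otimes>\<^sub>M M)"
    by (rule path_density_measurable[OF gl]) measurable
  have pair_m: "(\<lambda>z. ennreal (path_density (gl l) (fst z) (snd z)) * c' (fst z) (X (snd z) (fst z))) \<in> borel_measurable p_t"
    using measurable_compose[OF D_m measurable_ennreal] pair_compose_X[OF c'_m]
    by (intro borel_measurable_times_ennreal) (simp_all cong: measurable_cong_sets)
  have inner_m: "(\<lambda>u. \<integral>\<^sup>+\<omega>. ennreal (path_density (gl l) u \<omega>) * c' u (X \<omega> u) \<partial>M) \<in> borel_measurable borel"
    by (rule borel_measurable_nn_integral) (use pair_m in \<open>simp add: case_prod_beta cong: measurable_cong_sets\<close>)
  note int = coeff_response(1)[OF \<alpha> l]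
  have "(\<integral>\<^sup>+\<omega>. ennreal (P'.jsum \<alpha> t \<omega>) \<partial>P' l) = (\<integral>\<^sup>+u\<in>{0..t}. (\<integral>\<^sup>+\<omega>. c' u (X' l \<omega> u) \<partial>P' l) \<partial>lborel)"
    unfolding c'_def by (rule P'.compensator[OF t_nonneg fin m nn])
  also have "\<dots> = (\<integral>\<^sup>+u\<in>{0..t}. (\<integral>\<^sup>+\<omega>. ennreal (path_density (gl l) u \<omega>) * c' u (X \<omega> u) \<partial>M) \<partial>lborel)"
  proof (rule nn_integral_cong)
    fix u
    have "c' u \<in> borel_measurable \<X>" using measurable_Pair2[OF c'_m, of u] by simp
    from girsanov[OF P' fin this, of u]
    show "(\<integral>\<^sup>+\<omega>. c' u (X' l \<omega> u) \<partial>P' l) * indicator {0..t} u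
        = (\<integral>\<^sup>+\<omega>. ennreal (path_density (gl l) u \<omega>) * c' u (X \<omega> u) \<partial>M) * indicator {0..t} u"
      by (auto split: split_indicator)
  qed
  also have "\<dots> = (\<integral>\<^sup>+u. (\<integral>\<^sup>+\<omega>. ennreal (path_density (gl l) u \<omega>) * c' u (X \<omega> u) \<partial>M) \<partial>interval_measure t)"
    by (rule nn_integral_interval_measure[symmetric, OF inner_m])
  also have "\<dots> = (\<integral>\<^sup>+z. ennreal (path_density (gl l) (fst z) (snd z)) * c' (fst z) (X (snd z) (fst z)) \<partial>p_t)"
    using nn_integral_fst[OF pair_m] by simp
  also have "\<dots> = (\<integral>\<^sup>+z. ennreal (case z of (s, \<omega>) \<Rightarrow> path_density (gl l) s \<omega> * tilted_contraction \<alpha> l s (X \<omega> s)) \<partial>p_t)"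
  proof (rule nn_integral_cong_AE)
    \<comment> \<open>The extended and the Bochner contraction agree where \<open>\<alpha>\<close>
      is integrable, that is, almost everywhere.\<close>
    show "AE z in p_t. ennreal (path_density (gl l) (fst z) (snd z)) * c' (fst z) (X (snd z) (fst z))
        = ennreal (case z of (s, \<omega>) \<Rightarrow> path_density (gl l) s \<omega> * tilted_contraction \<alpha> l s (X \<omega> s))"
      using abs_contraction_AE_finite[OF \<alpha>] AE_space
    proof eventually_elim
      case (elim z)
      let ?x = "X (snd z) (fst z)"
      have x: "?x \<in> space \<X>" using elim(2) by (auto simp: space_pair_measure intro: X_space)
      have "c' (fst z) ?x = ennreal (tilted_contraction \<alpha> l (fst z) ?x)"
        unfolding c'_def tilted_contraction_def contraction_def
        using tilted_contraction_finite(1)[OF m x elim(1)] nn by (intro nn_integral_eq_integral) auto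
      then show ?case by (simp add: case_prod_beta ennreal_mult' path_density_def)
    qed
  qed
  also have "\<dots> = ennreal (\<integral>(s, \<omega>). path_density (gl l) s \<omega> * tilted_contraction \<alpha> l s (X \<omega> s) \<partial>p_t)"
    using nn
    by (intro nn_integral_eq_integral[OF int] AE_I2)
      (auto simp: path_density_def tilted_contraction_def contraction_def case_prod_beta)
  finally have eq: "(\<integral>\<^sup>+\<omega>. ennreal (P'.jsum \<alpha> t \<omega>) \<partial>P' l)
      = ennreal (\<integral>(s, \<omega>). path_density (gl l) s \<omega> * tilted_contraction \<alpha> l s (X \<omega> s) \<partial>p_t)" .
  have "P'.jsum \<alpha> t \<in> borel_measurable (P' l)" by (rule P'.jsum_measurable[OF m]) auto
  moreover have "AE \<omega> in P' l. 0 \<le> P'.jsum \<alpha> t \<omega>" using nn by (intro AE_I2) (simp add: P'.jsum_def sum_nonneg)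
  moreover have "0 \<le> (\<integral>(s, \<omega>). path_density (gl l) s \<omega> * tilted_contraction \<alpha> l s (X \<omega> s) \<partial>p_t)"
    using nn by (intro integral_nonneg_AE AE_I2)
      (auto simp: path_density_def tilted_contraction_def contraction_def case_prod_beta)
  ultimately have res: "integrable (P' l) (P'.jsum \<alpha> t)"
    "(\<integral>\<omega>. P'.jsum \<alpha> t \<omega> \<partial>P' l) = (\<integral>(s, \<omega>). path_density (gl l) s \<omega> * tilted_contraction \<alpha> l s (X \<omega> s) \<partial>p_t)"
    using nn_integral_eq_integrable[of "P'.jsum \<alpha> t" "P' l"] eq by auto
  have js: "jump_sum \<alpha> (X' l \<omega>) t = P'.jsum \<alpha> t \<omega>" if "\<omega> \<in> space (P' l)" for \<omega>
    by (rule P'.jump_sum_eq_jsum[OF that t_nonneg order_refl])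
  show "integrable (P' l) (\<lambda>\<omega>. jump_sum \<alpha> (X' l \<omega>) t)"
    using res(1) js by (simp cong: Bochner_Integration.integrable_cong)
  show "(\<integral>\<omega>. jump_sum \<alpha> (X' l \<omega>) t \<partial>P' l)
      = (\<integral>(s, \<omega>). path_density (gl l) s \<omega> * tilted_contraction \<alpha> l s (X \<omega> s) \<partial>p_t)"
    using res(2) js by (simp cong: Bochner_Integration.integral_cong)
qed

lemma exp_integrable_coeff_mono:
  assumes \<alpha>: "exp_integrable_coeff \<alpha> c" and \<beta>: "measurable_coeff \<beta>" and le: "\<And>s x y. \<bar>\<beta> s x y\<bar> \<le> \<bar>\<alpha> s x y\<bar>"
  shows "exp_integrable_coeff \<beta> c"
proof -
  have "abs_contraction r \<beta> s x \<le> abs_contraction r \<alpha> s x" for s x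
    unfolding abs_contraction_def using le by (intro nn_integral_mono ennreal_leI)
  then have "(\<integral>\<^sup>+s. (\<integral>\<^sup>+\<omega>. abs_contraction r \<beta> s (X \<omega> s) * ennreal (exp (c * W \<omega>)) \<partial>M) \<partial>interval_measure t)
      \<le> (\<integral>\<^sup>+s. (\<integral>\<^sup>+\<omega>. abs_contraction r \<alpha> s (X \<omega> s) * ennreal (exp (c * W \<omega>)) \<partial>M) \<partial>interval_measure t)"
    by (intro nn_integral_mono mult_right_mono) auto
  then show ?thesis using \<alpha> \<beta> by (auto simp: exp_integrable_coeff_def)
qed

lemma jump_mean:
  assumes \<alpha>: "exp_integrable_coeff \<alpha> c"
    and l: "\<bar>l\<bar> \<le> 1" "\<bar>l\<bar> * C0 \<le> c / 2" and fin: "AE \<omega> in P' l. \<exists>n. t < T' l n \<omega>"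
  shows "integrable (P' l) (\<lambda>\<omega>. jump_sum \<alpha> (X' l \<omega>) t)"
    "(\<integral>\<omega>. jump_sum \<alpha> (X' l \<omega>) t \<partial>P' l)
      = (\<integral>(s, \<omega>). path_density (gl l) s \<omega> * tilted_contraction \<alpha> l s (X \<omega> s) \<partial>p_t)"
proof -
  have m: "measurable_coeff \<alpha>" using \<alpha> by (simp add: exp_integrable_coeff_def)
  define a1 where "a1 s x y = max 0 (\<alpha> s x y)" for s x y
  define a2 where "a2 s x y = max 0 (- \<alpha> s x y)" for s x y
  have ma1: "measurable_coeff a1"
    unfolding a1_def by (rule measurable_coeff_map2[OF m m, where F = "\<lambda>a b. max 0 a"]) measurable
  have ma2: "measurable_coeff a2"
    unfolding a2_def by (rule measurable_coeff_map2[OF m m, where F = "\<lambda>a b. max 0 (- a)"]) measurable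
  from ma1 ma2 have a: "exp_integrable_coeff a1 c" "exp_integrable_coeff a2 c"
    using exp_integrable_coeff_mono[OF \<alpha>, of a1] exp_integrable_coeff_mono[OF \<alpha>, of a2]
    by (auto simp: a1_def a2_def)
  have nn: "0 \<le> a1 s x y" "0 \<le> a2 s x y" for s x y by (auto simp: a1_def a2_def)
  have \<alpha>_eq: "\<alpha> = (\<lambda>s x y. a1 s x y - a2 s x y)" by (intro ext) (simp add: a1_def a2_def)
  note j1 = jump_mean_nonneg[OF a(1) nn(1) l fin] and j2 = jump_mean_nonneg[OF a(2) nn(2) l fin]
  note i1 = coeff_response(1)[OF a(1) l] and i2 = coeff_response(1)[OF a(2) l] and i = coeff_response(1)[OF \<alpha> l]
  have js: "(\<lambda>\<omega>. jump_sum \<alpha> (X' l \<omega>) t) = (\<lambda>\<omega>. jump_sum a1 (X' l \<omega>) t - jump_sum a2 (X' l \<omega>) t)"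
    by (subst \<alpha>_eq) (simp add: jump_sum_diff)
  show "integrable (P' l) (\<lambda>\<omega>. jump_sum \<alpha> (X' l \<omega>) t)"
    unfolding js by (rule Bochner_Integration.integrable_diff[OF j1(1) j2(1)])
  have "(\<integral>\<omega>. jump_sum \<alpha> (X' l \<omega>) t \<partial>P' l)
      = (\<integral>(s, \<omega>). path_density (gl l) s \<omega> * tilted_contraction a1 l s (X \<omega> s) \<partial>p_t)
        - (\<integral>(s, \<omega>). path_density (gl l) s \<omega> * tilted_contraction a2 l s (X \<omega> s) \<partial>p_t)"
    unfolding js Bochner_Integration.integral_diff[OF j1(1) j2(1)] j1(2) j2(2) ..
  also have "\<dots> = (\<integral>z. (case z of (s, \<omega>) \<Rightarrow> path_density (gl l) s \<omega> * tilted_contraction a1 l s (X \<omega> s))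
        - (case z of (s, \<omega>) \<Rightarrow> path_density (gl l) s \<omega> * tilted_contraction a2 l s (X \<omega> s)) \<partial>p_t)"
    by (rule Bochner_Integration.integral_diff[OF i1 i2, symmetric])
  also have "\<dots> = (\<integral>(s, \<omega>). path_density (gl l) s \<omega> * tilted_contraction \<alpha> l s (X \<omega> s) \<partial>p_t)"
  \<comment> \<open>The Bochner contraction is additive where both parts of \<open>\<alpha>\<close>
    are integrable, so the integrands agree only almost everywhere.\<close>
  proof (rule integral_cong_AE)
    show "AE z in p_t. (case z of (s, \<omega>) \<Rightarrow> path_density (gl l) s \<omega> * tilted_contraction a1 l s (X \<omega> s))
        - (case z of (s, \<omega>) \<Rightarrow> path_density (gl l) s \<omega> * tilted_contraction a2 l s (X \<omega> s))
        = (case z of (s, \<omega>) \<Rightarrow> path_density (gl l) s \<omega> * tilted_contraction \<alpha> l s (X \<omega> s))"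
      using abs_contraction_AE_finite[OF a(1)] abs_contraction_AE_finite[OF a(2)] AE_space
    proof eventually_elim
      case (elim z)
      let ?x = "X (snd z) (fst z)" let ?s = "fst z"
      have x: "?x \<in> space \<X>" using elim(3) by (auto simp: space_pair_measure intro: X_space)
      have m12: "measurable_coeff a1" "measurable_coeff a2" using a by (auto simp: exp_integrable_coeff_def)
      have "(\<integral>y. exp (l * g ?s ?x y) * (a1 ?s ?x y - a2 ?s ?x y) \<partial>r ?x)
          = (\<integral>y. exp (l * g ?s ?x y) * a1 ?s ?x y - exp (l * g ?s ?x y) * a2 ?s ?x y \<partial>r ?x)"
        by (simp only: right_diff_distrib)
      also have "\<dots> = (\<integral>y. exp (l * g ?s ?x y) * a1 ?s ?x y \<partial>r ?x) - (\<integral>y. exp (l * g ?s ?x y) * a2 ?s ?x y \<partial>r ?x)"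
        by (rule Bochner_Integration.integral_diff[OF tilted_contraction_finite(1)[OF m12(1) x elim(1)]
              tilted_contraction_finite(1)[OF m12(2) x elim(2)]])
      finally have "tilted_contraction \<alpha> l ?s ?x = tilted_contraction a1 l ?s ?x - tilted_contraction a2 l ?s ?x"
        unfolding tilted_contraction_def contraction_def by (subst \<alpha>_eq)
      then show ?case by (simp add: case_prod_beta right_diff_distrib)
    qed
  qed (use i1 i2 i in \<open>auto intro!: borel_measurable_diff dest: borel_measurable_integrable\<close>)
  finally show "(\<integral>\<omega>. jump_sum \<alpha> (X' l \<omega>) t \<partial>P' l)
      = (\<integral>(s, \<omega>). path_density (gl l) s \<omega> * tilted_contraction \<alpha> l s (X \<omega> s) \<partial>p_t)" .
qed

text \<open>Since \<open>W\<close> does not depend on time, Tonelli gathers the contractions into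
  \<open>abs_time_integral\<close>. Its pairing with \<open>exp (c * W \<omega>)\<close> is then
  bounded by its norm.\<close>

lemma exp_integrable_coeff_of_Lp:
  assumes m: "measurable_coeff \<alpha>" and p: "1 < p" and Lp: "in_Lp M p (\<lambda>\<omega>. abs_time_integral r \<alpha> t (X \<omega>))"
  shows "\<exists>c. exp_integrable_coeff \<alpha> c"
proof -
  obtain a where a: "0 < a" "(\<integral>\<^sup>+\<omega>. ennreal (exp (a * W \<omega>)) \<partial>M) < \<infinity>" using exp_moment_W by blast
  from Lp_norm_exp_bound[OF p W_measurable a] obtain c C where c: "0 < c" and C: "0 < C"
    "\<And>f. f \<in> borel_measurable M \<Longrightarrow> (\<integral>\<^sup>+\<omega>. f \<omega> * ennreal (exp (c * W \<omega>)) \<partial>M) \<le> Lp_norm M p f * ennreal C"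
    by blast
  interpret \<mu>: finite_measure "interval_measure t" by (rule finite_interval_measure)
  interpret pr: pair_sigma_finite "interval_measure t" M ..
  define f where "f s \<omega> = abs_contraction r \<alpha> s (X \<omega> s) * ennreal (exp (c * W \<omega>))" for s \<omega>
  have 1: "(\<lambda>z. abs_contraction r \<alpha> (fst z) (X (snd z) (fst z))) \<in> borel_measurable p_t"
    by (rule pair_compose_X) (unfold case_prod_beta, rule abs_contraction_measurable[OF m], measurable)
  have fm: "(\<lambda>(s, \<omega>). f s \<omega>) \<in> borel_measurable p_t"
    unfolding f_def case_prod_beta using 1 W_measurable by measurable
  have "(\<integral>\<^sup>+s. (\<integral>\<^sup>+\<omega>. f s \<omega> \<partial>M) \<partial>interval_measure t) = (\<integral>\<^sup>+\<omega>. (\<integral>\<^sup>+s. f s \<omega> \<partial>interval_measure t) \<partial>M)"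
    by (rule pr.Fubini'[symmetric, OF fm])
  also have "\<dots> = (\<integral>\<^sup>+\<omega>. abs_time_integral r \<alpha> t (X \<omega>) * ennreal (exp (c * W \<omega>)) \<partial>M)"
  proof (rule nn_integral_cong)
    fix \<omega> assume w: "\<omega> \<in> space M"
    have ac: "(\<lambda>s. abs_contraction r \<alpha> s (X \<omega> s)) \<in> borel_measurable borel"
      by (rule abs_contraction_measurable[OF m _ X_compose_measurable]) (use w in auto)
    have "(\<integral>\<^sup>+s. f s \<omega> \<partial>interval_measure t) = (\<integral>\<^sup>+s. abs_contraction r \<alpha> s (X \<omega> s) \<partial>interval_measure t) * ennreal (exp (c * W \<omega>))"
      unfolding f_def using ac by (intro nn_integral_multc) (simp cong: measurable_cong_sets)
    then show "(\<integral>\<^sup>+s. f s \<omega> \<partial>interval_measure t) = abs_time_integral r \<alpha> t (X \<omega>) * ennreal (exp (c * W \<omega>))"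
      by (simp add: nn_integral_interval_measure[OF ac] abs_time_integral_def)
  qed
  also have "\<dots> \<le> Lp_norm M p (\<lambda>\<omega>. abs_time_integral r \<alpha> t (X \<omega>)) * ennreal C"
    using Lp by (intro C(2)) (simp add: in_Lp_def)
  also have "\<dots> < \<infinity>" using Lp by (simp add: in_Lp_def ennreal_mult_less_top)
  finally show ?thesis using m c by (auto simp: exp_integrable_coeff_def f_def)
qed

lemma jump_response:
  assumes m: "measurable_coeff \<alpha>" and p: "1 < p" and Lp: "in_Lp M p (\<lambda>\<omega>. abs_time_integral r \<alpha> t (X \<omega>))"
  shows "\<forall>\<^sub>F l in nhds 0. integrable (P' l) (\<lambda>\<omega>. jump_sum \<alpha> (X' l \<omega>) t)"
    "AE s in lborel. s \<in> {0..t} \<longrightarrow>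
       (AE \<omega> in M. integrable (r (X \<omega> s)) (\<alpha> s (X \<omega> s)) \<and>
          integrable (r (X \<omega> s)) (\<lambda>y. \<alpha> s (X \<omega> s) y * g s (X \<omega> s) y)) \<and>
       integrable M (\<lambda>\<omega>. product_contraction \<alpha> s (X \<omega> s)) \<and>
       integrable M (\<lambda>\<omega>. contraction r \<alpha> s (X \<omega> s) * G s \<omega>)"
    "set_integrable lborel {0..t} (\<lambda>s. \<integral>\<omega>. product_contraction \<alpha> s (X \<omega> s) \<partial>M)"
    "set_integrable lborel {0..t} (\<lambda>s. \<integral>\<omega>. contraction r \<alpha> s (X \<omega> s) * G s \<omega> \<partial>M)"
    "((\<lambda>l. \<integral>\<omega>. jump_sum \<alpha> (X' l \<omega>) t \<partial>P' l) has_real_derivative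
       (LINT s:{0..t}|lborel. \<integral>\<omega>. product_contraction \<alpha> s (X \<omega> s) \<partial>M) +
       (LINT s:{0..t}|lborel. \<integral>\<omega>. contraction r \<alpha> s (X \<omega> s) * G s \<omega> \<partial>M)) (at 0)"
proof -
  from exp_integrable_coeff_of_Lp[OF assms] obtain c where \<alpha>: "exp_integrable_coeff \<alpha> c" by blast
  then have c2: "0 < c / 2" by (simp add: exp_integrable_coeff_def)
  interpret \<mu>: finite_measure "interval_measure t" by (rule finite_interval_measure)
  interpret pr: pair_sigma_finite "interval_measure t" M ..
  note R = coeff_response[OF \<alpha>]
  note f1 = fubini_interval[OF R(2)] and f2 = fubini_interval[OF R(3)]
  have small: "\<forall>\<^sub>F l in nhds 0. integrable (P' l) (\<lambda>\<omega>. jump_sum \<alpha> (X' l \<omega>) t) \<and>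
      (\<integral>\<omega>. jump_sum \<alpha> (X' l \<omega>) t \<partial>P' l)
        = (\<integral>(s, \<omega>). path_density (gl l) s \<omega> * tilted_contraction \<alpha> l s (X \<omega> s) \<partial>p_t)"
    using eventually_small[OF c2] by eventually_elim (use jump_mean[OF \<alpha>] in blast)
  then show "\<forall>\<^sub>F l in nhds 0. integrable (P' l) (\<lambda>\<omega>. jump_sum \<alpha> (X' l \<omega>) t)"
    by eventually_elim blast
  show "set_integrable lborel {0..t} (\<lambda>s. \<integral>\<omega>. product_contraction \<alpha> s (X \<omega> s) \<partial>M)" by (rule f1(2))
  show "set_integrable lborel {0..t} (\<lambda>s. \<integral>\<omega>. contraction r \<alpha> s (X \<omega> s) * G s \<omega> \<partial>M)" by (rule f2(2))
  have "((\<lambda>l. \<integral>(s, \<omega>). path_density (gl l) s \<omega> * tilted_contraction \<alpha> l s (X \<omega> s) \<partial>p_t) has_real_derivative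
       (LINT s:{0..t}|lborel. \<integral>\<omega>. product_contraction \<alpha> s (X \<omega> s) \<partial>M) +
       (LINT s:{0..t}|lborel. \<integral>\<omega>. contraction r \<alpha> s (X \<omega> s) * G s \<omega> \<partial>M)) (at 0)"
    using R(4) unfolding f1(3) f2(3) .
  then show "((\<lambda>l. \<integral>\<omega>. jump_sum \<alpha> (X' l \<omega>) t \<partial>P' l) has_real_derivative
       (LINT s:{0..t}|lborel. \<integral>\<omega>. product_contraction \<alpha> s (X \<omega> s) \<partial>M) +
       (LINT s:{0..t}|lborel. \<integral>\<omega>. contraction r \<alpha> s (X \<omega> s) * G s \<omega> \<partial>M)) (at 0)"
    by (rule DERIV_cong_ev[THEN iffD2, rotated -1]) (use small in \<open>auto elim: eventually_mono\<close>)
  have "AE s in interval_measure t. AE \<omega> in M. abs_contraction r \<alpha> s (X \<omega> s) < \<infinity>"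
    using pr.AE_pair[OF abs_contraction_AE_finite[OF \<alpha>]] by simp
  then have "AE s in interval_measure t. AE \<omega> in M. integrable (r (X \<omega> s)) (\<alpha> s (X \<omega> s)) \<and>
          integrable (r (X \<omega> s)) (\<lambda>y. \<alpha> s (X \<omega> s) y * g s (X \<omega> s) y)"
  proof eventually_elim
    case (elim s)
    show ?case
      using elim AE_space
    proof eventually_elim
      case (elim \<omega>)
      then show ?case
        using tilted_contraction_finite(2)[OF m X_space] integrable_iff_abs_contraction[OF m X_space] by blast
    qed
  qed
  then show "AE s in lborel. s \<in> {0..t} \<longrightarrow>
       (AE \<omega> in M. integrable (r (X \<omega> s)) (\<alpha> s (X \<omega> s)) \<and>
          integrable (r (X \<omega> s)) (\<lambda>y. \<alpha> s (X \<omega> s) y * g s (X \<omega> s) y)) \<and>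
       integrable M (\<lambda>\<omega>. product_contraction \<alpha> s (X \<omega> s)) \<and>
       integrable M (\<lambda>\<omega>. contraction r \<alpha> s (X \<omega> s) * G s \<omega>)"
    unfolding AE_interval_measure using f1(1) f2(1) by eventually_elim blast
qed

end

section \<open>Extension to coefficients given on [0, t]\<close>

lemma measurable_extend_zero:
  fixes f :: "real \<Rightarrow> 'b \<Rightarrow> real"
  assumes f: "(\<lambda>(s, z). f s z) \<in> borel_measurable (restrict_space borel {0..t} \<Otimes>\<^sub>M N)"
  shows "(\<lambda>(s, z). if s \<in> {0..t} then f s z else 0) \<in> borel_measurable (borel \<Otimes>\<^sub>M N)"
proof -
  let ?R = "restrict_space (borel \<Otimes>\<^sub>M N) {p. fst p \<in> {0..t}}"
  have "fst \<in> measurable ?R (restrict_space borel {0..t})"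
    by (rule measurable_restrict_space2) (auto simp: space_restrict_space intro: measurable_restrict_space1)
  then have "(\<lambda>p. (fst p, snd p)) \<in> measurable ?R (restrict_space borel {0..t} \<Otimes>\<^sub>M N)"
    by (rule measurable_Pair) (rule measurable_restrict_space1, simp)
  from measurable_compose[OF this f] have 1: "(\<lambda>p. f (fst p) (snd p)) \<in> borel_measurable ?R"
    unfolding case_prod_beta by simp
  have "{p \<in> space (borel \<Otimes>\<^sub>M N). fst p \<in> {0..t}} \<in> sets (borel \<Otimes>\<^sub>M N)" by measurable
  then have "(\<lambda>p. if fst p \<in> {0..t} then f (fst p) (snd p) else 0) \<in> borel_measurable (borel \<Otimes>\<^sub>M N)"
    by (subst measurable_If_restrict_space_iff) (use 1 in auto)
  then show ?thesis by (simp add: case_prod_beta)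
qed

definition extend_zero :: "real \<Rightarrow> (real \<Rightarrow> 'b \<Rightarrow> 'c \<Rightarrow> real) \<Rightarrow> real \<Rightarrow> 'b \<Rightarrow> 'c \<Rightarrow> real" where
  "extend_zero t \<alpha> = (\<lambda>s x y. if s \<in> {0..t} then \<alpha> s x y else 0)"

lemma extend_zero_eq [simp]: "s \<in> {0..t} \<Longrightarrow> extend_zero t \<alpha> s = \<alpha> s"
  by (simp add: extend_zero_def fun_eq_iff)

lemma contraction_extend_zero [simp]: "s \<in> {0..t} \<Longrightarrow> contraction r (extend_zero t \<alpha>) s = contraction r \<alpha> s"
  by (simp add: contraction_def fun_eq_iff)

lemma abs_time_integral_extend_zero: "abs_time_integral r (extend_zero t \<alpha>) t \<xi> = abs_time_integral r \<alpha> t \<xi>"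
  unfolding abs_time_integral_def abs_contraction_def
  by (intro nn_integral_cong) (auto split: split_indicator)

lemma jump_sum_extend_zero: "s \<le> t \<Longrightarrow> jump_sum (extend_zero t \<alpha>) \<xi> s = jump_sum \<alpha> \<xi> s"
  unfolding jump_sum_def by (intro sum.cong) (auto simp: jumps_upto_def)

lemma G_functional_extend_zero:
  assumes "s \<le> t" shows "G_functional r (extend_zero t g) s \<xi> = G_functional r g s \<xi>"
proof -
  have "(LINT u:{0..s}|lborel. contraction r (extend_zero t g) u (\<xi> u)) = (LINT u:{0..s}|lborel. contraction r g u (\<xi> u))"
    using assms by (intro set_lebesgue_integral_cong) auto
  then show ?thesis using jump_sum_extend_zero[OF assms, of g] by (simp add: G_functional_def)
qed

lemma condition_C_extend_zero: "condition_C r t M X (extend_zero t \<alpha>) \<longleftrightarrow> condition_C r t M X \<alpha>"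
  by (simp add: condition_C_def abs_time_integral_extend_zero)

context rate_kernel begin

lemma measurable_coeff_extend_zero:
  assumes "measurable2_on \<X> t \<alpha>" shows "measurable_coeff (extend_zero t \<alpha>)"
proof -
  have "(\<lambda>(s, z). \<alpha> s (fst z) (snd z)) \<in> borel_measurable (restrict_space borel {0..t} \<Otimes>\<^sub>M \<X> \<Otimes>\<^sub>M \<X>)"
    using assms by (simp only: measurable2_on_def case_prod_beta')
  from measurable_extend_zero[OF this] show ?thesis
    by (simp only: extend_zero_def case_prod_beta')
qed

lemma bounded_tilt_extend_zero:
  assumes "measurable2_on \<X> t \<alpha>" "bounded2_on \<X> t \<alpha>"
  shows "bounded_tilt (extend_zero t \<alpha>)"
proof -
  from assms(2) obtain C where C: "\<forall>s\<in>{0..t}. \<forall>x\<in>space \<X>. \<forall>y\<in>space \<X>. \<bar>\<alpha> s x y\<bar> \<le> C"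
    unfolding bounded2_on_def by blast
  have "\<bar>extend_zero t \<alpha> s x y\<bar> \<le> \<bar>C\<bar>" if "x \<in> space \<X>" "y \<in> space \<X>" for s x y
    using C that by (auto simp: extend_zero_def intro: order_trans[OF _ abs_ge_self])
  then show ?thesis
    using measurable_coeff_extend_zero[OF assms(1)] unfolding bounded_tilt_def by blast
qed

text \<open>Passage to a smaller time window and to data that agree on it. Agreement at states of
  \<open>space \<X>\<close> and at nonnegative times suffices, because a jump process meets no
  others.\<close>

lemma jump_process_cong:
  assumes J: "jump_process \<X> \<nu> I S J M T Y" and I: "I' \<subseteq> I" "I' \<subseteq> {0..}"
    and S: "\<And>s x u. x \<in> space \<X> \<Longrightarrow> 0 \<le> s \<Longrightarrow> s \<le> u \<Longrightarrow> u \<in> I' \<Longrightarrow> S s x u = S' s x u"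
    and J': "\<And>u x B. x \<in> space \<X> \<Longrightarrow> u \<in> I' \<Longrightarrow> B \<in> sets \<X> \<Longrightarrow> J u x B = J' u x B"
  shows "jump_process \<X> \<nu> I' S' J' M T Y"
proof -
  have Y: "Y n \<omega> \<in> space \<X>" if "\<omega> \<in> space M" for n \<omega>
    using J that by (auto simp: jump_process_def dest: measurable_space)
  have T: "0 \<le> T n \<omega>" if w: "\<omega> \<in> space M" for n \<omega>
  proof (induction n)
    case (Suc n)
    then show ?case using J w unfolding jump_process_def by (meson less_imp_le order_trans)
  qed (use J w in \<open>auto simp: jump_process_def\<close>)
  have 1: "AE \<omega> in M. T n \<omega> \<le> u \<longrightarrow>
      real_cond_exp M (history \<X> M T Y n) (indicator {\<omega>\<in>space M. u < T (Suc n) \<omega>}) \<omega> = S' (T n \<omega>) (Y n \<omega>) u"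
    if u: "u \<in> I'" for n u
  proof -
    have "AE \<omega> in M. T n \<omega> \<le> u \<longrightarrow>
      real_cond_exp M (history \<X> M T Y n) (indicator {\<omega>\<in>space M. u < T (Suc n) \<omega>}) \<omega> = S (T n \<omega>) (Y n \<omega>) u"
      using J u I(1) unfolding jump_process_def by blast
    then show ?thesis using AE_space by eventually_elim (simp add: S[OF Y T _ u])
  qed
  have 2: "AE \<omega> in M. T (Suc n) \<omega> \<in> I' \<longrightarrow>
      real_cond_exp M (history_and_next_time \<X> M T Y n) (indicator {\<omega>\<in>space M. Y (Suc n) \<omega> \<in> B}) \<omega>
        = J' (T (Suc n) \<omega>) (Y n \<omega>) B" if B: "B \<in> sets \<X>" for n B
  proof -
    have "AE \<omega> in M. T (Suc n) \<omega> \<in> I \<longrightarrow>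
      real_cond_exp M (history_and_next_time \<X> M T Y n) (indicator {\<omega>\<in>space M. Y (Suc n) \<omega> \<in> B}) \<omega>
        = J (T (Suc n) \<omega>) (Y n \<omega>) B"
      using J B unfolding jump_process_def by blast
    then show ?thesis using AE_space by eventually_elim (use I(1) in \<open>auto simp: J'[OF Y _ B]\<close>)
  qed
  have 3: "\<forall>\<omega>\<in>space M. T 0 \<omega> = 0 \<and> (\<forall>n. T n \<omega> < T (Suc n) \<omega> \<and> (T (Suc n) \<omega> \<in> I' \<longrightarrow> Y (Suc n) \<omega> \<noteq> Y n \<omega>))"
    using J I(1) unfolding jump_process_def by blast
  have 4: "prob_space M" "\<forall>n. T n \<in> borel_measurable M" "\<forall>n. Y n \<in> M \<rightarrow>\<^sub>M \<X>" "distr M \<X> (Y 0) = \<nu>"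
    using J unfolding jump_process_def by blast+
  show ?thesis unfolding jump_process_def using 1 2 3 4 by blast
qed

lemma unperturbed_tilted_process:
  assumes "markov_jump_process \<X> r \<nu> M T Y"
  shows "tilted_process \<X> r \<nu> (\<lambda>_ _ _. 0) t M T Y"
proof unfold_locales
  show "bounded_tilt (\<lambda>_ _ _. 0)" by (rule bounded_tilt_zero)
  show "jump_process \<X> \<nu> {0..t} (surv (\<lambda>_ _ _. 0))
      (\<lambda>u x B. (\<integral>y. exp 0 * indicator B y \<partial>r x) / tilted_rate (\<lambda>_ _ _. 0) u x) M T Y"
  proof (rule jump_process_cong[OF assms[unfolded markov_jump_process_def]])
    fix s x u assume x: "x \<in> space \<X>" and su: "s \<le> (u :: real)"
    have "(LINT w:{s..u}|lborel. rate x) = rate x * (u - s)"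
      using su by (simp add: set_lebesgue_integral_def mult.commute)
    then show "exp (- (rate x * (u - s))) = surv (\<lambda>_ _ _. 0) s x u"
      by (simp add: surv_def tilted_rate_zero[OF x])
  next
    fix u x B assume x: "x \<in> space \<X>" and B: "B \<in> sets \<X>"
    have "B \<inter> space (r x) = B" using sets.sets_into_space[OF B] by (auto simp: space_r[OF x])
    then show "measure (r x) B / rate x = (\<integral>y. exp 0 * indicator B y \<partial>r x) / tilted_rate (\<lambda>_ _ _. 0) u x"
      by (simp add: tilted_rate_zero[OF x])
  qed auto
qed

lemma perturbed_tilted_process:
  assumes P: "perturbed_jump_process \<X> r g t l \<nu> M T Y" and g: "bounded_tilt (extend_zero t g)"
  shows "tilted_process \<X> r \<nu> (\<lambda>s x y. l * extend_zero t g s x y) t M T Y"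
proof unfold_locales
  let ?h = "\<lambda>s x y. l * extend_zero t g s x y"
  show h: "bounded_tilt ?h" by (rule bounded_tilt_scale[OF g])
  have meas: "measure (tilted_kernel r g l u x) B = (\<integral>y. exp (?h u x y) * indicator B y \<partial>r x)"
    if u: "u \<in> {0..t}" and x: "x \<in> space \<X>" and B: "B \<in> sets \<X>" for u x B
  proof -
    have Br: "B \<in> sets (r x)" using B by (simp add: sets_r[OF x])
    have hm: "(\<lambda>y. exp (?h u x y)) \<in> borel_measurable (r x)"
      by (rule measurable_compose[OF bounded_tilt_measurable_r(1)[OF h x] borel_measurable_exp])
    then have m: "(\<lambda>y. ennreal (exp (l * g u x y))) \<in> borel_measurable (r x)"
      using u by (intro measurable_compose[OF _ measurable_ennreal]) simp
    have "emeasure (tilted_kernel r g l u x) B = (\<integral>\<^sup>+y. ennreal (exp (l * g u x y)) * indicator B y \<partial>r x)"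
      unfolding tilted_kernel_def by (rule emeasure_density[OF m Br])
    also have "\<dots> = (\<integral>\<^sup>+y. ennreal (exp (?h u x y) * indicator B y) \<partial>r x)"
      using u by (intro nn_integral_cong) (auto split: split_indicator)
    finally show ?thesis
      unfolding measure_def
      by (subst integral_eq_nn_integral) (use hm Br in auto)
  qed
  have rate_eq: "total_rate \<X> (tilted_kernel r g l u) x = tilted_rate ?h u x"
    if u: "u \<in> {0..t}" and x: "x \<in> space \<X>" for u x
    unfolding total_rate_def meas[OF u x sets.top] tilted_rate_def
    by (intro Bochner_Integration.integral_cong) (auto simp: space_r[OF x])
  show "jump_process \<X> \<nu> {0..t} (surv ?h)
      (\<lambda>u x B. (\<integral>y. exp (?h u x y) * indicator B y \<partial>r x) / tilted_rate ?h u x) M T Y"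
  proof (rule jump_process_cong[OF P[unfolded perturbed_jump_process_def]])
    fix s x u assume x: "x \<in> space \<X>" and s: "0 \<le> s" "s \<le> u" "u \<in> {0..t}"
    have "(LINT w:{s..u}|lborel. total_rate \<X> (tilted_kernel r g l w) x) = (LINT w:{s..u}|lborel. tilted_rate ?h w x)"
      using s by (intro set_lebesgue_integral_cong) (auto intro!: rate_eq x)
    then show "exp (- (LINT w:{s..u}|lborel. total_rate \<X> (tilted_kernel r g l w) x)) = surv ?h s x u"
      by (simp add: surv_def)
  next
    fix u x B assume "x \<in> space \<X>" "u \<in> {0..t}" "B \<in> sets \<X>"
    then show "measure (tilted_kernel r g l u x) B / total_rate \<X> (tilted_kernel r g l u) x
      = (\<integral>y. exp (?h u x y) * indicator B y \<partial>r x) / tilted_rate ?h u x"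
      by (simp only: meas rate_eq)
  qed auto
qed

end

section \<open>Assembly of the response formulas\<close>

lemma explosion_time_gt_iff: "ereal t < explosion_time T \<omega> \<longleftrightarrow> (\<exists>n. t < T n \<omega>)"
  by (simp add: explosion_time_def less_SUP_iff)

lemma (in perturbed_base) G_functional_eq:
  assumes w: "\<omega> \<in> space M" and s: "0 \<le> s" "s \<le> t" and g': "g = extend_zero t g'"
  shows "G_functional r g' s (X \<omega>) = G s \<omega>"
  unfolding G_functional_extend_zero[OF s(2), of r g', symmetric] g'[symmetric]
  by (simp add: G_functional_def G_def jump_sum_eq_jsum[OF w s])

theorem theorem3p5:
  fixes \<X> :: "'a measure" and r :: "'a \<Rightarrow> 'a measure" and \<nu> :: "'a measure"
    and g :: "real \<Rightarrow> 'a \<Rightarrow> 'a \<Rightarrow> real" and t :: real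
    and P :: "'w measure" and T :: "nat \<Rightarrow> 'w \<Rightarrow> real" and Y :: "nat \<Rightarrow> 'w \<Rightarrow> 'a"
    and P' :: "real \<Rightarrow> 'v measure"
    and T' :: "real \<Rightarrow> nat \<Rightarrow> 'v \<Rightarrow> real" and Y' :: "real \<Rightarrow> nat \<Rightarrow> 'v \<Rightarrow> 'a"
    and X :: "'w \<Rightarrow> real \<Rightarrow> 'a" and X' :: "real \<Rightarrow> 'v \<Rightarrow> real \<Rightarrow> 'a"
  defines "X \<equiv> jump_path T Y" and "X' \<equiv> (\<lambda>l. jump_path (T' l) (Y' l))"
  assumes singletons: "\<forall>x\<in>space \<X>. {x} \<in> sets \<X>"
    and kernel: "transition_kernel \<X> r"
    and initial: "prob_space \<nu>" "sets \<nu> = sets \<X>"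
    and unperturbed: "markov_jump_process \<X> r \<nu> P T Y"
    and no_explosion: "AE \<omega> in P. explosion_time T \<omega> = \<infinity>"
    and t_pos: "t > 0"
    and g: "measurable2_on \<X> t g" "bounded2_on \<X> t g" "condition_C r t P X g"
    and perturbed: "\<And>l. perturbed_jump_process \<X> r g t l \<nu> (P' l) (T' l) (Y' l)"
  shows
    \<comment> \<open>well-posedness of the perturbed process and of \<open>G\<close>\<close>
    "((\<forall>\<^sub>F l in nhds 0. AE \<omega> in P' l. explosion_time (T' l) \<omega> > ereal t) \<and>
      (AE \<omega> in P. set_integrable lborel {0..t} (\<lambda>u. contraction r g u (X \<omega> u))))
    \<and>
    \<comment> \<open>(1)\<close>
     (\<forall>(v :: 'a \<Rightarrow> real) p. v \<in> borel_measurable \<X> \<longrightarrow> 1 < p \<longrightarrow>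
        in_Lp P p (\<lambda>\<omega>. ennreal \<bar>v (X \<omega> t)\<bar>) \<longrightarrow>
        (\<forall>\<^sub>F l in nhds 0. integrable (P' l) (\<lambda>\<omega>. v (X' l \<omega> t))) \<and>
        integrable P (\<lambda>\<omega>. v (X \<omega> t) * G_functional r g t (X \<omega>)) \<and>
        ((\<lambda>l. \<integral>\<omega>. v (X' l \<omega> t) \<partial>P' l)
           has_real_derivative (\<integral>\<omega>. v (X \<omega> t) * G_functional r g t (X \<omega>) \<partial>P)) (at 0))
    \<and>
    \<comment> \<open>(2)\<close>
     (\<forall>(v :: real \<Rightarrow> 'a \<Rightarrow> real) p. measurable1_on \<X> t v \<longrightarrow> 1 < p \<longrightarrow>
        (\<integral>\<^sup>+s\<in>{0..t}. Lp_norm P p (\<lambda>\<omega>. ennreal \<bar>v s (X \<omega> s)\<bar>) \<partial>lborel) < \<infinity> \<longrightarrow>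
        (\<forall>\<^sub>F l in nhds 0.
           (AE \<omega> in P' l. set_integrable lborel {0..t} (\<lambda>s. v s (X' l \<omega> s))) \<and>
           integrable (P' l) (\<lambda>\<omega>. LINT s:{0..t}|lborel. v s (X' l \<omega> s))) \<and>
        (AE s in lborel. s \<in> {0..t} \<longrightarrow>
           integrable P (\<lambda>\<omega>. v s (X \<omega> s) * G_functional r g s (X \<omega>))) \<and>
        set_integrable lborel {0..t}
          (\<lambda>s. \<integral>\<omega>. v s (X \<omega> s) * G_functional r g s (X \<omega>) \<partial>P) \<and>
        ((\<lambda>l. \<integral>\<omega>. (LINT s:{0..t}|lborel. v s (X' l \<omega> s)) \<partial>P' l)
           has_real_derivative
             (LINT s:{0..t}|lborel. \<integral>\<omega>. v s (X \<omega> s) * G_functional r g s (X \<omega>) \<partial>P)) (at 0))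
    \<and>
    \<comment> \<open>(3)\<close>
     (\<forall>(\<alpha> :: real \<Rightarrow> 'a \<Rightarrow> 'a \<Rightarrow> real) p. measurable2_on \<X> t \<alpha> \<longrightarrow> 1 < p \<longrightarrow>
        in_Lp P p (\<lambda>\<omega>. ennreal (jump_sum (\<lambda>s x y. \<bar>\<alpha> s x y\<bar>) (X \<omega>) t)) \<longrightarrow>
        in_Lp P p (\<lambda>\<omega>. abs_time_integral r \<alpha> t (X \<omega>)) \<longrightarrow>
        (\<forall>\<^sub>F l in nhds 0. integrable (P' l) (\<lambda>\<omega>. jump_sum \<alpha> (X' l \<omega>) t)) \<and>
        (AE s in lborel. s \<in> {0..t} \<longrightarrow>
           (AE \<omega> in P. integrable (r (X \<omega> s)) (\<alpha> s (X \<omega> s)) \<and>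
              integrable (r (X \<omega> s)) (\<lambda>y. \<alpha> s (X \<omega> s) y * g s (X \<omega> s) y)) \<and>
           integrable P (\<lambda>\<omega>. contraction r (\<lambda>s x y. \<alpha> s x y * g s x y) s (X \<omega> s)) \<and>
           integrable P (\<lambda>\<omega>. contraction r \<alpha> s (X \<omega> s) * G_functional r g s (X \<omega>))) \<and>
        set_integrable lborel {0..t}
          (\<lambda>s. \<integral>\<omega>. contraction r (\<lambda>s x y. \<alpha> s x y * g s x y) s (X \<omega> s) \<partial>P) \<and>
        set_integrable lborel {0..t}
          (\<lambda>s. \<integral>\<omega>. contraction r \<alpha> s (X \<omega> s) * G_functional r g s (X \<omega>) \<partial>P) \<and>
        ((\<lambda>l. \<integral>\<omega>. jump_sum \<alpha> (X' l \<omega>) t \<partial>P' l)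
           has_real_derivative
             (LINT s:{0..t}|lborel. \<integral>\<omega>. contraction r (\<lambda>s x y. \<alpha> s x y * g s x y) s (X \<omega> s) \<partial>P) +
             (LINT s:{0..t}|lborel. \<integral>\<omega>. contraction r \<alpha> s (X \<omega> s) * G_functional r g s (X \<omega>) \<partial>P))
           (at 0))
    \<and>
    \<comment> \<open>the parenthetical example in (3)\<close>
     (\<forall>(\<alpha> :: real \<Rightarrow> 'a \<Rightarrow> 'a \<Rightarrow> real). measurable2_on \<X> t \<alpha> \<longrightarrow> bounded2_on \<X> t \<alpha> \<longrightarrow>
        condition_C r t P X \<alpha> \<longrightarrow>
        (\<exists>p>1. in_Lp P p (\<lambda>\<omega>. ennreal (jump_sum (\<lambda>s x y. \<bar>\<alpha> s x y\<bar>) (X \<omega>) t)) \<and>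
               in_Lp P p (\<lambda>\<omega>. abs_time_integral r \<alpha> t (X \<omega>))))"
proof -
  interpret rate_kernel \<X> r by (unfold_locales) (rule kernel)
  define g0 where "g0 = extend_zero t g"
  have g0: "bounded_tilt g0" unfolding g0_def by (rule bounded_tilt_extend_zero[OF g(1,2)])
  have base: "base_process \<X> r \<nu> t P T Y"
  proof -
    interpret tilted_process \<X> r \<nu> "\<lambda>_ _ _. 0" t P T Y by (rule unperturbed_tilted_process[OF unperturbed])
    show ?thesis
    proof unfold_locales
      show "0 \<le> t" using t_pos by simp
      show "AE \<omega> in P. \<exists>n. t < T n \<omega>"
        using no_explosion by eventually_elim (simp add: explosion_time_gt_iff[symmetric])
    qed
  qed
  interpret base: base_process \<X> r \<nu> t P T Y by (rule base)
  \<comment> \<open>This is stated for any bounded coefficient under Condition C: it is used for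
    \<open>g\<close>, and again for \<open>\<alpha>\<close> in the parenthetical example.\<close>
  have perturbed_base: "\<exists>K \<theta>. perturbed_base \<X> r \<nu> t P T Y (extend_zero t \<alpha>) K \<theta>"
    if \<alpha>: "measurable2_on \<X> t \<alpha>" "bounded2_on \<X> t \<alpha>" "condition_C r t P X \<alpha>" for \<alpha>
  proof -
    have b: "bounded_tilt (extend_zero t \<alpha>)" by (rule bounded_tilt_extend_zero[OF \<alpha>(1,2)])
    have "condition_C r t P base.X (extend_zero t \<alpha>)"
      using \<alpha>(3) by (simp add: condition_C_extend_zero X_def)
    from base.condition_C_exp_moment[OF b this] obtain \<theta> where \<theta>: "0 < \<theta>"
      "(\<integral>\<^sup>+\<omega>. ennreal (exp (\<theta> * (LINT u:{0..t}|lborel. contraction r (\<lambda>s x y. \<bar>extend_zero t \<alpha> s x y\<bar>) u (base.X \<omega> u)))) \<partial>P) < \<infinity>"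
      by blast
    obtain K where K: "\<And>s x y. x \<in> space \<X> \<Longrightarrow> y \<in> space \<X> \<Longrightarrow> \<bar>extend_zero t \<alpha> s x y\<bar> \<le> K"
      by (rule bounded_tiltE[OF b]) (rule that)
    have "perturbed_base \<X> r \<nu> t P T Y (extend_zero t \<alpha>) \<bar>K\<bar> \<theta>"
      by unfold_locales (use b \<theta> order_trans[OF K abs_ge_self] in auto)
    then show ?thesis by blast
  qed
  from perturbed_base[OF g] obtain K \<theta> where pb: "perturbed_base \<X> r \<nu> t P T Y g0 K \<theta>"
    unfolding g0_def by blast
  interpret pb: perturbed_base \<X> r \<nu> t P T Y g0 K \<theta> by (rule pb)
  have tp: "tilted_process \<X> r \<nu> (\<lambda>s x y. l * g0 s x y) t (P' l) (T' l) (Y' l)" for l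
    unfolding g0_def by (rule perturbed_tilted_process[OF perturbed g0[unfolded g0_def]])
  interpret pf: perturbed_family \<X> r \<nu> t P T Y g0 K \<theta> P' T' Y'
    by (intro perturbed_family.intro perturbed_family_axioms.intro pb tp)
  have Geq: "G_functional r g s (X \<omega>) = pb.G s \<omega>" if "\<omega> \<in> space P" "0 \<le> s" "s \<le> t" for s \<omega>
    unfolding X_def by (rule pb.G_functional_eq[OF that g0_def])
  have t0: "0 \<le> t" using t_pos by simp
  have "\<forall>\<^sub>F l in nhds 0. AE \<omega> in P' l. explosion_time (T' l) \<omega> > ereal t"
    using pf.eventually_small[of 1] by (simp add: explosion_time_gt_iff eventually_conj_iff)
  moreover have "AE \<omega> in P. set_integrable lborel {0..t} (\<lambda>u. contraction r g u (X \<omega> u))"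
    using base.finite_jumps AE_space
  proof eventually_elim
    case (elim \<omega>)
    then obtain m where m: "t < T m \<omega>" by auto
    have "set_integrable lborel {0..t} (\<lambda>u. contraction r g0 u (base.X \<omega> u))"
      by (rule base.path_integrable[where \<phi> = "contraction r g0", OF elim(2) set_integrable_contraction[OF g0] t0 m])
    then show ?case
      unfolding X_def g0_def by (subst (asm) set_integrable_cong[OF refl refl]) auto
  qed
  moreover have "(\<forall>\<^sub>F l in nhds 0. integrable (P' l) (\<lambda>\<omega>. v (X' l \<omega> t))) \<and>
        integrable P (\<lambda>\<omega>. v (X \<omega> t) * G_functional r g t (X \<omega>)) \<and>
        ((\<lambda>l. \<integral>\<omega>. v (X' l \<omega> t) \<partial>P' l)
           has_real_derivative (\<integral>\<omega>. v (X \<omega> t) * G_functional r g t (X \<omega>) \<partial>P)) (at 0)"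
    if "v \<in> borel_measurable \<X>" "1 < p" "in_Lp P p (\<lambda>\<omega>. ennreal \<bar>v (X \<omega> t)\<bar>)" for v :: "'a \<Rightarrow> real" and p
    using pf.terminal_response[OF that(1,2) that(3)[unfolded X_def]] Geq[OF _ t0 order_refl]
    by (simp add: X_def X'_def cong: Bochner_Integration.integrable_cong Bochner_Integration.integral_cong)
  moreover have "(\<forall>\<^sub>F l in nhds 0.
           (AE \<omega> in P' l. set_integrable lborel {0..t} (\<lambda>s. v s (X' l \<omega> s))) \<and>
           integrable (P' l) (\<lambda>\<omega>. LINT s:{0..t}|lborel. v s (X' l \<omega> s))) \<and>
        (AE s in lborel. s \<in> {0..t} \<longrightarrow>
           integrable P (\<lambda>\<omega>. v s (X \<omega> s) * G_functional r g s (X \<omega>))) \<and>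
        set_integrable lborel {0..t}
          (\<lambda>s. \<integral>\<omega>. v s (X \<omega> s) * G_functional r g s (X \<omega>) \<partial>P) \<and>
        ((\<lambda>l. \<integral>\<omega>. (LINT s:{0..t}|lborel. v s (X' l \<omega> s)) \<partial>P' l)
           has_real_derivative
             (LINT s:{0..t}|lborel. \<integral>\<omega>. v s (X \<omega> s) * G_functional r g s (X \<omega>) \<partial>P)) (at 0)"
    if v: "measurable1_on \<X> t v" and p: "1 < p"
      and Lp: "(\<integral>\<^sup>+s\<in>{0..t}. Lp_norm P p (\<lambda>\<omega>. ennreal \<bar>v s (X \<omega> s)\<bar>) \<partial>lborel) < \<infinity>"
    for v :: "real \<Rightarrow> 'a \<Rightarrow> real" and p
  proof -
    \<comment> \<open>The extension by zero is measurable on the full time line and changes nothing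
      on \<open>[0, t]\<close>. The remaining equations transfer each conclusion from
      \<open>v0\<close> back to \<open>v\<close>.\<close>
    define v0 where "v0 s x = (if s \<in> {0..t} then v s x else 0)" for s x
    have v0: "(\<lambda>(s, x). v0 s x) \<in> borel_measurable (borel \<Otimes>\<^sub>M \<X>)"
      unfolding v0_def using v by (intro measurable_extend_zero) (simp add: measurable1_on_def)
    have v0_eq: "v0 s = v s" if "s \<in> {0..t}" for s using that by (simp add: v0_def fun_eq_iff)
    have "(\<integral>\<^sup>+s\<in>{0..t}. Lp_norm P p (\<lambda>\<omega>. ennreal \<bar>v0 s (X \<omega> s)\<bar>) \<partial>lborel)
        = (\<integral>\<^sup>+s\<in>{0..t}. Lp_norm P p (\<lambda>\<omega>. ennreal \<bar>v s (X \<omega> s)\<bar>) \<partial>lborel)"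
      by (intro nn_integral_cong) (auto simp: v0_eq split: split_indicator)
    then have Lp0: "(\<integral>\<^sup>+s\<in>{0..t}. Lp_norm P p (\<lambda>\<omega>. ennreal \<bar>v0 s (base.X \<omega> s)\<bar>) \<partial>lborel) < \<infinity>"
      using Lp by (simp add: X_def)
    note R = pf.running_response[OF v0 p Lp0]
    have si: "set_integrable lborel {0..t} (\<lambda>s. v0 s (\<xi> s)) \<longleftrightarrow> set_integrable lborel {0..t} (\<lambda>s. v s (\<xi> s))" for \<xi>
      by (intro set_integrable_cong) (auto simp: v0_eq)
    have li: "(LINT s:{0..t}|lborel. v0 s (\<xi> s)) = (LINT s:{0..t}|lborel. v s (\<xi> s))" for \<xi>
      by (intro set_lebesgue_integral_cong) (auto simp: v0_eq)
    have ii: "integrable P (\<lambda>\<omega>. v0 s (base.X \<omega> s) * pb.G s \<omega>)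
        \<longleftrightarrow> integrable P (\<lambda>\<omega>. v s (X \<omega> s) * G_functional r g s (X \<omega>))" if s: "s \<in> {0..t}" for s
      using s by (intro Bochner_Integration.integrable_cong) (auto simp: v0_eq Geq X_def[symmetric])
    have ie: "(\<integral>\<omega>. v0 s (base.X \<omega> s) * pb.G s \<omega> \<partial>P)
        = (\<integral>\<omega>. v s (X \<omega> s) * G_functional r g s (X \<omega>) \<partial>P)" if s: "s \<in> {0..t}" for s
      using s by (intro Bochner_Integration.integral_cong) (auto simp: v0_eq Geq X_def[symmetric])
    have "set_integrable lborel {0..t} (\<lambda>s. \<integral>\<omega>. v0 s (base.X \<omega> s) * pb.G s \<omega> \<partial>P)
        \<longleftrightarrow> set_integrable lborel {0..t} (\<lambda>s. \<integral>\<omega>. v s (X \<omega> s) * G_functional r g s (X \<omega>) \<partial>P)"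
      by (intro set_integrable_cong) (auto simp: ie)
    moreover have "(LINT s:{0..t}|lborel. \<integral>\<omega>. v0 s (base.X \<omega> s) * pb.G s \<omega> \<partial>P)
        = (LINT s:{0..t}|lborel. \<integral>\<omega>. v s (X \<omega> s) * G_functional r g s (X \<omega>) \<partial>P)"
      by (intro set_lebesgue_integral_cong) (auto simp: ie)
    moreover have "AE s in lborel. s \<in> {0..t} \<longrightarrow>
           integrable P (\<lambda>\<omega>. v s (X \<omega> s) * G_functional r g s (X \<omega>))"
      using R(2) by eventually_elim (simp add: ii)
    ultimately show ?thesis using R(1,3,4) unfolding si li X'_def by simp
  qed
  moreover have "(\<forall>\<^sub>F l in nhds 0. integrable (P' l) (\<lambda>\<omega>. jump_sum \<alpha> (X' l \<omega>) t)) \<and>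
        (AE s in lborel. s \<in> {0..t} \<longrightarrow>
           (AE \<omega> in P. integrable (r (X \<omega> s)) (\<alpha> s (X \<omega> s)) \<and>
              integrable (r (X \<omega> s)) (\<lambda>y. \<alpha> s (X \<omega> s) y * g s (X \<omega> s) y)) \<and>
           integrable P (\<lambda>\<omega>. contraction r (\<lambda>s x y. \<alpha> s x y * g s x y) s (X \<omega> s)) \<and>
           integrable P (\<lambda>\<omega>. contraction r \<alpha> s (X \<omega> s) * G_functional r g s (X \<omega>))) \<and>
        set_integrable lborel {0..t}
          (\<lambda>s. \<integral>\<omega>. contraction r (\<lambda>s x y. \<alpha> s x y * g s x y) s (X \<omega> s) \<partial>P) \<and>
        set_integrable lborel {0..t}
          (\<lambda>s. \<integral>\<omega>. contraction r \<alpha> s (X \<omega> s) * G_functional r g s (X \<omega>) \<partial>P) \<and>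
        ((\<lambda>l. \<integral>\<omega>. jump_sum \<alpha> (X' l \<omega>) t \<partial>P' l)
           has_real_derivative
             (LINT s:{0..t}|lborel. \<integral>\<omega>. contraction r (\<lambda>s x y. \<alpha> s x y * g s x y) s (X \<omega> s) \<partial>P) +
             (LINT s:{0..t}|lborel. \<integral>\<omega>. contraction r \<alpha> s (X \<omega> s) * G_functional r g s (X \<omega>) \<partial>P))
           (at 0)"
    if \<alpha>: "measurable2_on \<X> t \<alpha>" and p: "1 < p" and Lp: "in_Lp P p (\<lambda>\<omega>. abs_time_integral r \<alpha> t (X \<omega>))"
    for \<alpha> :: "real \<Rightarrow> 'a \<Rightarrow> 'a \<Rightarrow> real" and p
  proof -
    define \<alpha>0 where "\<alpha>0 = extend_zero t \<alpha>"
    have \<alpha>0: "measurable_coeff \<alpha>0" unfolding \<alpha>0_def by (rule measurable_coeff_extend_zero[OF \<alpha>])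
    have Lp0: "in_Lp P p (\<lambda>\<omega>. abs_time_integral r \<alpha>0 t (base.X \<omega>))"
      using Lp by (simp add: \<alpha>0_def abs_time_integral_extend_zero X_def)
    note R = pf.jump_response[OF \<alpha>0 p Lp0]
    have js: "jump_sum \<alpha>0 \<xi> t = jump_sum \<alpha> \<xi> t" for \<xi>
      unfolding \<alpha>0_def by (rule jump_sum_extend_zero) simp
    have pc: "pb.product_contraction \<alpha>0 s = contraction r (\<lambda>s x y. \<alpha> s x y * g s x y) s"
      and ce: "contraction r \<alpha>0 s = contraction r \<alpha> s" and ae: "\<alpha>0 s = \<alpha> s" and ge: "g0 s = g s"
      if "s \<in> {0..t}" for s
      unfolding pb.product_contraction_def unfolding contraction_def \<alpha>0_def g0_def
      using that by simp_all
    have ii: "integrable P (\<lambda>\<omega>. contraction r \<alpha> s (X \<omega> s) * pb.G s \<omega>)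
        \<longleftrightarrow> integrable P (\<lambda>\<omega>. contraction r \<alpha> s (X \<omega> s) * G_functional r g s (X \<omega>))" if s: "s \<in> {0..t}" for s
      using s by (intro Bochner_Integration.integrable_cong) (auto simp: Geq)
    have ie: "(\<integral>\<omega>. contraction r \<alpha>0 s (base.X \<omega> s) * pb.G s \<omega> \<partial>P)
        = (\<integral>\<omega>. contraction r \<alpha> s (X \<omega> s) * G_functional r g s (X \<omega>) \<partial>P)" if s: "s \<in> {0..t}" for s
      using s by (intro Bochner_Integration.integral_cong) (auto simp: ce Geq X_def[symmetric])
    have "set_integrable lborel {0..t} (\<lambda>s. \<integral>\<omega>. pb.product_contraction \<alpha>0 s (base.X \<omega> s) \<partial>P)
        \<longleftrightarrow> set_integrable lborel {0..t} (\<lambda>s. \<integral>\<omega>. contraction r (\<lambda>s x y. \<alpha> s x y * g s x y) s (X \<omega> s) \<partial>P)"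
      by (intro set_integrable_cong) (auto simp: pc X_def)
    moreover have "(LINT s:{0..t}|lborel. \<integral>\<omega>. pb.product_contraction \<alpha>0 s (base.X \<omega> s) \<partial>P)
        = (LINT s:{0..t}|lborel. \<integral>\<omega>. contraction r (\<lambda>s x y. \<alpha> s x y * g s x y) s (X \<omega> s) \<partial>P)"
      by (intro set_lebesgue_integral_cong) (auto simp: pc X_def)
    moreover have "set_integrable lborel {0..t} (\<lambda>s. \<integral>\<omega>. contraction r \<alpha>0 s (base.X \<omega> s) * pb.G s \<omega> \<partial>P)
        \<longleftrightarrow> set_integrable lborel {0..t} (\<lambda>s. \<integral>\<omega>. contraction r \<alpha> s (X \<omega> s) * G_functional r g s (X \<omega>) \<partial>P)"
      by (intro set_integrable_cong) (auto simp: ie)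
    moreover have "(LINT s:{0..t}|lborel. \<integral>\<omega>. contraction r \<alpha>0 s (base.X \<omega> s) * pb.G s \<omega> \<partial>P)
        = (LINT s:{0..t}|lborel. \<integral>\<omega>. contraction r \<alpha> s (X \<omega> s) * G_functional r g s (X \<omega>) \<partial>P)"
      by (intro set_lebesgue_integral_cong) (auto simp: ie)
    moreover have "AE s in lborel. s \<in> {0..t} \<longrightarrow>
           (AE \<omega> in P. integrable (r (X \<omega> s)) (\<alpha> s (X \<omega> s)) \<and>
              integrable (r (X \<omega> s)) (\<lambda>y. \<alpha> s (X \<omega> s) y * g s (X \<omega> s) y)) \<and>
           integrable P (\<lambda>\<omega>. contraction r (\<lambda>s x y. \<alpha> s x y * g s x y) s (X \<omega> s)) \<and>
           integrable P (\<lambda>\<omega>. contraction r \<alpha> s (X \<omega> s) * G_functional r g s (X \<omega>))"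
      using R(2) by eventually_elim (simp add: ii[unfolded X_def] pc ce ae ge X_def)
    ultimately show ?thesis using R(1,3,4,5) unfolding js X'_def by simp
  qed
  moreover have "\<exists>p>1. in_Lp P p (\<lambda>\<omega>. ennreal (jump_sum (\<lambda>s x y. \<bar>\<alpha> s x y\<bar>) (X \<omega>) t)) \<and>
               in_Lp P p (\<lambda>\<omega>. abs_time_integral r \<alpha> t (X \<omega>))"
    if \<alpha>: "measurable2_on \<X> t \<alpha>" "bounded2_on \<X> t \<alpha>" "condition_C r t P X \<alpha>" for \<alpha>
  proof -
    \<comment> \<open>Now \<open>\<alpha>\<close> takes the place of \<open>g\<close>, and its own
      \<open>W\<close> dominates both the sum over the jumps and the time integral.\<close>
    from perturbed_base[OF \<alpha>] obtain K \<theta> where "perturbed_base \<X> r \<nu> t P T Y (extend_zero t \<alpha>) K \<theta>" by blast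
    then interpret ex: perturbed_base \<X> r \<nu> t P T Y "extend_zero t \<alpha>" K \<theta> .
    have abs: "(\<lambda>s x y. \<bar>extend_zero t \<alpha> s x y\<bar>) = extend_zero t (\<lambda>s x y. \<bar>\<alpha> s x y\<bar>)"
      by (intro ext) (simp add: extend_zero_def)
    have js: "jump_sum (\<lambda>s x y. \<bar>\<alpha> s x y\<bar>) (X \<omega>) t = base.jsum (\<lambda>s x y. \<bar>extend_zero t \<alpha> s x y\<bar>) t \<omega>"
      if "\<omega> \<in> space P" for \<omega>
      using base.jump_sum_eq_jsum[OF that t0 order_refl, of "\<lambda>s x y. \<bar>extend_zero t \<alpha> s x y\<bar>"]
        jump_sum_extend_zero[OF order_refl, of t "\<lambda>s x y. \<bar>\<alpha> s x y\<bar>"]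
      by (simp add: abs X_def)
    have in_Lp_cong: "in_Lp P 2 f" if f': "in_Lp P 2 f'" and eq: "\<And>\<omega>. \<omega> \<in> space P \<Longrightarrow> f \<omega> = f' \<omega>" for f f'
    proof -
      have "f \<in> borel_measurable P" using f' measurable_cong[of P f f' borel] eq by (simp add: in_Lp_def)
      moreover have "(\<integral>\<^sup>+\<omega>. ennpowr (f \<omega>) 2 \<partial>P) = (\<integral>\<^sup>+\<omega>. ennpowr (f' \<omega>) 2 \<partial>P)"
        by (intro nn_integral_cong) (simp add: eq)
      moreover have "real_of_ereal 2 = 2" "(2::ereal) \<noteq> \<infinity>" using numeral_eq_ereal[of "Num.Bit0 Num.One"] by auto
      ultimately show ?thesis using f' by (simp add: in_Lp_def Lp_norm_def)
    qed
    have "in_Lp P 2 (\<lambda>\<omega>. ennreal (jump_sum (\<lambda>s x y. \<bar>\<alpha> s x y\<bar>) (X \<omega>) t))"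
      by (rule in_Lp_cong[OF ex.in_L2(1)]) (simp add: js)
    moreover have "in_Lp P 2 (\<lambda>\<omega>. abs_time_integral r \<alpha> t (X \<omega>))"
      using ex.in_L2(2) by (simp add: abs_time_integral_extend_zero X_def)
    moreover have "(1::ereal) < 2" by simp
    ultimately show ?thesis by blast
  qed
  ultimately show ?thesis by blast
qed

end
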